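(* Let $d\ge 1$ be an integer. (i) Let $1\le q<3$ and set $M_q=\lfloor \frac{3d}{3-q}\rfloor+1$. Let $C_0<\infty$ and let $m(\xi_1,\xi_2,\xi_3)$ be a function in $L^q(\mathbb{R}^{3d})\cap \mathcal{C}^{M_q}(\mathbb{R}^{3d})$ satisfying $$\|\partial^{\alpha}m\|_{L^\infty(\mathbb{R}^{3d})}\le C_0\qquad\text{for all multi-indices } \alpha \text{ with } |\alpha|\le M_q.$$ Then the trilinear operator $T_m$ with multiplier $m$ satisfies $$\|T_m\|_{L^2\times L^2\times L^2\to L^{2/3}}\le C\,\|m\|_{L^q(\mathbb{R}^{3d})}^{q/3},$$ where the constant $C$ depends only on $C_0$, $d$ and $q$. (ii) Conversely, there is a function $m\in\bigcap_{q>3}L^q(\mathbb{R}^{3d})\cap\mathcal{L}^\infty(\mathbb{R}^{3d})$ such that the associated operator $T_m$ is not bounded from $L^2(\mathbb{R}^d)\times L^2(\mathbb{R}^d)\times L^2(\mathbb{R}^d)$ to $L^{2/3}(\mathbb{R}^d)$.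
   Context: For a function $m$ on $\mathbb{R}^{3d}=\mathbb{R}^d\times\mathbb{R}^d\times\mathbb{R}^d$, the trilinear multiplier operator $T_m$ is defined by $$T_m(f,g,h)(x)=\int_{\mathbb{R}^d}\int_{\mathbb{R}^d}\int_{\mathbb{R}^d}m(\xi,\eta,\delta)\,\hat f(\xi)\hat g(\eta)\hat h(\delta)\,e^{2\pi i x\cdot(\xi+\eta+\delta)}\,d\xi\,d\eta\,d\delta,\qquad x\in\mathbb{R}^d,$$ initially for Schwartz functions $f,g,h$ on $\mathbb{R}^d$, where $\hat f(\xi)=\int_{\mathbb{R}^d} f(x)e^{-2\pi i x\cdot\xi}\,dx$. The quantity $\|T_m\|_{L^2\times L^2\times L^2\to L^{2/3}}$ is the infimum of all $A\ge 0$ such that $\|T_m(f,g,h)\|_{L^{2/3}(\mathbb{R}^d)}\le A\|f\|_{L^2}\|g\|_{L^2}\|h\|_{L^2}$ for all Schwartz functions $f,g,h$ on $\mathbb{R}^d$; $T_m$ is bounded if this infimum is finite. Here $\|F\|_{L^{2/3}}=(\int|F|^{2/3})^{3/2}$. $\mathcal{C}^{M}(\mathbb{R}^{3d})$ is the space of functions whose derivatives up to and including order $M$ exist and are continuous. $\mathcal{L}^\infty(\mathbb{R}^{3d})$ is the space of smooth ($C^\infty$) functions on $\mathbb{R}^{3d}$ all of whose partial derivatives of every order (including order zero) are bounded. *)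

theory Defs
  imports "HOL-Analysis.Analysis" "HOL-Probability.Essential_Supremum"
begin

definition partial_deriv ::
  "'a::euclidean_space \<Rightarrow> ('a \<Rightarrow> complex) \<Rightarrow> 'a \<Rightarrow> complex"
  where "partial_deriv b f x = vector_derivative (\<lambda>t. f (x + t *\<^sub>R b)) (at 0)"

text \<open>A multi-index \<open>\<alpha>\<close> is written as a list \<open>bs\<close> of standard basis vectors, in which \<open>b\<close> occurs
  \<open>\<alpha>\<^sub>b\<close> times, so that \<open>|\<alpha>| = length bs\<close>. For functions whose derivatives up to that order are
  continuous the order of the list is immaterial.\<close>

definition iter_deriv ::
  "'a::euclidean_space list \<Rightarrow> ('a \<Rightarrow> complex) \<Rightarrow> 'a \<Rightarrow> complex"
  where "iter_deriv bs f = foldr partial_deriv bs f"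

text \<open>The second conjunct is existence of the partial derivatives; it is needed because
  \<^const>\<open>vector_derivative\<close> is total.\<close>

definition Ck :: "nat \<Rightarrow> ('a::euclidean_space \<Rightarrow> complex) \<Rightarrow> bool"
  where "Ck n f \<longleftrightarrow>
    (\<forall>bs. set bs \<subseteq> Basis \<and> length bs \<le> n \<longrightarrow> continuous_on UNIV (iter_deriv bs f)) \<and>
    (\<forall>bs b x. set bs \<subseteq> Basis \<and> length bs < n \<and> b \<in> Basis \<longrightarrow>
       (\<lambda>t::real. iter_deriv bs f (x + t *\<^sub>R b)) differentiable (at 0))"

definition smooth :: "('a::euclidean_space \<Rightarrow> complex) \<Rightarrow> bool"
  where "smooth f \<longleftrightarrow> (\<forall>n. Ck n f)"

definition smooth_bounded :: "('a::euclidean_space \<Rightarrow> complex) \<Rightarrow> bool"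
  where "smooth_bounded f \<longleftrightarrow>
    smooth f \<and> (\<forall>bs. set bs \<subseteq> Basis \<longrightarrow> bounded (range (iter_deriv bs f)))"

definition schwartz :: "('a::euclidean_space \<Rightarrow> complex) \<Rightarrow> bool"
  where "schwartz f \<longleftrightarrow>
    smooth f \<and> (\<forall>bs k. set bs \<subseteq> Basis \<longrightarrow> bounded (range (\<lambda>x. norm x ^ k *\<^sub>R iter_deriv bs f x)))"

definition fourier :: "('a::euclidean_space \<Rightarrow> complex) \<Rightarrow> 'a \<Rightarrow> complex"
  where "fourier f \<xi> = (LINT x|lborel. f x * cis (- 2 * pi * (x \<bullet> \<xi>)))"

text \<open>For Schwartz \<open>f\<close>, \<open>g\<close>, \<open>h\<close> and bounded measurable \<open>m\<close> the integral converges absolutely.\<close>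

definition trilinear_op ::
  "('a::euclidean_space \<times> 'a \<times> 'a \<Rightarrow> complex) \<Rightarrow>
   ('a \<Rightarrow> complex) \<Rightarrow> ('a \<Rightarrow> complex) \<Rightarrow> ('a \<Rightarrow> complex) \<Rightarrow> 'a \<Rightarrow> complex"
  where "trilinear_op m f g h x =
    (LINT \<xi>|lborel. LINT \<eta>|lborel. LINT \<delta>|lborel.
       m (\<xi>, \<eta>, \<delta>) * fourier f \<xi> * fourier g \<eta> * fourier h \<delta> *
       cis (2 * pi * (x \<bullet> (\<xi> + \<eta> + \<delta>))))"

text \<open>Real powers on \<open>[0, \<infinity>]\<close>, for exponents \<open>r > 0\<close> only.\<close>

definition ennpowr :: "ennreal \<Rightarrow> real \<Rightarrow> ennreal"
  where "ennpowr a r = (if a = \<infinity> then \<infinity> else ennreal (enn2real a powr r))"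

definition Lp_norm :: "real \<Rightarrow> ('a::euclidean_space \<Rightarrow> complex) \<Rightarrow> ennreal"
  where "Lp_norm p f = ennpowr (\<integral>\<^sup>+ x. ennreal (norm (f x) powr p) \<partial>lborel) (1 / p)"

definition in_Lp :: "real \<Rightarrow> ('a::euclidean_space \<Rightarrow> complex) \<Rightarrow> bool"
  where "in_Lp p f \<longleftrightarrow> f \<in> borel_measurable lborel \<and> Lp_norm p f < \<infinity>"

definition Linf_norm :: "('a::euclidean_space \<Rightarrow> complex) \<Rightarrow> ennreal"
  where "Linf_norm f = esssup lborel (\<lambda>x. ennreal (norm (f x)))"

text \<open>The infimum over the empty set is \<open>\<infinity>\<close>.\<close>

definition op_norm :: "('a::euclidean_space \<times> 'a \<times> 'a \<Rightarrow> complex) \<Rightarrow> ennreal"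
  where "op_norm m = Inf {A. A < \<infinity> \<and>
    (\<forall>f g h. schwartz f \<and> schwartz g \<and> schwartz h \<longrightarrow>
       Lp_norm (2/3) (trilinear_op m f g h) \<le> A * Lp_norm 2 f * Lp_norm 2 g * Lp_norm 2 h)}"

definition bounded_op :: "('a::euclidean_space \<times> 'a \<times> 'a \<Rightarrow> complex) \<Rightarrow> bool"
  where "bounded_op m \<longleftrightarrow> op_norm m < \<infinity>"

end

theory Submission
  imports Defs "HOL-Probability.Characteristic_Functions" "HOL-Probability.Sinc_Integral" "HOL-Computational_Algebra.Polynomial" "HOL-Real_Asymp.Real_Asymp"
begin

text \<open>For part (i) suppose first that the multiplier is a finite sum \<open>\<Sum> c i j k * a i \<xi> * b j \<eta> * d k \<delta>\<close>, in
which the functions \<open>a i\<close> are bounded by 1 and have disjoint supports, and likewise the \<open>b j\<close> and the \<open>d k\<close>. Then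
\<open>T m f g h = \<Sum> c i j k * F i * G j * H k\<close>, where \<open>F i\<close> is the piece of \<open>f\<close> with frequencies in the support
of \<open>a i\<close>, and so on. If \<open>\<Sum> \<bar>c i j k\<bar>\<^sup>2\<close> over \<open>i\<close> and \<open>j\<close> is at most \<open>K\<close> for each \<open>k\<close>, then the pointwise
Cauchy-Schwarz inequality in \<open>(i, j)\<close>, the Hoelder inequality with exponents 3, 3, 3 and the Plancherel
inequality give an \<open>L\<^sup>2\<^sup>/\<^sup>3\<close> bound \<open>\<surd>K\<close> (\<open>trilinear_sum_slice_bound\<close>). Any of the three indices may be
the one that is held fixed. Coefficients that are at most \<open>A\<close> and whose \<open>q\<close>-th powers have sum at most \<open>Q\<close> can,
for \<open>q < 3\<close>, be split into four classes such that each class satisfies such a slice condition, with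
\<open>K = A powr (2 - 2*q/3) * Q powr (2/3)\<close> (\<open>trilinear_sum_bound\<close>).

A general \<open>m\<close> is a superposition of sums of this kind. On the dyadic cubes of side \<open>2\<close> to the power \<open>-l\<close> replace
\<open>m\<close> by the tensor product Lagrange interpolant \<open>p l\<close> of degree less than \<open>M\<close> in each variable, and write
\<open>m\<close> as the limit of the telescoping sum \<open>p 0 + \<Sum> (p (l + 1) - p l)\<close>. Interpolation reproduces polynomials, so
\<open>p (l + 1) - p l\<close> is the interpolant of \<open>m - p l\<close> on the finer cubes; its coefficients are therefore values of
\<open>m - p l\<close>, of size \<open>O(2 powr (- l * M))\<close> by the bound on the derivatives. The nodes are placed by an averaging
argument (\<open>good_sampling_shift\<close>) such that the \<open>q\<close>-th powers of the values of \<open>m\<close> at the nodes of level \<open>l\<close> sum to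
at most a constant times \<open>2 powr (3 * d * l)\<close> times the \<open>q\<close>-th power of the \<open>L\<^sup>q\<close> norm. Level \<open>l\<close> then
contributes the square root of \<open>K\<close>, which is \<open>2 powr (- l * (M * (1 - q/3) - d))\<close> times the \<open>(q/3)\<close>-th power of
the \<open>L\<^sup>q\<close> norm, up to a constant, and the condition \<open>M > 3*d/(3-q)\<close> is exactly what makes these numbers decay
geometrically. Truncation to a box makes all the sums finite; the Fatou lemma removes it
(\<open>trilinear_main_estimate\<close>).

For part (ii) take a Gaussian window of width \<open>L\<close> times the chirp \<open>exp (\<i> * pi * \<bar>\<xi> + \<eta> + \<delta>\<bar>\<^sup>2 / L)\<close>, and
test it on three Gaussians with frequencies up to \<open>L\<close>. Without the chirp the output would live on a ball of
radius \<open>1/L\<close>; the chirp disperses it over the unit ball, and since the exponent 2/3 is below 1 this increases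
the quasinorm. The computation gives an operator norm of order at least \<open>L\<close> to the power \<open>d\<close>, whereas the \<open>L\<^sup>q\<close> norm of
the window is of order \<open>L powr (3*d/q)\<close>, which is of smaller order exactly when \<open>q > 3\<close>. Summing
such chirps with coefficients \<open>i / L i ^ d\<close> over a rapidly increasing sequence \<open>L i\<close> gives one function in all
the \<open>L\<^sup>q\<close> with \<open>q > 3\<close> on whose \<open>i\<close>-th test function the operator has ratio at least of order \<open>i\<close>; the other terms
of the sum disturb this only by a bounded amount because the scales are so far apart
(\<open>counterexample_lower_bound\<close>). Derivatives of a chirp are polynomials in \<open>z/L\<close> times the chirp and so are bounded
uniformly in \<open>L\<close>, hence the sum is smooth with bounded derivatives (\<open>gaussian_series_smooth_bounded\<close>).\<close>

section \<open>Gaussians and the Plancherel inequality\<close>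

lemma lborel_integrable_prod:
  fixes w :: "'a::euclidean_space \<Rightarrow> real \<Rightarrow> complex"
  assumes "\<And>b. b \<in> Basis \<Longrightarrow> integrable lborel (w b)"
  shows "integrable lborel (\<lambda>x::'a. \<Prod>b\<in>Basis. w b (x \<bullet> b))" (is ?I)
    and "(LINT x|lborel. (\<Prod>b\<in>Basis. w b ((x::'a) \<bullet> b))) = (\<Prod>b\<in>Basis. (LINT t|lborel. w b t))" (is ?E)
proof -
  interpret product_sigma_finite "\<lambda>_::'a. lborel :: real measure" by standard
  let ?P = "\<Pi>\<^sub>M b\<in>Basis. (lborel :: real measure)"
  let ?g = "\<lambda>f. \<Sum>b\<in>(Basis::'a set). f b *\<^sub>R b"
  have meas: "?g \<in> measurable ?P borel"
    by measurable
  have wm: "w b \<in> borel_measurable borel" if "b \<in> Basis" for b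
    using assms[OF that] by (auto dest: borel_measurable_integrable)
  have fm: "(\<lambda>x::'a. \<Prod>b\<in>Basis. w b (x \<bullet> b)) \<in> borel_measurable borel"
    using wm by measurable
  have eq: "(\<Prod>b\<in>Basis. w b (?g f \<bullet> b)) = (\<Prod>b\<in>Basis. w b (f b))" for f
    by (intro prod.cong) (auto simp: inner_sum_left inner_Basis if_distrib cong: if_cong)
  have int: "integrable ?P (\<lambda>f. \<Prod>b\<in>Basis. w b (f b))"
    using assms by (intro product_integrable_prod) auto
  show ?I
    unfolding lborel_eq[where 'a='a] integrable_distr_eq[OF meas fm] eq by (rule int)
  show ?E
    unfolding lborel_eq[where 'a='a]  integral_distr[OF meas fm] eq
    using assms by (intro product_integral_prod) auto
qed

text \<open>After scaling, this is the characteristic function of the standard normal distribution.\<close>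
lemma gaussian_fourier_real:
  fixes a y :: real
  assumes a: "a > 0"
  shows "integrable lborel (\<lambda>x. complex_of_real (exp (- pi * a * x\<^sup>2)) * cis (2 * pi * (x * y)))" (is "integrable _ ?f")
    and "(LINT x|lborel. complex_of_real (exp (- pi * a * x\<^sup>2)) * cis (2 * pi * (x * y)))
         = complex_of_real (exp (- pi * y\<^sup>2 / a) / sqrt a)"
proof -
  define c where "c = 1 / sqrt (2 * pi * a)"
  have c: "c > 0" and c2: "c\<^sup>2 = 1 / (2 * pi * a)" using a by (auto simp: c_def power_divide)
  let ?s = "\<lambda>x. complex_of_real (std_normal_density x) * iexp ((2 * pi * c * y) * x)"
  have i0: "integrable lborel std_normal_density" by simp
  have is1: "integrable lborel ?s"
    by (rule Bochner_Integration.integrable_bound[OF i0]) (auto simp: norm_mult)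
  have "char std_normal_distribution (2 * pi * c * y) = (LINT x|lborel. ?s x)"
    unfolding char_def by (subst integral_density) (auto simp: scaleR_conv_of_real)
  then have v: "(LINT x|lborel. ?s x) = complex_of_real (exp (- ((2 * pi * c * y)^2) / 2))"
    by (simp add: char_std_normal_distribution)
  have eq: "?f (0 + c * x) = complex_of_real (sqrt (2 * pi)) * ?s x" for x
  proof -
    have "pi * a * (c * x)\<^sup>2 = x\<^sup>2 / 2" using a by (simp add: power_mult_distrib c2)
    then show ?thesis
      by (simp add: std_normal_density_def cis_conv_exp mult_ac)
  qed
  show 1: "integrable lborel ?f"
    using c is1 by (subst lborel_integrable_real_affine_iff[where c=c and t=0, symmetric]) (simp_all only: eq, auto)
  have "(LINT x|lborel. ?f x) = \<bar>c\<bar> *\<^sub>R (LINT x|lborel. ?f (0 + c * x))"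
    using c by (intro lborel_integral_real_affine) auto
  also have "\<dots> = \<bar>c\<bar> *\<^sub>R (complex_of_real (sqrt (2 * pi)) * (LINT x|lborel. ?s x))"
    unfolding eq using is1 by simp
  also have "\<dots> = complex_of_real (c * sqrt (2*pi) * exp (- ((2 * pi * c * y)^2) / 2))"
    unfolding v using c by (simp add: scaleR_conv_of_real)
  also have "c * sqrt (2*pi) = 1 / sqrt a" by (simp add: c_def real_sqrt_mult)
  also have "(2 * pi * c * y)^2 / 2 = pi * y\<^sup>2 / a"
    using a by (simp add: power_mult_distrib c2) (simp add: power2_eq_square)
  then have "- ((2 * pi * c * y)^2) / 2 = - pi * y\<^sup>2 / a" by simp
  finally show "(LINT x|lborel. ?f x) = complex_of_real (exp (- pi * y\<^sup>2 / a) / sqrt a)" by simp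
qed

lemma gaussian_fourier:
  fixes y :: "'a::euclidean_space" and a :: real
  assumes a: "a > 0"
  shows "integrable lborel (\<lambda>x. complex_of_real (exp (- pi * a * (norm x)\<^sup>2)) * cis (2 * pi * (x \<bullet> y)))" (is "integrable _ ?f")
    and "(LINT x|lborel. complex_of_real (exp (- pi * a * (norm x)\<^sup>2)) * cis (2 * pi * (x \<bullet> y)))
         = complex_of_real (exp (- pi * (norm y)\<^sup>2 / a) / sqrt a ^ DIM('a))"
proof -
  let ?w = "\<lambda>b t. complex_of_real (exp (- pi * a * t\<^sup>2)) * cis (2 * pi * (t * (y \<bullet> b)))"
  have sq: "(norm x)\<^sup>2 = (\<Sum>b\<in>Basis. (x \<bullet> b)\<^sup>2)" for x :: 'a
    by (simp add: norm_eq_sqrt_inner euclidean_inner[of x x] power2_eq_square sum_nonneg)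
  have cp: "cis (\<Sum>b\<in>S. g b) = (\<Prod>b\<in>S. cis (g b))" if "finite S" for S and g :: "'a \<Rightarrow> real"
    using that by (induction S rule: finite_induct) (auto simp flip: cis_mult)
  have feq: "?f = (\<lambda>x. \<Prod>b\<in>Basis. ?w b (x \<bullet> b))"
    by (rule ext, simp add: prod.distrib cp[symmetric] exp_sum[symmetric] sq sum_distrib_left of_real_prod[symmetric] euclidean_inner[of _ y] del: of_real_prod flip: sum_negf)
  show "integrable lborel ?f"
    unfolding feq using gaussian_fourier_real(1)[OF a] by (intro lborel_integrable_prod(1)) 
  have "(LINT x|lborel. ?f x) = (\<Prod>b\<in>Basis. (LINT t|lborel. ?w b t))"
    unfolding feq using gaussian_fourier_real(1)[OF a] by (intro lborel_integrable_prod(2)) 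
  also have "\<dots> = (\<Prod>b\<in>Basis. complex_of_real (exp (- pi * (y \<bullet> b)\<^sup>2 / a) / sqrt a))"
    by (simp only: gaussian_fourier_real(2)[OF a])
  also have "\<dots> = complex_of_real (exp (- pi * (norm y)\<^sup>2 / a) / sqrt a ^ DIM('a))"
    by (simp add: of_real_prod[symmetric] prod_dividef exp_sum[symmetric] sq sum_distrib_left sum_divide_distrib del: of_real_prod flip: sum_negf)
  finally show "(LINT x|lborel. ?f x) = \<dots>" .
qed

lemma cnj_measurable [measurable]: "cnj \<in> borel_measurable borel"
  by (intro borel_measurable_continuous_onI continuous_intros)

lemma fourier_measurable [measurable]:
  fixes u :: "'a::euclidean_space \<Rightarrow> complex"
  assumes [measurable]: "u \<in> borel_measurable borel"
  shows "fourier u \<in> borel_measurable borel"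
  unfolding fourier_def cis_conv_exp by measurable

lemma norm_fourier_le:
  fixes u :: "'a::euclidean_space \<Rightarrow> complex"
  assumes "integrable lborel u"
  shows "norm (fourier u y) \<le> (LINT x|lborel. norm (u x))"
  unfolding fourier_def by (rule order_trans[OF integral_norm_bound]) (simp add: norm_mult)

lemma integrable_mult_bounded:
  fixes u v :: "'a::euclidean_space \<Rightarrow> complex"
  assumes u: "integrable lborel u" and v: "v \<in> borel_measurable borel" "\<And>x. norm (v x) \<le> B"
  shows "integrable lborel (\<lambda>x. u x * v x)"
proof (rule Bochner_Integration.integrable_bound)
  show "integrable lborel (\<lambda>x. B * norm (u x))" using u by simp
  show "(\<lambda>x. u x * v x) \<in> borel_measurable lborel" using u v by (auto dest: borel_measurable_integrable)
  have "norm (u x * v x) \<le> norm (B * norm (u x))" for x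
  proof -
    have "norm (u x) * norm (v x) \<le> norm (u x) * B" by (intro mult_left_mono v) auto
    also have "\<dots> \<le> \<bar>B * norm (u x)\<bar>" by (simp add: mult.commute)
    finally show ?thesis by (simp add: norm_mult)
  qed
  then show "AE x in lborel. norm (u x * v x) \<le> norm (B * norm (u x))" by simp
qed

text \<open>Fubini: both sides are the double integral of \<open>u x * g y * cis (- 2 * pi * (x \<bullet> y))\<close>.\<close>
lemma fourier_multiplication:
  fixes u g :: "'a::euclidean_space \<Rightarrow> complex"
  assumes u: "integrable lborel u" and g: "integrable lborel g"
  shows "(LINT y|lborel. g y * fourier u y) = (LINT x|lborel. u x * fourier g x)"
proof -
  have [measurable]: "u \<in> borel_measurable borel" "g \<in> borel_measurable borel"
    using u g by (auto dest: borel_measurable_integrable)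
  let ?F = "\<lambda>(x, y). g y * (u x * cis (- 2 * pi * (x \<bullet> y)))"
  have int: "integrable (lborel \<Otimes>\<^sub>M lborel) ?F"
  proof (rule lborel_pair.Fubini_integrable)
    show "?F \<in> borel_measurable (lborel \<Otimes>\<^sub>M lborel)" unfolding cis_conv_exp by measurable
    show "integrable lborel (\<lambda>x. LINT y|lborel. norm (?F (x, y)))"
      using u by (simp add: norm_mult)
    have "integrable lborel (\<lambda>y. ?F (x, y))" for x
      unfolding prod.case by (rule integrable_mult_bounded[OF g, where B="norm (u x)"])
        (auto simp: norm_mult cis_conv_exp)
    then show "AE x in lborel. integrable lborel (\<lambda>y. ?F (x, y))" by simp
  qed
  have "(LINT y|lborel. g y * fourier u y) = (LINT y|lborel. LINT x|lborel. ?F (x, y))"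
    unfolding fourier_def by simp
  also have "\<dots> = (LINT x|lborel. LINT y|lborel. ?F (x, y))"
    using lborel_pair.Fubini_integral[OF int] by simp
  also have "\<dots> = (LINT x|lborel. LINT y|lborel. u x * (g y * cis (- 2 * pi * (y \<bullet> x))))"
    by (simp add: mult_ac inner_commute)
  also have "\<dots> = (LINT x|lborel. u x * fourier g x)"
    unfolding fourier_def by simp
  finally show ?thesis .
qed

lemma nn_integral_lborel_translate_scale:
  fixes f :: "'a::euclidean_space \<Rightarrow> ennreal"
  assumes [measurable]: "f \<in> borel_measurable borel" and c: "c \<noteq> 0"
  shows "ennreal (\<bar>c\<bar> ^ DIM('a)) * (\<integral>\<^sup>+x. f (t + c *\<^sub>R x) \<partial>lborel) = (\<integral>\<^sup>+x. f x \<partial>lborel)"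
  by (subst (2) lborel_affine[OF c, of t])
    (simp add: nn_integral_density nn_integral_distr nn_integral_cmult)

lemma nn_integral_lborel_uminus:
  fixes f :: "'a::euclidean_space \<Rightarrow> ennreal"
  assumes "f \<in> borel_measurable borel"
  shows "(\<integral>\<^sup>+x. f (t - x) \<partial>lborel) = (\<integral>\<^sup>+x. f x \<partial>lborel)"
  using nn_integral_lborel_translate_scale[OF assms, of "-1" t] by simp

lemma nn_integral_le_of_tendsto:
  fixes f :: "nat \<Rightarrow> 'a \<Rightarrow> ennreal"
  assumes [measurable]: "\<And>n. f n \<in> borel_measurable M"
    and lim: "\<And>x. (\<lambda>n. f n x) \<longlonglongrightarrow> g x" and le: "\<And>n. (\<integral>\<^sup>+x. f n x \<partial>M) \<le> C"
  shows "(\<integral>\<^sup>+x. g x \<partial>M) \<le> C"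
proof -
  have "(\<integral>\<^sup>+x. g x \<partial>M) = (\<integral>\<^sup>+x. liminf (\<lambda>n. f n x) \<partial>M)"
    by (simp add: lim_imp_Liminf[OF trivial_limit_sequentially lim])
  also have "\<dots> \<le> liminf (\<lambda>n. \<integral>\<^sup>+x. f n x \<partial>M)" by (rule nn_integral_liminf) simp
  also have "\<dots> \<le> liminf (\<lambda>n. C)" by (intro Liminf_mono) (simp add: le)
  finally show ?thesis by (simp add: Liminf_const)
qed

text \<open>With a Gaussian weight on the left all integrals converge absolutely. Applying the multiplication formula twice
turns the left-hand side into a double integral of \<open>u x * cnj (u y) * G (x - y)\<close> with a Gaussian \<open>G\<close> of total mass 1,
and \<open>2 * \<bar>u x\<bar> * \<bar>u y\<bar> \<le> \<bar>u x\<bar>\<^sup>2 + \<bar>u y\<bar>\<^sup>2\<close> finishes the proof.\<close>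
lemma plancherel_le_regularised:
  fixes u :: "'a::euclidean_space \<Rightarrow> complex"
  assumes u: "integrable lborel u" and e: "e > 0"
  shows "(\<integral>\<^sup>+y. ennreal (exp (- pi * e * (norm y)\<^sup>2) * (norm (fourier u y))\<^sup>2) \<partial>lborel)
          \<le> (\<integral>\<^sup>+x. ennreal ((norm (u x))\<^sup>2) \<partial>lborel)"
proof -
  have um [measurable]: "u \<in> borel_measurable borel"
    using u by (auto dest: borel_measurable_integrable)
  define g where "g = (\<lambda>y::'a. complex_of_real (exp (- pi * e * (norm y)\<^sup>2)))"
  define G where "G = (\<lambda>z::'a. exp (- pi * (norm z)\<^sup>2 / e) / sqrt e ^ DIM('a))"
  define B where "B = (LINT x|lborel. norm (u x))"
  have [measurable]: "g \<in> borel_measurable borel" "G \<in> borel_measurable borel"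
    unfolding g_def G_def by measurable
  have G0: "G z \<ge> 0" for z using e by (simp add: G_def)
  have gi: "integrable lborel (\<lambda>y. g y * cis (2 * pi * (y \<bullet> z)))" 
    and gG: "(LINT y|lborel. g y * cis (2 * pi * (y \<bullet> z))) = G z" for z
    using gaussian_fourier[OF e, of z] by (auto simp: g_def G_def)
  have gi0: "integrable lborel g" using gi[of 0] by simp
  have fB: "norm (fourier u y) \<le> B" for y unfolding B_def by (rule norm_fourier_le[OF u])
  define h where "h = (\<lambda>y. g y * cnj (fourier u y))"
  have hm: "integrable lborel h"
    unfolding h_def by (rule integrable_mult_bounded[OF gi0, where B=B])
      (use fB in auto)
  have fh: "fourier h x = cnj (LINT y|lborel. u y * G (x - y))" for x
  proof -
    let ?k = "\<lambda>y. g y * cis (2 * pi * (y \<bullet> x))"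
    have "fourier ?k y = G (x - y)" for y
      unfolding fourier_def gG[symmetric]
      by (intro Bochner_Integration.integral_cong) (simp_all add: cis_mult algebra_simps inner_diff_right)
    then have 1: "(LINT y|lborel. ?k y * fourier u y) = (LINT y|lborel. u y * G (x - y))"
      using fourier_multiplication[OF u gi[of x]] by simp
    have 2: "h y * cis (- 2 * pi * (y \<bullet> x)) = cnj (?k y * fourier u y)" for y
      by (simp add: h_def g_def cis_cnj)
    have "fourier h x = cnj (LINT y|lborel. ?k y * fourier u y)"
      unfolding fourier_def[of h] 2 by (rule Bochner_Integration.integral_cnj)
    then show ?thesis by (simp only: 1)
  qed
  have uG: "integrable lborel (\<lambda>y. u y * complex_of_real (G (x - y)))" for x
    by (rule integrable_mult_bounded[OF u, where B="1 / sqrt e ^ DIM('a)"]) 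
       (use e in \<open>auto simp: G_def divide_right_mono norm_divide norm_power\<close>)
  have fh_le: "ennreal (norm (fourier h x)) \<le> (\<integral>\<^sup>+y. ennreal (norm (u y) * G (x - y)) \<partial>lborel)" for x
  proof -
    have "ennreal (norm (fourier h x)) = ennreal (norm (LINT y|lborel. u y * G (x - y)))"
      by (simp add: fh)
    also have "\<dots> \<le> (\<integral>\<^sup>+y. ennreal (norm (u y * complex_of_real (G (x - y)))) \<partial>lborel)"
      using uG by (rule integral_norm_bound_ennreal)
    finally show ?thesis using G0 by (simp add: norm_mult)
  qed
  have S: "(\<integral>\<^sup>+x. \<integral>\<^sup>+y. ennreal ((norm (u x))\<^sup>2 * G (x - y)) \<partial>lborel \<partial>lborel) = (\<integral>\<^sup>+x. ennreal ((norm (u x))\<^sup>2) \<partial>lborel)"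
    (is "?S1 = ?R")
  proof -
    have "(\<integral>\<^sup>+y. ennreal (G (x - y)) \<partial>lborel) = 1" for x
    proof -
      have 1: "integrable lborel G"
        using gaussian_fourier(1)[of "1/e" 0] e
        unfolding G_def divide_inverse
        by (intro integrable_mult_left) (simp add: complex_of_real_integrable_eq divide_inverse mult_ac del: of_real_exp of_real_power of_real_divide)
      have "(LINT z|lborel. complex_of_real (exp (- pi * (1/e) * (norm z)\<^sup>2)) * cis (2 * pi * (z \<bullet> (0::'a)))) = complex_of_real (sqrt e ^ DIM('a))"
        using e by (subst gaussian_fourier(2)) (auto simp: real_sqrt_divide power_divide)
      then have "complex_of_real (LINT z|lborel. exp (- pi * (1/e) * (norm (z::'a))\<^sup>2)) = complex_of_real (sqrt e ^ DIM('a))"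
        by (simp del: of_real_exp of_real_power of_real_mult)
      then have "(LINT z|lborel. G z) = 1" using e unfolding G_def of_real_eq_iff by simp
      with 1 have "(\<integral>\<^sup>+y. ennreal (G y) \<partial>lborel) = 1" using G0 by (simp add: nn_integral_eq_integral)
      moreover have "(\<integral>\<^sup>+y. ennreal (G (x - y)) \<partial>lborel) = (\<integral>\<^sup>+y. ennreal (G y) \<partial>lborel)"
        by (rule nn_integral_lborel_uminus) simp
      ultimately show ?thesis by simp
    qed
    then show ?thesis using G0 by (simp add: ennreal_mult nn_integral_cmult)
  qed
  have sym: "(\<integral>\<^sup>+x. \<integral>\<^sup>+y. ennreal ((norm (u y))\<^sup>2 * G (x - y)) \<partial>lborel \<partial>lborel) = ?R"
    unfolding S[symmetric]
    by (subst lborel_pair.Fubini') (auto simp: G_def norm_minus_commute)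
  have I1: "integrable lborel (\<lambda>x. u x * fourier h x)"
    by (rule integrable_mult_bounded[OF u, where B="LINT x|lborel. norm (h x)"])
       (use hm norm_fourier_le[OF hm] in \<open>auto simp: h_def\<close>)
  have real: "h y * fourier u y = complex_of_real (exp (- pi * e * (norm y)\<^sup>2) * (norm (fourier u y))\<^sup>2)" for y
    unfolding h_def g_def of_real_mult complex_norm_square by simp
  have I2: "integrable lborel (\<lambda>y. h y * fourier u y)"
    by (rule integrable_mult_bounded[OF hm, where B=B]) (use fB in auto)
  (* k stands for the factor 1/2 in the arithmetic-geometric mean inequality; as a variable it is not
     rewritten inside ennreal *)
  obtain k :: real where k: "k = 1 / 2" and k0: "0 \<le> k" by fastforce
  let ?L = "\<integral>\<^sup>+y. ennreal (exp (- pi * e * (norm y)\<^sup>2) * (norm (fourier u y))\<^sup>2) \<partial>lborel"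
  have I2': "integrable lborel (\<lambda>y. exp (- pi * e * (norm y)\<^sup>2) * (norm (fourier u y))\<^sup>2)"
    using I2 unfolding real complex_of_real_integrable_eq .
  have "?L = ennreal (LINT y|lborel. exp (- pi * e * (norm y)\<^sup>2) * (norm (fourier u y))\<^sup>2)"
    by (rule nn_integral_eq_integral) (use I2' in auto)
  also have "\<dots> = ennreal (norm (LINT y|lborel. h y * fourier u y))"
    unfolding real integral_complex_of_real norm_of_real by (subst abs_of_nonneg) auto
  also have "\<dots> = ennreal (norm (LINT x|lborel. u x * fourier h x))"
    by (simp add: fourier_multiplication[OF u hm])
  also have "\<dots> \<le> (\<integral>\<^sup>+x. ennreal (norm (u x * fourier h x)) \<partial>lborel)"
    using I1 by (rule integral_norm_bound_ennreal)
  also have "\<dots> \<le> (\<integral>\<^sup>+x. ennreal (norm (u x)) * (\<integral>\<^sup>+y. ennreal (norm (u y) * G (x - y)) \<partial>lborel) \<partial>lborel)"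
    by (intro nn_integral_mono) (use fh_le in \<open>auto simp: norm_mult ennreal_mult intro!: mult_left_mono\<close>)
  also have "\<dots> = (\<integral>\<^sup>+x. \<integral>\<^sup>+y. ennreal (norm (u x) * norm (u y) * G (x - y)) \<partial>lborel \<partial>lborel)"
    using G0 by (simp add: nn_integral_cmult[symmetric] ennreal_mult mult.assoc)
  also have "\<dots> \<le> (\<integral>\<^sup>+x. \<integral>\<^sup>+y. ennreal k * (ennreal ((norm (u x))\<^sup>2 * G (x - y)) + ennreal ((norm (u y))\<^sup>2 * G (x - y))) \<partial>lborel \<partial>lborel)"
  proof (intro nn_integral_mono)
    fix x y :: 'a
    have "2 * (norm (u x) * norm (u y)) \<le> (norm (u x))\<^sup>2 + (norm (u y))\<^sup>2"
      using sum_squares_bound[of "norm (u x)" "norm (u y)"] by simp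
    from mult_right_mono[OF this G0[of "x-y"]]
    have le: "norm (u x) * norm (u y) * G (x - y) \<le> k * ((norm (u x))\<^sup>2 * G (x - y) + (norm (u y))\<^sup>2 * G (x - y))"
      by (simp add: algebra_simps k)
    show "ennreal (norm (u x) * norm (u y) * G (x - y)) \<le> ennreal k * (ennreal ((norm (u x))\<^sup>2 * G (x - y)) + ennreal ((norm (u y))\<^sup>2 * G (x - y)))"
      by (rule ord_le_eq_trans[OF ennreal_leI[OF le]])
        (use G0 k0 in \<open>simp add: ennreal_mult ennreal_plus \<close>)
  qed
  also have "\<dots> = ennreal k * (?R + ?R)"
    by (simp add: nn_integral_cmult nn_integral_add S sym)
  also have "\<dots> = ?R"
  proof -
    have "ennreal k + ennreal k = 1" using k by (simp add: ennreal_plus[symmetric] del: ennreal_plus)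
    then have "(ennreal k + ennreal k) * ?R = ?R" by simp
    then show ?thesis by (simp only: distrib_left distrib_right)
  qed
  finally show ?thesis .
qed

text \<open>The weight tends to 1, and the Fatou lemma gives the limit.\<close>
lemma plancherel_le:
  fixes u :: "'a::euclidean_space \<Rightarrow> complex"
  assumes u: "integrable lborel u"
  shows "(\<integral>\<^sup>+y. ennreal ((norm (fourier u y))\<^sup>2) \<partial>lborel) \<le> (\<integral>\<^sup>+x. ennreal ((norm (u x))\<^sup>2) \<partial>lborel)"
proof (rule nn_integral_le_of_tendsto)
  let ?f = "\<lambda>n y. ennreal (exp (- pi * (1 / real (Suc n)) * (norm y)\<^sup>2) * (norm (fourier u y))\<^sup>2)"
  have [measurable]: "u \<in> borel_measurable borel" using u by (auto dest: borel_measurable_integrable)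
  show "?f n \<in> borel_measurable lborel" for n by simp
  show "(\<integral>\<^sup>+y. ?f n y \<partial>lborel) \<le> (\<integral>\<^sup>+x. ennreal ((norm (u x))\<^sup>2) \<partial>lborel)" for n
    by (rule plancherel_le_regularised[OF u]) simp
  show "(\<lambda>n. ?f n y) \<longlonglongrightarrow> ennreal ((norm (fourier u y))\<^sup>2)" for y
  proof (rule tendsto_ennrealI)
    have "(\<lambda>n. 1 / real (Suc n)) \<longlonglongrightarrow> 0" using LIMSEQ_inverse_real_of_nat by (simp add: inverse_eq_divide)
    then have "(\<lambda>n. exp (- pi * (1 / real (Suc n)) * (norm y)\<^sup>2) * (norm (fourier u y))\<^sup>2) \<longlonglongrightarrow> exp (- pi * 0 * (norm y)\<^sup>2) * (norm (fourier u y))\<^sup>2"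
      by (intro tendsto_intros)
    then show "(\<lambda>n. exp (- pi * (1 / real (Suc n)) * (norm y)\<^sup>2) * (norm (fourier u y))\<^sup>2) \<longlonglongrightarrow> (norm (fourier u y))\<^sup>2"
      by simp
  qed
qed

section \<open>Schwartz functions and their Fourier transforms\<close>

lemma iter_deriv_Nil [simp]: "iter_deriv [] f = f"
  and iter_deriv_Cons: "iter_deriv (b # bs) f = partial_deriv b (iter_deriv bs f)"
  and iter_deriv_snoc: "iter_deriv (bs @ [b]) f = iter_deriv bs (partial_deriv b f)"
  by (simp_all add: iter_deriv_def)

text \<open>The definition provides the derivative of the restriction to a line only at parameter 0; moving the base point
along the line gives it everywhere.\<close>
lemma Ck_line_derivative:
  assumes "Ck n f" "set bs \<subseteq> Basis" "length bs < n" "b \<in> Basis"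
  shows "((\<lambda>t. iter_deriv bs f (x + t *\<^sub>R b)) has_vector_derivative iter_deriv (b # bs) f (x + t0 *\<^sub>R b)) (at t0)"
proof -
  let ?g = "\<lambda>s. iter_deriv bs f ((x + t0 *\<^sub>R b) + s *\<^sub>R b)"
  have "?g differentiable (at 0)" using assms unfolding Ck_def by blast
  then have "(?g has_vector_derivative iter_deriv (b # bs) f (x + t0 *\<^sub>R b)) (at 0)"
    by (simp add: vector_derivative_works iter_deriv_Cons partial_deriv_def)
  moreover have "((\<lambda>t. t - t0) has_vector_derivative 1) (at t0)"
    by (auto intro!: derivative_eq_intros)
  ultimately have "((?g \<circ> (\<lambda>t. t - t0)) has_vector_derivative 1 *\<^sub>R iter_deriv (b # bs) f (x + t0 *\<^sub>R b)) (at t0)"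
    by (intro vector_diff_chain_at) auto
  moreover have "?g \<circ> (\<lambda>t. t - t0) = (\<lambda>t. iter_deriv bs f (x + t *\<^sub>R b))"
    by (auto simp: algebra_simps fun_eq_iff)
  ultimately show ?thesis by simp
qed

lemma schwartz_partial_deriv:
  assumes f: "schwartz f" and b: "b \<in> Basis"
  shows "schwartz (partial_deriv b f)"
proof -
  have sm: "Ck n f" for n using f by (auto simp: schwartz_def smooth_def)
  have "Ck n (partial_deriv b f)" for n
  proof -
    have "set (bs @ [b]) \<subseteq> Basis \<and> length (bs @ [b]) \<le> Suc n" if "set bs \<subseteq> Basis" "length bs \<le> n" for bs
      using that b by auto
    then show ?thesis
      using sm[of "Suc n"] b unfolding Ck_def iter_deriv_snoc[symmetric] by fastforce
  qed
  moreover have "bounded (range (\<lambda>x. norm x ^ k *\<^sub>R iter_deriv (bs @ [b]) f x))" if "set bs \<subseteq> Basis" for bs k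
    using f b that unfolding schwartz_def by auto
  ultimately show ?thesis
    by (auto simp: schwartz_def smooth_def iter_deriv_snoc)
qed

lemma schwartz_continuous: "schwartz f \<Longrightarrow> continuous_on UNIV f"
  unfolding schwartz_def smooth_def Ck_def by (metis empty_subsetI iter_deriv_Nil le0 list.size(3) set_empty)

lemma schwartz_measurable [measurable_dest]: "schwartz f \<Longrightarrow> f \<in> borel_measurable borel"
  using schwartz_continuous by (rule borel_measurable_continuous_onI)

lemma schwartz_decay:
  assumes f: "schwartz f"
  obtains C where "C \<ge> 0" "\<And>x. norm (f x) \<le> C / (1 + norm x) ^ N"
proof -
  have "bounded (range (\<lambda>x. norm x ^ k *\<^sub>R f x))" for k
    using f unfolding schwartz_def by (metis empty_subsetI iter_deriv_Nil set_empty)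
  then have "\<forall>k. \<exists>B. \<forall>x. norm x ^ k * norm (f x) \<le> B"
    by (force simp: bounded_iff)
  then obtain B where B: "\<And>k x. norm x ^ k * norm (f x) \<le> B k" by metis
  define C where "C = 2 ^ N * (B 0 + B N)"
  have le: "(1 + norm x) ^ N * norm (f x) \<le> C" for x
  proof -
    have "(1 + norm x) ^ N \<le> (2 * max 1 (norm x)) ^ N" by (intro power_mono) auto
    also have "\<dots> \<le> 2 ^ N * (norm x ^ 0 + norm x ^ N)" 
      by (auto simp: power_mult_distrib max_def)
    finally have "(1 + norm x) ^ N * norm (f x) \<le> 2 ^ N * (norm x ^ 0 + norm x ^ N) * norm (f x)"
      by (rule mult_right_mono) simp
    also have "\<dots> = 2 ^ N * (norm x ^ 0 * norm (f x) + norm x ^ N * norm (f x))" by (simp add: algebra_simps)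
    also have "\<dots> \<le> C" unfolding C_def by (intro mult_left_mono add_mono B) auto
    finally show ?thesis .
  qed
  have p: "(1 + norm x) ^ N > 0" for x :: 'a by (simp add: add_pos_nonneg)
  show ?thesis
  proof
    show "C \<ge> 0" using le[of 0] by (meson mult_nonneg_nonneg norm_ge_zero order_trans p less_imp_le)
    show "norm (f x) \<le> C / (1 + norm x) ^ N" for x
      using le[of x] p[of x] by (simp add: field_simps)
  qed
qed

lemma integrable_inverse_1_plus_sq: "integrable lborel (\<lambda>t::real. inverse (1 + t\<^sup>2))"
  using integrable_inverse_1_plus_square by (simp add: set_integrable_def einterval_def)

text \<open>The weight is dominated by the product over the coordinates of \<open>1 / (1 + x\<^sub>b\<^sup>2)\<close>, since \<open>1 + x\<^sub>b\<^sup>2 \<le> (1 + norm x)\<^sup>2\<close>.\<close>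
lemma integrable_weight: "integrable lborel (\<lambda>x::'a::euclidean_space. 1 / (1 + norm x) ^ (2 * DIM('a)))"
proof -
  have "integrable lborel (\<lambda>x::'a. \<Prod>b\<in>Basis. complex_of_real (inverse (1 + (x \<bullet> b)\<^sup>2)))"
    by (intro lborel_integrable_prod(1)[where w="\<lambda>b t. complex_of_real (inverse (1 + t\<^sup>2))"])
      (simp add: integrable_inverse_1_plus_sq complex_of_real_integrable_eq del: of_real_inverse)
  then show ?thesis
  proof (rule Bochner_Integration.integrable_bound, measurable, intro AE_I2)
    fix x :: 'a
    have "(\<Prod>b\<in>(Basis::'a set). 1 + (x \<bullet> b)\<^sup>2) \<le> (\<Prod>b\<in>(Basis::'a set). (1 + norm x)\<^sup>2)"
    proof (rule prod_mono)
      fix b :: 'a assume b: "b \<in> Basis"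
      have "(x \<bullet> b)\<^sup>2 \<le> (norm x)\<^sup>2" using Basis_le_norm[OF b, of x] by (simp add: abs_le_square_iff[symmetric])
      then show "0 \<le> 1 + (x \<bullet> b)\<^sup>2 \<and> 1 + (x \<bullet> b)\<^sup>2 \<le> (1 + norm x)\<^sup>2" by (simp add: power2_sum add_increasing2)
    qed
    then have "(\<Prod>b\<in>(Basis::'a set). 1 + (x \<bullet> b)\<^sup>2) \<le> (1 + norm x) ^ (2 * DIM('a))" by (simp add: power_mult)
    moreover have "(\<Prod>b\<in>(Basis::'a set). 1 + (x \<bullet> b)\<^sup>2) > 0" by (intro prod_pos) (simp add: add_pos_nonneg)
    ultimately have "1 / (1 + norm x) ^ (2 * DIM('a)) \<le> 1 / (\<Prod>b\<in>(Basis::'a set). 1 + (x \<bullet> b)\<^sup>2)" by (intro divide_left_mono) auto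
    also have "\<dots> = norm (\<Prod>b\<in>Basis. complex_of_real (inverse (1 + (x \<bullet> b)\<^sup>2)))"
      by (simp add: prod_norm[symmetric] prod_inversef[symmetric] norm_inverse del: of_real_inverse)
        (simp add: inverse_eq_divide prod_dividef)
    finally show "norm (1 / (1 + norm x) ^ (2 * DIM('a))) \<le> norm (\<Prod>b\<in>Basis. complex_of_real (inverse (1 + (x \<bullet> b)\<^sup>2)))"
      by simp
  qed
qed

lemma integrable_of_decay:
  fixes f :: "'a::euclidean_space \<Rightarrow> complex"
  assumes "f \<in> borel_measurable borel" "\<And>x. norm (f x) \<le> C / (1 + norm x) ^ (2 * DIM('a))"
  shows "integrable lborel f"
proof (rule Bochner_Integration.integrable_bound[OF integrable_mult_right[OF integrable_weight, of C]])
  have "norm (f x) \<le> \<bar>C\<bar> / (1 + norm x) ^ (2 * DIM('a))" for x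
    by (rule order_trans[OF assms(2)]) (simp add: divide_right_mono)
  then show "AE x in lborel. norm (f x) \<le> norm (C * (1 / (1 + norm x) ^ (2 * DIM('a))))" by simp
qed (use assms in simp)

lemma schwartz_integrable:
  fixes f :: "'a::euclidean_space \<Rightarrow> complex"
  assumes f: "schwartz f"
  shows "integrable lborel f"
proof -
  obtain C where "\<And>x. norm (f x) \<le> C / (1 + norm x) ^ (2 * DIM('a))"
    using schwartz_decay[OF f] by metis
  then show ?thesis using f by (intro integrable_of_decay) auto
qed

lemma integral_lborel_translate:
  fixes f :: "'a::euclidean_space \<Rightarrow> complex"
  assumes [measurable]: "f \<in> borel_measurable borel"
  shows "(LINT x|lborel. f (t + x)) = (LINT x|lborel. f x)"
  by (subst (2) lborel_distr_plus[of t, symmetric]) (simp add: integral_distr)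

lemma integrable_lborel_translate:
  fixes f :: "'a::euclidean_space \<Rightarrow> complex"
  assumes f: "integrable lborel f"
  shows "integrable lborel (\<lambda>x. f (t + x))"
proof -
  have "f \<in> borel_measurable borel" using f by (auto dest: borel_measurable_integrable)
  moreover have "integrable (distr lborel borel ((+) t)) f" using f by (simp add: lborel_distr_plus)
  ultimately show ?thesis by (subst (asm) integrable_distr_eq) auto
qed

lemma fourier_translate:
  fixes f :: "'a::euclidean_space \<Rightarrow> complex"
  assumes f: "integrable lborel f"
  shows "fourier (\<lambda>x. f (t + x)) \<xi> = cis (2 * pi * (t \<bullet> \<xi>)) * fourier f \<xi>"
proof -
  have [measurable]: "f \<in> borel_measurable borel" using f by (auto dest: borel_measurable_integrable)
  let ?g = "\<lambda>x. f x * cis (- 2 * pi * (x \<bullet> \<xi>))"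
  have "fourier (\<lambda>x. f (t + x)) \<xi> = (LINT x|lborel. cis (2 * pi * (t \<bullet> \<xi>)) * ?g (t + x))"
    unfolding fourier_def
    by (intro Bochner_Integration.integral_cong) (auto simp: cis_mult mult.left_commute[of "cis _"] algebra_simps)
  also have "\<dots> = cis (2 * pi * (t \<bullet> \<xi>)) * (LINT x|lborel. ?g (t + x))" by simp
  also have "(LINT x|lborel. ?g (t + x)) = fourier f \<xi>"
    unfolding fourier_def by (rule integral_lborel_translate) (simp add: cis_conv_exp)
  finally show ?thesis .
qed

lemma has_vector_derivative_quotient:
  fixes f :: "real \<Rightarrow> complex"
  assumes "(f has_vector_derivative D) (at 0)"
  shows "((\<lambda>t. (f t - f 0) /\<^sub>R t) \<longlongrightarrow> D) (at 0)"
proof -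
  have "((\<lambda>h. norm (f (0 + h) - f 0 - h *\<^sub>R D) / norm h) \<longlongrightarrow> 0) (at 0)"
    using assms unfolding has_vector_derivative_def has_derivative_at by blast
  then have "((\<lambda>h. norm ((f h - f 0) /\<^sub>R h - D)) \<longlongrightarrow> 0) (at 0)"
  proof (rule Lim_transform_eventually)
    show "\<forall>\<^sub>F h in at 0. norm (f (0 + h) - f 0 - h *\<^sub>R D) / norm h = norm ((f h - f 0) /\<^sub>R h - D)"
    proof (rule eventually_mono[OF eventually_neq_at_within[of 0]])
      fix h :: real assume h: "h \<noteq> 0"
      have "(f h - f 0) /\<^sub>R h - D = (f (0 + h) - f 0 - h *\<^sub>R D) /\<^sub>R h" using h by (simp add: algebra_simps)
      then show "norm (f (0 + h) - f 0 - h *\<^sub>R D) / norm h = norm ((f h - f 0) /\<^sub>R h - D)"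
        by (simp add: divide_inverse mult.commute)
    qed
  qed
  then show ?thesis by (simp add: tendsto_norm_zero_iff LIM_zero_iff)
qed

text \<open>Instead of integrating by parts, take the transform of the difference quotients, which is explicit because a
translation becomes a phase. The quotients converge boundedly with an integrable majorant by the decay of
the derivative.\<close>
lemma fourier_partial_deriv:
  fixes f :: "'a::euclidean_space \<Rightarrow> complex"
  assumes f: "schwartz f" and b: "b \<in> Basis"
  shows "fourier (partial_deriv b f) \<xi> = 2 * pi * \<i> * (b \<bullet> \<xi>) * fourier f \<xi>"
proof -
  let ?N = "2 * DIM('a)"
  have f': "schwartz (partial_deriv b f)" by (rule schwartz_partial_deriv[OF f b])
  have [measurable]: "f \<in> borel_measurable borel" "partial_deriv b f \<in> borel_measurable borel"
    using f f' by (auto dest: schwartz_measurable)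
  obtain C where C0: "C \<ge> 0" and C: "\<And>x. norm (partial_deriv b f x) \<le> C / (1 + norm x) ^ ?N"
    using schwartz_decay[OF f'] by metis
  have der: "((\<lambda>t. f (x + t *\<^sub>R b)) has_vector_derivative partial_deriv b f (x + t0 *\<^sub>R b)) (at t0)" for x t0
    using Ck_line_derivative[of 1 f "[]" b x t0] f b by (simp add: iter_deriv_Cons schwartz_def smooth_def)
  define \<tau> where "\<tau> = (\<lambda>n. 1 / real (Suc n))"
  have \<tau>: "\<tau> n > 0" "\<tau> n \<le> 1" for n by (auto simp: \<tau>_def)
  have \<tau>0: "\<tau> \<longlonglongrightarrow> 0" unfolding \<tau>_def using LIMSEQ_inverse_real_of_nat by (simp add: inverse_eq_divide)
  have \<tau>at: "filterlim \<tau> (at 0) sequentially"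
    using \<tau>0 \<tau>(1) by (auto simp: filterlim_at intro!: always_eventually) (metis less_irrefl)
  define d where "d = (\<lambda>n x. (f (\<tau> n *\<^sub>R b + x) - f x) /\<^sub>R \<tau> n)"
  have lim1: "(\<lambda>n. d n x) \<longlonglongrightarrow> partial_deriv b f x" for x
  proof -
    have "((\<lambda>t. (f (x + t *\<^sub>R b) - f x) /\<^sub>R t) \<longlongrightarrow> partial_deriv b f x) (at 0)"
      using has_vector_derivative_quotient[OF der[of x 0, simplified add_0_right scaleR_zero_left]] by simp
    from filterlim_compose[OF this \<tau>at] show ?thesis by (simp add: d_def add.commute)
  qed
  have bd: "norm (d n x) \<le> C * 2 ^ ?N / (1 + norm x) ^ ?N" for n x
  proof -
    have "\<exists>s\<in>{0<..<\<tau> n}. norm (f (x + \<tau> n *\<^sub>R b) - f (x + 0 *\<^sub>R b)) \<le> norm ((\<tau> n - 0) *\<^sub>R partial_deriv b f (x + s *\<^sub>R b))"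
      using der unfolding has_vector_derivative_def
      by (intro mvt_general[where f="\<lambda>t. f (x + t *\<^sub>R b)" and f'="\<lambda>s h. h *\<^sub>R partial_deriv b f (x + s *\<^sub>R b)"] \<tau>)
        (auto intro!: continuous_at_imp_continuous_on has_derivative_continuous)
    then obtain s where s: "0 < s" "s < \<tau> n" and "norm (f (x + \<tau> n *\<^sub>R b) - f x) \<le> \<tau> n * norm (partial_deriv b f (x + s *\<^sub>R b))"
      using \<tau>(1)[of n] by auto
    then have "norm (d n x) \<le> norm (partial_deriv b f (x + s *\<^sub>R b))"
      using \<tau>(1)[of n] by (simp add: d_def add.commute divide_inverse_commute[symmetric] pos_divide_le_eq mult.commute)
    also have "\<dots> \<le> C / (1 + norm (x + s *\<^sub>R b)) ^ ?N" by (rule C)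
    also have "\<dots> \<le> C / ((1 + norm x) / 2) ^ ?N"
    proof (intro divide_left_mono power_mono)
      have 1: "norm x \<le> norm (x + s *\<^sub>R b) + norm (s *\<^sub>R b)" by (metis add_diff_cancel_right' norm_triangle_ineq4)
      have 2: "norm (s *\<^sub>R b) \<le> 1" using s \<tau>(2)[of n] b by simp
      show "(1 + norm x) / 2 \<le> 1 + norm (x + s *\<^sub>R b)"
        using 1 2 norm_ge_zero[of "x + s *\<^sub>R b"] by argo
    qed (auto simp: C0 add_pos_nonneg intro!: mult_pos_pos zero_less_power divide_pos_pos)
    finally show ?thesis by (simp add: power_divide)
  qed
  have "(\<lambda>n. LINT x|lborel. d n x * cis (- 2 * pi * (x \<bullet> \<xi>))) \<longlonglongrightarrow> (LINT x|lborel. partial_deriv b f x * cis (- 2 * pi * (x \<bullet> \<xi>)))"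
  proof (rule integral_dominated_convergence)
    show "integrable lborel (\<lambda>x::'a. C * 2 ^ ?N * (1 / (1 + norm x) ^ ?N))"
      by (intro integrable_mult_right integrable_weight)
    show "AE x in lborel. (\<lambda>n. d n x * cis (- 2 * pi * (x \<bullet> \<xi>))) \<longlonglongrightarrow> partial_deriv b f x * cis (- 2 * pi * (x \<bullet> \<xi>))"
      by (intro AE_I2 tendsto_intros lim1)
    show "AE x in lborel. norm (d n x * cis (- 2 * pi * (x \<bullet> \<xi>))) \<le> C * 2 ^ ?N * (1 / (1 + norm x) ^ ?N)" for n
      using bd by (simp add: norm_mult)
  qed (simp_all add: d_def cis_conv_exp)
  moreover have "(LINT x|lborel. d n x * cis (- 2 * pi * (x \<bullet> \<xi>))) = (cis (\<tau> n * (2 * pi * (b \<bullet> \<xi>))) - cis 0) /\<^sub>R \<tau> n * fourier f \<xi>" for n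
  proof -
    have i: "integrable lborel (\<lambda>x. g x * cis (- 2 * pi * (x \<bullet> \<xi>)))" if "integrable lborel g" for g
      using that by (rule integrable_mult_bounded[where B=1]) (auto simp: cis_conv_exp)
    have if': "integrable lborel f" by (rule schwartz_integrable[OF f])
    have "(LINT x|lborel. d n x * cis (- 2 * pi * (x \<bullet> \<xi>))) = (LINT x|lborel. (f (\<tau> n *\<^sub>R b + x) * cis (- 2 * pi * (x \<bullet> \<xi>)) - f x * cis (- 2 * pi * (x \<bullet> \<xi>))) /\<^sub>R \<tau> n)"
      by (simp add: d_def algebra_simps scaleR_conv_of_real)
    also have "\<dots> = (fourier (\<lambda>x. f (\<tau> n *\<^sub>R b + x)) \<xi> - fourier f \<xi>) /\<^sub>R \<tau> n"
      unfolding fourier_def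
      using i[OF if'] i[OF integrable_lborel_translate[OF if']] by (simp add: Bochner_Integration.integral_diff)
    finally show ?thesis unfolding fourier_translate[OF if'] by (simp add: algebra_simps)
  qed
  moreover have "(\<lambda>n. (cis (\<tau> n * (2 * pi * (b \<bullet> \<xi>))) - cis 0) /\<^sub>R \<tau> n * fourier f \<xi>) \<longlonglongrightarrow> 2 * pi * \<i> * (b \<bullet> \<xi>) * fourier f \<xi>"
  proof (intro tendsto_mult tendsto_const)
    let ?c = "2 * pi * (b \<bullet> \<xi>)"
    have "((\<lambda>t. exp (\<i> * (complex_of_real t * ?c))) has_vector_derivative (\<i> * ?c)) (at 0)"
      by (rule has_vector_derivative_real_field) (auto intro!: derivative_eq_intros)
    then have "((\<lambda>t. cis (t * ?c)) has_vector_derivative (\<i> * ?c)) (at 0)"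
      by (simp add: cis_conv_exp)
    from has_vector_derivative_quotient[OF this]
    have "((\<lambda>t. (cis (t * ?c) - cis 0) /\<^sub>R t) \<longlongrightarrow> 2 * pi * \<i> * (b \<bullet> \<xi>)) (at 0)"
      by (simp add: mult_ac)
    from filterlim_compose[OF this \<tau>at] show "(\<lambda>n. (cis (\<tau> n * ?c) - cis 0) /\<^sub>R \<tau> n) \<longlonglongrightarrow> 2 * pi * \<i> * (b \<bullet> \<xi>)" .
  qed
  ultimately show ?thesis unfolding fourier_def[of "partial_deriv b f"] using LIMSEQ_unique by simp
qed

text \<open>Each factor \<open>1 + (\<xi> \<bullet> b)\<^sup>2\<close> is paid for by replacing \<open>f\<close> by \<open>f\<close> and its second derivative in direction \<open>b\<close>; hence
the induction on the set of directions, with \<open>f\<close> arbitrary.\<close>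
lemma fourier_schwartz_decay:
  fixes f :: "'a::euclidean_space \<Rightarrow> complex"
  assumes "finite S" "S \<subseteq> Basis" "schwartz f"
  shows "\<exists>C. \<forall>\<xi>. (\<Prod>b\<in>S. 1 + (\<xi> \<bullet> b)\<^sup>2) * norm (fourier f \<xi>) \<le> C"
  using assms
proof (induction S arbitrary: f rule: finite_induct)
  case empty
  then show ?case using norm_fourier_le[OF schwartz_integrable] by auto
next
  case (insert b S)
  then have b: "b \<in> Basis" by simp
  let ?g = "partial_deriv b (partial_deriv b f)"
  have g: "schwartz ?g" using insert b by (intro schwartz_partial_deriv)
  obtain C1 where C1: "\<And>\<xi>. (\<Prod>b\<in>S. 1 + (\<xi> \<bullet> b)\<^sup>2) * norm (fourier f \<xi>) \<le> C1" using insert by force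
  obtain C2 where C2: "\<And>\<xi>. (\<Prod>b\<in>S. 1 + (\<xi> \<bullet> b)\<^sup>2) * norm (fourier ?g \<xi>) \<le> C2" using insert g by force
  have "(\<Prod>c\<in>insert b S. 1 + (\<xi> \<bullet> c)\<^sup>2) * norm (fourier f \<xi>) \<le> C1 + C2" for \<xi>
  proof -
    let ?P = "\<Prod>c\<in>S. 1 + (\<xi> \<bullet> c)\<^sup>2"
    have P: "?P \<ge> 0" by (intro prod_nonneg) auto
    have "norm (fourier ?g \<xi>) = (2 * pi * (\<xi> \<bullet> b))\<^sup>2 * norm (fourier f \<xi>)"
      using insert b by (simp add: fourier_partial_deriv schwartz_partial_deriv norm_mult inner_commute power2_eq_square abs_mult[symmetric])
    moreover have "(\<xi> \<bullet> b)\<^sup>2 \<le> (2 * pi * (\<xi> \<bullet> b))\<^sup>2"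
    proof -
      have "1 \<le> 2 * pi" using pi_gt3 by simp
      then have "1 \<le> (2 * pi)\<^sup>2" by (rule one_le_power)
      from mult_right_mono[OF this, of "(\<xi> \<bullet> b)\<^sup>2"] show ?thesis by (simp add: power_mult_distrib)
    qed
    ultimately have "(\<xi> \<bullet> b)\<^sup>2 * norm (fourier f \<xi>) \<le> norm (fourier ?g \<xi>)" by (simp add: mult_right_mono)
    then have "?P * ((\<xi> \<bullet> b)\<^sup>2 * norm (fourier f \<xi>)) \<le> ?P * norm (fourier ?g \<xi>)" using P by (intro mult_left_mono)
    with C1[of \<xi>] C2[of \<xi>] have "?P * norm (fourier f \<xi>) + ?P * ((\<xi> \<bullet> b)\<^sup>2 * norm (fourier f \<xi>)) \<le> C1 + C2" by linarith
    then show ?thesis using insert by (simp add: algebra_simps)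
  qed
  then show ?case by blast
qed

lemma fourier_schwartz_integrable:
  fixes f :: "'a::euclidean_space \<Rightarrow> complex"
  assumes f: "schwartz f"
  shows "integrable lborel (fourier f)"
proof -
  obtain C where C: "\<And>\<xi>. (\<Prod>b\<in>Basis. 1 + (\<xi> \<bullet> b)\<^sup>2) * norm (fourier f \<xi>) \<le> C"
    using fourier_schwartz_decay[OF finite_Basis subset_refl f] by blast
  have "integrable lborel (\<lambda>x::'a. complex_of_real C * (\<Prod>b\<in>Basis. complex_of_real (inverse (1 + (x \<bullet> b)\<^sup>2))))"
    by (intro integrable_mult_right lborel_integrable_prod(1)[where w="\<lambda>b t. complex_of_real (inverse (1 + t\<^sup>2))"])
      (simp add: integrable_inverse_1_plus_sq complex_of_real_integrable_eq del: of_real_inverse)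
  then show ?thesis
  proof (rule Bochner_Integration.integrable_bound)
    show "fourier f \<in> borel_measurable lborel" using f by (auto dest: schwartz_measurable)
    show "AE \<xi> in lborel. norm (fourier f \<xi>) \<le> norm (complex_of_real C * (\<Prod>b\<in>Basis. complex_of_real (inverse (1 + (\<xi> \<bullet> b)\<^sup>2))))"
    proof (intro AE_I2)
      fix \<xi> :: 'a
      let ?P = "\<Prod>b\<in>(Basis::'a set). 1 + (\<xi> \<bullet> b)\<^sup>2"
      have P: "?P > 0" by (intro prod_pos) (simp add: add_pos_nonneg)
      have "norm (fourier f \<xi>) \<le> C / ?P" using C[of \<xi>] P by (simp add: field_simps)
      also have "\<dots> \<le> norm (complex_of_real (C * inverse ?P))" unfolding norm_of_real by (simp add: divide_inverse)
      also have "complex_of_real (C * inverse ?P) = complex_of_real C * (\<Prod>b\<in>Basis. complex_of_real (inverse (1 + (\<xi> \<bullet> b)\<^sup>2)))"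
        by (simp add: prod_inversef[symmetric])
      finally show "norm (fourier f \<xi>) \<le> norm \<dots>" .
    qed
  qed
qed

section \<open>Square functions and trilinear sums\<close>

lemma powr_third_cubed: "(x powr (1/3)) ^ 3 = x" if "x \<ge> 0" for x :: real
proof (cases "x = 0")
  case False
  then have "(x powr (1/3)) ^ 3 = (x powr (1/3)) powr 3" using that by simp
  then show ?thesis using that False by (simp only: powr_powr) simp
qed simp

lemma square_powr_third: "(x\<^sup>2) powr (1/3) = x powr (2/3)" if "x \<ge> 0" for x :: real
proof (cases "x = 0")
  case False
  then have "x\<^sup>2 = x powr 2" using that by simp
  then show ?thesis by (simp only: powr_powr) simp
qed simp

lemma powr_third_sum_le:
  fixes a b c :: real
  assumes "a \<ge> 0" "b \<ge> 0" "c \<ge> 0"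
  shows "(a * b * c) powr (1/3) \<le> (a + b + c) / 3"
proof -
  define x y z where "x = a powr (1/3)" "y = b powr (1/3)" "z = c powr (1/3)"
  have [simp]: "x \<ge> 0" "y \<ge> 0" "z \<ge> 0" by (auto simp: x_y_z_def)
  have cube: "x ^ 3 = a" "y ^ 3 = b" "z ^ 3 = c"
    using assms by (auto simp: x_y_z_def powr_third_cubed)
  have "(x + y + z) * ((x - y)\<^sup>2 + (y - z)\<^sup>2 + (z - x)\<^sup>2) \<ge> 0" by (intro mult_nonneg_nonneg) auto
  then have "3 * (x * y * z) \<le> x ^ 3 + y ^ 3 + z ^ 3" by (simp add: power2_eq_square power3_eq_cube algebra_simps)
  moreover have "(a * b * c) powr (1/3) = x * y * z" using assms by (simp add: x_y_z_def powr_mult)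
  ultimately show ?thesis by (simp add: cube)
qed

text \<open>The Hoelder inequality with exponents 3, 3, 3, obtained from the inequality of arithmetic and geometric means after
normalising the three integrals.\<close>
lemma nn_integral_powr_third_le:
  fixes u v w :: "'a \<Rightarrow> real"
  assumes [measurable]: "u \<in> borel_measurable M" "v \<in> borel_measurable M" "w \<in> borel_measurable M"
    and nn: "\<And>x. u x \<ge> 0" "\<And>x. v x \<ge> 0" "\<And>x. w x \<ge> 0"
    and U: "(\<integral>\<^sup>+x. ennreal (u x) \<partial>M) \<le> ennreal U" and V: "(\<integral>\<^sup>+x. ennreal (v x) \<partial>M) \<le> ennreal V"
    and W: "(\<integral>\<^sup>+x. ennreal (w x) \<partial>M) \<le> ennreal W"
    and pos: "U \<ge> 0" "V \<ge> 0" "W \<ge> 0"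
  shows "(\<integral>\<^sup>+x. ennreal ((u x * v x * w x) powr (1/3)) \<partial>M) \<le> ennreal ((U * V * W) powr (1/3))"
proof (cases "U = 0 \<or> V = 0 \<or> W = 0")
  case True
  have z: "AE x in M. f x = 0" if "(\<integral>\<^sup>+x. ennreal (f x) \<partial>M) \<le> ennreal 0" "f \<in> borel_measurable M" "\<And>x. f x \<ge> 0" for f
  proof -
    have "(\<integral>\<^sup>+x. ennreal (f x) \<partial>M) = 0" using that(1) by simp
    then have "AE x in M. ennreal (f x) = 0" using that(2) by (subst (asm) nn_integral_0_iff_AE) auto
    then show ?thesis using that(3) by (auto simp: ennreal_eq_0_iff intro: antisym)
  qed
  have "AE x in M. u x * v x * w x = 0"
    using True
  proof (elim disjE)
    assume "U = 0" then show ?thesis using z[of u] U nn by (auto simp: eventually_mono)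
  next
    assume "V = 0" then show ?thesis using z[of v] V nn by (auto simp: eventually_mono)
  next
    assume "W = 0" then show ?thesis using z[of w] W nn by (auto simp: eventually_mono)
  qed
  then have "AE x in M. ennreal ((u x * v x * w x) powr (1/3)) = 0" by (rule eventually_mono) simp
  then have "(\<integral>\<^sup>+x. ennreal ((u x * v x * w x) powr (1/3)) \<partial>M) = 0"
    by (subst nn_integral_0_iff_AE) auto
  then show ?thesis by simp
next
  case False
  then have p: "U > 0" "V > 0" "W > 0" using pos by auto
  define P where "P = (U * V * W) powr (1/3)"
  have P0: "P \<ge> 0" by (simp add: P_def)
  have "(u x * v x * w x) powr (1/3) \<le> P / 3 * (u x / U + v x / V + w x / W)" for x
  proof -
    have "u x * v x * w x = (U * V * W) * (u x / U * (v x / V) * (w x / W))" using p by simp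
    moreover have "0 \<le> u x / U * (v x / V) * (w x / W)" using p nn by (intro mult_nonneg_nonneg divide_nonneg_pos) auto
    moreover have "0 \<le> U * V * W" using p by simp
    ultimately have "(u x * v x * w x) powr (1/3) = P * (u x / U * (v x / V) * (w x / W)) powr (1/3)"
      unfolding P_def by (simp only: powr_mult)
    also have "\<dots> \<le> P * ((u x / U + v x / V + w x / W) / 3)"
      using P0 p nn by (intro mult_left_mono powr_third_sum_le) auto
    finally show ?thesis by simp
  qed
  then have "(\<integral>\<^sup>+x. ennreal ((u x * v x * w x) powr (1/3)) \<partial>M) \<le> (\<integral>\<^sup>+x. ennreal (P / (3 * U)) * ennreal (u x) + ennreal (P / (3 * V)) * ennreal (v x) + ennreal (P / (3 * W)) * ennreal (w x) \<partial>M)"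
    using p P0 nn by (intro nn_integral_mono) (auto simp: ennreal_mult'[symmetric] ennreal_plus[symmetric] algebra_simps simp del: ennreal_plus intro!: ennreal_leI)
  also have "\<dots> = ennreal (P / (3 * U)) * (\<integral>\<^sup>+x. ennreal (u x) \<partial>M) + ennreal (P / (3 * V)) * (\<integral>\<^sup>+x. ennreal (v x) \<partial>M) + ennreal (P / (3 * W)) * (\<integral>\<^sup>+x. ennreal (w x) \<partial>M)"
    by (simp add: nn_integral_add nn_integral_cmult)
  also have "\<dots> \<le> ennreal (P / (3 * U)) * ennreal U + ennreal (P / (3 * V)) * ennreal V + ennreal (P / (3 * W)) * ennreal W"
    by (intro add_mono mult_left_mono U V W) auto
  also have "\<dots> = ennreal P" using p P0 by (simp add: ennreal_mult'[symmetric] ennreal_plus[symmetric] del: ennreal_plus)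
  finally show ?thesis by (simp add: P_def)
qed

text \<open>An almost orthogonal family with weights \<open>\<phi>\<close>. This is the only property of the frequency pieces of an
\<open>L\<^sup>2\<close> function that the trilinear estimates use.\<close>
definition bessel_family :: "'i set \<Rightarrow> ('i \<Rightarrow> 'a::euclidean_space \<Rightarrow> complex) \<Rightarrow> ('i \<Rightarrow> real) \<Rightarrow> bool"
  where "bessel_family J F \<phi> \<longleftrightarrow> finite J \<and> (\<forall>j. F j \<in> borel_measurable borel) \<and> (\<forall>j. \<phi> j \<ge> 0) \<and>
    (\<forall>a. (\<integral>\<^sup>+x. ennreal ((norm (\<Sum>j\<in>J. a j * F j x))\<^sup>2) \<partial>lborel) \<le> ennreal (\<Sum>j\<in>J. (norm (a j))\<^sup>2 * \<phi> j))"

text \<open>Apply the defining inequality to the coefficient families that are 1 at one index and 0 at the others, and add.\<close>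
lemma bessel_family_square_function:
  assumes F: "bessel_family J F \<phi>"
  shows "(\<integral>\<^sup>+x. ennreal (\<Sum>j\<in>J. (norm (F j x))\<^sup>2) \<partial>lborel) \<le> ennreal (\<Sum>j\<in>J. \<phi> j)"
proof -
  have [measurable]: "F j \<in> borel_measurable borel" for j using F by (auto simp: bessel_family_def)
  have fin: "finite J" and nn: "\<And>j. \<phi> j \<ge> 0" using F by (auto simp: bessel_family_def)
  have "(\<integral>\<^sup>+x. ennreal ((norm (F j x))\<^sup>2) \<partial>lborel) \<le> ennreal (\<phi> j)" if "j \<in> J" for j
  proof -
    have "(\<integral>\<^sup>+x. ennreal ((norm (\<Sum>i\<in>J. of_bool (i = j) * F i x))\<^sup>2) \<partial>lborel) \<le> ennreal (\<Sum>i\<in>J. (norm (of_bool (i = j) :: complex))\<^sup>2 * \<phi> i)"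
      using conjunct2[OF conjunct2[OF conjunct2[OF F[unfolded bessel_family_def]]], rule_format, of "\<lambda>i. of_bool (i = j)"] .
    moreover have "(\<Sum>i\<in>J. of_bool (i = j) * F i x) = F j x" for x using fin that by (simp add: of_bool_def if_distrib[of "\<lambda>z. z * _"] cong: if_cong)
    moreover have "(\<Sum>i\<in>J. (norm (of_bool (i = j) :: complex))\<^sup>2 * \<phi> i) = \<phi> j" 
    proof -
      have "(\<Sum>i\<in>J. (norm (of_bool (i = j) :: complex))\<^sup>2 * \<phi> i) = (\<Sum>i\<in>J. if i = j then \<phi> i else 0)" by (intro sum.cong) auto
      then show ?thesis using fin that by simp
    qed
    ultimately show ?thesis by simp
  qed
  then have "(\<Sum>j\<in>J. \<integral>\<^sup>+x. ennreal ((norm (F j x))\<^sup>2) \<partial>lborel) \<le> (\<Sum>j\<in>J. ennreal (\<phi> j))" by (rule sum_mono)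
  then show ?thesis by (simp add: nn_integral_sum[symmetric] sum_ennreal nn sum_nonneg)
qed

text \<open>Cauchy-Schwarz in \<open>(i, j)\<close> bounds the squared modulus of the sum by \<open>u x * v x * w x\<close>, where \<open>u\<close> and \<open>v\<close> are the
squared square functions of \<open>F\<close> and \<open>G\<close> and \<open>w\<close> is the sum over \<open>i\<close> and \<open>j\<close> of the squared moduli of the functions
\<open>\<Sum> c i j k * H k\<close>. The slice condition enters only in the integral of \<open>w\<close>: exchanging the order of
summation collects the coefficients belonging to one \<open>k\<close>.\<close>
lemma trilinear_sum_slice_bound:
  fixes F G H :: "'i \<Rightarrow> 'a::euclidean_space \<Rightarrow> complex"
  assumes F: "bessel_family J F f" and G: "bessel_family J G g" and H: "bessel_family J H h"
    and K: "\<And>k. k \<in> J \<Longrightarrow> (\<Sum>i\<in>J. \<Sum>j\<in>J. (norm (c i j k))\<^sup>2) \<le> K" and K0: "K \<ge> 0"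
  shows "(\<integral>\<^sup>+x. ennreal (norm (\<Sum>i\<in>J. \<Sum>j\<in>J. \<Sum>k\<in>J. c i j k * F i x * G j x * H k x) powr (2/3)) \<partial>lborel)
    \<le> ennreal ((K * sum f J * sum g J * sum h J) powr (1/3))"
proof -
  have [measurable]: "F j \<in> borel_measurable borel" "G j \<in> borel_measurable borel" "H j \<in> borel_measurable borel" for j
    using F G H by (auto simp: bessel_family_def)
  have fin: "finite J" and nn: "\<And>j. f j \<ge> 0" "\<And>j. g j \<ge> 0" "\<And>j. h j \<ge> 0" using F G H by (auto simp: bessel_family_def)
  define u where "u = (\<lambda>x. \<Sum>i\<in>J. (norm (F i x))\<^sup>2)"
  define v where "v = (\<lambda>x. \<Sum>i\<in>J. (norm (G i x))\<^sup>2)"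
  define w where "w = (\<lambda>x. \<Sum>i\<in>J. \<Sum>j\<in>J. (norm (\<Sum>k\<in>J. c i j k * H k x))\<^sup>2)"
  have pw: "norm (\<Sum>i\<in>J. \<Sum>j\<in>J. \<Sum>k\<in>J. c i j k * F i x * G j x * H k x) powr (2/3) \<le> (u x * v x * w x) powr (1/3)" for x
  proof -
    let ?T = "norm (\<Sum>i\<in>J. \<Sum>j\<in>J. \<Sum>k\<in>J. c i j k * F i x * G j x * H k x)"
    let ?a = "\<lambda>p. norm (F (fst p) x) * norm (G (snd p) x)" and ?b = "\<lambda>p. norm (\<Sum>k\<in>J. c (fst p) (snd p) k * H k x)"
    have "(\<Sum>i\<in>J. \<Sum>j\<in>J. \<Sum>k\<in>J. c i j k * F i x * G j x * H k x) = (\<Sum>p\<in>J\<times>J. F (fst p) x * G (snd p) x * (\<Sum>k\<in>J. c (fst p) (snd p) k * H k x))"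
      by (simp add: sum.cartesian_product' sum_distrib_left mult_ac)
    then have "?T \<le> (\<Sum>p\<in>J\<times>J. ?a p * ?b p)"
      by (auto simp: norm_mult intro!: sum_norm_le)
    then have "?T\<^sup>2 \<le> (\<Sum>p\<in>J\<times>J. ?a p * ?b p)\<^sup>2" by (intro power_mono) auto
    also have "\<dots> \<le> (\<Sum>p\<in>J\<times>J. (?a p)\<^sup>2) * (\<Sum>p\<in>J\<times>J. (?b p)\<^sup>2)" by (rule Cauchy_Schwarz_ineq_sum)
    also have "(\<Sum>p\<in>J\<times>J. (?a p)\<^sup>2) = u x * v x" 
      unfolding u_def v_def sum_product sum.cartesian_product' by (simp add: power_mult_distrib)
    also have "(\<Sum>p\<in>J\<times>J. (?b p)\<^sup>2) = w x" unfolding w_def sum.cartesian_product' by simp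
    finally have "(?T\<^sup>2) powr (1/3) \<le> (u x * v x * w x) powr (1/3)" by (intro powr_mono2) auto
    moreover have "(?T\<^sup>2) powr (1/3) = ?T powr (2/3)" by (rule square_powr_third) simp
    ultimately show ?thesis by simp
  qed
  have w: "(\<integral>\<^sup>+x. ennreal (w x) \<partial>lborel) \<le> ennreal (K * sum h J)"
  proof -
    have "(\<integral>\<^sup>+x. ennreal (w x) \<partial>lborel) = (\<Sum>i\<in>J. \<Sum>j\<in>J. \<integral>\<^sup>+x. ennreal ((norm (\<Sum>k\<in>J. c i j k * H k x))\<^sup>2) \<partial>lborel)"
      unfolding w_def by (simp add: nn_integral_sum[symmetric] sum_nonneg sum_ennreal)
    also have "\<dots> \<le> (\<Sum>i\<in>J. \<Sum>j\<in>J. ennreal (\<Sum>k\<in>J. (norm (c i j k))\<^sup>2 * h k))"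
      using H by (intro sum_mono) (auto simp: bessel_family_def)
    also have "\<dots> = ennreal (\<Sum>i\<in>J. \<Sum>j\<in>J. \<Sum>k\<in>J. (norm (c i j k))\<^sup>2 * h k)"
      using nn by (simp add: sum_ennreal sum_nonneg)
    also have "(\<Sum>i\<in>J. \<Sum>j\<in>J. \<Sum>k\<in>J. (norm (c i j k))\<^sup>2 * h k) = (\<Sum>k\<in>J. (\<Sum>i\<in>J. \<Sum>j\<in>J. (norm (c i j k))\<^sup>2) * h k)"
    proof -
      have "(\<Sum>i\<in>J. \<Sum>j\<in>J. \<Sum>k\<in>J. (norm (c i j k))\<^sup>2 * h k) = (\<Sum>i\<in>J. \<Sum>k\<in>J. \<Sum>j\<in>J. (norm (c i j k))\<^sup>2 * h k)"
        by (intro sum.cong refl sum.swap)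
      also have "\<dots> = (\<Sum>k\<in>J. \<Sum>i\<in>J. \<Sum>j\<in>J. (norm (c i j k))\<^sup>2 * h k)" by (rule sum.swap)
      finally show ?thesis by (simp add: sum_distrib_right)
    qed
    also have "\<dots> \<le> (\<Sum>k\<in>J. K * h k)" using K nn by (intro sum_mono mult_right_mono) auto
    finally show ?thesis by (simp add: sum_distrib_left ennreal_leI)
  qed
  have "(\<integral>\<^sup>+x. ennreal (norm (\<Sum>i\<in>J. \<Sum>j\<in>J. \<Sum>k\<in>J. c i j k * F i x * G j x * H k x) powr (2/3)) \<partial>lborel) \<le> (\<integral>\<^sup>+x. ennreal ((u x * v x * w x) powr (1/3)) \<partial>lborel)"
    by (intro nn_integral_mono ennreal_leI pw)
  also have "\<dots> \<le> ennreal ((sum f J * sum g J * (K * sum h J)) powr (1/3))"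
  proof (rule nn_integral_powr_third_le)
    show "(\<integral>\<^sup>+x. ennreal (u x) \<partial>lborel) \<le> ennreal (sum f J)" unfolding u_def by (rule bessel_family_square_function[OF F])
    show "(\<integral>\<^sup>+x. ennreal (v x) \<partial>lborel) \<le> ennreal (sum g J)" unfolding v_def by (rule bessel_family_square_function[OF G])
    show "(\<integral>\<^sup>+x. ennreal (w x) \<partial>lborel) \<le> ennreal (K * sum h J)" by (rule w)
  qed (use nn K0 in \<open>auto simp: u_def v_def w_def sum_nonneg\<close>)
  finally show ?thesis by (simp add: mult_ac)
qed

section \<open>Splitting the coefficients\<close>

text \<open>Multiply the condition on \<open>R\<close> by \<open>\<bar>c p\<bar>\<^sup>2\<close> and split \<open>\<bar>c p\<bar> powr (q/3 + 2)\<close> into \<open>\<bar>c p\<bar> powr (2 - 2*q/3)\<close>, which is at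
most the corresponding power of \<open>A\<close> as \<open>q < 3\<close>, and \<open>\<bar>c p\<bar> powr q\<close>, whose sum is again \<open>S\<close>. The factor \<open>S\<close> cancels.\<close>
lemma slice_sum_le:
  fixes c :: "'p \<Rightarrow> complex"
  assumes fin: "finite P" and A: "\<And>p. p \<in> P \<Longrightarrow> norm (c p) \<le> A" and q: "0 < q" "q < 3" and Q: "Q > 0"
    and S: "S = (\<Sum>p\<in>P. norm (c p) powr q)"
    and R: "\<And>p. p \<in> R \<Longrightarrow> S \<le> Q powr (2/3) * norm (c p) powr (q/3)" and RP: "R \<subseteq> P"
  shows "(\<Sum>p\<in>R. (norm (c p))\<^sup>2) \<le> A powr (2 - 2*q/3) * Q powr (2/3)"
proof (cases "S = 0")
  case True
  then have "norm (c p) powr q = 0" if "p \<in> P" for p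
    using that S by (simp add: sum_nonneg_eq_0_iff[OF fin])
  then have "c p = 0" if "p \<in> R" for p using that RP by auto
  then show ?thesis by simp
next
  case False
  then have S0: "S > 0" unfolding S by (simp add: sum_nonneg order.strict_iff_order)
  let ?K = "A powr (2 - 2*q/3) * Q powr (2/3)"
  have "S * (norm (c p))\<^sup>2 \<le> ?K * norm (c p) powr q" if p: "p \<in> R" for p
  proof (cases "c p = 0")
    case False
    then have n: "norm (c p) > 0" by simp
    have "S * (norm (c p))\<^sup>2 \<le> Q powr (2/3) * norm (c p) powr (q/3) * norm (c p) powr 2"
      using R[OF p] n by (simp add: mult_right_mono)
    also have "\<dots> = Q powr (2/3) * (norm (c p) powr (2 - 2*q/3) * norm (c p) powr q)"
    proof -
      have "q/3 + 2 = (2 - 2*q/3) + q" by simp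
      then show ?thesis by (simp only: mult.assoc powr_add[symmetric])
    qed
    also have "\<dots> \<le> Q powr (2/3) * (A powr (2 - 2*q/3) * norm (c p) powr q)"
      using q A[of p] p RP by (intro mult_left_mono mult_right_mono powr_mono2) auto
    finally show ?thesis by (simp add: mult_ac)
  qed simp
  then have "(\<Sum>p\<in>R. S * (norm (c p))\<^sup>2) \<le> (\<Sum>p\<in>R. ?K * norm (c p) powr q)" by (rule sum_mono)
  also have "\<dots> = ?K * (\<Sum>p\<in>R. norm (c p) powr q)" by (simp add: sum_distrib_left)
  also have "\<dots> \<le> ?K * S" unfolding S using fin RP by (intro mult_left_mono sum_mono2) auto
  finally have "S * (\<Sum>p\<in>R. (norm (c p))\<^sup>2) \<le> S * ?K" by (simp add: sum_distrib_left mult_ac)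
  then show ?thesis using S0 by simp
qed

text \<open>The counterpart of the previous lemma for entries that are small compared with both marginals: there
\<open>\<bar>c i j\<bar> powr (2*q/3)\<close> is at most a multiple of \<open>S i * S' j\<close>, and that product is summable in \<open>(i, j)\<close>.\<close>
lemma slice_sum_le_product:
  fixes c :: "'i \<Rightarrow> 'i \<Rightarrow> complex"
  assumes A: "\<And>i j. i \<in> J \<Longrightarrow> j \<in> J \<Longrightarrow> norm (c i j) \<le> A" and q: "0 < q" "q < 3" and Q: "Q > 0"
    and S: "\<And>i. S i \<ge> 0" "\<And>i. S' i \<ge> 0" "(\<Sum>i\<in>J. S i) \<le> Q" "(\<Sum>i\<in>J. S' i) \<le> Q"
    and R: "\<And>i j. i \<in> J \<Longrightarrow> j \<in> J \<Longrightarrow> c i j \<noteq> 0 \<Longrightarrow> Q powr (2/3) * norm (c i j) powr (q/3) \<le> S i \<and> Q powr (2/3) * norm (c i j) powr (q/3) \<le> S' j"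
  shows "(\<Sum>i\<in>J. \<Sum>j\<in>J. (norm (c i j))\<^sup>2) \<le> A powr (2 - 2*q/3) * Q powr (2/3)"
proof -
  let ?A = "A powr (2 - 2*q/3)"
  have "(norm (c i j))\<^sup>2 \<le> ?A * Q powr (-4/3) * (S i * S' j)" if ij: "i \<in> J" "j \<in> J" for i j
  proof (cases "c i j = 0")
    case False
    then have n: "norm (c i j) > 0" by simp
    have "(Q powr (2/3) * norm (c i j) powr (q/3)) * (Q powr (2/3) * norm (c i j) powr (q/3)) \<le> S i * S' j"
      using R[OF ij False] S by (intro mult_mono) auto
    also have "(Q powr (2/3) * norm (c i j) powr (q/3)) * (Q powr (2/3) * norm (c i j) powr (q/3)) = Q powr (4/3) * norm (c i j) powr (2*q/3)"
    proof -
      have "Q powr (2/3) * Q powr (2/3) = Q powr (4/3)" "norm (c i j) powr (q/3) * norm (c i j) powr (q/3) = norm (c i j) powr (2*q/3)"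
        by (simp_all flip: powr_add)
      moreover have "(a * b) * (a * b) = (a * a) * (b * b)" for a b :: real by (simp only: mult_ac)
      ultimately show ?thesis by presburger
    qed
    finally have 1: "Q powr (4/3) * norm (c i j) powr (2*q/3) \<le> S i * S' j" .
    have "Q powr (-4/3) * (Q powr (4/3) * norm (c i j) powr (2*q/3)) \<le> Q powr (-4/3) * (S i * S' j)"
      by (rule mult_left_mono[OF 1]) simp
    then have 2: "norm (c i j) powr (2*q/3) \<le> Q powr (-4/3) * (S i * S' j)"
      using Q by (simp add: mult.assoc[symmetric] powr_add[symmetric])
    have "(norm (c i j))\<^sup>2 = norm (c i j) powr (2 - 2*q/3) * norm (c i j) powr (2*q/3)"
      using n by (simp add: powr_add[symmetric])
    also have "\<dots> \<le> ?A * (Q powr (-4/3) * (S i * S' j))"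
      using q A[OF ij] by (intro mult_mono 2 powr_mono2) auto
    finally show ?thesis by (simp add: mult_ac)
  qed (use S in simp)
  then have "(\<Sum>i\<in>J. \<Sum>j\<in>J. (norm (c i j))\<^sup>2) \<le> (\<Sum>i\<in>J. \<Sum>j\<in>J. ?A * Q powr (-4/3) * (S i * S' j))" by (intro sum_mono)
  also have "\<dots> = ?A * Q powr (-4/3) * ((\<Sum>i\<in>J. S i) * (\<Sum>i\<in>J. S' i))"
    unfolding sum_product by (simp only: sum_distrib_left)
  also have "\<dots> \<le> ?A * Q powr (-4/3) * (Q * Q)"
    using S Q by (intro mult_left_mono mult_mono sum_nonneg) auto
  also have "\<dots> = ?A * Q powr (2/3)"
  proof -
    have "Q powr (2/3) = Q powr (-4/3 + (1 + 1))" by simp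
    also have "\<dots> = Q powr (-4/3) * (Q powr 1 * Q powr 1)" by (simp only: powr_add)
    also have "\<dots> = Q powr (-4/3) * (Q * Q)" using Q by simp
    finally show ?thesis by simp
  qed
  finally show ?thesis .
qed

text \<open>Subadditivity of \<open>x powr p\<close> for \<open>p \<le> 1\<close>; it replaces the triangle inequality in \<open>L\<^sup>2\<^sup>/\<^sup>3\<close>.\<close>
lemma powr_sum_le:
  fixes f :: "'i \<Rightarrow> real"
  assumes "0 < p" "p \<le> 1" "\<And>i. i \<in> I \<Longrightarrow> f i \<ge> 0"
  shows "(\<Sum>i\<in>I. f i) powr p \<le> (\<Sum>i\<in>I. f i powr p)"
proof -
  have add: "(a + b) powr p \<le> a powr p + b powr p" if "a \<ge> 0" "b \<ge> 0" for a b :: real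
  proof (cases "a + b = 0")
    case False
    then have s: "a + b > 0" using that by simp
    have le: "t \<le> t powr p" if "0 \<le> t" "t \<le> 1" for t :: real
    proof (cases "t = 0")
      case False
      then show ?thesis using that assms powr_mono'[of p 1 t] by simp
    qed simp
    have "1 = a / (a + b) + b / (a + b)" using s by (simp add: add_divide_distrib[symmetric])
    also have "\<dots> \<le> (a / (a + b)) powr p + (b / (a + b)) powr p"
      using that s by (intro add_mono le) auto
    also have "\<dots> = (a powr p + b powr p) / (a + b) powr p" using that s by (simp add: powr_divide add_divide_distrib)
    finally show ?thesis using s by (simp add: field_simps)
  qed (use that in simp)
  show ?thesis
  proof (cases "finite I")
    case True
    then show ?thesis using assms(3)
    proof (induction I rule: finite_induct)
      case (insert i I)
      have "(\<Sum>i\<in>insert i I. f i) powr p \<le> f i powr p + (\<Sum>i\<in>I. f i) powr p"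
        using insert by (simp add: add sum_nonneg)
      also have "\<dots> \<le> f i powr p + (\<Sum>i\<in>I. f i powr p)" using insert by simp
      finally show ?case using insert by simp
    qed simp
  qed simp
qed

lemma norm_sum_powr_le:
  fixes f :: "'i \<Rightarrow> complex"
  assumes "0 < p" "p \<le> 1"
  shows "norm (\<Sum>i\<in>I. f i) powr p \<le> (\<Sum>i\<in>I. norm (f i) powr p)"
  by (rule order_trans[OF powr_mono2[OF _ _ norm_sum] powr_sum_le]) (use assms in auto)

text \<open>Let \<open>S1 i\<close>, \<open>S2 j\<close>, \<open>S3 k\<close> be the marginals of \<open>\<bar>c\<bar> powr q\<close>. An entry is assigned to the first of the indices
\<open>k\<close>, \<open>i\<close>, \<open>j\<close> whose marginal is at most the threshold \<open>Q powr (2/3) * \<bar>c i j k\<bar> powr (q/3)\<close>; for the entries of such a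
class \<open>slice_sum_le\<close> controls the slices in which that index is fixed. The entries left over lie below
\<open>S1\<close> and \<open>S2\<close>, and their slices with \<open>k\<close> fixed are controlled by \<open>slice_sum_le_product\<close>. The factor 4 counts the
classes.\<close>
lemma trilinear_sum_bound:
  fixes F G H :: "'i \<Rightarrow> 'a::euclidean_space \<Rightarrow> complex"
  assumes F: "bessel_family J F f" and G: "bessel_family J G g" and H: "bessel_family J H h"
    and A: "\<And>i j k. i \<in> J \<Longrightarrow> j \<in> J \<Longrightarrow> k \<in> J \<Longrightarrow> norm (c i j k) \<le> A"
    and Q: "(\<Sum>i\<in>J. \<Sum>j\<in>J. \<Sum>k\<in>J. norm (c i j k) powr q) \<le> Q"
    and q: "0 < q" "q < 3"
  shows "(\<integral>\<^sup>+x. ennreal (norm (\<Sum>i\<in>J. \<Sum>j\<in>J. \<Sum>k\<in>J. c i j k * F i x * G j x * H k x) powr (2/3)) \<partial>lborel)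
    \<le> ennreal (4 * (A powr (2 - 2*q/3) * Q powr (2/3) * sum f J * sum g J * sum h J) powr (1/3))"
proof -
  have [measurable]: "F j \<in> borel_measurable borel" "G j \<in> borel_measurable borel" "H j \<in> borel_measurable borel" for j
    using F G H by (auto simp: bessel_family_def)
  have fin: "finite J" using F by (auto simp: bessel_family_def)
  have "0 \<le> (\<Sum>i\<in>J. \<Sum>j\<in>J. \<Sum>k\<in>J. norm (c i j k) powr q)" by (intro sum_nonneg) auto
  then have Q0: "0 \<le> Q" using Q by linarith
  show ?thesis
  proof (cases "Q = 0")
    case True
    have "(\<Sum>i\<in>J. \<Sum>j\<in>J. \<Sum>k\<in>J. norm (c i j k) powr q) = 0"
      using Q True by (intro antisym sum_nonneg) auto
    then have "c i j k = 0" if "i \<in> J" "j \<in> J" "k \<in> J" for i j k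
      using that by (simp add: sum_nonneg_eq_0_iff[OF fin] sum_nonneg)
    then have "(\<Sum>i\<in>J. \<Sum>j\<in>J. \<Sum>k\<in>J. c i j k * F i x * G j x * H k x) = 0" for x
      by (intro sum.neutral ballI) simp
    then show ?thesis by simp
  next
    case False
    with Q0 have Qpos: "Q > 0" by simp
    let ?K = "A powr (2 - 2*q/3) * Q powr (2/3)"
    define S1 where "S1 = (\<lambda>i. \<Sum>j\<in>J. \<Sum>k\<in>J. norm (c i j k) powr q)"
    define S2 where "S2 = (\<lambda>j. \<Sum>i\<in>J. \<Sum>k\<in>J. norm (c i j k) powr q)"
    define S3 where "S3 = (\<lambda>k. \<Sum>i\<in>J. \<Sum>j\<in>J. norm (c i j k) powr q)"
    define thr where "thr = (\<lambda>i j k. Q powr (2/3) * norm (c i j k) powr (q/3))"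
    define cl :: "'i \<Rightarrow> 'i \<Rightarrow> 'i \<Rightarrow> nat" where "cl = (\<lambda>i j k. if S3 k \<le> thr i j k then 3 else if S1 i \<le> thr i j k then 1
      else if S2 j \<le> thr i j k then 2 else 0)"
    define b where "b = (\<lambda>n i j k. if cl i j k = n then c i j k else 0)"
    define T where "T = (\<lambda>n x. \<Sum>i\<in>J. \<Sum>j\<in>J. \<Sum>k\<in>J. b n i j k * F i x * G j x * H k x)"
    let ?B = "(?K * sum f J * sum g J * sum h J) powr (1/3)"
    have Sn: "S1 i \<ge> 0" "S2 i \<ge> 0" for i by (auto simp: S1_def S2_def intro!: sum_nonneg)
    have S1Q: "sum S1 J \<le> Q" unfolding S1_def by (rule Q)
    have S2Q: "sum S2 J \<le> Q" unfolding S2_def by (subst sum.swap) (rule Q)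
    have K0: "?K \<ge> 0" by simp
    (* the slice bound for one of the classes 1, 2, 3, stated for a two-dimensional slice d of the coefficients *)
    have sl: "(\<Sum>i\<in>J. \<Sum>j\<in>J. (norm (if P i j then d i j else 0))\<^sup>2) \<le> ?K"
      if d: "\<And>i j. i \<in> J \<Longrightarrow> j \<in> J \<Longrightarrow> norm (d i j) \<le> A" and 
        P: "\<And>i j. i \<in> J \<Longrightarrow> j \<in> J \<Longrightarrow> P i j \<Longrightarrow> (\<Sum>i\<in>J. \<Sum>j\<in>J. norm (d i j) powr q) \<le> Q powr (2/3) * norm (d i j) powr (q/3)"
      for P and d :: "'i \<Rightarrow> 'i \<Rightarrow> complex"
    proof -
      let ?R = "{p \<in> J \<times> J. P (fst p) (snd p)}"
      have "(\<Sum>i\<in>J. \<Sum>j\<in>J. (norm (if P i j then d i j else 0))\<^sup>2) = (\<Sum>p\<in>J \<times> J. if P (fst p) (snd p) then (norm (d (fst p) (snd p)))\<^sup>2 else 0)"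
        unfolding sum.cartesian_product' by (intro sum.cong refl) auto
      also have "\<dots> = (\<Sum>p\<in>?R. (norm (d (fst p) (snd p)))\<^sup>2)"
        using fin by (simp add: sum.If_cases Collect_conj_eq[symmetric] Int_def)
      also have "\<dots> \<le> ?K"
        by (rule slice_sum_le[OF _ _ q Qpos refl, where P="J \<times> J"])
          (use fin d P in \<open>auto simp: sum.cartesian_product'\<close>)
      finally show ?thesis .
    qed
    have T3: "(\<integral>\<^sup>+x. ennreal (norm (T 3 x) powr (2/3)) \<partial>lborel) \<le> ennreal ?B"
      unfolding T_def
    proof (rule trilinear_sum_slice_bound[OF F G H _ K0])
      fix k assume k: "k \<in> J"
      show "(\<Sum>i\<in>J. \<Sum>j\<in>J. (norm (b 3 i j k))\<^sup>2) \<le> ?K"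
        unfolding b_def by (rule sl) (use A k in \<open>auto simp: cl_def thr_def S3_def split: if_splits\<close>)
    qed
    have T0: "(\<integral>\<^sup>+x. ennreal (norm (T 0 x) powr (2/3)) \<partial>lborel) \<le> ennreal ?B"
      unfolding T_def
    proof (rule trilinear_sum_slice_bound[OF F G H _ K0])
      fix k assume k: "k \<in> J"
      show "(\<Sum>i\<in>J. \<Sum>j\<in>J. (norm (b 0 i j k))\<^sup>2) \<le> ?K"
      proof (rule slice_sum_le_product[OF _ q Qpos Sn S1Q S2Q])
        fix i j assume ij: "i \<in> J" "j \<in> J"
        have "norm (c i j k) \<le> A" using A ij k by blast
        moreover have "0 \<le> A" using calculation norm_ge_zero order_trans by blast
        ultimately show "norm (b 0 i j k) \<le> A" by (auto simp: b_def)
        assume "b 0 i j k \<noteq> 0"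
        then show "Q powr (2/3) * norm (b 0 i j k) powr (q/3) \<le> S1 i \<and> Q powr (2/3) * norm (b 0 i j k) powr (q/3) \<le> S2 j"
          by (auto simp: b_def cl_def thr_def split: if_splits)
      qed
    qed
    have T1: "(\<integral>\<^sup>+x. ennreal (norm (T 1 x) powr (2/3)) \<partial>lborel) \<le> ennreal ?B"
    proof -
      have "T 1 x = (\<Sum>j\<in>J. \<Sum>k\<in>J. \<Sum>i\<in>J. b 1 i j k * G j x * H k x * F i x)" for x
      proof -
        have "T 1 x = (\<Sum>j\<in>J. \<Sum>i\<in>J. \<Sum>k\<in>J. b 1 i j k * G j x * H k x * F i x)"
          unfolding T_def by (subst sum.swap) (simp add: mult_ac)
        also have "\<dots> = (\<Sum>j\<in>J. \<Sum>k\<in>J. \<Sum>i\<in>J. b 1 i j k * G j x * H k x * F i x)"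
          by (intro sum.cong refl sum.swap)
        finally show ?thesis .
      qed
      then have "(\<integral>\<^sup>+x. ennreal (norm (T 1 x) powr (2/3)) \<partial>lborel) \<le> ennreal ((?K * sum g J * sum h J * sum f J) powr (1/3))"
      proof (simp only:, intro trilinear_sum_slice_bound[OF G H F _ K0])
        fix i assume i: "i \<in> J"
        show "(\<Sum>j\<in>J. \<Sum>k\<in>J. (norm (b 1 i j k))\<^sup>2) \<le> ?K"
          unfolding b_def by (rule sl) (use A i in \<open>auto simp: cl_def thr_def S1_def split: if_splits\<close>)
      qed
      then show ?thesis by (simp add: mult_ac)
    qed
    have T2: "(\<integral>\<^sup>+x. ennreal (norm (T 2 x) powr (2/3)) \<partial>lborel) \<le> ennreal ?B"
    proof -
      have "T 2 x = (\<Sum>i\<in>J. \<Sum>k\<in>J. \<Sum>j\<in>J. b 2 i j k * F i x * H k x * G j x)" for x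
      proof -
        have "T 2 x = (\<Sum>i\<in>J. \<Sum>k\<in>J. \<Sum>j\<in>J. b 2 i j k * F i x * G j x * H k x)"
          unfolding T_def by (intro sum.cong refl sum.swap)
        then show ?thesis by (simp add: mult_ac)
      qed
      then have "(\<integral>\<^sup>+x. ennreal (norm (T 2 x) powr (2/3)) \<partial>lborel) \<le> ennreal ((?K * sum f J * sum h J * sum g J) powr (1/3))"
      proof (simp only:, intro trilinear_sum_slice_bound[OF F H G _ K0])
        fix j assume j: "j \<in> J"
        show "(\<Sum>i\<in>J. \<Sum>k\<in>J. (norm (b 2 i j k))\<^sup>2) \<le> ?K"
          unfolding b_def by (rule sl) (use A j in \<open>auto simp: cl_def thr_def S2_def split: if_splits\<close>)
      qed
      then show ?thesis by (simp add: mult_ac)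
    qed
    have "(\<Sum>i\<in>J. \<Sum>j\<in>J. \<Sum>k\<in>J. c i j k * F i x * G j x * H k x) = (\<Sum>n\<in>{0,1,2,3}. T n x)" for x
    proof -
      have "c i j k = b 0 i j k + b 1 i j k + b 2 i j k + b 3 i j k" for i j k by (auto simp: b_def cl_def)
      then show ?thesis unfolding T_def by (simp add: sum.distrib[symmetric] algebra_simps)
    qed
    then have "norm (\<Sum>i\<in>J. \<Sum>j\<in>J. \<Sum>k\<in>J. c i j k * F i x * G j x * H k x) powr (2/3) \<le> (\<Sum>n\<in>{0,1,2,3}. norm (T n x) powr (2/3))" for x
      by (simp only:) (rule norm_sum_powr_le, auto)
    then have "(\<integral>\<^sup>+x. ennreal (norm (\<Sum>i\<in>J. \<Sum>j\<in>J. \<Sum>k\<in>J. c i j k * F i x * G j x * H k x) powr (2/3)) \<partial>lborel)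
      \<le> (\<integral>\<^sup>+x. (\<Sum>n\<in>{0,1,2,3}. ennreal (norm (T n x) powr (2/3))) \<partial>lborel)"
      by (intro nn_integral_mono) (simp add: sum_ennreal ennreal_plus[symmetric] ennreal_leI del: ennreal_plus)
    also have "\<dots> = (\<Sum>n\<in>{0,1,2,3}. \<integral>\<^sup>+x. ennreal (norm (T n x) powr (2/3)) \<partial>lborel)"
      by (rule nn_integral_sum) (simp add: T_def)
    also have "\<dots> \<le> (\<Sum>n\<in>{0::nat,1,2,3}. ennreal ?B)"
      using T0 T1 T2 T3 by (intro sum_mono) auto
    also have "\<dots> = ennreal (\<Sum>n\<in>{0::nat,1,2,3}. ?B)" by (rule sum_ennreal) simp
    also have "(\<Sum>n\<in>{0::nat,1,2,3}. ?B) = 4 * ?B" by simp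
    finally show ?thesis .
  qed
qed

section \<open>Frequency pieces and the trilinear operator\<close>

text \<open>The pieces have disjoint frequency supports, so the squares of the moduli add up pointwise on the frequency side. The
Plancherel inequality transports this to the physical side.\<close>
lemma bessel_family_pieces:
  fixes u \<phi> :: "'a::euclidean_space \<Rightarrow> complex" and \<kappa> :: "'a \<Rightarrow> 'i"
  assumes u: "integrable lborel u" and U: "(\<integral>\<^sup>+x. ennreal ((norm (u x))\<^sup>2) \<partial>lborel) \<le> ennreal U" "U \<ge> 0"
    and \<phi>: "\<phi> \<in> borel_measurable borel" "\<And>x. norm (\<phi> x) \<le> L"
    and \<kappa>: "\<And>j. {x. \<kappa> x = j} \<in> sets borel" and J: "finite J"
  obtains h where "bessel_family J (\<lambda>j x. fourier (\<lambda>\<xi>. (if \<kappa> \<xi> = j then \<phi> \<xi> else 0) * u \<xi>) (- x)) h"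
    "sum h J \<le> L\<^sup>2 * U"
proof -
  have [measurable]: "u \<in> borel_measurable borel" using u by (auto dest: borel_measurable_integrable)
  note \<phi>(1)[measurable]
  have [measurable]: "Measurable.pred borel (\<lambda>x. \<kappa> x = j)" for j using \<kappa> by (simp add: pred_def)
  have L0: "L \<ge> 0" using \<phi>(2)[of 0] norm_ge_zero order_trans by blast
  define v where "v = (\<lambda>j \<xi>. (if \<kappa> \<xi> = j then \<phi> \<xi> else 0) * u \<xi>)"
  have vm [measurable]: "v j \<in> borel_measurable borel" for j unfolding v_def by measurable
  have vi: "integrable lborel (v j)" for j
  proof -
    have "integrable lborel (\<lambda>\<xi>. u \<xi> * (if \<kappa> \<xi> = j then \<phi> \<xi> else 0))"
      by (rule integrable_mult_bounded[OF u, where B=L]) (use \<phi>(2) L0 in auto)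
    then show ?thesis by (simp add: v_def mult.commute)
  qed
  have sum_sq: "(norm (\<Sum>j\<in>J. a j * v j \<xi>))\<^sup>2 = (\<Sum>j\<in>J. (norm (a j))\<^sup>2 * (norm (v j \<xi>))\<^sup>2)" for a :: "'i \<Rightarrow> complex" and \<xi>
  proof -
    have 1: "(\<Sum>j\<in>J. a j * v j \<xi>) = (\<Sum>j\<in>J. if j = \<kappa> \<xi> then a j * v j \<xi> else 0)"
      by (intro sum.cong) (auto simp: v_def)
    have 2: "(\<Sum>j\<in>J. (norm (a j))\<^sup>2 * (norm (v j \<xi>))\<^sup>2) = (\<Sum>j\<in>J. if j = \<kappa> \<xi> then (norm (a j))\<^sup>2 * (norm (v j \<xi>))\<^sup>2 else 0)"
      by (intro sum.cong) (auto simp: v_def)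
    show ?thesis unfolding 1 2 using J by (simp add: norm_mult power_mult_distrib)
  qed
  have le: "(\<Sum>j\<in>J. (norm (v j \<xi>))\<^sup>2) \<le> L\<^sup>2 * (norm (u \<xi>))\<^sup>2" for \<xi>
  proof -
    have "(\<Sum>j\<in>J. (norm (v j \<xi>))\<^sup>2) = (\<Sum>j\<in>J. if j = \<kappa> \<xi> then (norm (\<phi> \<xi> * u \<xi>))\<^sup>2 else 0)"
      by (intro sum.cong) (auto simp: v_def)
    also have "\<dots> \<le> (norm (\<phi> \<xi> * u \<xi>))\<^sup>2" using J by simp
    also have "\<dots> \<le> L\<^sup>2 * (norm (u \<xi>))\<^sup>2"
      by (simp add: norm_mult power_mult_distrib mult_right_mono power_mono \<phi>(2))
    finally show ?thesis .
  qed
  define h where "h = (\<lambda>j. if j \<in> J then enn2real (\<integral>\<^sup>+x. ennreal ((norm (v j x))\<^sup>2) \<partial>lborel) else 0)"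
  have h0: "h j \<ge> 0" for j by (simp add: h_def)
  have tot: "(\<Sum>j\<in>J. \<integral>\<^sup>+x. ennreal ((norm (v j x))\<^sup>2) \<partial>lborel) \<le> ennreal (L\<^sup>2 * U)"
  proof -
    have "(\<Sum>j\<in>J. \<integral>\<^sup>+x. ennreal ((norm (v j x))\<^sup>2) \<partial>lborel) = (\<integral>\<^sup>+x. ennreal (\<Sum>j\<in>J. (norm (v j x))\<^sup>2) \<partial>lborel)"
      by (simp add: nn_integral_sum[symmetric] sum_ennreal)
    also have "\<dots> \<le> (\<integral>\<^sup>+x. ennreal (L\<^sup>2) * ennreal ((norm (u x))\<^sup>2) \<partial>lborel)"
      by (intro nn_integral_mono) (use le in \<open>simp add: ennreal_mult'[symmetric] ennreal_leI\<close>)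
    also have "\<dots> = ennreal (L\<^sup>2) * (\<integral>\<^sup>+x. ennreal ((norm (u x))\<^sup>2) \<partial>lborel)" by (rule nn_integral_cmult) simp
    also have "\<dots> \<le> ennreal (L\<^sup>2) * ennreal U" by (intro mult_left_mono U) simp
    finally show ?thesis using U(2) by (simp add: ennreal_mult'[symmetric])
  qed
  have h: "(\<integral>\<^sup>+x. ennreal ((norm (v j x))\<^sup>2) \<partial>lborel) = ennreal (h j)" if "j \<in> J" for j
  proof -
    have "(\<integral>\<^sup>+x. ennreal ((norm (v j x))\<^sup>2) \<partial>lborel) \<le> (\<Sum>j\<in>J. \<integral>\<^sup>+x. ennreal ((norm (v j x))\<^sup>2) \<partial>lborel)"
      using J that by (intro member_le_sum) auto
    also note tot
    finally have "(\<integral>\<^sup>+x. ennreal ((norm (v j x))\<^sup>2) \<partial>lborel) < \<infinity>" using order.strict_trans1 by fastforce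
    then show ?thesis using that by (simp add: h_def)
  qed
  show ?thesis
  proof
    have "bessel_family J (\<lambda>j x. fourier (v j) (- x)) h"
      unfolding bessel_family_def
    proof (intro conjI allI J h0)
      show "(\<lambda>x. fourier (v j) (- x)) \<in> borel_measurable borel" for j by measurable
      fix a :: "'i \<Rightarrow> complex"
      let ?w = "\<lambda>\<xi>. \<Sum>j\<in>J. a j * v j \<xi>"
      have wi: "integrable lborel ?w" using vi by (intro Bochner_Integration.integrable_sum integrable_mult_right)
      have i: "integrable lborel (\<lambda>x. a j * (v j x * cis (- 2 * pi * (x \<bullet> y))))" for j y
        by (intro integrable_mult_right integrable_mult_bounded[OF vi, where B=1]) (auto simp: cis_conv_exp)
      have "fourier ?w y = (\<Sum>j\<in>J. a j * fourier (v j) y)" for y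
      proof -
        have "fourier ?w y = (LINT x|lborel. (\<Sum>j\<in>J. a j * (v j x * cis (- 2 * pi * (x \<bullet> y)))))"
          unfolding fourier_def by (simp add: sum_distrib_right mult.assoc)
        also have "\<dots> = (\<Sum>j\<in>J. (LINT x|lborel. a j * (v j x * cis (- 2 * pi * (x \<bullet> y)))))"
          by (rule Bochner_Integration.integral_sum) (rule i)
        finally show ?thesis by (simp add: fourier_def)
      qed
      then have "(\<integral>\<^sup>+x. ennreal ((norm (\<Sum>j\<in>J. a j * fourier (v j) (- x)))\<^sup>2) \<partial>lborel) = (\<integral>\<^sup>+x. ennreal ((norm (fourier ?w (- x)))\<^sup>2) \<partial>lborel)"
        by simp
      also have "\<dots> = (\<integral>\<^sup>+x. ennreal ((norm (fourier ?w x))\<^sup>2) \<partial>lborel)"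
        using nn_integral_lborel_uminus[of "\<lambda>x. ennreal ((norm (fourier ?w x))\<^sup>2)" 0] by simp
      also have "\<dots> \<le> (\<integral>\<^sup>+x. ennreal ((norm (?w x))\<^sup>2) \<partial>lborel)" by (rule plancherel_le[OF wi])
      also have "\<dots> = (\<Sum>j\<in>J. \<integral>\<^sup>+x. ennreal ((norm (a j))\<^sup>2) * ennreal ((norm (v j x))\<^sup>2) \<partial>lborel)"
        unfolding sum_sq by (simp add: nn_integral_sum[symmetric] sum_ennreal[symmetric] ennreal_mult' )
      also have "\<dots> = (\<Sum>j\<in>J. ennreal ((norm (a j))\<^sup>2) * ennreal (h j))"
        by (intro sum.cong refl, subst nn_integral_cmult) (simp_all add: h)
      also have "\<dots> = ennreal (\<Sum>j\<in>J. (norm (a j))\<^sup>2 * h j)"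
        using h0 by (simp add: ennreal_mult'[symmetric] sum_ennreal)
      finally show "(\<integral>\<^sup>+x. ennreal ((norm (\<Sum>j\<in>J. a j * fourier (v j) (- x)))\<^sup>2) \<partial>lborel) \<le> ennreal (\<Sum>j\<in>J. (norm (a j))\<^sup>2 * h j)" .
    qed
    then show "bessel_family J (\<lambda>j x. fourier (\<lambda>\<xi>. (if \<kappa> \<xi> = j then \<phi> \<xi> else 0) * u \<xi>) (- x)) h"
      by (simp add: v_def)
    have "ennreal (sum h J) = (\<Sum>j\<in>J. ennreal (h j))" using h0 by (simp add: sum_ennreal)
    also have "\<dots> = (\<Sum>j\<in>J. \<integral>\<^sup>+x. ennreal ((norm (v j x))\<^sup>2) \<partial>lborel)" by (intro sum.cong refl) (simp add: h)
    finally have "ennreal (sum h J) \<le> ennreal (L\<^sup>2 * U)" using tot by simp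
    then show "sum h J \<le> L\<^sup>2 * U" using U(2) by (simp add: ennreal_le_iff)
  qed
qed

text \<open>For a multiplier \<open>A \<xi> * B \<eta> * C \<delta>\<close> the triple integral factors into three inverse Fourier transforms. These are
written as \<open>fourier\<close> at \<open>- x\<close>.\<close>
lemma trilinear_op_tensor_sum:
  fixes f g h :: "'a::euclidean_space \<Rightarrow> complex" and A B C :: "'s \<Rightarrow> 'a \<Rightarrow> complex"
  assumes f: "integrable lborel (fourier f)" and g: "integrable lborel (fourier g)" and h: "integrable lborel (fourier h)"
    and meas: "\<And>s. s \<in> S \<Longrightarrow> A s \<in> borel_measurable borel" "\<And>s. s \<in> S \<Longrightarrow> B s \<in> borel_measurable borel" "\<And>s. s \<in> S \<Longrightarrow> C s \<in> borel_measurable borel"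
    and bd: "\<And>s \<xi>. s \<in> S \<Longrightarrow> norm (A s \<xi>) \<le> L" "\<And>s \<xi>. s \<in> S \<Longrightarrow> norm (B s \<xi>) \<le> L" "\<And>s \<xi>. s \<in> S \<Longrightarrow> norm (C s \<xi>) \<le> L"
  shows "trilinear_op (\<lambda>(\<xi>, \<eta>, \<delta>). \<Sum>s\<in>S. c s * A s \<xi> * B s \<eta> * C s \<delta>) f g h x
    = (\<Sum>s\<in>S. c s * fourier (\<lambda>\<xi>. A s \<xi> * fourier f \<xi>) (-x) * fourier (\<lambda>\<xi>. B s \<xi> * fourier g \<xi>) (-x) * fourier (\<lambda>\<xi>. C s \<xi> * fourier h \<xi>) (-x))"
proof -
  define a where "a = (\<lambda>s \<xi>. A s \<xi> * fourier f \<xi> * cis (- 2 * pi * (\<xi> \<bullet> - x)))"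
  define b where "b = (\<lambda>s \<xi>. B s \<xi> * fourier g \<xi> * cis (- 2 * pi * (\<xi> \<bullet> - x)))"
  define d where "d = (\<lambda>s \<xi>. C s \<xi> * fourier h \<xi> * cis (- 2 * pi * (\<xi> \<bullet> - x)))"
  have int: "integrable lborel (\<lambda>\<xi>. D \<xi> * u \<xi> * cis (- 2 * pi * (\<xi> \<bullet> - x)))" 
    if "integrable lborel u" "D \<in> borel_measurable borel" "\<And>\<xi>. norm (D \<xi>) \<le> L" for D u :: "'a \<Rightarrow> complex"
    using integrable_mult_bounded[OF that(1), of "\<lambda>\<xi>. D \<xi> * cis (- 2 * pi * (\<xi> \<bullet> - x))" L] that(2,3)
    by (simp add: norm_mult cis_conv_exp mult_ac)
  have ai: "integrable lborel (a s)" "integrable lborel (b s)" "integrable lborel (d s)" if "s \<in> S" for s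
    unfolding a_def b_def d_def
    by (rule int[OF f meas(1)[OF that] bd(1)[OF that]], rule int[OF g meas(2)[OF that] bd(2)[OF that]], rule int[OF h meas(3)[OF that] bd(3)[OF that]])
  have cis3: "cis (2 * pi * (x \<bullet> (\<xi> + \<eta> + \<delta>))) = cis (- 2 * pi * (\<xi> \<bullet> - x)) * cis (- 2 * pi * (\<eta> \<bullet> - x)) * cis (- 2 * pi * (\<delta> \<bullet> - x))" for \<xi> \<eta> \<delta>
    by (simp add: cis_mult inner_add_left inner_add_right inner_commute algebra_simps)
  have "trilinear_op (\<lambda>(\<xi>, \<eta>, \<delta>). \<Sum>s\<in>S. c s * A s \<xi> * B s \<eta> * C s \<delta>) f g h x
    = (LINT \<xi>|lborel. LINT \<eta>|lborel. LINT \<delta>|lborel. (\<Sum>s\<in>S. c s * a s \<xi> * b s \<eta> * d s \<delta>))"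
    unfolding trilinear_op_def cis3 a_def b_def d_def by (simp add: sum_distrib_left sum_distrib_right mult_ac)
  also have "\<dots> = (LINT \<xi>|lborel. LINT \<eta>|lborel. (\<Sum>s\<in>S. c s * a s \<xi> * b s \<eta> * integral\<^sup>L lborel (d s)))"
    using ai by (subst Bochner_Integration.integral_sum) auto
  also have "\<dots> = (LINT \<xi>|lborel. (\<Sum>s\<in>S. c s * a s \<xi> * integral\<^sup>L lborel (b s) * integral\<^sup>L lborel (d s)))"
    using ai by (subst Bochner_Integration.integral_sum) auto
  also have "\<dots> = (\<Sum>s\<in>S. c s * integral\<^sup>L lborel (a s) * integral\<^sup>L lborel (b s) * integral\<^sup>L lborel (d s))"
    using ai by (subst Bochner_Integration.integral_sum) auto
  finally show ?thesis unfolding a_def b_def d_def fourier_def .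
qed

text \<open>Dominated convergence in each of the three nested integrals.\<close>
lemma trilinear_op_tendsto:
  fixes f g h :: "'a::euclidean_space \<Rightarrow> complex" and mm :: "nat \<Rightarrow> 'a \<times> 'a \<times> 'a \<Rightarrow> complex"
  assumes f: "integrable lborel (fourier f)" and g: "integrable lborel (fourier g)" and h: "integrable lborel (fourier h)"
    and meas: "\<And>n. mm n \<in> borel_measurable borel" "m \<in> borel_measurable borel"
    and bd: "\<And>n z. norm (mm n z) \<le> L" and lim: "\<And>z. (\<lambda>n. mm n z) \<longlonglongrightarrow> m z"
  shows "(\<lambda>n. trilinear_op (mm n) f g h x) \<longlonglongrightarrow> trilinear_op m f g h x"
proof -
  note meas[measurable]
  have [measurable]: "fourier f \<in> borel_measurable borel" "fourier g \<in> borel_measurable borel" "fourier h \<in> borel_measurable borel"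
    using f g h by (auto dest: borel_measurable_integrable)
  have L0: "L \<ge> 0" using bd[of 0 0] norm_ge_zero order_trans by blast
  define N where "N = (\<lambda>u::'a \<Rightarrow> complex. LINT \<xi>|lborel. norm (u \<xi>))"
  have N0: "N u \<ge> 0" for u unfolding N_def by simp
  let ?k = "\<lambda>m \<xi> \<eta> \<delta>. m (\<xi>, \<eta>, \<delta>) * fourier f \<xi> * fourier g \<eta> * fourier h \<delta> * cis (2 * pi * (x \<bullet> (\<xi> + \<eta> + \<delta>)))"
  have km [measurable]: "(\<lambda>(\<xi>, \<eta>, \<delta>). ?k m' \<xi> \<eta> \<delta>) \<in> borel_measurable (lborel \<Otimes>\<^sub>M lborel \<Otimes>\<^sub>M lborel)" if [measurable]: "m' \<in> borel_measurable borel" for m'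
    unfolding cis_conv_exp by measurable
  have kb: "norm (?k (mm n) \<xi> \<eta> \<delta>) \<le> L * norm (fourier f \<xi>) * norm (fourier g \<eta>) * norm (fourier h \<delta>)" for n \<xi> \<eta> \<delta>
    by (simp add: norm_mult mult_right_mono bd)
  have hi: "integrable lborel (\<lambda>\<delta>. c * norm (fourier h \<delta>))" "integrable lborel (\<lambda>\<delta>. c * norm (fourier g \<delta>))" "integrable lborel (\<lambda>\<delta>. c * norm (fourier f \<delta>))" for c :: real
    using f g h by auto
  have m0: "(\<lambda>\<delta>. ?k m' \<xi> \<eta> \<delta>) \<in> borel_measurable lborel" if [measurable]: "m' \<in> borel_measurable borel" for m' \<xi> \<eta>
    unfolding cis_conv_exp by measurable
  have lim1: "(\<lambda>n. LINT \<delta>|lborel. ?k (mm n) \<xi> \<eta> \<delta>) \<longlonglongrightarrow> (LINT \<delta>|lborel. ?k m \<xi> \<eta> \<delta>)" for \<xi> \<eta>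
    by (rule integral_dominated_convergence[OF m0 m0 hi(1)[of "L * norm (fourier f \<xi>) * norm (fourier g \<eta>)"]])
      (intro AE_I2 tendsto_intros lim kb meas)+
  have bd1: "norm (LINT \<delta>|lborel. ?k (mm n) \<xi> \<eta> \<delta>) \<le> L * norm (fourier f \<xi>) * N (fourier h) * norm (fourier g \<eta>)" for n \<xi> \<eta>
  proof -
    have "norm (LINT \<delta>|lborel. ?k (mm n) \<xi> \<eta> \<delta>) \<le> (LINT \<delta>|lborel. L * norm (fourier f \<xi>) * norm (fourier g \<eta>) * norm (fourier h \<delta>))"
      by (rule Bochner_Integration.integral_norm_bound_integral[OF Bochner_Integration.integrable_bound[OF hi(1)[of "L * norm (fourier f \<xi>) * norm (fourier g \<eta>)"]] hi(1)])
        (use kb L0 in \<open>auto simp: abs_mult intro!: m0 meas\<close>)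
    then show ?thesis by (simp add: N_def mult_ac)
  qed
  have m1 [measurable]: "(\<lambda>(\<xi>, \<eta>). LINT \<delta>|lborel. ?k m' \<xi> \<eta> \<delta>) \<in> borel_measurable (lborel \<Otimes>\<^sub>M lborel)" if [measurable]: "m' \<in> borel_measurable borel" for m'
    unfolding cis_conv_exp by measurable
  have m1': "(\<lambda>\<eta>. LINT \<delta>|lborel. ?k m' \<xi> \<eta> \<delta>) \<in> borel_measurable lborel" if [measurable]: "m' \<in> borel_measurable borel" for m' \<xi>
    using m1[OF that] by measurable
  have lim2: "(\<lambda>n. LINT \<eta>|lborel. LINT \<delta>|lborel. ?k (mm n) \<xi> \<eta> \<delta>) \<longlonglongrightarrow> (LINT \<eta>|lborel. LINT \<delta>|lborel. ?k m \<xi> \<eta> \<delta>)" for \<xi>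
    by (rule integral_dominated_convergence[OF _ _ hi(2)[of "L * norm (fourier f \<xi>) * N (fourier h)"]])
      (auto intro!: AE_I2 lim1 bd1 m1' meas)
  have bd2: "norm (LINT \<eta>|lborel. LINT \<delta>|lborel. ?k (mm n) \<xi> \<eta> \<delta>) \<le> L * N (fourier h) * N (fourier g) * norm (fourier f \<xi>)" for n \<xi>
  proof -
    have "norm (LINT \<eta>|lborel. LINT \<delta>|lborel. ?k (mm n) \<xi> \<eta> \<delta>) \<le> (LINT \<eta>|lborel. L * norm (fourier f \<xi>) * N (fourier h) * norm (fourier g \<eta>))"
      by (rule Bochner_Integration.integral_norm_bound_integral[OF Bochner_Integration.integrable_bound[OF hi(2)[of "L * norm (fourier f \<xi>) * N (fourier h)"]] hi(2)])
        (use bd1 L0 N0 in \<open>auto simp: abs_mult intro!: m1' meas\<close>)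
    then show ?thesis by (simp add: N_def mult_ac)
  qed
  have m2: "(\<lambda>\<xi>. LINT \<eta>|lborel. LINT \<delta>|lborel. ?k m' \<xi> \<eta> \<delta>) \<in> borel_measurable lborel" if [measurable]: "m' \<in> borel_measurable borel" for m'
    using m1[OF that] by measurable
  show ?thesis unfolding trilinear_op_def
    by (rule integral_dominated_convergence[OF _ _ hi(3)[of "L * N (fourier h) * N (fourier g)"]])
      (auto intro!: AE_I2 lim2 bd2 m2 meas)
qed

section \<open>Lagrange interpolation\<close>

definition lagrange_poly :: "nat \<Rightarrow> nat \<Rightarrow> complex poly"
  where "lagrange_poly M j = (\<Prod>i\<in>{..<M} - {j}. smult (1 / (of_nat j / of_nat M - of_nat i / of_nat M)) [:- (of_nat i / of_nat M), 1:])"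

lemma degree_lagrange_poly: "j < M \<Longrightarrow> degree (lagrange_poly M j) < M"
proof -
  assume j: "j < M"
  have "degree (lagrange_poly M j) \<le> (\<Sum>i\<in>{..<M} - {j}. degree (smult (1 / (of_nat j / of_nat M - of_nat i / of_nat M)) [:- (of_nat i / of_nat M), 1 :: complex:]))"
    unfolding lagrange_poly_def by (rule degree_prod_sum_le[unfolded o_def]) simp
  also have "\<dots> \<le> (\<Sum>i\<in>{..<M} - {j}. 1)" by (intro sum_mono order_trans[OF degree_smult_le]) simp
  also have "\<dots> < M" using j by simp
  finally show ?thesis .
qed

lemma poly_lagrange_poly_node:
  assumes "i < M" "j < M"
  shows "poly (lagrange_poly M j) (of_nat i / of_nat M) = (if i = j then 1 else 0)"
proof (cases "i = j")
  case True
  have "poly (smult (1 / (of_nat j / of_nat M - of_nat x / of_nat M)) [:- (of_nat x / of_nat M), 1:]) (of_nat j / of_nat M) = (1 :: complex)"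
    if "x \<in> {..<M} - {j}" for x
  proof -
    have "(of_nat j / of_nat M - of_nat x / of_nat M :: complex) \<noteq> 0" using that by auto
    moreover have "poly (smult (1 / d) [:- t, 1:]) y = (y - t) / d" for d t y :: complex
      by (simp add: divide_inverse algebra_simps)
    ultimately show ?thesis by (simp only: divide_self not_False_eq_True)
  qed
  with True show ?thesis unfolding lagrange_poly_def poly_prod by (simp add: prod.neutral del: poly_smult)
next
  case False
  then have "i \<in> {..<M} - {j}" using assms by simp
  then show ?thesis using False unfolding lagrange_poly_def poly_prod
    by (auto intro!: prod_zero bexI[of _ i])
qed

text \<open>Both sides are polynomials of degree less than \<open>M\<close> in \<open>y\<close>, and they agree at the \<open>M\<close> nodes.\<close>
lemma lagrange_interpolation:
  assumes "degree P < M"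
  shows "(\<Sum>j<M. poly (lagrange_poly M j) y * poly P (of_nat j / of_nat M)) = poly P y"
proof -
  let ?R = "\<Sum>j<M. smult (poly P (of_nat j / of_nat M)) (lagrange_poly M j)"
  have M: "M > 0" using assms by simp
  have "?R = P"
  proof (rule poly_eqI_degree)
    let ?A = "(\<lambda>i. of_nat i / of_nat M :: complex) ` {..<M}"
    have inj: "inj_on (\<lambda>i. of_nat i / of_nat M :: complex) {..<M}" using M by (auto simp: inj_on_def)
    then have "card ?A = M" by (simp add: card_image)
    then show "card ?A > degree P" using assms by simp
    have "degree ?R \<le> M - 1"
    proof (intro degree_sum_le order_trans[OF degree_smult_le])
      fix j assume "j \<in> {..<M}"
      then show "degree (lagrange_poly M j) \<le> M - 1" using degree_lagrange_poly[of j M] by simp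
    qed simp
    then show "card ?A > degree ?R" using \<open>card ?A = M\<close> M by simp
    fix y assume "y \<in> ?A"
    then obtain i where i: "i < M" "y = of_nat i / of_nat M" by auto
    have "poly ?R y = (\<Sum>j<M. if j = i then poly P (of_nat j / of_nat M) else 0)"
      unfolding poly_sum using i poly_lagrange_poly_node[of i M] by (intro sum.cong) auto
    then show "poly ?R y = poly P y" using i by simp
  qed
  then have "poly ?R y = poly P y" by simp
  then show ?thesis by (simp add: poly_sum mult.commute)
qed

text \<open>Distinct nodes are at least \<open>1/M\<close> apart and every factor \<open>\<bar>y - i/M\<bar>\<close> is at most 2.\<close>
lemma norm_lagrange_poly_le:
  assumes j: "j < M" and y: "\<bar>y\<bar> \<le> 1"
  shows "norm (poly (lagrange_poly M j) (complex_of_real y)) \<le> (2 * real M) ^ M"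
proof -
  have M: "M > 0" using j by simp
  have f: "norm (poly (smult (1 / (of_nat j / of_nat M - of_nat i / of_nat M)) [:- (of_nat i / of_nat M), 1:]) (complex_of_real y)) \<le> 2 * real M"
    if i: "i \<in> {..<M} - {j}" for i
  proof -
    have "norm (complex_of_real y - of_nat i / of_nat M) \<le> \<bar>y\<bar> + real i / real M"
      using norm_triangle_ineq4[of "complex_of_real y" "of_nat i / of_nat M"] by (simp add: norm_divide)
    also have "\<dots> \<le> 2"
    proof -
      have "real i / real M \<le> 1" using i by simp
      with y show ?thesis by linarith
    qed
    finally have 1: "norm (complex_of_real y - of_nat i / of_nat M) \<le> 2" .
    have "(of_nat j / of_nat M - of_nat i / of_nat M :: complex) = complex_of_real ((real j - real i) / real M)"
      by (simp add: diff_divide_distrib)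
    moreover have "1 / real M \<le> \<bar>(real j - real i) / real M\<bar>"
    proof -
      have "1 \<le> \<bar>real j - real i\<bar>" using i by (auto simp: abs_if)
      then show ?thesis using M by (simp add: divide_right_mono)
    qed
    moreover have "1 / \<bar>z\<bar> \<le> real M" if "1 / real M \<le> \<bar>z\<bar>" for z :: real
    proof -
      have "0 < 1 / real M" using M by simp
      then have "\<bar>z\<bar> > 0" using that by linarith
      then show ?thesis using that M by (simp add: field_simps)
    qed
    ultimately have 2: "norm (1 / (of_nat j / of_nat M - of_nat i / of_nat M :: complex)) \<le> real M"
      by (simp only: norm_divide norm_of_real norm_one)
    have "norm (poly (smult (1 / (of_nat j / of_nat M - of_nat i / of_nat M)) [:- (of_nat i / of_nat M), 1:]) (complex_of_real y))
      = norm (1 / (of_nat j / of_nat M - of_nat i / of_nat M :: complex)) * norm (complex_of_real y - of_nat i / of_nat M)"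
    proof -
      have "poly (smult a [:- t, 1:]) w = a * (w - t)" for a t w :: complex by (simp add: algebra_simps)
      then show ?thesis by (simp only: norm_mult)
    qed
    also have "\<dots> \<le> real M * 2" by (intro mult_mono 1 2) auto
    finally show ?thesis by simp
  qed
  have "norm (poly (lagrange_poly M j) (complex_of_real y)) \<le> (\<Prod>i\<in>{..<M} - {j}. 2 * real M)"
    unfolding lagrange_poly_def poly_prod prod_norm[symmetric] using f by (intro prod_mono) auto
  also have "\<dots> = (2 * real M) ^ (M - 1)" using j by simp
  also have "\<dots> \<le> (2 * real M) ^ M" using M by (intro power_increasing) auto
  finally show ?thesis .
qed

section \<open>Interpolation on cubes\<close>

text \<open>The constant \<open>B\<close> comes without a factorial because the remainder is bounded by repeated use of the mean value
inequality: the antiderivative of the polynomial for \<open>G (Suc 0)\<close> is used for \<open>G 0\<close>.\<close>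
lemma taylor_polynomial_exists:
  fixes G :: "nat \<Rightarrow> real \<Rightarrow> complex"
  assumes "\<And>j t. j < M \<Longrightarrow> (G j has_vector_derivative G (Suc j) t) (at t)"
    and "\<And>t. norm (G M t) \<le> B" and r: "r \<ge> 0"
  shows "\<exists>a. \<forall>t. \<bar>t\<bar> \<le> r \<longrightarrow> norm (G 0 t - (\<Sum>k<M. a k * complex_of_real t ^ k)) \<le> B * r ^ M"
  using assms(1,2)
proof (induction M arbitrary: G)
  case 0
  then show ?case by simp
next
  case (Suc M)
  have "\<exists>a. \<forall>t. \<bar>t\<bar> \<le> r \<longrightarrow> norm (G (Suc 0) t - (\<Sum>k<M. a k * complex_of_real t ^ k)) \<le> B * r ^ M"
    using Suc.prems by (intro Suc.IH[of "\<lambda>j. G (Suc j)"]) auto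
  then obtain a where a: "\<And>t. \<bar>t\<bar> \<le> r \<Longrightarrow> norm (G (Suc 0) t - (\<Sum>k<M. a k * complex_of_real t ^ k)) \<le> B * r ^ M" by blast
  define a' where "a' = (\<lambda>k. case k of 0 \<Rightarrow> G 0 0 | Suc k \<Rightarrow> a k / of_nat (Suc k))"
  let ?D = "\<lambda>t. G 0 t - (\<Sum>k<Suc M. a' k * complex_of_real t ^ k)"
  have expand: "(\<Sum>k<Suc M. a' k * complex_of_real t ^ k) = G 0 0 + (\<Sum>k<M. a k / of_nat (Suc k) * complex_of_real t ^ Suc k)" for t
    by (subst sum.lessThan_Suc_shift) (simp add: a'_def)
  have der: "(?D has_vector_derivative (G (Suc 0) t - (\<Sum>k<M. a k * complex_of_real t ^ k))) (at t)" for t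
  proof -
    have "((\<lambda>t. a k / of_nat (Suc k) * complex_of_real t ^ Suc k) has_vector_derivative a k * complex_of_real t ^ k) (at t)" for k
    proof (rule has_vector_derivative_real_field)
      have "((\<lambda>z. a k / of_nat (Suc k) * z ^ Suc k) has_field_derivative a k / of_nat (Suc k) * (of_nat (Suc k) * complex_of_real t ^ k)) (at (complex_of_real t))"
        by (rule derivative_eq_intros refl | simp)+
      moreover have "a k / of_nat (Suc k) * (of_nat (Suc k) * complex_of_real t ^ k) = a k * complex_of_real t ^ k"
        by (simp del: of_nat_Suc)
      ultimately show "((\<lambda>z. a k / of_nat (Suc k) * z ^ Suc k) has_field_derivative a k * complex_of_real t ^ k) (at (complex_of_real t))"
        by simp
    qed
    then have "((\<lambda>t. G 0 t - (G 0 0 + (\<Sum>k<M. a k / of_nat (Suc k) * complex_of_real t ^ Suc k))) has_vector_derivative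
       G (Suc 0) t - (0 + (\<Sum>k<M. a k * complex_of_real t ^ k))) (at t)"
      by (intro has_vector_derivative_diff has_vector_derivative_add has_vector_derivative_sum has_vector_derivative_const Suc.prems) auto
    then show ?thesis unfolding expand by simp
  qed
  have "norm (?D t) \<le> B * r ^ Suc M" if t: "\<bar>t\<bar> \<le> r" for t
  proof -
    have B0: "B * r ^ M \<ge> 0" using order_trans[OF norm_ge_zero a[of 0]] r by simp
    have "norm (?D t - ?D 0) \<le> B * r ^ M * norm (t - 0)"
    proof (rule differentiable_bound[where S="{-r..r}" and f'="\<lambda>x h. h *\<^sub>R (G (Suc 0) x - (\<Sum>k<M. a k * complex_of_real x ^ k))"])
      show "(?D has_derivative (\<lambda>h. h *\<^sub>R (G (Suc 0) x - (\<Sum>k<M. a k * complex_of_real x ^ k)))) (at x within {-r..r})" for x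
        using der[of x] unfolding has_vector_derivative_def by (rule has_derivative_at_withinI)
      show "onorm (\<lambda>h. h *\<^sub>R (G (Suc 0) x - (\<Sum>k<M. a k * complex_of_real x ^ k))) \<le> B * r ^ M" if "x \<in> {-r..r}" for x
      proof (rule onorm_le)
        fix h :: real
        have "norm (G (Suc 0) x - (\<Sum>k<M. a k * complex_of_real x ^ k)) \<le> B * r ^ M" using that by (intro a) auto
        then show "norm (h *\<^sub>R (G (Suc 0) x - (\<Sum>k<M. a k * complex_of_real x ^ k))) \<le> B * r ^ M * norm h"
          by (simp add: mult.commute mult_left_mono)
      qed
    qed (use t r in auto)
    moreover have "?D 0 = 0" unfolding expand by simp
    moreover have "B * r ^ M * norm (t - 0) \<le> B * r ^ M * r" using t B0 by (intro mult_left_mono) auto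
    ultimately show ?thesis by (simp add: mult_ac)
  qed
  then show ?case by (intro exI[of _ a']) blast
qed

text \<open>Approximation by polynomials is required only along lines parallel to the axes, with an arbitrary polynomial for
each line. This is all that tensor product interpolation needs, it follows from the pure derivatives of order
\<open>M\<close>, and it holds with \<open>\<epsilon> = 0\<close> for functions that are polynomial of degree less than \<open>M\<close> in each variable.\<close>
definition line_approx :: "nat \<Rightarrow> 'a::euclidean_space set \<Rightarrow> real \<Rightarrow> ('a \<Rightarrow> complex) \<Rightarrow> bool"
  where "line_approx M C \<epsilon> u \<longleftrightarrow> (\<forall>x\<in>C. \<forall>b\<in>Basis. \<exists>P. degree P < M \<and>
     (\<forall>t. x + t *\<^sub>R b \<in> C \<longrightarrow> norm (u (x + t *\<^sub>R b) - poly P (complex_of_real t)) \<le> \<epsilon>))"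

text \<open>Half-open, so that the cubes with corners in a lattice partition the space.\<close>
definition cube :: "'a::euclidean_space \<Rightarrow> real \<Rightarrow> 'a set"
  where "cube k r = {x. \<forall>b\<in>Basis. k \<bullet> b \<le> x \<bullet> b \<and> x \<bullet> b < k \<bullet> b + r}"

lemma line_approx_Ck:
  fixes m :: "'a::euclidean_space \<Rightarrow> complex"
  assumes M: "M > 0" and m: "Ck M m" and bd: "\<And>b x. b \<in> Basis \<Longrightarrow> norm (iter_deriv (replicate M b) m x) \<le> B"
    and r: "r > 0"
  shows "line_approx M (cube k r) (B * r ^ M) m"
  unfolding line_approx_def
proof (intro ballI)
  fix x b :: 'a assume x: "x \<in> cube k r" and b: "b \<in> Basis"
  let ?G = "\<lambda>j t. iter_deriv (replicate j b) m (x + t *\<^sub>R b)"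
  have "\<exists>a. \<forall>t. \<bar>t\<bar> \<le> r \<longrightarrow> norm (?G 0 t - (\<Sum>k<M. a k * complex_of_real t ^ k)) \<le> B * r ^ M"
  proof (rule taylor_polynomial_exists)
    fix j t assume "j < M"
    then show "(?G j has_vector_derivative ?G (Suc j) t) (at t)"
      using Ck_line_derivative[OF m, of "replicate j b" b x t] b by (simp add: set_replicate_conv_if)
  qed (use bd b r in auto)
  then obtain a where a: "\<And>t. \<bar>t\<bar> \<le> r \<Longrightarrow> norm (m (x + t *\<^sub>R b) - (\<Sum>k<M. a k * complex_of_real t ^ k)) \<le> B * r ^ M" by auto
  show "\<exists>P. degree P < M \<and> (\<forall>t. x + t *\<^sub>R b \<in> cube k r \<longrightarrow> norm (m (x + t *\<^sub>R b) - poly P (complex_of_real t)) \<le> B * r ^ M)"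
  proof (intro exI[of _ "\<Sum>k<M. monom (a k) k"] conjI allI impI)
    have "degree (\<Sum>k<M. monom (a k) k) \<le> M - 1"
      using M by (intro degree_sum_le order_trans[OF degree_monom_le]) auto
    then show "degree (\<Sum>k<M. monom (a k) k) < M" using M by simp
    fix t assume t: "x + t *\<^sub>R b \<in> cube k r"
    then have "k \<bullet> b \<le> x \<bullet> b + t" "x \<bullet> b + t < k \<bullet> b + r" "k \<bullet> b \<le> x \<bullet> b" "x \<bullet> b < k \<bullet> b + r"
      using x b by (auto simp: cube_def inner_add_left)
    then have "\<bar>t\<bar> \<le> r" by auto
    from a[OF this] show "norm (m (x + t *\<^sub>R b) - poly (\<Sum>k<M. monom (a k) k) (complex_of_real t)) \<le> B * r ^ M"
      by (simp add: poly_sum poly_monom)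
  qed
qed

text \<open>The nodes form a grid of \<open>M\<close> points in each direction, starting at \<open>c\<close> and with spacing \<open>r/M\<close>. If in every coordinate \<open>c\<close> lies
between the corner of a cube of side \<open>r\<close> and that corner plus \<open>r/M\<close>, all the nodes lie in that cube; this
leaves room to choose \<open>c\<close>.\<close>
definition node :: "nat \<Rightarrow> real \<Rightarrow> 'a::euclidean_space \<Rightarrow> ('a \<Rightarrow> nat) \<Rightarrow> 'a"
  where "node M r c \<alpha> = (\<Sum>b\<in>Basis. (c \<bullet> b + r * real (\<alpha> b) / real M) *\<^sub>R b)"

definition bump :: "nat \<Rightarrow> real \<Rightarrow> ('a::euclidean_space \<Rightarrow> nat) \<Rightarrow> 'a \<Rightarrow> complex"
  where "bump M r \<alpha> y = (\<Prod>b\<in>Basis. poly (lagrange_poly M (\<alpha> b)) (complex_of_real ((y \<bullet> b) / r)))"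

definition interp :: "nat \<Rightarrow> real \<Rightarrow> 'a::euclidean_space \<Rightarrow> ('a \<Rightarrow> complex) \<Rightarrow> 'a \<Rightarrow> complex"
  where "interp M r c u x = (\<Sum>\<alpha>\<in>Basis \<rightarrow>\<^sub>E {..<M}. u (node M r c \<alpha>) * bump M r \<alpha> (x - c))"

abbreviation interp_const :: "nat \<Rightarrow> real" where "interp_const M \<equiv> 1 + real M * (2 * real M) ^ M"

text \<open>Interpolate in one coordinate after the other. In one coordinate, subtracting a polynomial that the interpolation
reproduces shows that the error is at most \<open>interp_const M * \<epsilon>\<close>; each further coordinate multiplies the accumulated
error by at most \<open>interp_const M\<close>. With \<open>\<epsilon> = 0\<close> the lemma says that interpolation reproduces functions that are
polynomial in each variable.\<close>
lemma interp_error: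
  fixes u :: "'a::euclidean_space \<Rightarrow> complex"
  assumes M: "M > 0" and r: "r > 0" and u: "line_approx M (cube k r) \<epsilon> u" and e: "\<epsilon> \<ge> 0"
    and c: "\<And>b. b \<in> Basis \<Longrightarrow> k \<bullet> b \<le> c \<bullet> b \<and> c \<bullet> b < k \<bullet> b + r / real M" and x: "x \<in> cube k r"
  shows "norm (u x - interp M r c u x) \<le> \<epsilon> * (real DIM('a) * interp_const M ^ DIM('a))"
proof -
  let ?L = "(2 * real M) ^ M"
  let ?l = "\<lambda>b j x. poly (lagrange_poly M j) (complex_of_real (((x - c) \<bullet> b) / r))"
  let ?mv = "\<lambda>b j x::'a. x + (c \<bullet> b + r * real j / real M - x \<bullet> b) *\<^sub>R b"
  have lb: "norm (?l b j x) \<le> ?L" if "x \<in> cube k r" "b \<in> Basis" "j < M" for b j x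
  proof (rule norm_lagrange_poly_le[OF that(3)])
    have "r / real M \<le> r" using M r by (simp add: divide_le_eq)
    then have "\<bar>(x - c) \<bullet> b\<bar> \<le> r" using that(1,2) c[OF that(2)] by (auto simp: cube_def inner_diff_left abs_le_iff)
    then show "\<bar>(x - c) \<bullet> b / r\<bar> \<le> 1" using r by (simp add: abs_divide)
  qed
  have mv: "x + (c \<bullet> b + r * real j / real M - x \<bullet> b) *\<^sub>R b \<in> cube k r" if "x \<in> cube k r" "b \<in> Basis" "j < M" for b j x
  proof -
    have 1: "r * real j / real M \<ge> 0" using r by simp
    have 2: "r / real M + r * real j / real M \<le> r"
    proof -
      have "r / real M + r * real j / real M = r * (real (Suc j) / real M)" by (simp add: add_divide_distrib distrib_left)
      also have "\<dots> \<le> r * 1" using r that(3) by (intro mult_left_mono) auto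
      finally show ?thesis by simp
    qed
    have "?mv b j x \<bullet> b' = (if b' = b then c \<bullet> b + r * real j / real M else x \<bullet> b')" if "b' \<in> Basis" for b'
      using that \<open>b \<in> Basis\<close> by (simp add: inner_add_left inner_Basis)
    then show ?thesis using that(1) c[OF that(2)] 1 2 by (auto simp: cube_def)
  qed
  have step: "norm (u x - (\<Sum>j<M. ?l b j x * u (?mv b j x))) \<le> interp_const M * \<epsilon>" if x: "x \<in> cube k r" and b: "b \<in> Basis" for x b
  proof -
    obtain P where P: "degree P < M" "\<And>t. x + t *\<^sub>R b \<in> cube k r \<Longrightarrow> norm (u (x + t *\<^sub>R b) - poly P (complex_of_real t)) \<le> \<epsilon>"
      using u x b unfolding line_approx_def by meson
    let ?R = "pcompose P [:complex_of_real (c \<bullet> b - x \<bullet> b), complex_of_real r:]"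
    have "degree ?R < M" using P(1) degree_pcompose_le[of P "[:complex_of_real (c \<bullet> b - x \<bullet> b), complex_of_real r:]"]
      by (simp split: if_splits)
    from lagrange_interpolation[OF this, of "complex_of_real ((x - c) \<bullet> b / r)"]
    have "(\<Sum>j<M. ?l b j x * poly ?R (of_nat j / of_nat M)) = poly ?R (complex_of_real ((x - c) \<bullet> b / r))" .
    moreover have "poly ?R (complex_of_real ((x - c) \<bullet> b / r)) = poly P 0"
      using r by (simp add: poly_pcompose inner_diff_left)
    moreover have "poly ?R (of_nat j / of_nat M) = poly P (complex_of_real (c \<bullet> b + r * real j / real M - x \<bullet> b))" for j
      by (simp add: poly_pcompose algebra_simps)
    ultimately have rep: "poly P 0 = (\<Sum>j<M. ?l b j x * poly P (complex_of_real (c \<bullet> b + r * real j / real M - x \<bullet> b)))" by simp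
    have dec: "u x - (\<Sum>j<M. ?l b j x * u (?mv b j x)) = (u x - poly P 0) - (\<Sum>j<M. ?l b j x * (u (?mv b j x) - poly P (complex_of_real (c \<bullet> b + r * real j / real M - x \<bullet> b))))"
      by (simp add: rep right_diff_distrib sum_subtractf)
    have "norm (u x - (\<Sum>j<M. ?l b j x * u (?mv b j x))) \<le> norm (u x - poly P 0) + norm (\<Sum>j<M. ?l b j x * (u (?mv b j x) - poly P (complex_of_real (c \<bullet> b + r * real j / real M - x \<bullet> b))))"
      unfolding dec by (rule norm_triangle_ineq4)
    also have "\<dots> \<le> \<epsilon> + (\<Sum>j<M. ?L * \<epsilon>)"
    proof (rule add_mono)
      have "norm (u (x + 0 *\<^sub>R b) - poly P (complex_of_real 0)) \<le> \<epsilon>" by (rule P(2)) (simp only: scaleR_zero_left add_0_right x)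
      then show "norm (u x - poly P 0) \<le> \<epsilon>" by (simp only: scaleR_zero_left add_0_right of_real_0)
    next
      show "norm (\<Sum>j<M. ?l b j x * (u (?mv b j x) - poly P (complex_of_real (c \<bullet> b + r * real j / real M - x \<bullet> b)))) \<le> (\<Sum>j<M. ?L * \<epsilon>)"
      proof (intro sum_norm_le)
        fix j assume "j \<in> {..<M}"
        then have j: "j < M" by simp
        show "norm (?l b j x * (u (?mv b j x) - poly P (complex_of_real (c \<bullet> b + r * real j / real M - x \<bullet> b)))) \<le> ?L * \<epsilon>"
          unfolding norm_mult by (intro mult_mono lb[OF x b j] P(2)[OF mv[OF x b j]]) auto
      qed
    qed
    also have "\<dots> = interp_const M * \<epsilon>" by (simp add: algebra_simps)
    finally show ?thesis .
  qed
  (* the interpolant in the coordinates of S only, the remaining coordinates of x being left alone *)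
  define I where "I = (\<lambda>S x. \<Sum>\<alpha>\<in>S \<rightarrow>\<^sub>E {..<M}. (\<Prod>b\<in>S. ?l b (\<alpha> b) x) * u (x + (\<Sum>b\<in>S. (c \<bullet> b + r * real (\<alpha> b) / real M - x \<bullet> b) *\<^sub>R b)))"
  have I_insert: "I (insert b S) x = (\<Sum>j<M. ?l b j x * I S (?mv b j x))"
    if S: "finite S" "S \<subseteq> Basis" "b \<in> Basis" "b \<notin> S" for S b x
  proof -
    have inj: "inj_on (\<lambda>(y, g). g(b := y)) ({..<M} \<times> (S \<rightarrow>\<^sub>E {..<M}))"
      using inj_combinator[OF S(4), of "\<lambda>_. {..<M}"] by simp
    have other: "?mv b j x \<bullet> b' = x \<bullet> b'" if "b' \<in> S" for b' j
    proof -
      have "b \<bullet> b' = 0" using that S by (auto simp: inner_Basis)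
      then show ?thesis by (simp add: inner_add_left)
    qed
    have "I (insert b S) x = (\<Sum>(j, \<alpha>)\<in>{..<M} \<times> (S \<rightarrow>\<^sub>E {..<M}). (\<Prod>b'\<in>insert b S. ?l b' ((\<alpha>(b := j)) b') x) *
       u (x + (\<Sum>b'\<in>insert b S. (c \<bullet> b' + r * real ((\<alpha>(b := j)) b') / real M - x \<bullet> b') *\<^sub>R b')))"
      unfolding I_def PiE_insert_eq by (subst sum.reindex[OF inj]) (simp add: case_prod_beta)
    also have "\<dots> = (\<Sum>(j, \<alpha>)\<in>{..<M} \<times> (S \<rightarrow>\<^sub>E {..<M}). ?l b j x * ((\<Prod>b'\<in>S. ?l b' (\<alpha> b') (?mv b j x)) *
       u (?mv b j x + (\<Sum>b'\<in>S. (c \<bullet> b' + r * real (\<alpha> b') / real M - ?mv b j x \<bullet> b') *\<^sub>R b'))))"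
    proof (intro sum.cong refl, clarify)
      fix j \<alpha>
      have 1: "(\<Prod>b'\<in>S. ?l b' ((\<alpha>(b := j)) b') x) = (\<Prod>b'\<in>S. ?l b' (\<alpha> b') (?mv b j x))"
        using S(4) other by (intro prod.cong refl) (auto simp: inner_diff_left)
      have 2: "(\<Sum>b'\<in>S. (c \<bullet> b' + r * real ((\<alpha>(b := j)) b') / real M - x \<bullet> b') *\<^sub>R b') = (\<Sum>b'\<in>S. (c \<bullet> b' + r * real (\<alpha> b') / real M - ?mv b j x \<bullet> b') *\<^sub>R b')"
        using S(4) other by (intro sum.cong refl) auto
      show "(\<Prod>b'\<in>insert b S. ?l b' ((\<alpha>(b := j)) b') x) *
       u (x + (\<Sum>b'\<in>insert b S. (c \<bullet> b' + r * real ((\<alpha>(b := j)) b') / real M - x \<bullet> b') *\<^sub>R b')) =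
       ?l b j x * ((\<Prod>b'\<in>S. ?l b' (\<alpha> b') (?mv b j x)) *
       u (?mv b j x + (\<Sum>b'\<in>S. (c \<bullet> b' + r * real (\<alpha> b') / real M - ?mv b j x \<bullet> b') *\<^sub>R b')))"
        unfolding prod.insert[OF S(1,4)] sum.insert[OF S(1,4)] 1 2 by (simp add: add.assoc mult.assoc)
    qed
    also have "\<dots> = (\<Sum>j<M. ?l b j x * I S (?mv b j x))"
      unfolding I_def by (simp add: sum.cartesian_product[symmetric] sum_distrib_left)
    finally show ?thesis .
  qed
  have K1: "interp_const M \<ge> 1" by simp
  have main: "\<forall>x\<in>cube k r. norm (u x - I S x) \<le> \<epsilon> * (real (card S) * interp_const M ^ card S)"
    if "finite S" "S \<subseteq> Basis" for S
    using that
  proof (induction S rule: finite_induct)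
    case empty
    then show ?case by (simp add: I_def)
  next
    case (insert b S)
    show ?case
    proof
      fix x assume x: "x \<in> cube k r"
      let ?n = "card S" and ?K = "interp_const M"
      have dec: "u x - I (insert b S) x = (u x - (\<Sum>j<M. ?l b j x * u (?mv b j x))) + (\<Sum>j<M. ?l b j x * (u (?mv b j x) - I S (?mv b j x)))"
        using insert by (simp add: I_insert right_diff_distrib sum_subtractf)
      have "norm (u x - I (insert b S) x) \<le> ?K * \<epsilon> + (\<Sum>j<M. ?L * (\<epsilon> * (real ?n * ?K ^ ?n)))"
        unfolding dec
      proof (intro order_trans[OF norm_triangle_ineq] add_mono step x)
        show "b \<in> Basis" using insert by simp
        show "norm (\<Sum>j<M. ?l b j x * (u (?mv b j x) - I S (?mv b j x))) \<le> (\<Sum>j<M. ?L * (\<epsilon> * (real ?n * ?K ^ ?n)))"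
        proof (intro sum_norm_le)
          fix j assume "j \<in> {..<M}"
          then have j: "j < M" by simp
          have b: "b \<in> Basis" and IH: "norm (u (?mv b j x) - I S (?mv b j x)) \<le> \<epsilon> * (real ?n * ?K ^ ?n)"
            using insert mv[OF x _ j, of b] by auto
          show "norm (?l b j x * (u (?mv b j x) - I S (?mv b j x))) \<le> ?L * (\<epsilon> * (real ?n * ?K ^ ?n))"
            unfolding norm_mult by (intro mult_mono lb[OF x b j] IH) auto
        qed
      qed
      also have "\<dots> \<le> ?K * \<epsilon> + ?K * (\<epsilon> * (real ?n * ?K ^ ?n))"
        using e by (simp add: mult.assoc[symmetric] mult_right_mono)
      finally have le: "norm (u x - I (insert b S) x) \<le> ?K * \<epsilon> + ?K * (\<epsilon> * (real ?n * ?K ^ ?n))" .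
      have "?K ^ 1 \<le> ?K ^ Suc ?n" using K1 by (intro power_increasing) auto
      then have "\<epsilon> * ?K ^ 1 \<le> \<epsilon> * ?K ^ Suc ?n" using e by (rule mult_left_mono)
      with le have "norm (u x - I (insert b S) x) \<le> \<epsilon> * ?K ^ Suc ?n + ?K * (\<epsilon> * (real ?n * ?K ^ ?n))"
        by (simp add: mult.commute)
      also have "\<dots> = \<epsilon> * (real (Suc ?n) * ?K ^ Suc ?n)" by (simp add: algebra_simps)
      finally show "norm (u x - I (insert b S) x) \<le> \<epsilon> * (real (card (insert b S)) * ?K ^ card (insert b S))"
        using insert by simp
    qed
  qed
  have "interp M r c u x = I Basis x"
  proof -
    have "x + (\<Sum>b\<in>Basis. (c \<bullet> b + r * real (\<alpha> b) / real M - x \<bullet> b) *\<^sub>R b) = node M r c \<alpha>" for \<alpha>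
      by (simp add: node_def scaleR_left_diff_distrib sum_subtractf euclidean_representation)
    then show ?thesis by (simp add: interp_def I_def bump_def mult.commute)
  qed
  then show ?thesis using main[OF finite_Basis subset_refl] x by simp
qed

text \<open>Along a line parallel to an axis all Lagrange factors but one are constant.\<close>
lemma line_approx_interp:
  fixes u :: "'a::euclidean_space \<Rightarrow> complex"
  assumes M: "M > 0" 
  shows "line_approx M C 0 (interp M r c u)"
  unfolding line_approx_def
proof (intro ballI)
  fix x b :: 'a assume b: "b \<in> Basis"
  let ?q = "[:complex_of_real ((x - c) \<bullet> b / r), complex_of_real (1 / r):]"
  let ?d = "\<lambda>\<alpha>. u (node M r c \<alpha>) * (\<Prod>b'\<in>Basis - {b}. poly (lagrange_poly M (\<alpha> b')) (complex_of_real (((x - c) \<bullet> b') / r)))"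
  let ?P = "\<Sum>\<alpha>\<in>Basis \<rightarrow>\<^sub>E {..<M}. smult (?d \<alpha>) (pcompose (lagrange_poly M (\<alpha> b)) ?q)"
  have deg: "degree ?P \<le> M - 1"
  proof (intro degree_sum_le)
    show "finite ((Basis::'a set) \<rightarrow>\<^sub>E {..<M})" by (intro finite_PiE) auto
    fix \<alpha> assume "\<alpha> \<in> (Basis::'a set) \<rightarrow>\<^sub>E {..<M}"
    then have "\<alpha> b < M" using b by auto
    then have 1: "degree (lagrange_poly M (\<alpha> b)) \<le> M - 1" using degree_lagrange_poly[of "\<alpha> b" M] by simp
    have "degree (smult (?d \<alpha>) (pcompose (lagrange_poly M (\<alpha> b)) ?q)) \<le> degree (pcompose (lagrange_poly M (\<alpha> b)) ?q)"
      by (rule degree_smult_le)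
    also have "\<dots> \<le> degree (lagrange_poly M (\<alpha> b)) * degree ?q" by (rule degree_pcompose_le)
    also have "\<dots> \<le> degree (lagrange_poly M (\<alpha> b)) * 1" by (intro mult_left_mono) auto
    finally show "degree (smult (?d \<alpha>) (pcompose (lagrange_poly M (\<alpha> b)) ?q)) \<le> M - 1" using 1 by simp
  qed
  have "interp M r c u (x + t *\<^sub>R b) = poly ?P (complex_of_real t)" for t
  proof -
    have "bump M r \<alpha> (x + t *\<^sub>R b - c) = poly (lagrange_poly M (\<alpha> b)) (poly ?q (complex_of_real t)) * (\<Prod>b'\<in>Basis - {b}. poly (lagrange_poly M (\<alpha> b')) (complex_of_real (((x - c) \<bullet> b') / r)))" for \<alpha>
    proof -
      have 1: "poly ?q (complex_of_real t) = complex_of_real (((x + t *\<^sub>R b - c) \<bullet> b) / r)"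
        using b by (simp add: inner_diff_left inner_add_left add_divide_distrib diff_divide_distrib)
      have 2: "(x + t *\<^sub>R b - c) \<bullet> b' = (x - c) \<bullet> b'" if "b' \<in> Basis - {b}" for b'
        using that b by (auto simp: inner_diff_left inner_add_left inner_Basis)
      show ?thesis unfolding bump_def 1 using b 2 by (subst prod.remove[of _ b]) (auto intro!: prod.cong)
    qed
    then show ?thesis unfolding interp_def poly_sum by (simp add: poly_pcompose mult_ac)
  qed
  then show "\<exists>P. degree P < M \<and> (\<forall>t. x + t *\<^sub>R b \<in> C \<longrightarrow> norm (interp M r c u (x + t *\<^sub>R b) - poly P (complex_of_real t)) \<le> 0)"
    using deg M by (intro exI[of _ ?P]) auto
qed

section \<open>Dyadic cubes and sampling points\<close>

text \<open>The lower corner of the cube of the lattice of mesh \<open>r\<close> that contains \<open>x\<close>. Cubes of the lattice are represented by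
their corners, that is, by the fixed points of \<open>corner r\<close>.\<close>
definition corner :: "real \<Rightarrow> 'a::euclidean_space \<Rightarrow> 'a"
  where "corner r x = (\<Sum>b\<in>Basis. (r * of_int \<lfloor>(x \<bullet> b) / r\<rfloor>) *\<^sub>R b)"

lemma corner_inner: "b \<in> Basis \<Longrightarrow> corner r x \<bullet> b = r * of_int \<lfloor>(x \<bullet> b) / r\<rfloor>"
  by (simp add: corner_def)

lemma corner_measurable [measurable]: "corner r \<in> borel_measurable borel"
  unfolding corner_def by measurable

lemma mem_cube_corner: "r > 0 \<Longrightarrow> x \<in> cube (corner r x) r"
proof -
  assume r: "r > 0"
  have "r * of_int \<lfloor>y / r\<rfloor> \<le> y \<and> y < r * of_int \<lfloor>y / r\<rfloor> + r" for y :: real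
  proof -
    have "r * of_int \<lfloor>y / r\<rfloor> \<le> r * (y / r)" using r by (intro mult_left_mono) auto
    moreover have "r * (y / r) < r * (of_int \<lfloor>y / r\<rfloor> + 1)" using r by (intro mult_strict_left_mono) linarith+
    ultimately show ?thesis using r by (simp add: distrib_left)
  qed
  then show ?thesis by (auto simp: cube_def corner_inner)
qed

lemma corner_eqI:
  assumes r: "r > 0" and k: "corner r k = k" and x: "x \<in> cube k r"
  shows "corner r x = k"
proof (rule euclidean_eqI)
  fix b :: 'a assume b: "b \<in> Basis"
  have kb: "k \<bullet> b = r * of_int \<lfloor>(k \<bullet> b) / r\<rfloor>" using corner_inner[OF b, of r k] k by simp
  have "k \<bullet> b \<le> x \<bullet> b" "x \<bullet> b < k \<bullet> b + r" using x b by (auto simp: cube_def)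
  then have "of_int \<lfloor>(k \<bullet> b) / r\<rfloor> \<le> (x \<bullet> b) / r" "(x \<bullet> b) / r < of_int \<lfloor>(k \<bullet> b) / r\<rfloor> + 1"
    using kb r by (simp_all add: field_simps)
  then have "\<lfloor>(x \<bullet> b) / r\<rfloor> = \<lfloor>(k \<bullet> b) / r\<rfloor>" by (simp add: floor_eq_iff)
  then show "corner r x \<bullet> b = k \<bullet> b" using kb by (simp add: corner_inner b)
qed

lemma corner_corner: "r > 0 \<Longrightarrow> corner r (corner r x) = corner r x"
  by (rule euclidean_eqI) (simp add: corner_inner)

lemma corner_double_corner:
  assumes r: "r > 0" shows "corner (2 * r) (corner r x) = corner (2 * r) x"
proof (rule euclidean_eqI)
  fix b :: 'a assume b: "b \<in> Basis"
  let ?y = "(x \<bullet> b) / r"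
  have h: "\<lfloor>a / 2\<rfloor> = \<lfloor>a\<rfloor> div 2" for a :: real using floor_divide_real_eq_div[of 2 a] by simp
  have "\<lfloor>(corner r x \<bullet> b) / (2 * r)\<rfloor> = \<lfloor>real_of_int \<lfloor>?y\<rfloor> / 2\<rfloor>" using r b by (simp add: corner_inner)
  also have "\<dots> = \<lfloor>?y / 2\<rfloor>" unfolding h by simp
  also have "?y / 2 = (x \<bullet> b) / (2 * r)" by simp
  finally show "corner (2 * r) (corner r x) \<bullet> b = corner (2 * r) x \<bullet> b" using b by (simp add: corner_inner)
qed

lemma cube_child_subset:
  assumes r: "r > 0" and k: "corner r k = k"
  shows "cube k r \<subseteq> cube (corner (2 * r) k) (2 * r)"
proof
  fix x assume "x \<in> cube k r"
  then have "corner (2 * r) x = corner (2 * r) k" using corner_eqI[OF r k] corner_double_corner[OF r] by metis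
  then show "x \<in> cube (corner (2 * r) k) (2 * r)" using mem_cube_corner[of "2 * r" x] r by simp
qed

definition box_set :: "nat \<Rightarrow> 'a::euclidean_space set"
  where "box_set K = {x. \<forall>b\<in>Basis. - real K \<le> x \<bullet> b \<and> x \<bullet> b < real K}"

definition lattice_box :: "real \<Rightarrow> nat \<Rightarrow> 'a::euclidean_space set"
  where "lattice_box r K = {k. corner r k = k} \<inter> box_set K"

lemma finite_lattice_box:
  assumes r: "r > 0" shows "finite (lattice_box r K :: 'a::euclidean_space set)"
proof -
  let ?Z = "{\<lfloor>- real K / r\<rfloor>..\<lfloor>real K / r\<rfloor>}"
  have "lattice_box r K \<subseteq> (\<lambda>i. \<Sum>b\<in>(Basis::'a set). (r * of_int (i b)) *\<^sub>R b) ` (Basis \<rightarrow>\<^sub>E ?Z)"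
  proof
    fix k :: 'a assume k: "k \<in> lattice_box r K"
    let ?i = "restrict (\<lambda>b. \<lfloor>(k \<bullet> b) / r\<rfloor>) Basis"
    have "k = (\<Sum>b\<in>Basis. (r * of_int (?i b)) *\<^sub>R b)"
      using k by (simp add: lattice_box_def corner_def)
    moreover have "?i \<in> Basis \<rightarrow>\<^sub>E ?Z"
    proof (rule restrict_PiE_iff[THEN iffD2], intro ballI)
      fix b :: 'a assume "b \<in> Basis"
      then have "- real K \<le> k \<bullet> b" "k \<bullet> b \<le> real K" using k by (auto simp: lattice_box_def box_set_def less_imp_le)
      then have "- real K / r \<le> (k \<bullet> b) / r" "(k \<bullet> b) / r \<le> real K / r" using r by (simp_all only: divide_right_mono less_imp_le)
      then show "\<lfloor>(k \<bullet> b) / r\<rfloor> \<in> ?Z" by (simp only: atLeastAtMost_iff floor_mono conj_absorb simp_thms)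
    qed
    ultimately show "k \<in> (\<lambda>i. \<Sum>b\<in>Basis. (r * of_int (i b)) *\<^sub>R b) ` (Basis \<rightarrow>\<^sub>E ?Z)" by blast
  qed
  moreover have "finite ((Basis::'a set) \<rightarrow>\<^sub>E ?Z)" by (intro finite_PiE) auto
  ultimately show ?thesis using finite_surj by blast
qed

text \<open>The bounds of the box are integers and hence multiples of the mesh, so no dyadic cube of side at most 1 crosses its boundary.\<close>
lemma corner_box_set_iff:
  "corner (1 / 2 ^ l) x \<in> box_set K \<longleftrightarrow> x \<in> box_set K"
proof -
  have "- real K \<le> 1 / 2 ^ l * of_int \<lfloor>y / (1 / 2 ^ l)\<rfloor> \<longleftrightarrow> - real K \<le> y" for y :: real
  proof -
    have "- real K \<le> 1 / 2 ^ l * of_int \<lfloor>y / (1 / 2 ^ l)\<rfloor> \<longleftrightarrow> real_of_int (- int K * 2 ^ l) \<le> of_int \<lfloor>y * 2 ^ l\<rfloor>"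
      by (simp add: field_simps)
    also have "\<dots> \<longleftrightarrow> - int K * 2 ^ l \<le> \<lfloor>y * 2 ^ l\<rfloor>" by (simp only: of_int_le_iff)
    also have "\<dots> \<longleftrightarrow> - real K \<le> y" 
    proof -
      have "real_of_int (- int K * 2 ^ l) = - real K * 2 ^ l" by simp
      then show ?thesis unfolding le_floor_iff by (simp only:) (rule mult_le_cancel_right_pos, simp)
    qed
    finally show ?thesis .
  qed
  moreover have "1 / 2 ^ l * of_int \<lfloor>y / (1 / 2 ^ l)\<rfloor> < real K \<longleftrightarrow> y < real K" for y :: real
  proof -
    have "1 / 2 ^ l * of_int \<lfloor>y / (1 / 2 ^ l)\<rfloor> < real K \<longleftrightarrow> of_int \<lfloor>y * 2 ^ l\<rfloor> < real_of_int (int K * 2 ^ l)"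
      by (simp add: field_simps)
    also have "\<dots> \<longleftrightarrow> \<lfloor>y * 2 ^ l\<rfloor> < int K * 2 ^ l" by (simp only: of_int_less_iff)
    also have "\<dots> \<longleftrightarrow> y < real K" 
    proof -
      have "real_of_int (int K * 2 ^ l) = real K * 2 ^ l" by simp
      then show ?thesis unfolding floor_less_iff by (simp only:) (rule mult_less_cancel_right_pos, simp)
    qed
    finally show ?thesis .
  qed
  ultimately show ?thesis by (auto simp: box_set_def corner_inner)
qed

lemma corner_mem_lattice_box: "x \<in> box_set K \<Longrightarrow> corner (1 / 2 ^ l) x \<in> lattice_box (1 / 2 ^ l) K"
  by (simp add: lattice_box_def corner_box_set_iff corner_corner)

lemma emeasure_cube:
  fixes k :: "'a::euclidean_space"
  assumes r: "r > 0" shows "emeasure lborel (cube k r) = ennreal (r ^ DIM('a))" and cube_sets [measurable]: "cube k r \<in> sets borel"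
proof -
  have [measurable]: "cube k r \<in> sets borel" for k :: 'a and r unfolding cube_def by measurable
  then show "cube k r \<in> sets borel" .
  let ?e = "k + r *\<^sub>R One"
  have "box k ?e \<subseteq> cube k r" "cube k r \<subseteq> cbox k ?e"
    by (force simp: cube_def box_def cbox_def inner_add_left inner_sum_left inner_Basis)+
  then have 1: "emeasure lborel (box k ?e) \<le> emeasure lborel (cube k r)" "emeasure lborel (cube k r) \<le> emeasure lborel (cbox k ?e)"
    by (auto intro!: emeasure_mono)
  have "emeasure lborel (box k ?e) = ennreal (r ^ DIM('a))" "emeasure lborel (cbox k ?e) = ennreal (r ^ DIM('a))"
    using r by (simp_all add: emeasure_lborel_box_eq emeasure_lborel_cbox_eq inner_add_left)
  with 1 show "emeasure lborel (cube k r) = ennreal (r ^ DIM('a))" by simp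
qed

lemma node_inner: "b \<in> Basis \<Longrightarrow> node M r c \<alpha> \<bullet> b = c \<bullet> b + r * real (\<alpha> b) / real M"
  by (simp add: node_def)

lemma node_translate: "node M r (k + s) \<alpha> = node M r k \<alpha> + s"
  by (rule euclidean_eqI) (simp add: node_inner inner_add_left)

lemma cube_node_subset:
  assumes r: "r > 0" and M: "M > 0" and \<alpha>: "\<alpha> \<in> Basis \<rightarrow>\<^sub>E {..<M}"
  shows "cube (node M r k \<alpha>) (r / real M) \<subseteq> cube k r"
proof
  fix x assume x: "x \<in> cube (node M r k \<alpha>) (r / real M)"
  show "x \<in> cube k r"
    unfolding cube_def
  proof (intro CollectI ballI)
    fix b :: 'a assume b: "b \<in> Basis"
    have "\<alpha> b < M" using \<alpha> b by auto
    have "r * real (\<alpha> b) / real M + r / real M = r * (real (Suc (\<alpha> b)) / real M)" by (simp add: add_divide_distrib distrib_left)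
    also have "\<dots> \<le> r * 1" using r \<open>\<alpha> b < M\<close> by (intro mult_left_mono) auto
    finally have "r * real (\<alpha> b) / real M + r / real M \<le> r" by simp
    moreover have "0 \<le> r * real (\<alpha> b) / real M" using r by simp
    moreover have "k \<bullet> b + r * real (\<alpha> b) / real M \<le> x \<bullet> b" "x \<bullet> b < k \<bullet> b + r * real (\<alpha> b) / real M + r / real M"
      using x b by (auto simp: cube_def node_inner)
    ultimately show "k \<bullet> b \<le> x \<bullet> b \<and> x \<bullet> b < k \<bullet> b + r" by linarith
  qed
qed

lemma cube_nodes_disjoint:
  assumes r: "r > 0" and M: "M > 0" and k: "corner r k = k" "corner r k' = k'"
    and \<alpha>: "\<alpha> \<in> Basis \<rightarrow>\<^sub>E {..<M}" "\<alpha>' \<in> Basis \<rightarrow>\<^sub>E {..<M}"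
    and x: "x \<in> cube (node M r k \<alpha>) (r / real M)" "x \<in> cube (node M r k' \<alpha>') (r / real M)"
  shows "k = k' \<and> \<alpha> = \<alpha>'"
proof
  have "corner r x = k" "corner r x = k'"
    using x cube_node_subset[OF r M] \<alpha> k by (auto intro!: corner_eqI[OF r])
  then show k': "k = k'" by simp
  show "\<alpha> = \<alpha>'"
  proof (rule PiE_ext[OF \<alpha>])
    fix b :: 'a assume b: "b \<in> Basis"
    have A: "\<lfloor>(x \<bullet> b - k \<bullet> b) * real M / r\<rfloor> = int (\<beta> b)" if "x \<in> cube (node M r k \<beta>) (r / real M)" for \<beta>
    proof -
      have "k \<bullet> b + r * real (\<beta> b) / real M \<le> x \<bullet> b" "x \<bullet> b < k \<bullet> b + r * real (\<beta> b) / real M + r / real M"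
        using that b by (auto simp: cube_def node_inner)
      then have "real (\<beta> b) \<le> (x \<bullet> b - k \<bullet> b) * real M / r" "(x \<bullet> b - k \<bullet> b) * real M / r < real (\<beta> b) + 1"
        using r M by (simp_all add: field_simps)
      then show ?thesis by (simp add: floor_eq_iff)
    qed
    show "\<alpha> b = \<alpha>' b" using A[of \<alpha>] A[of \<alpha>'] x k' by simp
  qed
qed

text \<open>Averaging: as \<open>s\<close> runs through a cube of side \<open>r/M\<close>, the shifted nodes \<open>node M r (k + s) \<alpha>\<close> sweep out disjoint cubes,
so the average of the sum over \<open>s\<close> is at most the integral of \<open>g\<close> divided by the volume of that cube. If no \<open>s\<close> did
as well as the average, the integral over \<open>s\<close> would be too large.\<close>
lemma good_sampling_shift:
  fixes g :: "'a::euclidean_space \<Rightarrow> ennreal"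
  assumes [measurable]: "g \<in> borel_measurable borel" and r: "r > 0" and M: "M > 0"
    and J: "finite J" "\<And>k. k \<in> J \<Longrightarrow> corner r k = k"
  shows "\<exists>s. (\<forall>b\<in>Basis. 0 \<le> s \<bullet> b \<and> s \<bullet> b < r / real M) \<and>
    ennreal ((r / real M) ^ DIM('a)) * (\<Sum>k\<in>J. \<Sum>\<alpha>\<in>Basis \<rightarrow>\<^sub>E {..<M}. g (node M r (k + s) \<alpha>)) \<le> (\<integral>\<^sup>+x. g x \<partial>lborel)"
proof (rule ccontr)
  let ?\<rho> = "r / real M" and ?A = "(Basis::'a set) \<rightarrow>\<^sub>E {..<M}" and ?I = "\<integral>\<^sup>+x. g x \<partial>lborel"
  let ?C = "cube (0::'a) ?\<rho>"
  let ?S = "\<lambda>s. ennreal (?\<rho> ^ DIM('a)) * (\<Sum>k\<in>J. \<Sum>\<alpha>\<in>?A. g (node M r (k + s) \<alpha>))"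
  assume neg: "\<not> ?thesis"
  have \<rho>: "?\<rho> > 0" using r M by simp
  have [measurable]: "cube k \<rho> \<in> sets borel" for k :: 'a and \<rho> unfolding cube_def by measurable
  have finA: "finite ?A" by (intro finite_PiE) auto
  have big: "?I < ?S s" if "s \<in> ?C" for s
  proof -
    have "\<forall>b\<in>Basis. 0 \<le> s \<bullet> b \<and> s \<bullet> b < ?\<rho>" using that by (simp add: cube_def)
    with neg show ?thesis by (meson not_le)
  qed
  have I: "?I < \<infinity>" using big[of 0] \<rho> by (auto simp: cube_def intro: order.strict_trans2)
  have node_m [measurable]: "(\<lambda>s. node M r (k + s) \<alpha>) \<in> borel_measurable borel" for k :: 'a and \<alpha>
    unfolding node_translate by measurable
  have upper: "(\<integral>\<^sup>+s. ?S s * indicator ?C s \<partial>lborel) \<le> ennreal (?\<rho> ^ DIM('a)) * ?I"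
  proof -
    (* the cube swept out by one node *)
    have piece: "(\<integral>\<^sup>+s. g (node M r (k + s) \<alpha>) * indicator ?C s \<partial>lborel) = (\<integral>\<^sup>+x. g x * indicator (cube (node M r k \<alpha>) ?\<rho>) x \<partial>lborel)" for k \<alpha>
    proof -
      have "(indicator (cube (node M r k \<alpha>) ?\<rho>) (node M r k \<alpha> + s) :: ennreal) = indicator ?C s" for s
        by (auto simp: indicator_def cube_def inner_add_left)
      then show ?thesis
        using nn_integral_lborel_translate_scale[of "\<lambda>x. g x * indicator (cube (node M r k \<alpha>) ?\<rho>) x" 1 "node M r k \<alpha>"]
        by (simp add: node_translate)
    qed
    have "(\<integral>\<^sup>+s. ?S s * indicator ?C s \<partial>lborel) = ennreal (?\<rho> ^ DIM('a)) * (\<integral>\<^sup>+s. (\<Sum>k\<in>J. \<Sum>\<alpha>\<in>?A. g (node M r (k + s) \<alpha>) * indicator ?C s) \<partial>lborel)"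
      by (subst nn_integral_cmult[symmetric]) (simp_all add: sum_distrib_right mult.assoc)
    also have "(\<integral>\<^sup>+s. (\<Sum>k\<in>J. \<Sum>\<alpha>\<in>?A. g (node M r (k + s) \<alpha>) * indicator ?C s) \<partial>lborel) = (\<Sum>k\<in>J. \<Sum>\<alpha>\<in>?A. \<integral>\<^sup>+s. g (node M r (k + s) \<alpha>) * indicator ?C s \<partial>lborel)"
      by (simp add: nn_integral_sum)
    also have "\<dots> = (\<Sum>k\<in>J. \<Sum>\<alpha>\<in>?A. \<integral>\<^sup>+x. g x * indicator (cube (node M r k \<alpha>) ?\<rho>) x \<partial>lborel)"
      by (simp only: piece)
    also have "\<dots> = (\<integral>\<^sup>+x. (\<Sum>k\<in>J. \<Sum>\<alpha>\<in>?A. g x * indicator (cube (node M r k \<alpha>) ?\<rho>) x) \<partial>lborel)"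
      by (simp add: nn_integral_sum)
    also have "\<dots> \<le> ?I"
    proof (rule nn_integral_mono)
      fix x :: 'a
      have dis: "disjoint_family_on (\<lambda>p. cube (node M r (fst p) (snd p)) ?\<rho>) (J \<times> ?A)"
        unfolding disjoint_family_on_def
      proof (intro ballI impI)
        fix p p' assume p: "p \<in> J \<times> ?A" "p' \<in> J \<times> ?A" "p \<noteq> p'"
        have k: "corner r (fst p) = fst p" "corner r (fst p') = fst p'" and \<alpha>: "snd p \<in> ?A" "snd p' \<in> ?A"
          using p J(2) by (auto simp: mem_Times_iff)
        have "\<not> (x \<in> cube (node M r (fst p) (snd p)) ?\<rho> \<and> x \<in> cube (node M r (fst p') (snd p')) ?\<rho>)" for x
          using cube_nodes_disjoint[OF r M k \<alpha>, of x] p(3) by (meson prod_eqI)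
        then show "cube (node M r (fst p) (snd p)) ?\<rho> \<inter> cube (node M r (fst p') (snd p')) ?\<rho> = {}" by blast
      qed
      have 1: "(\<Sum>k\<in>J. \<Sum>\<alpha>\<in>?A. g x * indicator (cube (node M r k \<alpha>) ?\<rho>) x) = g x * (\<Sum>p\<in>J \<times> ?A. indicator (cube (node M r (fst p) (snd p)) ?\<rho>) x)"
        by (simp add: sum.cartesian_product' sum_distrib_left)
      have 2: "(\<Sum>p\<in>J \<times> ?A. indicator (cube (node M r (fst p) (snd p)) ?\<rho>) x) = (indicator (\<Union>p\<in>J \<times> ?A. cube (node M r (fst p) (snd p)) ?\<rho>) x :: ennreal)"
        by (rule indicator_UN_disjoint[OF _ dis, symmetric]) (use finA J(1) in blast)
      show "(\<Sum>k\<in>J. \<Sum>\<alpha>\<in>?A. g x * indicator (cube (node M r k \<alpha>) ?\<rho>) x) \<le> g x"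
        unfolding 1 2 by (auto simp: indicator_def)
    qed
    finally show ?thesis by (simp add: mult_left_mono)
  qed
  have const: "(\<integral>\<^sup>+s. ?I * indicator ?C s \<partial>lborel) = ennreal (?\<rho> ^ DIM('a)) * ?I"
    by (simp add: nn_integral_cmult_indicator emeasure_cube[OF \<rho>] mult.commute)
  have "(\<integral>\<^sup>+s. ?I * indicator ?C s \<partial>lborel) < (\<integral>\<^sup>+s. ?S s * indicator ?C s \<partial>lborel)"
  proof (rule nn_integral_less)
    show "(\<integral>\<^sup>+s. ?I * indicator ?C s \<partial>lborel) \<noteq> \<infinity>"
      unfolding const using I by (simp add: ennreal_mult_eq_top_iff less_top)
    show "AE s in lborel. ?I * indicator ?C s \<le> ?S s * indicator ?C s"
      using big by (auto simp: indicator_def intro!: AE_I2 less_imp_le)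
    show "\<not> (AE s in lborel. ?S s * indicator ?C s \<le> ?I * indicator ?C s)"
    proof
      assume "AE s in lborel. ?S s * indicator ?C s \<le> ?I * indicator ?C s"
      then have "AE s in lborel. s \<notin> ?C"
      proof (rule eventually_mono)
        fix s assume le: "?S s * indicator ?C s \<le> ?I * indicator ?C s"
        show "s \<notin> ?C"
        proof
          assume "s \<in> ?C" with le big[of s] show False by simp
        qed
      qed
      then have "emeasure lborel ?C = 0" by (subst (asm) AE_iff_measurable[of ?C]) auto
      then show False using emeasure_cube(1)[OF \<rho>, of "0::'a"] r M by simp
    qed
  qed simp_all
  then show False using upper const by simp
qed

text \<open>In each coordinate the corner of a child agrees with that of its parent or exceeds it by \<open>r\<close>.\<close>
lemma card_children_le:
  assumes r: "r > 0" and J: "\<And>k. k \<in> J \<Longrightarrow> corner r k = (k::'a::euclidean_space)" "finite J"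
  shows "card {k \<in> J. corner (2 * r) k = k'} \<le> 2 ^ DIM('a)"
proof -
  let ?X = "{k \<in> J. corner (2 * r) k = k'}" and ?f = "\<lambda>k. {b \<in> (Basis::'a set). k \<bullet> b \<noteq> k' \<bullet> b}"
  have val: "k \<bullet> b = k' \<bullet> b \<or> k \<bullet> b = k' \<bullet> b + r" if k: "k \<in> ?X" and b: "b \<in> Basis" for k b
  proof -
    define i where "i = \<lfloor>(k \<bullet> b) / r\<rfloor>"
    have 1: "k \<bullet> b = r * of_int i" using corner_inner[OF b, of r k] J(1)[of k] k by (simp add: i_def)
    have "\<lfloor>(k \<bullet> b) / (2 * r)\<rfloor> = i div 2"
      using floor_divide_real_eq_div[of 2 "real_of_int i"] r by (simp add: 1)
    then have 2: "k' \<bullet> b = 2 * r * of_int (i div 2)" using corner_inner[OF b, of "2 * r" k] k by simp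
    have "i = 2 * (i div 2) \<or> i = 2 * (i div 2) + 1" by presburger
    then have "real_of_int i = 2 * of_int (i div 2) \<or> real_of_int i = 2 * of_int (i div 2) + 1" by linarith
    then show ?thesis unfolding 1 2 by (elim disjE) (simp_all add: algebra_simps)
  qed
  have "inj_on ?f ?X"
  proof (rule inj_onI)
    fix k l assume k: "k \<in> ?X" and l: "l \<in> ?X" and eq: "?f k = ?f l"
    show "k = l"
    proof (rule euclidean_eqI)
      fix b :: 'a assume b: "b \<in> Basis"
      have "b \<in> ?f k \<longleftrightarrow> b \<in> ?f l" by (simp only: eq)
      then show "k \<bullet> b = l \<bullet> b" using val[OF k b] val[OF l b] b by auto
    qed
  qed
  then have "card ?X \<le> card (Pow (Basis::'a set))" by (intro card_inj_on_le[of ?f]) auto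
  then show ?thesis by (simp add: card_Pow)
qed

section \<open>The multiscale decomposition of the multiplier\<close>

lemma sum_powr_le_card_powr:
  fixes x :: "'i \<Rightarrow> real"
  assumes "finite I" "\<And>i. i \<in> I \<Longrightarrow> x i \<ge> 0" "q > 0"
  shows "(\<Sum>i\<in>I. x i) powr q \<le> real (card I) powr q * (\<Sum>i\<in>I. x i powr q)"
proof (cases "I = {}")
  case False
  let ?m = "Max (x ` I)"
  have "?m \<in> x ` I" using assms False by (intro Max_in) auto
  then obtain j where j: "j \<in> I" "x j = ?m" by force
  have le: "x i \<le> x j" if "i \<in> I" for i using that assms j by (simp add: Max_ge)
  have "(\<Sum>i\<in>I. x i) \<le> real (card I) * x j" using sum_bounded_above[of I x "x j"] le by simp
  then have "(\<Sum>i\<in>I. x i) powr q \<le> (real (card I) * x j) powr q" using assms by (intro powr_mono2 sum_nonneg) auto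
  also have "\<dots> = real (card I) powr q * x j powr q" by (simp add: powr_mult)
  also have "\<dots> \<le> real (card I) powr q * (\<Sum>i\<in>I. x i powr q)"
    using assms j by (intro mult_left_mono member_le_sum) auto
  finally show ?thesis .
qed simp

lemma norm_bump_le:
  fixes x :: "'a::euclidean_space"
  assumes M: "M > 0" and r: "r > 0" and \<alpha>: "\<And>b. b \<in> Basis \<Longrightarrow> \<alpha> b < M"
    and s: "\<And>b. b \<in> Basis \<Longrightarrow> 0 \<le> s \<bullet> b \<and> s \<bullet> b < r / real M" and x: "x \<in> cube k r"
  shows "norm (bump M r \<alpha> (x - (k + s))) \<le> ((2 * real M) ^ M) ^ DIM('a)"
proof -
  have "norm (poly (lagrange_poly M (\<alpha> b)) (complex_of_real ((x - (k + s)) \<bullet> b / r))) \<le> (2 * real M) ^ M" if b: "b \<in> Basis" for b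
  proof (rule norm_lagrange_poly_le)
    show "\<alpha> b < M" using \<alpha> b by blast
    have "r / real M \<le> r" using M r by (simp add: divide_le_eq)
    then have "\<bar>(x - (k + s)) \<bullet> b\<bar> \<le> r" using s[OF b] x b by (auto simp: cube_def inner_diff_left inner_add_left abs_le_iff)
    then show "\<bar>(x - (k + s)) \<bullet> b / r\<bar> \<le> 1" using r by (simp add: abs_divide)
  qed
  then have "norm (bump M r \<alpha> (x - (k + s))) \<le> (\<Prod>b\<in>(Basis::'a set). (2 * real M) ^ M)"
    unfolding bump_def prod_norm[symmetric] by (intro prod_mono) auto
  then show ?thesis by simp
qed

lemma interp_diff: "interp M r c (\<lambda>x. u x - v x) x = interp M r c u x - interp M r c v x"
  by (simp add: interp_def left_diff_distrib sum_subtractf)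

abbreviation scale :: "nat \<Rightarrow> real" where "scale l \<equiv> 1 / 2 ^ l"

text \<open>The values at the nodes of level \<open>l\<close> of the difference between \<open>m\<close> and its interpolant of level \<open>l - 1\<close>; at level 0 the
values of \<open>m\<close> itself. By the reproduction property these are the coefficients of the difference of two consecutive
interpolants. The shifts \<open>s l\<close> move the nodes inside the cubes.\<close>
definition multiscale_coeff :: "nat \<Rightarrow> (nat \<Rightarrow> 'a::euclidean_space) \<Rightarrow> ('a \<Rightarrow> complex) \<Rightarrow> nat \<Rightarrow> 'a \<Rightarrow> ('a \<Rightarrow> nat) \<Rightarrow> complex"
  where "multiscale_coeff M s m l k \<alpha> = (let y = node M (scale l) (k + s l) \<alpha> in
     m y - (if l = 0 then 0 else let k' = corner (scale (l - 1)) k in interp M (scale (l - 1)) (k' + s (l - 1)) m y))"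

lemma multiscale_coeff_Suc: "multiscale_coeff M s m (Suc l) k \<alpha> =
   (let y = node M (scale (Suc l)) (k + s (Suc l)) \<alpha> in m y - interp M (scale l) (corner (scale l) k + s l) m y)"
  by (simp add: multiscale_coeff_def Let_def)

text \<open>The factor \<open>2 ^ M\<close> allows the error at level \<open>l\<close> to be written with \<open>scale (Suc l)\<close>, the scale at which it is sampled, and
the summand 1 makes the constant at least \<open>C0\<close>, so that level 0 obeys the same bound.\<close>
definition approx_const :: "nat \<Rightarrow> nat \<Rightarrow> real \<Rightarrow> real"
  where "approx_const n M C0 = C0 * 2 ^ M * (1 + real n * interp_const M ^ n)"

locale multiscale =
  fixes M :: nat and s :: "nat \<Rightarrow> 'a::euclidean_space" and m :: "'a \<Rightarrow> complex" and C0 :: real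
  assumes M: "M > 0" and s: "\<And>l b. b \<in> Basis \<Longrightarrow> 0 \<le> s l \<bullet> b \<and> s l \<bullet> b < scale l / real M"
    and Ck: "Ck M m" and deriv: "\<And>b x. b \<in> Basis \<Longrightarrow> norm (iter_deriv (replicate M b) m x) \<le> C0"
    and bounded: "\<And>x. norm (m x) \<le> C0"
begin

abbreviation "idx \<equiv> (Basis::'a set) \<rightarrow>\<^sub>E {..<M}"
abbreviation "nodes l k \<alpha> \<equiv> node M (scale l) (k + s l) \<alpha>"

lemma C0_nonneg: "C0 \<ge> 0" using bounded[of 0] order_trans[OF norm_ge_zero] by blast

lemma shifted: "b \<in> Basis \<Longrightarrow> k \<bullet> b \<le> (k + s l) \<bullet> b \<and> (k + s l) \<bullet> b < k \<bullet> b + scale l / real M"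
  using s[of b l] by (simp add: inner_add_left)

lemma nodes_mem_cube: assumes "\<alpha> \<in> idx" shows "nodes l k \<alpha> \<in> cube k (scale l)"
proof -
  have "nodes l k \<alpha> \<in> cube (node M (scale l) k \<alpha>) (scale l / real M)"
    using s[of _ l] by (auto simp: cube_def node_translate inner_add_left)
  moreover have "scale l > 0" by simp
  ultimately show ?thesis using cube_node_subset[OF _ M assms, of "scale l" k] by blast
qed

lemma C0_le_err: "C0 \<le> approx_const DIM('a) M C0"
proof -
  have "(1::real) * 1 \<le> 2 ^ M * (1 + real DIM('a) * interp_const M ^ DIM('a))" by (intro mult_mono) auto
  then show ?thesis unfolding approx_const_def using C0_nonneg mult_left_mono[of 1 "2 ^ M * (1 + real DIM('a) * interp_const M ^ DIM('a))" C0] by (simp add: mult.assoc)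
qed

lemma level_interp_error:
  assumes "x \<in> cube k (scale l)"
  shows "norm (m x - interp M (scale l) (k + s l) m x) \<le> approx_const DIM('a) M C0 * (scale (Suc l)) ^ M"
proof -
  have "norm (m x - interp M (scale l) (k + s l) m x) \<le> C0 * (scale l) ^ M * (real DIM('a) * interp_const M ^ DIM('a))"
    by (rule interp_error[OF M _ line_approx_Ck[OF M Ck deriv] _ shifted assms]) (use C0_nonneg in auto)
  also have "\<dots> \<le> C0 * (scale l) ^ M * (1 + real DIM('a) * interp_const M ^ DIM('a))"
    using C0_nonneg by (intro mult_left_mono) auto
  also have "\<dots> = approx_const DIM('a) M C0 * (scale (Suc l)) ^ M" by (simp add: approx_const_def power_divide power_mult_distrib)
  finally show ?thesis .
qed

lemma coeff_bound:
  assumes \<alpha>: "\<alpha> \<in> idx" and k: "corner (scale l) k = k"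
  shows "norm (multiscale_coeff M s m l k \<alpha>) \<le> approx_const DIM('a) M C0 * (scale l) ^ M"
proof (cases l)
  case 0
  then show ?thesis using order_trans[OF bounded C0_le_err] by (simp add: multiscale_coeff_def)
next
  case (Suc j)
  have "nodes l k \<alpha> \<in> cube (corner (2 * scale l) k) (2 * scale l)"
  proof -
    have "scale l > 0" by simp
    from cube_child_subset[OF this k] nodes_mem_cube[OF \<alpha>] show ?thesis by blast
  qed
  then have "nodes l k \<alpha> \<in> cube (corner (scale j) k) (scale j)" using Suc by simp
  from level_interp_error[OF this] show ?thesis using Suc by (simp add: multiscale_coeff_Suc Let_def)
qed

text \<open>Evaluated at one point, the sum of the levels up to \<open>K\<close> telescopes to the interpolant of level \<open>K\<close>, because
interpolation at the finer level leaves the coarser interpolant unchanged.\<close>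
lemma telescope:
  "(\<Sum>l\<le>K. \<Sum>\<alpha>\<in>idx. multiscale_coeff M s m l (corner (scale l) z) \<alpha> * bump M (scale l) \<alpha> (z - (corner (scale l) z + s l)))
    = interp M (scale K) (corner (scale K) z + s K) m z"
proof (induction K)
  case 0
  then show ?case by (simp add: multiscale_coeff_def interp_def)
next
  case (Suc K)
  let ?r = "scale (Suc K)" and ?k = "corner (scale (Suc K)) z"
  let ?p = "interp M (scale K) (corner (scale K) z + s K) m"
  have "corner (2 * ?r) ?k = corner (2 * ?r) z" by (rule corner_double_corner) simp
  then have par: "corner (scale K) ?k = corner (scale K) z" by simp
  have "(\<Sum>\<alpha>\<in>idx. multiscale_coeff M s m (Suc K) ?k \<alpha> * bump M ?r \<alpha> (z - (?k + s (Suc K))))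
    = interp M ?r (?k + s (Suc K)) (\<lambda>x. m x - ?p x) z"
    unfolding interp_def[of M ?r] multiscale_coeff_Suc par Let_def by simp
  also have "\<dots> = interp M ?r (?k + s (Suc K)) m z - interp M ?r (?k + s (Suc K)) ?p z" by (rule interp_diff)
  (* reproduction: the error bound with \<epsilon> = 0 *)
  also have "interp M ?r (?k + s (Suc K)) ?p z = ?p z"
  proof -
    have "norm (?p z - interp M ?r (?k + s (Suc K)) ?p z) \<le> 0 * (real DIM('a) * interp_const M ^ DIM('a))"
      by (rule interp_error[OF M _ line_approx_interp[OF M] _ shifted mem_cube_corner]) auto
    then show ?thesis by simp
  qed
  finally show ?case using Suc by simp
qed

definition sample_sum where "sample_sum q l k = (\<Sum>\<alpha>\<in>idx. norm (m (nodes l k \<alpha>)) powr q)"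

lemma finite_idx: "finite idx" by (intro finite_PiE) auto

text \<open>A coefficient involves the value of \<open>m\<close> at one node of the cube and the values at the nodes of the parent cube.\<close>
lemma coeff_powr:
  assumes q: "q > 0" and \<alpha>: "\<alpha> \<in> idx" and k: "corner (scale l) k = k"
  shows "norm (multiscale_coeff M s m l k \<alpha>) powr q \<le>
    2 powr q * (sample_sum q l k + (if l = 0 then 0 else ((((2 * real M) ^ M) ^ DIM('a)) * real (card idx)) powr q * sample_sum q (l - 1) (corner (scale (l - 1)) k)))"
proof -
  let ?y = "nodes l k \<alpha>"
  have two: "(a + b) powr q \<le> 2 powr q * (a powr q + b powr q)" if "a \<ge> 0" "b \<ge> 0" for a b :: real
    using sum_powr_le_card_powr[of "{True, False}" "\<lambda>i. if i then a else b" q] that q by simp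
  have 1: "norm (m ?y) powr q \<le> sample_sum q l k"
    unfolding sample_sum_def using finite_idx \<alpha> by (intro member_le_sum) auto
  show ?thesis
  proof (cases l)
    case 0
    have "1 powr q \<le> 2 powr q" using q by (intro powr_mono2) auto
    then have "sample_sum q l k \<le> 2 powr q * sample_sum q l k"
      using mult_right_mono[of 1 "2 powr q" "sample_sum q l k"] by (simp add: sample_sum_def sum_nonneg)
    with 1 show ?thesis using 0 by (simp add: multiscale_coeff_def)
  next
    case (Suc j)
    let ?k' = "corner (scale j) k"
    let ?p = "interp M (scale j) (?k' + s j) m ?y"
    have y: "?y \<in> cube ?k' (scale j)"
    proof -
      have "scale l > 0" by simp
      from cube_child_subset[OF this k] nodes_mem_cube[OF \<alpha>]
      have "?y \<in> cube (corner (2 * scale l) k) (2 * scale l)" by blast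
      then show ?thesis using Suc by simp
    qed
    have "norm ?p \<le> (\<Sum>\<beta>\<in>idx. norm (m (nodes j ?k' \<beta>)) * (((2 * real M) ^ M) ^ DIM('a)))"
      unfolding interp_def
    proof (intro sum_norm_le)
      fix \<beta> assume \<beta>: "\<beta> \<in> idx"
      have "norm (bump M (scale j) \<beta> (?y - (?k' + s j))) \<le> (((2 * real M) ^ M) ^ DIM('a))"
        by (rule norm_bump_le[OF M _ _ s y]) (use \<beta> in auto)
      then show "norm (m (nodes j ?k' \<beta>) * bump M (scale j) \<beta> (?y - (?k' + s j))) \<le> norm (m (nodes j ?k' \<beta>)) * (((2 * real M) ^ M) ^ DIM('a))"
        unfolding norm_mult by (rule mult_left_mono) simp
    qed
    then have "norm ?p \<le> (((2 * real M) ^ M) ^ DIM('a)) * (\<Sum>\<beta>\<in>idx. norm (m (nodes j ?k' \<beta>)))" by (simp add: sum_distrib_left mult.commute)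
    then have "norm ?p powr q \<le> ((((2 * real M) ^ M) ^ DIM('a)) * (\<Sum>\<beta>\<in>idx. norm (m (nodes j ?k' \<beta>)))) powr q" using q by (intro powr_mono2) auto
    also have "\<dots> \<le> (((2 * real M) ^ M) ^ DIM('a)) powr q * (real (card idx) powr q * sample_sum q j ?k')"
      unfolding powr_mult sample_sum_def using q finite_idx by (intro mult_left_mono sum_powr_le_card_powr) auto
    also have "\<dots> = ((((2 * real M) ^ M) ^ DIM('a)) * real (card idx)) powr q * sample_sum q j ?k'" by (simp only: powr_mult mult.assoc)
    finally have 2: "norm ?p powr q \<le> ((((2 * real M) ^ M) ^ DIM('a)) * real (card idx)) powr q * sample_sum q j ?k'" .
    have "norm (multiscale_coeff M s m l k \<alpha>) powr q \<le> (norm (m ?y) + norm ?p) powr q"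
      using q Suc by (intro powr_mono2) (auto simp: multiscale_coeff_Suc Let_def norm_triangle_ineq4)
    also have "\<dots> \<le> 2 powr q * (norm (m ?y) powr q + norm ?p powr q)" by (rule two) auto
    also have "\<dots> \<le> 2 powr q * (sample_sum q l k + ((((2 * real M) ^ M) ^ DIM('a)) * real (card idx)) powr q * sample_sum q j ?k')"
      by (intro mult_left_mono add_mono 1 2) auto
    finally show ?thesis using Suc by simp
  qed
qed

text \<open>A parent cube has at most \<open>2 ^ DIM('a)\<close> children, which compensates exactly for the sampling bound of the coarser level being smaller by
that factor.\<close>
lemma coeff_powr_sum:
  assumes q: "q > 0" and \<alpha>: "\<alpha> \<in> idx" and lK: "l \<le> K"
    and samp: "\<And>l. l \<le> K \<Longrightarrow> (\<Sum>k\<in>lattice_box (scale l) K. sample_sum q l k) \<le> (real M * 2 ^ l) ^ DIM('a) * Nq"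
  shows "(\<Sum>k\<in>lattice_box (scale l) K. norm (multiscale_coeff M s m l k \<alpha>) powr q)
    \<le> 2 powr q * (1 + ((((2 * real M) ^ M) ^ DIM('a)) * real (card idx)) powr q) * real M ^ DIM('a) * (2 ^ l) ^ DIM('a) * Nq"
proof -
  let ?J = "\<lambda>l. lattice_box (scale l) K :: 'a set" and ?B = "((((2 * real M) ^ M) ^ DIM('a)) * real (card idx)) powr q" and ?n = "DIM('a)"
  have fin: "finite (?J l)" for l by (rule finite_lattice_box) simp
  have kJ: "corner (scale l) k = k" if "k \<in> ?J l" for k l using that by (simp add: lattice_box_def)
  have S0: "sample_sum q l k \<ge> 0" for l k by (simp add: sample_sum_def sum_nonneg)
  have N0: "(real M * 2 ^ l) ^ ?n * Nq \<ge> 0" if "l \<le> K" for l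
    by (rule order_trans[OF _ samp[OF that]]) (intro sum_nonneg S0)
  have "(\<Sum>k\<in>?J l. norm (multiscale_coeff M s m l k \<alpha>) powr q)
    \<le> (\<Sum>k\<in>?J l. 2 powr q * (sample_sum q l k + (if l = 0 then 0 else ?B * sample_sum q (l - 1) (corner (scale (l - 1)) k))))"
    by (intro sum_mono coeff_powr q \<alpha> kJ)
  also have "\<dots> = 2 powr q * ((\<Sum>k\<in>?J l. sample_sum q l k) + (\<Sum>k\<in>?J l. if l = 0 then 0 else ?B * sample_sum q (l - 1) (corner (scale (l - 1)) k)))"
    by (simp only: sum.distrib sum_distrib_left[symmetric])
  also have "\<dots> \<le> 2 powr q * ((real M * 2 ^ l) ^ ?n * Nq + ?B * ((real M * 2 ^ l) ^ ?n * Nq))"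
  proof (intro mult_left_mono add_mono samp lK)
    show "(\<Sum>k\<in>?J l. if l = 0 then 0 else ?B * sample_sum q (l - 1) (corner (scale (l - 1)) k)) \<le> ?B * ((real M * 2 ^ l) ^ ?n * Nq)"
    proof (cases l)
      case 0
      then show ?thesis using N0[of 0] by simp
    next
      case (Suc j)
      have par: "corner (scale j) k \<in> ?J j" if k: "k \<in> ?J l" for k
        using k by (intro corner_mem_lattice_box) (simp add: lattice_box_def)
      have "(\<Sum>k\<in>?J l. sample_sum q j (corner (scale j) k)) = (\<Sum>k'\<in>?J j. real (card {k \<in> ?J l. corner (scale j) k = k'}) * sample_sum q j k')"
        by (rule sum_fun_comp[OF fin fin]) (use par in blast)
      also have "\<dots> \<le> (\<Sum>k'\<in>?J j. 2 ^ ?n * sample_sum q j k')"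
      proof (intro sum_mono mult_right_mono S0)
        fix k' :: 'a
        have "card {k \<in> ?J l. corner (2 * scale l) k = k'} \<le> 2 ^ ?n"
          by (rule card_children_le[OF _ kJ fin]) auto
        then have "card {k \<in> ?J l. corner (scale j) k = k'} \<le> 2 ^ ?n" using Suc by simp
        then have "real (card {k \<in> ?J l. corner (scale j) k = k'}) \<le> real (2 ^ ?n)" by (rule of_nat_mono)
        then show "real (card {k \<in> ?J l. corner (scale j) k = k'}) \<le> 2 ^ ?n" by simp
      qed
      also have "\<dots> \<le> 2 ^ ?n * ((real M * 2 ^ j) ^ ?n * Nq)"
        unfolding sum_distrib_left[symmetric] using samp[of j] lK Suc by (intro mult_left_mono) auto
      also have "\<dots> = (real M * 2 ^ l) ^ ?n * Nq" using Suc by (simp add: power_mult_distrib)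
      finally show ?thesis using Suc by (simp add: sum_distrib_left[symmetric] mult_left_mono)
    qed
  qed auto
  also have "\<dots> = 2 powr q * (1 + ?B) * real M ^ ?n * (2 ^ l) ^ ?n * Nq"
  proof -
    have "a * (x * y * z + b * (x * y * z)) = a * (1 + b) * x * y * z" for a b x y z :: real by (simp add: algebra_simps)
    then show ?thesis by (simp only: power_mult_distrib)
  qed
  finally show ?thesis .
qed

end

text \<open>The shift is chosen for each level separately; only the sum over the cubes of the level and in the box is controlled.\<close>
lemma shift_exists:
  fixes m :: "'a::euclidean_space \<Rightarrow> complex"
  assumes [measurable]: "m \<in> borel_measurable borel" and M: "M > 0"
    and Nq: "(\<integral>\<^sup>+x. ennreal (norm (m x) powr q) \<partial>lborel) = ennreal Nq" "Nq \<ge> 0"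
  obtains s where "\<And>b. b \<in> Basis \<Longrightarrow> 0 \<le> s \<bullet> b \<and> s \<bullet> b < scale l / real M"
    "(\<Sum>k\<in>lattice_box (scale l) K. \<Sum>\<alpha>\<in>Basis \<rightarrow>\<^sub>E {..<M}. norm (m (node M (scale l) (k + s) \<alpha>)) powr q) \<le> (real M * 2 ^ l) ^ DIM('a) * Nq"
proof -
  let ?J = "lattice_box (scale l) K :: 'a set" and ?A = "(Basis::'a set) \<rightarrow>\<^sub>E {..<M}" and ?n = "DIM('a)"
  have "\<exists>s. (\<forall>b\<in>Basis. 0 \<le> s \<bullet> b \<and> s \<bullet> b < scale l / real M) \<and>
    ennreal ((scale l / real M) ^ ?n) * (\<Sum>k\<in>?J. \<Sum>\<alpha>\<in>?A. ennreal (norm (m (node M (scale l) (k + s) \<alpha>)) powr q)) \<le> (\<integral>\<^sup>+x. ennreal (norm (m x) powr q) \<partial>lborel)"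
  proof (rule good_sampling_shift[where g="\<lambda>x. ennreal (norm (m x) powr q)"])
    show "finite ?J" by (rule finite_lattice_box) simp
    show "corner (scale l) k = k" if "k \<in> ?J" for k using that by (simp add: lattice_box_def)
  qed (use M in auto)
  then obtain s where s: "\<And>b. b \<in> Basis \<Longrightarrow> 0 \<le> s \<bullet> b \<and> s \<bullet> b < scale l / real M"
    and le: "ennreal ((scale l / real M) ^ ?n) * (\<Sum>k\<in>?J. \<Sum>\<alpha>\<in>?A. ennreal (norm (m (node M (scale l) (k + s) \<alpha>)) powr q)) \<le> ennreal Nq"
    unfolding Nq by blast
  let ?S = "\<Sum>k\<in>?J. \<Sum>\<alpha>\<in>?A. norm (m (node M (scale l) (k + s) \<alpha>)) powr q"
  have "ennreal ((scale l / real M) ^ ?n * ?S) \<le> ennreal Nq"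
    using le by (simp add: sum_ennreal sum_nonneg ennreal_mult'[symmetric])
  then have "(scale l / real M) ^ ?n * ?S \<le> Nq" using Nq(2) by (simp only: ennreal_le_iff)
  then have "(real M * 2 ^ l) ^ ?n * ((scale l / real M) ^ ?n * ?S) \<le> (real M * 2 ^ l) ^ ?n * Nq" by (rule mult_left_mono) simp
  moreover have "(real M * 2 ^ l) ^ ?n * ((scale l / real M) ^ ?n * ?S) = ?S"
  proof -
    have "(real M * 2 ^ l) * (scale l / real M) = 1" using M by simp
    then have "(real M * 2 ^ l) ^ ?n * (scale l / real M) ^ ?n = 1" by (simp only: power_mult_distrib[symmetric] power_one)
    then show ?thesis by (simp only: mult.assoc[symmetric] mult_1_left)
  qed
  ultimately have "?S \<le> (real M * 2 ^ l) ^ ?n * Nq" by (simp only:)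
  with s show ?thesis by (rule that)
qed

section \<open>Constants and geometric decay\<close>

lemma corner_Pair: "corner r (x, y) = (corner r x, corner r y)"
proof (rule euclidean_eqI)
  fix b :: "'a \<times> 'b" assume "b \<in> Basis"
  then show "corner r (x, y) \<bullet> b = (corner r x, corner r y) \<bullet> b"
    by (subst corner_inner) (auto simp: Basis_prod_def corner_inner)
qed

lemma box_set_Pair: "(x, y) \<in> box_set K \<longleftrightarrow> x \<in> box_set K \<and> y \<in> box_set K"
  by (auto simp: box_set_def Basis_prod_def ball_Un)

lemma lattice_box_Pair: "(x, y) \<in> lattice_box r K \<longleftrightarrow> x \<in> lattice_box r K \<and> y \<in> lattice_box r K"
  by (auto simp: lattice_box_def corner_Pair box_set_Pair)

lemma lattice_box_prod: "lattice_box r K = lattice_box r K \<times> lattice_box r K"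
  by (auto simp: lattice_box_Pair)

text \<open>The tensor product structure: this is what turns one level of the decomposition into a sum of products of a function
of \<open>\<xi>\<close>, one of \<open>\<eta>\<close> and one of \<open>\<delta>\<close>.\<close>
lemma bump_Pair: "bump M r \<alpha> (x, y) = bump M r (\<lambda>b. \<alpha> (b, 0)) x * bump M r (\<lambda>b. \<alpha> (0, b)) y"
  unfolding bump_def Basis_prod_def
  by (subst prod.union_disjoint) (auto simp: prod.reindex inj_on_def)

text \<open>The constant in \<open>coeff_powr_sum\<close> with the number \<open>M ^ n\<close> of nodes inserted.\<close>
definition level_const :: "nat \<Rightarrow> nat \<Rightarrow> real \<Rightarrow> real"
  where "level_const n M q = 2 powr q * (1 + (((2 * real M) ^ M) ^ n * real M ^ n) powr q) * real M ^ n"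

text \<open>The factor gained from one level to the next. Coefficients shrink by \<open>2 ^ M\<close>, and the bound on their \<open>q\<close>-th powers grows by
\<open>2 ^ n\<close>; the exponents are those of \<open>trilinear_sum_bound\<close>, which estimates the \<open>2/3\<close>-power of the quasinorm.\<close>
definition decay_ratio :: "nat \<Rightarrow> nat \<Rightarrow> real \<Rightarrow> real"
  where "decay_ratio n M q = ((1/2) ^ M) powr ((2 - 2*q/3) / 3) * (2 ^ n) powr (2/9)"

definition piece_const :: "nat \<Rightarrow> nat \<Rightarrow> real \<Rightarrow> real \<Rightarrow> real"
  where "piece_const d M q C0 = 4 * (approx_const (3*d) M C0 powr (2 - 2*q/3) * level_const (3*d) M q powr (2/3) * (((2 * real M) ^ M) ^ d) ^ 6) powr (1/3)"

definition main_const :: "nat \<Rightarrow> nat \<Rightarrow> real \<Rightarrow> real \<Rightarrow> real"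
  where "main_const d M q C0 = real M ^ (3*d) * piece_const d M q C0 / (1 - decay_ratio (3*d) M q)"

text \<open>With \<open>n = 3 * d\<close> the hypothesis reads \<open>M > 3 * d / (3 - q)\<close>.\<close>
lemma decay_ratio_less_1:
  assumes "real M * (3 - q) > real n"
  shows "decay_ratio n M q < 1"
proof -
  have a: "((1/2::real) ^ M) powr ((2 - 2*q/3) / 3) = 2 powr (- (real M * ((2 - 2*q/3) / 3)))"
  proof -
    have "(2::real) powr (- real M) = inverse (2 ^ M)" by (simp add: powr_minus powr_realpow)
    moreover have "(1/2::real) ^ M = inverse (2 ^ M)" by (simp add: power_one_over inverse_eq_divide)
    ultimately have "(1/2::real) ^ M = 2 powr (- real M)" by (simp only:)
    then show ?thesis by (simp only: powr_powr) simp
  qed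
  have b: "(2 ^ n :: real) powr (2/9) = 2 powr (real n * (2/9))"
  proof -
    have "(2::real) ^ n = 2 powr (real n)" by (simp add: powr_realpow)
    then show ?thesis by (simp only: powr_powr)
  qed
  have e: "- (real M * ((2 - 2*q/3) / 3)) + real n * (2/9) < 0" using assms by (simp add: algebra_simps)
  have "decay_ratio n M q = 2 powr (- (real M * ((2 - 2*q/3) / 3)) + real n * (2/9))"
    unfolding decay_ratio_def a b powr_add by simp
  also have "\<dots> < 2 powr 0" using e by (intro powr_less_mono) auto
  finally show ?thesis by simp
qed

lemma main_const_nonneg:
  assumes "real M * (3 - q) > real (3 * d)"
  shows "main_const d M q C0 \<ge> 0"
  using decay_ratio_less_1[OF assms] by (auto simp: main_const_def piece_const_def)

lemma level_powr_eq:
  fixes U V W :: real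
  assumes C0: "C0 \<ge> 0" and Nq: "Nq \<ge> 0" and n: "U \<ge> 0" "V \<ge> 0" "W \<ge> 0"
  shows "4 * ((approx_const (3*d) M C0 * (1 / 2 ^ l) ^ M) powr (2 - 2*q/3) * (level_const (3*d) M q * (2 ^ l) ^ (3*d) * Nq) powr (2/3) *
      ((((2 * real M) ^ M) ^ d)\<^sup>2 * U) * ((((2 * real M) ^ M) ^ d)\<^sup>2 * V) * ((((2 * real M) ^ M) ^ d)\<^sup>2 * W)) powr (1/3)
    = piece_const d M q C0 * decay_ratio (3*d) M q ^ l * (Nq powr (2/9) * (U * V * W) powr (1/3))"
proof -
  let ?L = "((2 * real M) ^ M) ^ d"
  have 1: "((1 / 2 ^ l :: real) ^ M) powr x = (((1/2) ^ M) powr x) ^ l" for x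
  proof -
    have "(1 / 2 ^ l :: real) ^ M = ((1/2) ^ M) ^ l" by (simp add: power_one_over[symmetric] power_mult[symmetric] mult.commute)
    also have "\<dots> powr x = (((1/2) ^ M) powr x) ^ l" by (induction l) (simp_all add: powr_mult)
    finally show ?thesis .
  qed
  have 2: "((2 ^ l :: real) ^ (3*d)) powr x = ((2 ^ (3*d)) powr x) ^ l" for x
  proof -
    have "(2 ^ l :: real) ^ (3*d) = (2 ^ (3*d)) ^ l" by (simp add: power_mult[symmetric] mult.commute)
    also have "\<dots> powr x = ((2 ^ (3*d)) powr x) ^ l" by (induction l) (simp_all add: powr_mult)
    finally show ?thesis .
  qed
  have L6: "?L ^ 6 = ?L\<^sup>2 * ?L\<^sup>2 * ?L\<^sup>2" by (simp flip: power_add)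
  have 4: "((2 - 2*q/3)) * (1/3) = (2 - 2*q/3) / 3" by simp
  let ?a = "approx_const (3*d) M C0 powr (2 - 2*q/3)" and ?b = "level_const (3*d) M q powr (2/3)"
  have alg: "a * x * (b * y * z) * (L2 * U) * (L2 * V) * (L2 * W) = (a * b * (L2 * L2 * L2)) * (x * y) * (z * (U * V * W))" for a b x y z L2 :: real
    by (simp only: mult_ac)
  have p3: "(X * (Y * Y') * (Z * R)) powr (1/3) = X powr (1/3) * (Y powr (1/3) * Y' powr (1/3)) * (Z powr (1/3) * R powr (1/3))" for X Y Y' Z R :: real
    by (simp only: powr_mult)
  have eq: "(approx_const (3*d) M C0 * (1 / 2 ^ l) ^ M) powr (2 - 2*q/3) * (level_const (3*d) M q * (2 ^ l) ^ (3*d) * Nq) powr (2/3) *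
      (?L\<^sup>2 * U) * (?L\<^sup>2 * V) * (?L\<^sup>2 * W)
     = (?a * ?b * ?L ^ 6) * (((1 / 2 ^ l) ^ M) powr (2 - 2*q/3) * ((2 ^ l) ^ (3*d)) powr (2/3)) * (Nq powr (2/3) * (U * V * W))"
    unfolding powr_mult L6 by (rule alg)
  have "4 * ((approx_const (3*d) M C0 * (1 / 2 ^ l) ^ M) powr (2 - 2*q/3) * (level_const (3*d) M q * (2 ^ l) ^ (3*d) * Nq) powr (2/3) *
      (?L\<^sup>2 * U) * (?L\<^sup>2 * V) * (?L\<^sup>2 * W)) powr (1/3)
     = 4 * ((?a * ?b * ?L ^ 6) powr (1/3)) * ((((1 / 2 ^ l) ^ M) powr (2 - 2*q/3)) powr (1/3) * (((2 ^ l) ^ (3*d)) powr (2/3)) powr (1/3)) * ((Nq powr (2/3)) powr (1/3) * (U * V * W) powr (1/3))"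
    unfolding eq p3 by (simp only: mult.assoc)
  also have "(((1 / 2 ^ l :: real) ^ M) powr (2 - 2*q/3)) powr (1/3) * (((2 ^ l) ^ (3*d)) powr (2/3)) powr (1/3) = decay_ratio (3*d) M q ^ l"
  proof -
    have 5: "(2/3) * (1/3) = (2/9 :: real)" by simp
    show ?thesis unfolding powr_powr 4 5 unfolding 1 2 decay_ratio_def power_mult_distrib ..
  qed
  also have "(Nq powr (2/3)) powr (1/3) = Nq powr (2/9)" by (simp add: powr_powr)
  finally show ?thesis unfolding piece_const_def by (simp only: mult.assoc)
qed

lemma trilinear_bound_pieces:
  fixes F G H :: "'s \<Rightarrow> 'i \<Rightarrow> 'a::euclidean_space \<Rightarrow> complex"
  assumes P: "finite P"
    and F: "\<And>p. p \<in> P \<Longrightarrow> \<exists>w. bessel_family (J p) (F p) w \<and> sum w (J p) \<le> U"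
    and G: "\<And>p. p \<in> P \<Longrightarrow> \<exists>w. bessel_family (J p) (G p) w \<and> sum w (J p) \<le> V"
    and H: "\<And>p. p \<in> P \<Longrightarrow> \<exists>w. bessel_family (J p) (H p) w \<and> sum w (J p) \<le> W"
    and A: "\<And>p i j k. p \<in> P \<Longrightarrow> i \<in> J p \<Longrightarrow> j \<in> J p \<Longrightarrow> k \<in> J p \<Longrightarrow> norm (c p i j k) \<le> A p"
    and Q: "\<And>p. p \<in> P \<Longrightarrow> (\<Sum>i\<in>J p. \<Sum>j\<in>J p. \<Sum>k\<in>J p. norm (c p i j k) powr q) \<le> Q p"
    and q: "0 < q" "q < 3" and nn: "U \<ge> 0" "V \<ge> 0" "W \<ge> 0"
  shows "(\<integral>\<^sup>+x. ennreal (norm (\<Sum>p\<in>P. \<Sum>i\<in>J p. \<Sum>j\<in>J p. \<Sum>k\<in>J p. c p i j k * F p i x * G p j x * H p k x) powr (2/3)) \<partial>lborel)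
    \<le> ennreal (\<Sum>p\<in>P. 4 * (A p powr (2 - 2*q/3) * Q p powr (2/3) * U * V * W) powr (1/3))"
proof -
  let ?T = "\<lambda>p x. \<Sum>i\<in>J p. \<Sum>j\<in>J p. \<Sum>k\<in>J p. c p i j k * F p i x * G p j x * H p k x"
  let ?B = "\<lambda>p. 4 * (A p powr (2 - 2*q/3) * Q p powr (2/3) * U * V * W) powr (1/3)"
  have meas: "?T p \<in> borel_measurable borel" if p: "p \<in> P" for p
  proof -
    have [measurable]: "F p j \<in> borel_measurable borel" "G p j \<in> borel_measurable borel" "H p j \<in> borel_measurable borel" for j
      using F[OF p] G[OF p] H[OF p] by (auto simp: bessel_family_def)
    show ?thesis by measurable
  qed
  have one: "(\<integral>\<^sup>+x. ennreal (norm (?T p x) powr (2/3)) \<partial>lborel) \<le> ennreal (?B p)" if p: "p \<in> P" for p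
  proof -
    obtain f g h where f: "bessel_family (J p) (F p) f" "sum f (J p) \<le> U"
      and g: "bessel_family (J p) (G p) g" "sum g (J p) \<le> V"
      and h: "bessel_family (J p) (H p) h" "sum h (J p) \<le> W" using F[OF p] G[OF p] H[OF p] by blast
    have nn': "0 \<le> sum f (J p)" "0 \<le> sum g (J p)" "0 \<le> sum h (J p)"
      using f g h by (auto simp: bessel_family_def intro!: sum_nonneg)
    have "(\<integral>\<^sup>+x. ennreal (norm (?T p x) powr (2/3)) \<partial>lborel)
      \<le> ennreal (4 * (A p powr (2 - 2*q/3) * Q p powr (2/3) * sum f (J p) * sum g (J p) * sum h (J p)) powr (1/3))"
      by (rule trilinear_sum_bound[OF f(1) g(1) h(1) _ Q[OF p] q]) (rule A[OF p])
    also have "\<dots> \<le> ennreal (?B p)"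
      using f g h nn nn' by (intro ennreal_leI mult_left_mono powr_mono2 mult_mono mult_nonneg_nonneg) auto
    finally show ?thesis .
  qed
  have "(\<integral>\<^sup>+x. ennreal (norm (\<Sum>p\<in>P. ?T p x) powr (2/3)) \<partial>lborel) \<le> (\<integral>\<^sup>+x. (\<Sum>p\<in>P. ennreal (norm (?T p x) powr (2/3))) \<partial>lborel)"
  proof (rule nn_integral_mono)
    fix x
    have "ennreal (norm (\<Sum>p\<in>P. ?T p x) powr (2/3)) \<le> ennreal (\<Sum>p\<in>P. norm (?T p x) powr (2/3))"
      by (intro ennreal_leI norm_sum_powr_le) auto
    then show "ennreal (norm (\<Sum>p\<in>P. ?T p x) powr (2/3)) \<le> (\<Sum>p\<in>P. ennreal (norm (?T p x) powr (2/3)))"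
      by (simp add: sum_ennreal)
  qed
  also have "\<dots> = (\<Sum>p\<in>P. \<integral>\<^sup>+x. ennreal (norm (?T p x) powr (2/3)) \<partial>lborel)"
    by (rule nn_integral_sum) (use meas in auto)
  also have "\<dots> \<le> (\<Sum>p\<in>P. ennreal (?B p))" by (rule sum_mono) (rule one)
  also have "\<dots> = ennreal (\<Sum>p\<in>P. ?B p)" by (rule sum_ennreal) auto
  finally show ?thesis .
qed

context multiscale begin

text \<open>The interpolant of level \<open>K\<close>, written as its telescoping sum and truncated to a box. The parameter \<open>K\<close> controls both
the number of levels and the size of the box.\<close>
definition approximant :: "nat \<Rightarrow> 'a \<Rightarrow> complex"
  where "approximant K z = (if z \<in> box_set K then
     \<Sum>l\<le>K. \<Sum>\<alpha>\<in>idx. multiscale_coeff M s m l (corner (scale l) z) \<alpha> * bump M (scale l) \<alpha> (z - (corner (scale l) z + s l)) else 0)"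

lemma approximant_error:
  assumes "z \<in> box_set K"
  shows "norm (m z - approximant K z) \<le> approx_const DIM('a) M C0 * (scale (Suc K)) ^ M"
  using assms level_interp_error[of z "corner (scale K) z" K] mem_cube_corner[of "scale K" z]
  by (simp add: approximant_def telescope)

lemma approximant_bound: "norm (approximant K z) \<le> C0 + approx_const DIM('a) M C0"
proof (cases "z \<in> box_set K")
  case True
  have "approx_const DIM('a) M C0 * (scale (Suc K)) ^ M \<le> approx_const DIM('a) M C0 * 1"
  proof (intro mult_left_mono power_le_one)
    have "(1::real) \<le> 2 ^ Suc K" by (rule one_le_power) simp
    then show "scale (Suc K) \<le> 1" by simp
  qed (use C0_le_err C0_nonneg in auto)
  then have "norm (m z - approximant K z) \<le> approx_const DIM('a) M C0" using approximant_error[OF True] by linarith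
  then have "norm (approximant K z) \<le> norm (m z) + approx_const DIM('a) M C0"
    using norm_triangle_ineq4[of "m z" "m z - approximant K z"] by simp
  then show ?thesis using bounded[of z] by linarith
next
  case False
  then show ?thesis using C0_le_err C0_nonneg by (simp add: approximant_def)
qed

end

lemma card_idx: "card ((Basis::'a::euclidean_space set) \<rightarrow>\<^sub>E {..<M}) = M ^ DIM('a)"
  by (simp add: card_PiE)

lemma bump_measurable [measurable]:
  "bump M r \<alpha> \<in> borel_measurable borel"
  unfolding bump_def divide_inverse by (intro borel_measurable_continuous_onI continuous_intros)

definition local_bump :: "nat \<Rightarrow> nat \<Rightarrow> 'a::euclidean_space \<Rightarrow> ('a \<Rightarrow> nat) \<Rightarrow> 'a \<Rightarrow> complex"
  where "local_bump M l t \<alpha> \<xi> = bump M (scale l) \<alpha> (\<xi> - (corner (scale l) \<xi> + t))"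

lemma local_bump_measurable [measurable]: "local_bump M l t \<alpha> \<in> borel_measurable borel"
  unfolding local_bump_def by measurable

lemma local_bump_bound:
  fixes t :: "'a::euclidean_space"
  assumes M: "M > 0" and \<alpha>: "\<And>b. b \<in> Basis \<Longrightarrow> \<alpha> b < M"
    and t: "\<And>b. b \<in> Basis \<Longrightarrow> 0 \<le> t \<bullet> b \<and> t \<bullet> b < scale l / real M"
  shows "norm (local_bump M l t \<alpha> \<xi>) \<le> ((2 * real M) ^ M) ^ DIM('a)"
  unfolding local_bump_def by (rule norm_bump_le[OF M _ \<alpha> t mem_cube_corner]) auto

lemma sum_lattice_box_triple:
  fixes f :: "'a::euclidean_space \<times> 'b::euclidean_space \<times> 'c::euclidean_space \<Rightarrow> real"
  shows "(\<Sum>k\<in>lattice_box r K. f k) = (\<Sum>i\<in>lattice_box r K. \<Sum>j\<in>lattice_box r K. \<Sum>k\<in>lattice_box r K. f (i, j, k))"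
  by (simp add: lattice_box_prod[where 'a='a and 'b="'b \<times> 'c"] lattice_box_prod[where 'a='b and 'b="'c"] sum.cartesian_product')

text \<open>For each level \<open>l\<close> and each multi-index \<open>\<alpha>\<close> of nodes, the level is a sum over triples of cubes of products of local
bumps with disjoint supports, so \<open>trilinear_sum_bound\<close> applies. Its coefficients are bounded by \<open>coeff_bound\<close> and have
\<open>q\<close>-th powers summing to the bound of \<open>coeff_powr_sum\<close>. The resulting bounds form a geometric progression in \<open>l\<close>, and
there are \<open>M ^ (3 * d)\<close> multi-indices for each level.\<close>
lemma trilinear_approximant_bound:
  fixes m :: "'a::euclidean_space \<times> 'a \<times> 'a \<Rightarrow> complex" and f g h :: "'a \<Rightarrow> complex"
  assumes ms: "multiscale M s m C0"
    and q: "0 < q" "q < 3" and Mq: "real M * (3 - q) > real (3 * DIM('a))" and Nq: "Nq \<ge> 0"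
    and samp: "\<And>l. l \<le> K \<Longrightarrow> (\<Sum>k\<in>lattice_box (scale l) K. multiscale.sample_sum M s m q l k) \<le> (real M * 2 ^ l) ^ DIM('a \<times> 'a \<times> 'a) * Nq"
    and f: "integrable lborel (fourier f)" "(\<integral>\<^sup>+x. ennreal ((norm (fourier f x))\<^sup>2) \<partial>lborel) \<le> ennreal U" "U \<ge> 0"
    and g: "integrable lborel (fourier g)" "(\<integral>\<^sup>+x. ennreal ((norm (fourier g x))\<^sup>2) \<partial>lborel) \<le> ennreal V" "V \<ge> 0"
    and h: "integrable lborel (fourier h)" "(\<integral>\<^sup>+x. ennreal ((norm (fourier h x))\<^sup>2) \<partial>lborel) \<le> ennreal W" "W \<ge> 0"
  shows "(\<lambda>x. trilinear_op (multiscale.approximant M s m K) f g h x) \<in> borel_measurable borel" (is ?meas)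
    and "multiscale.approximant M s m K \<in> borel_measurable borel" (is ?meas')
    and "(\<integral>\<^sup>+x. ennreal (norm (trilinear_op (multiscale.approximant M s m K) f g h x) powr (2/3)) \<partial>lborel)
      \<le> ennreal (main_const DIM('a) M q C0 * (Nq powr (2/9) * (U * V * W) powr (1/3)))" (is ?bound)
proof -
  interpret multiscale M s m C0 by (rule ms)
  let ?d = "DIM('a)" and ?A = "(Basis :: ('a \<times> 'a \<times> 'a) set) \<rightarrow>\<^sub>E {..<M}"
  have dim: "DIM('a \<times> 'a \<times> 'a) = 3 * ?d" by simp
  let ?L = "((2 * real M) ^ M) ^ ?d"
  (* P indexes the pairs of a level and a multi-index of nodes, J p the cubes of the level in one of the three
     variables, and \<kappa> p sends a frequency to its cube *)
  define P where "P = {..K} \<times> ?A"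
  define J where "J = (\<lambda>p::nat \<times> ('a \<times> 'a \<times> 'a \<Rightarrow> nat). lattice_box (scale (fst p)) K :: 'a set)"
  define c where "c = (\<lambda>p i j k. multiscale_coeff M s m (fst p) (i, j, k) (snd p))"
  define \<phi>1 where "\<phi>1 = (\<lambda>p::nat \<times> ('a \<times> 'a \<times> 'a \<Rightarrow> nat). local_bump M (fst p) (fst (s (fst p))) (\<lambda>b::'a. snd p (b, 0)))"
  define \<phi>2 where "\<phi>2 = (\<lambda>p::nat \<times> ('a \<times> 'a \<times> 'a \<Rightarrow> nat). local_bump M (fst p) (fst (snd (s (fst p)))) (\<lambda>b::'a. snd p (0, b, 0)))"
  define \<phi>3 where "\<phi>3 = (\<lambda>p::nat \<times> ('a \<times> 'a \<times> 'a \<Rightarrow> nat). local_bump M (fst p) (snd (snd (s (fst p)))) (\<lambda>b::'a. snd p (0, 0, b)))"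
  define \<kappa> where "\<kappa> = (\<lambda>p::nat \<times> ('a \<times> 'a \<times> 'a \<Rightarrow> nat). corner (scale (fst p)) :: 'a \<Rightarrow> 'a)"
  have finP: "finite P" unfolding P_def using finite_idx by blast
  have finJ: "finite (J p)" for p unfolding J_def by (rule finite_lattice_box) simp
  have sb: "0 \<le> fst (s l) \<bullet> b \<and> fst (s l) \<bullet> b < scale l / real M"
    "0 \<le> fst (snd (s l)) \<bullet> b \<and> fst (snd (s l)) \<bullet> b < scale l / real M"
    "0 \<le> snd (snd (s l)) \<bullet> b \<and> snd (snd (s l)) \<bullet> b < scale l / real M" if "b \<in> Basis" for b :: 'a and l
    using s[of "(b, 0)" l] s[of "(0, b, 0)" l] s[of "(0, 0, b)" l] that by (auto simp: Basis_prod_def inner_prod_def zero_prod_def)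
  have idxb: "snd p (b, 0) < M" "snd p (0, b, 0) < M" "snd p (0, 0, b) < M" if "p \<in> P" "b \<in> Basis" for p and b :: 'a
    using that by (auto simp: P_def Basis_prod_def zero_prod_def PiE_iff)
  have \<phi>b: "norm (\<phi>1 p \<xi>) \<le> ?L" "norm (\<phi>2 p \<xi>) \<le> ?L" "norm (\<phi>3 p \<xi>) \<le> ?L" if "p \<in> P" for p \<xi>
    unfolding \<phi>1_def \<phi>2_def \<phi>3_def by (rule local_bump_bound[OF M]; use idxb[OF that] sb in blast)+
  have \<phi>m [measurable]: "\<phi>1 p \<in> borel_measurable borel" "\<phi>2 p \<in> borel_measurable borel" "\<phi>3 p \<in> borel_measurable borel" for p
    unfolding \<phi>1_def \<phi>2_def \<phi>3_def by measurable
  have \<kappa>m: "{x. \<kappa> p x = j} \<in> sets borel" for p j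
  proof -
    have "\<kappa> p \<in> borel_measurable borel" unfolding \<kappa>_def by measurable
    then have "\<kappa> p -` {j} \<inter> space borel \<in> sets borel" by (rule measurable_sets) simp
    then show ?thesis by (simp add: vimage_def)
  qed
  have [measurable]: "Measurable.pred borel (\<lambda>x. \<kappa> p x = j)" for p j using \<kappa>m by (simp add: pred_def)
  define e where "e = (\<lambda>\<phi> p j \<xi>. if \<kappa> p \<xi> = j then (\<phi> p \<xi> :: complex) else 0)"
  have em [measurable]: "e \<phi>1 p j \<in> borel_measurable borel" "e \<phi>2 p j \<in> borel_measurable borel" "e \<phi>3 p j \<in> borel_measurable borel" for p j
    unfolding e_def by measurable
  (* all summands of the approximant in a single finite index set *)
  define S where "S = Sigma P (\<lambda>p. J p \<times> J p \<times> J p)"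
  have app: "approximant K = (\<lambda>(\<xi>, \<eta>, \<delta>). \<Sum>t\<in>S. c (fst t) (fst (snd t)) (fst (snd (snd t))) (snd (snd (snd t)))
     * e \<phi>1 (fst t) (fst (snd t)) \<xi> * e \<phi>2 (fst t) (fst (snd (snd t))) \<eta> * e \<phi>3 (fst t) (snd (snd (snd t))) \<delta>)"
  proof (rule ext, clarify)
    fix \<xi> \<eta> \<delta> :: 'a
    have one: "(\<Sum>t\<in>J p \<times> J p \<times> J p. c p (fst t) (fst (snd t)) (snd (snd t)) * e \<phi>1 p (fst t) \<xi> * e \<phi>2 p (fst (snd t)) \<eta> * e \<phi>3 p (snd (snd t)) \<delta>)
      = (if (\<xi>, \<eta>, \<delta>) \<in> box_set K then multiscale_coeff M s m (fst p) (corner (scale (fst p)) (\<xi>, \<eta>, \<delta>)) (snd p)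
          * bump M (scale (fst p)) (snd p) ((\<xi>, \<eta>, \<delta>) - (corner (scale (fst p)) (\<xi>, \<eta>, \<delta>) + s (fst p))) else 0)" for p
    proof -
      let ?t = "(\<kappa> p \<xi>, \<kappa> p \<eta>, \<kappa> p \<delta>)"
      let ?v = "c p (\<kappa> p \<xi>) (\<kappa> p \<eta>) (\<kappa> p \<delta>) * \<phi>1 p \<xi> * \<phi>2 p \<eta> * \<phi>3 p \<delta>"
      have "(\<Sum>t\<in>J p \<times> J p \<times> J p. c p (fst t) (fst (snd t)) (snd (snd t)) * e \<phi>1 p (fst t) \<xi> * e \<phi>2 p (fst (snd t)) \<eta> * e \<phi>3 p (snd (snd t)) \<delta>)
        = (\<Sum>t\<in>J p \<times> J p \<times> J p. if t = ?t then ?v else 0)"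
        by (intro sum.cong refl) (auto simp: e_def)
      also have "\<dots> = (if ?t \<in> J p \<times> J p \<times> J p then ?v else 0)" using finJ[of p] by simp
      also have "?t \<in> J p \<times> J p \<times> J p \<longleftrightarrow> (\<xi>, \<eta>, \<delta>) \<in> box_set K"
        by (simp add: J_def \<kappa>_def lattice_box_def corner_box_set_iff corner_corner box_set_Pair)
      also have "?v = multiscale_coeff M s m (fst p) (corner (scale (fst p)) (\<xi>, \<eta>, \<delta>)) (snd p)
          * bump M (scale (fst p)) (snd p) ((\<xi>, \<eta>, \<delta>) - (corner (scale (fst p)) (\<xi>, \<eta>, \<delta>) + s (fst p)))"
      proof -
        obtain s1 s2 s3 where s3: "s (fst p) = (s1, s2, s3)" by (cases "s (fst p)") auto
        show ?thesis
          unfolding c_def \<kappa>_def \<phi>1_def \<phi>2_def \<phi>3_def local_bump_def corner_Pair s3 by (simp add: bump_Pair)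
      qed
      finally show ?thesis .
    qed
    have "approximant K (\<xi>, \<eta>, \<delta>) = (\<Sum>p\<in>P. if (\<xi>, \<eta>, \<delta>) \<in> box_set K then multiscale_coeff M s m (fst p) (corner (scale (fst p)) (\<xi>, \<eta>, \<delta>)) (snd p)
          * bump M (scale (fst p)) (snd p) ((\<xi>, \<eta>, \<delta>) - (corner (scale (fst p)) (\<xi>, \<eta>, \<delta>) + s (fst p))) else 0)"
      unfolding approximant_def P_def by (simp add: sum.cartesian_product')
    also have "\<dots> = (\<Sum>p\<in>P. \<Sum>t\<in>J p \<times> J p \<times> J p. c p (fst t) (fst (snd t)) (snd (snd t)) * e \<phi>1 p (fst t) \<xi> * e \<phi>2 p (fst (snd t)) \<eta> * e \<phi>3 p (snd (snd t)) \<delta>)"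
      by (simp only: one)
    also have "\<dots> = (\<Sum>t\<in>S. c (fst t) (fst (snd t)) (fst (snd (snd t))) (snd (snd (snd t)))
     * e \<phi>1 (fst t) (fst (snd t)) \<xi> * e \<phi>2 (fst t) (fst (snd (snd t))) \<eta> * e \<phi>3 (fst t) (snd (snd (snd t))) \<delta>)"
      unfolding S_def using finP finJ by (subst sum.Sigma) (auto simp: case_prod_beta)
    finally show "approximant K (\<xi>, \<eta>, \<delta>) = \<dots>" .
  qed
  define F where "F = (\<lambda>p j x. fourier (\<lambda>\<xi>. e \<phi>1 p j \<xi> * fourier f \<xi>) (- x))"
  define G where "G = (\<lambda>p j x. fourier (\<lambda>\<xi>. e \<phi>2 p j \<xi> * fourier g \<xi>) (- x))"
  define H where "H = (\<lambda>p j x. fourier (\<lambda>\<xi>. e \<phi>3 p j \<xi> * fourier h \<xi>) (- x))"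
  have L0: "?L \<ge> 0" by simp
  have T: "trilinear_op (approximant K) f g h x = (\<Sum>p\<in>P. \<Sum>i\<in>J p. \<Sum>j\<in>J p. \<Sum>k\<in>J p. c p i j k * F p i x * G p j x * H p k x)" for x
  proof -
    have "trilinear_op (approximant K) f g h x = (\<Sum>t\<in>S. c (fst t) (fst (snd t)) (fst (snd (snd t))) (snd (snd (snd t)))
     * F (fst t) (fst (snd t)) x * G (fst t) (fst (snd (snd t))) x * H (fst t) (snd (snd (snd t))) x)"
      unfolding app F_def G_def H_def
    proof (rule trilinear_op_tensor_sum[OF f(1) g(1) h(1), where L="?L"])
      fix t \<xi> assume "t \<in> S"
      then have t: "fst t \<in> P" by (auto simp: S_def)
      show "norm (e \<phi>1 (fst t) (fst (snd t)) \<xi>) \<le> ?L" "norm (e \<phi>2 (fst t) (fst (snd (snd t))) \<xi>) \<le> ?L" "norm (e \<phi>3 (fst t) (snd (snd (snd t))) \<xi>) \<le> ?L"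
        unfolding e_def using \<phi>b[OF t] L0 by auto
    qed simp_all
    also have "\<dots> = (\<Sum>p\<in>P. \<Sum>t\<in>J p \<times> J p \<times> J p. c p (fst t) (fst (snd t)) (snd (snd t)) * F p (fst t) x * G p (fst (snd t)) x * H p (snd (snd t)) x)"
      unfolding S_def using finP finJ by (subst sum.Sigma) (auto simp: case_prod_beta)
    finally show ?thesis by (simp add: sum.cartesian_product')
  qed
  have bes: "\<exists>w. bessel_family (J p) (\<lambda>j x. fourier (\<lambda>\<xi>. e \<phi> p j \<xi> * u \<xi>) (- x)) w \<and> sum w (J p) \<le> ?L\<^sup>2 * X"
    if "\<phi> p \<in> borel_measurable borel" "\<And>\<xi>. norm (\<phi> p \<xi>) \<le> ?L" "integrable lborel u" "(\<integral>\<^sup>+x. ennreal ((norm (u x))\<^sup>2) \<partial>lborel) \<le> ennreal X" "X \<ge> 0"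
    for \<phi> p u X
  proof (rule bessel_family_pieces[OF that(3,4,5,1,2) \<kappa>m[of p] finJ[of p]])
    fix w assume "bessel_family (J p) (\<lambda>j x. fourier (\<lambda>\<xi>. (if \<kappa> p \<xi> = j then \<phi> p \<xi> else 0) * u \<xi>) (- x)) w" "sum w (J p) \<le> ?L\<^sup>2 * X"
    then show ?thesis unfolding e_def by (intro exI[of _ w] conjI)
  qed
  have bF: "\<exists>w. bessel_family (J p) (F p) w \<and> sum w (J p) \<le> ?L\<^sup>2 * U" if "p \<in> P" for p
    unfolding F_def by (rule bes[where \<phi>=\<phi>1, OF \<phi>m(1) \<phi>b(1)[OF that] f])
  have bG: "\<exists>w. bessel_family (J p) (G p) w \<and> sum w (J p) \<le> ?L\<^sup>2 * V" if "p \<in> P" for p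
    unfolding G_def by (rule bes[where \<phi>=\<phi>2, OF \<phi>m(2) \<phi>b(2)[OF that] g])
  have bH: "\<exists>w. bessel_family (J p) (H p) w \<and> sum w (J p) \<le> ?L\<^sup>2 * W" if "p \<in> P" for p
    unfolding H_def by (rule bes[where \<phi>=\<phi>3, OF \<phi>m(3) \<phi>b(3)[OF that] h])
  have FGHm [measurable]: "F p j \<in> borel_measurable borel" "G p j \<in> borel_measurable borel" "H p j \<in> borel_measurable borel" for p j
  proof -
    have [measurable]: "fourier f \<in> borel_measurable borel" "fourier g \<in> borel_measurable borel" "fourier h \<in> borel_measurable borel"
      using f g h by (auto dest: borel_measurable_integrable)
    show "F p j \<in> borel_measurable borel" "G p j \<in> borel_measurable borel" "H p j \<in> borel_measurable borel"
      unfolding F_def G_def H_def by measurable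
  qed
  show ?meas unfolding T by measurable
  show ?meas' unfolding app case_prod_beta borel_prod[symmetric] by measurable
  have cA: "norm (c p i j k) \<le> approx_const (3 * ?d) M C0 * (scale (fst p)) ^ M" if "p \<in> P" "i \<in> J p" "j \<in> J p" "k \<in> J p" for p i j k
  proof -
    have "snd p \<in> ?A" using that by (auto simp: P_def)
    moreover have "corner (scale (fst p)) (i, j, k) = (i, j, k)" using that by (auto simp: J_def lattice_box_def corner_Pair)
    ultimately show ?thesis using coeff_bound[of "snd p" "fst p" "(i, j, k)"] unfolding c_def dim by simp
  qed
  have cQ: "(\<Sum>i\<in>J p. \<Sum>j\<in>J p. \<Sum>k\<in>J p. norm (c p i j k) powr q) \<le> level_const (3 * ?d) M q * (2 ^ fst p) ^ (3 * ?d) * Nq" if p: "p \<in> P" for p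
  proof -
    have p': "snd p \<in> ?A" "fst p \<le> K" using p by (auto simp: P_def)
    have "(\<Sum>i\<in>J p. \<Sum>j\<in>J p. \<Sum>k\<in>J p. norm (c p i j k) powr q) = (\<Sum>k\<in>lattice_box (scale (fst p)) K. norm (multiscale_coeff M s m (fst p) k (snd p)) powr q)"
      unfolding J_def c_def by (rule sum_lattice_box_triple[symmetric])
    also have "\<dots> \<le> 2 powr q * (1 + ((((2 * real M) ^ M) ^ DIM('a \<times> 'a \<times> 'a)) * real (card ?A)) powr q) * real M ^ DIM('a \<times> 'a \<times> 'a) * (2 ^ fst p) ^ DIM('a \<times> 'a \<times> 'a) * Nq"
      by (rule coeff_powr_sum[OF q(1) p' samp])
    finally show ?thesis unfolding level_const_def card_idx dim by simp
  qed
  have "(\<integral>\<^sup>+x. ennreal (norm (trilinear_op (approximant K) f g h x) powr (2/3)) \<partial>lborel)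
    \<le> ennreal (\<Sum>p\<in>P. 4 * ((approx_const (3 * ?d) M C0 * (scale (fst p)) ^ M) powr (2 - 2*q/3) * (level_const (3 * ?d) M q * (2 ^ fst p) ^ (3 * ?d) * Nq) powr (2/3) * (?L\<^sup>2 * U) * (?L\<^sup>2 * V) * (?L\<^sup>2 * W)) powr (1/3))"
    unfolding T using f g h
    by (intro trilinear_bound_pieces[OF finP bF bG bH cA cQ q]) auto
  also have "(\<Sum>p\<in>P. 4 * ((approx_const (3 * ?d) M C0 * (scale (fst p)) ^ M) powr (2 - 2*q/3) * (level_const (3 * ?d) M q * (2 ^ fst p) ^ (3 * ?d) * Nq) powr (2/3) * (?L\<^sup>2 * U) * (?L\<^sup>2 * V) * (?L\<^sup>2 * W)) powr (1/3))
    = (\<Sum>p\<in>P. piece_const ?d M q C0 * decay_ratio (3*?d) M q ^ fst p * (Nq powr (2/9) * (U * V * W) powr (1/3)))"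
    by (intro sum.cong refl level_powr_eq C0_nonneg Nq f g h)
  also have "\<dots> = real M ^ (3 * ?d) * (\<Sum>l\<le>K. piece_const ?d M q C0 * decay_ratio (3*?d) M q ^ l * (Nq powr (2/9) * (U * V * W) powr (1/3)))"
  proof -
    have "real (card ?A) = real M ^ (3 * ?d)" unfolding card_idx dim by simp
    then show ?thesis unfolding P_def sum.cartesian_product' by (simp add: sum_distrib_left)
  qed
  also have "\<dots> = real M ^ (3 * ?d) * piece_const ?d M q C0 * (Nq powr (2/9) * (U * V * W) powr (1/3)) * (\<Sum>l\<le>K. decay_ratio (3*?d) M q ^ l)"
    by (simp add: sum_distrib_left sum_distrib_right mult_ac)
  also have "ennreal \<dots> \<le> ennreal (real M ^ (3 * ?d) * piece_const ?d M q C0 * (Nq powr (2/9) * (U * V * W) powr (1/3)) * (1 / (1 - decay_ratio (3*?d) M q)))"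
  proof (intro ennreal_leI mult_left_mono)
    let ?r = "decay_ratio (3*?d) M q"
    have r: "0 \<le> ?r" "?r < 1" using decay_ratio_less_1[OF Mq] by (auto simp: decay_ratio_def)
    have "(\<Sum>l\<le>K. ?r ^ l) \<le> (\<Sum>l. ?r ^ l)"
      using r by (intro sum_le_suminf summable_geometric) auto
    then show "(\<Sum>l\<le>K. ?r ^ l) \<le> 1 / (1 - ?r)" using r by (simp add: suminf_geometric)
    show "0 \<le> real M ^ (3 * ?d) * piece_const ?d M q C0 * (Nq powr (2/9) * (U * V * W) powr (1/3))"
      by (simp add: piece_const_def)
  qed
  finally show ?bound by (simp add: main_const_def mult_ac)
qed

section \<open>The bound for exponents below three\<close>

lemma schwartz_square_integrable:
  fixes f :: "'a::euclidean_space \<Rightarrow> complex"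
  assumes f: "schwartz f"
  obtains U where "U \<ge> 0" "(\<integral>\<^sup>+x. ennreal ((norm (f x))\<^sup>2) \<partial>lborel) = ennreal U"
proof -
  obtain C where C: "C \<ge> 0" "\<And>x. norm (f x) \<le> C / (1 + norm x) ^ 0" using schwartz_decay[OF f, of 0] by metis
  have i: "integrable lborel f" by (rule schwartz_integrable[OF f])
  have "integrable lborel (\<lambda>x. f x * f x)"
    by (rule integrable_mult_bounded[OF i, where B=C]) (use C f in \<open>auto dest: schwartz_measurable\<close>)
  then have "integrable lborel (\<lambda>x. norm (f x * f x))" by (rule integrable_norm)
  then have "integrable lborel (\<lambda>x. (norm (f x))\<^sup>2)" by (simp add: norm_mult power2_eq_square)
  then have "(\<integral>\<^sup>+x. ennreal ((norm (f x))\<^sup>2) \<partial>lborel) = ennreal (LINT x|lborel. (norm (f x))\<^sup>2)"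
    by (intro nn_integral_eq_integral) auto
  moreover have "(LINT x|lborel. (norm (f x))\<^sup>2) \<ge> 0" by simp
  ultimately show ?thesis by (rule that[rotated])
qed

lemma ennpowr_ennreal: "a \<ge> 0 \<Longrightarrow> ennpowr (ennreal a) p = ennreal (a powr p)"
  by (simp add: ennpowr_def)

lemma ennpowr_mono:
  assumes "a \<le> b" "p \<ge> 0" shows "ennpowr a p \<le> ennpowr b p"
proof (cases "b = \<infinity>")
  case False
  then have "a < \<infinity>" "b < \<infinity>" using assms(1) by (auto simp: less_top order.strict_trans1)
  then show ?thesis using assms by (auto simp: ennpowr_def intro!: ennreal_leI powr_mono2 enn2real_mono)
qed (simp add: ennpowr_def)

lemma Lp_norm_eq:
  assumes "(\<integral>\<^sup>+x. ennreal (norm (f x) powr p) \<partial>lborel) = ennreal X" "X \<ge> 0"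
  shows "Lp_norm p f = ennreal (X powr (1 / p))"
  unfolding Lp_norm_def assms(1) using assms(2) by (rule ennpowr_ennreal)

lemma Lp_norm_2_eq:
  assumes "(\<integral>\<^sup>+x. ennreal ((norm (f x))\<^sup>2) \<partial>lborel) = ennreal U" "U \<ge> 0"
  shows "Lp_norm 2 f = ennreal (U powr (1/2))"
  by (rule Lp_norm_eq) (use assms in \<open>simp_all add: powr_numeral\<close>)

text \<open>A continuous function exceeding \<open>C\<close> somewhere does so on an open set, which has positive measure.\<close>
lemma Linf_norm_pointwise:
  fixes f :: "'a::euclidean_space \<Rightarrow> complex"
  assumes f: "continuous_on UNIV f" and le: "Linf_norm f \<le> ennreal C" and C: "C \<ge> 0"
  shows "norm (f x) \<le> C"
proof (rule ccontr)
  assume "\<not> norm (f x) \<le> C"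
  let ?S = "{x. C < norm (f x)}"
  have op: "open ?S" using f by (intro open_Collect_less continuous_intros) auto
  have fm: "f \<in> borel_measurable borel" using f by (rule borel_measurable_continuous_onI)
  have "AE x in lborel. ennreal (norm (f x)) \<le> Linf_norm f"
    unfolding Linf_norm_def by (rule esssup_AE)
  then have "AE x in lborel. x \<notin> ?S"
  proof (rule eventually_mono)
    fix x assume "ennreal (norm (f x)) \<le> Linf_norm f"
    then have "ennreal (norm (f x)) \<le> ennreal C" using le by (rule order_trans)
    then show "x \<notin> ?S" using C by simp
  qed
  then have "emeasure lborel ?S = 0"
    using op by (subst (asm) AE_iff_measurable[of ?S]) auto
  then have "?S \<in> null_sets lborel" using op by auto
  then have "negligible ?S" unfolding negligible_iff_null_sets by (rule null_sets_completionI)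
  moreover have "x \<in> ?S" using \<open>\<not> norm (f x) \<le> C\<close> by simp
  ultimately show False using open_not_negligible[OF op] by blast
qed

text \<open>The approximants converge boundedly to \<open>m\<close>, so the operators converge pointwise by dominated convergence and the
Fatou lemma carries the uniform bound to the limit.\<close>
lemma trilinear_main_estimate:
  fixes m :: "'a::euclidean_space \<times> 'a \<times> 'a \<Rightarrow> complex" and f g h :: "'a \<Rightarrow> complex"
  assumes M: "M > 0" and q: "0 < q" "q < 3" and Mq: "real M * (3 - q) > real (3 * DIM('a))"
    and Ck: "Ck M m" and deriv: "\<And>b x. b \<in> Basis \<Longrightarrow> norm (iter_deriv (replicate M b) m x) \<le> C0"
    and bounded: "\<And>x. norm (m x) \<le> C0"
    and Nq: "(\<integral>\<^sup>+x. ennreal (norm (m x) powr q) \<partial>lborel) = ennreal Nq" "Nq \<ge> 0"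
    and f: "schwartz f" "(\<integral>\<^sup>+x. ennreal ((norm (f x))\<^sup>2) \<partial>lborel) = ennreal U" "U \<ge> 0"
    and g: "schwartz g" "(\<integral>\<^sup>+x. ennreal ((norm (g x))\<^sup>2) \<partial>lborel) = ennreal V" "V \<ge> 0"
    and h: "schwartz h" "(\<integral>\<^sup>+x. ennreal ((norm (h x))\<^sup>2) \<partial>lborel) = ennreal W" "W \<ge> 0"
  shows "(\<integral>\<^sup>+x. ennreal (norm (trilinear_op m f g h x) powr (2/3)) \<partial>lborel)
      \<le> ennreal (main_const DIM('a) M q C0 * (Nq powr (2/9) * (U * V * W) powr (1/3)))"
proof -
  have "continuous_on UNIV m" using Ck unfolding Ck_def by (metis empty_subsetI iter_deriv_Nil le0 list.size(3) set_empty)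
  then have mm: "m \<in> borel_measurable borel" by (rule borel_measurable_continuous_onI)
  have "\<forall>K l. \<exists>s. (\<forall>b\<in>Basis. 0 \<le> s \<bullet> b \<and> s \<bullet> b < scale l / real M) \<and>
    (\<Sum>k\<in>lattice_box (scale l) K. \<Sum>\<alpha>\<in>Basis \<rightarrow>\<^sub>E {..<M}. norm (m (node M (scale l) (k + s) \<alpha>)) powr q) \<le> (real M * 2 ^ l) ^ DIM('a \<times> 'a \<times> 'a) * Nq"
    using shift_exists[OF mm M Nq] by metis
  then obtain s where s: "\<And>K l b. b \<in> Basis \<Longrightarrow> 0 \<le> s K l \<bullet> b \<and> s K l \<bullet> b < scale l / real M"
    "\<And>K l. (\<Sum>k\<in>lattice_box (scale l) K. \<Sum>\<alpha>\<in>Basis \<rightarrow>\<^sub>E {..<M}. norm (m (node M (scale l) (k + s K l) \<alpha>)) powr q) \<le> (real M * 2 ^ l) ^ DIM('a \<times> 'a \<times> 'a) * Nq"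
    by metis
  have ms: "multiscale M (s K) m C0" for K
    by unfold_locales (use M s Ck deriv bounded in auto)
  let ?m = "\<lambda>K. multiscale.approximant M (s K) m K"
  have samp: "(\<Sum>k\<in>lattice_box (scale l) K. multiscale.sample_sum M (s K) m q l k) \<le> (real M * 2 ^ l) ^ DIM('a \<times> 'a \<times> 'a) * Nq" for K l
    unfolding multiscale.sample_sum_def[OF ms] by (rule s(2))
  note fi = fourier_schwartz_integrable[OF f(1)] and gi = fourier_schwartz_integrable[OF g(1)] and hi = fourier_schwartz_integrable[OF h(1)]
  note fb = plancherel_le[OF schwartz_integrable[OF f(1)], unfolded f(2)]
    and gb = plancherel_le[OF schwartz_integrable[OF g(1)], unfolded g(2)]
    and hb = plancherel_le[OF schwartz_integrable[OF h(1)], unfolded h(2)]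
  note bound = trilinear_approximant_bound[OF ms q Mq Nq(2) samp fi fb f(3) gi gb g(3) hi hb h(3)]
  have lim: "(\<lambda>K. trilinear_op (?m K) f g h x) \<longlonglongrightarrow> trilinear_op m f g h x" for x
  proof (rule trilinear_op_tendsto[OF fi gi hi bound(2) mm])
    show "norm (?m K z) \<le> C0 + approx_const DIM('a \<times> 'a \<times> 'a) M C0" for K z
      by (rule multiscale.approximant_bound[OF ms])
    fix z
    have "(\<lambda>K. m z - ?m K z) \<longlonglongrightarrow> 0"
    proof (rule Lim_null_comparison)
      obtain N :: nat where N: "norm z < real N" using reals_Archimedean2 by blast
      show "\<forall>\<^sub>F K in sequentially. norm (m z - ?m K z) \<le> approx_const DIM('a \<times> 'a \<times> 'a) M C0 * (scale (Suc K)) ^ M"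
      proof (rule eventually_sequentiallyI[of N])
        fix K assume "K \<ge> N"
        have "z \<in> box_set K"
          unfolding box_set_def
        proof (intro CollectI ballI)
          fix b :: "'a \<times> 'a \<times> 'a" assume "b \<in> Basis"
          then have "\<bar>z \<bullet> b\<bar> \<le> norm z" by (rule Basis_le_norm)
          then show "- real K \<le> z \<bullet> b \<and> z \<bullet> b < real K" using N \<open>K \<ge> N\<close> by (auto simp: abs_le_iff)
        qed
        then show "norm (m z - ?m K z) \<le> approx_const DIM('a \<times> 'a \<times> 'a) M C0 * (scale (Suc K)) ^ M"
          by (rule multiscale.approximant_error[OF ms])
      qed
      have "(\<lambda>K. scale (Suc K)) \<longlonglongrightarrow> 0" using LIMSEQ_Suc[OF LIMSEQ_power_zero[of "1/2::real"]] by (simp add: power_one_over)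
      then have "(\<lambda>K. approx_const DIM('a \<times> 'a \<times> 'a) M C0 * (scale (Suc K)) ^ M) \<longlonglongrightarrow> approx_const DIM('a \<times> 'a \<times> 'a) M C0 * 0 ^ M" by (intro tendsto_intros)
      then show "(\<lambda>K. approx_const DIM('a \<times> 'a \<times> 'a) M C0 * (scale (Suc K)) ^ M) \<longlonglongrightarrow> 0" using M by (simp add: power_0_left)
    qed
    from tendsto_diff[OF tendsto_const[of "m z"] this] show "(\<lambda>K. ?m K z) \<longlonglongrightarrow> m z" by simp
  qed
  show ?thesis
  proof (rule nn_integral_le_of_tendsto)
    show "(\<lambda>x. ennreal (norm (trilinear_op (?m K) f g h x) powr (2/3))) \<in> borel_measurable lborel" for K
      using bound(1)[of K] by simp
    show "(\<lambda>K. ennreal (norm (trilinear_op (?m K) f g h x) powr (2/3))) \<longlonglongrightarrow> ennreal (norm (trilinear_op m f g h x) powr (2/3))" for x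
      by (intro tendsto_ennrealI tendsto_powr2 tendsto_norm lim tendsto_const) auto
    show "(\<integral>\<^sup>+x. ennreal (norm (trilinear_op (?m K) f g h x) powr (2/3)) \<partial>lborel) \<le> ennreal (main_const DIM('a) M q C0 * (Nq powr (2/9) * (U * V * W) powr (1/3)))" for K
      by (rule bound(3))
  qed
qed

text \<open>Raise the main estimate to the power \<open>3/2\<close>: the exponents \<open>2/9\<close> and \<open>1/3\<close> become \<open>1/3\<close> and \<open>1/2\<close>.\<close>
lemma op_norm_le_Lp_norm:
  fixes m :: "'a::euclidean_space \<times> 'a \<times> 'a \<Rightarrow> complex"
  assumes M: "M > 0" and q: "0 < q" "q < 3" and Mq: "real M * (3 - q) > real (3 * DIM('a))"
    and m: "in_Lp q m" and Ck: "Ck M m" and C0: "C0 \<ge> 0"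
    and deriv: "\<And>bs. set bs \<subseteq> Basis \<Longrightarrow> length bs \<le> M \<Longrightarrow> Linf_norm (iter_deriv bs m) \<le> ennreal C0"
  shows "op_norm m \<le> ennreal (main_const DIM('a) M q C0 powr (3/2)) * ennpowr (Lp_norm q m) (q / 3)"
proof -
  let ?C = "main_const DIM('a) M q C0"
  have C: "?C \<ge> 0" by (rule main_const_nonneg[OF Mq])
  have pw: "norm (iter_deriv bs m x) \<le> C0" if "set bs \<subseteq> Basis" "length bs \<le> M" for bs x
    by (rule Linf_norm_pointwise[OF _ deriv[OF that] C0]) (use Ck that in \<open>simp add: Ck_def\<close>)
  define Nq where "Nq = enn2real (\<integral>\<^sup>+x. ennreal (norm (m x) powr q) \<partial>lborel)"
  have Nq0: "Nq \<ge> 0" by (simp add: Nq_def)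
  have "(\<integral>\<^sup>+x. ennreal (norm (m x) powr q) \<partial>lborel) \<noteq> \<infinity>"
    using m by (auto simp: in_Lp_def Lp_norm_def ennpowr_def)
  then have Nq: "(\<integral>\<^sup>+x. ennreal (norm (m x) powr q) \<partial>lborel) = ennreal Nq"
    by (simp add: Nq_def less_top)
  have nm: "ennpowr (Lp_norm q m) (q / 3) = ennreal (Nq powr (1/3))"
    unfolding Lp_norm_eq[OF Nq Nq0] using q by (simp add: ennpowr_ennreal powr_powr)
  show ?thesis
    unfolding op_norm_def nm
  proof (rule Inf_lower, rule CollectI, intro conjI allI impI)
    show "ennreal (?C powr (3/2)) * ennreal (Nq powr (1/3)) < \<infinity>" by (simp add: ennreal_mult_less_top)
    fix f g h :: "'a \<Rightarrow> complex" assume "schwartz f \<and> schwartz g \<and> schwartz h"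
    then have S: "schwartz f" "schwartz g" "schwartz h" by auto
    obtain U where U: "U \<ge> 0" "(\<integral>\<^sup>+x. ennreal ((norm (f x))\<^sup>2) \<partial>lborel) = ennreal U" using schwartz_square_integrable[OF S(1)] .
    obtain V where V: "V \<ge> 0" "(\<integral>\<^sup>+x. ennreal ((norm (g x))\<^sup>2) \<partial>lborel) = ennreal V" using schwartz_square_integrable[OF S(2)] .
    obtain W where W: "W \<ge> 0" "(\<integral>\<^sup>+x. ennreal ((norm (h x))\<^sup>2) \<partial>lborel) = ennreal W" using schwartz_square_integrable[OF S(3)] .
    have "(\<integral>\<^sup>+x. ennreal (norm (trilinear_op m f g h x) powr (2/3)) \<partial>lborel) \<le> ennreal (?C * (Nq powr (2/9) * (U * V * W) powr (1/3)))"
    proof (rule trilinear_main_estimate[OF M q Mq Ck _ _ Nq Nq0 S(1) U(2,1) S(2) V(2,1) S(3) W(2,1)])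
      show "norm (iter_deriv (replicate M b) m x) \<le> C0" if "b \<in> Basis" for b x
        using that by (intro pw) (auto simp: set_replicate_conv_if)
      show "norm (m x) \<le> C0" for x using pw[of "[]"] by simp
    qed
    then have "Lp_norm (2/3) (trilinear_op m f g h) \<le> ennpowr (ennreal (?C * (Nq powr (2/9) * (U * V * W) powr (1/3)))) (3/2)"
      unfolding Lp_norm_def by simp (rule ennpowr_mono, simp_all)
    also have "\<dots> = ennreal ((?C * (Nq powr (2/9) * (U * V * W) powr (1/3))) powr (3/2))"
      using C by (intro ennpowr_ennreal) auto
    also have "(?C * (Nq powr (2/9) * (U * V * W) powr (1/3))) powr (3/2) = ?C powr (3/2) * Nq powr (1/3) * U powr (1/2) * V powr (1/2) * W powr (1/2)"
      by (simp add: powr_mult powr_powr)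
    also have "ennreal \<dots> = ennreal (?C powr (3/2)) * ennreal (Nq powr (1/3)) * Lp_norm 2 f * Lp_norm 2 g * Lp_norm 2 h"
      unfolding Lp_norm_2_eq[OF U(2,1)] Lp_norm_2_eq[OF V(2,1)] Lp_norm_2_eq[OF W(2,1)] by (simp add: ennreal_mult)
    finally show "Lp_norm (2/3) (trilinear_op m f g h) \<le> ennreal (?C powr (3/2)) * ennreal (Nq powr (1/3)) * Lp_norm 2 f * Lp_norm 2 g * Lp_norm 2 h" .
  qed
qed

text \<open>The choice of \<open>M\<close> guarantees \<open>M * (3 - q) > 3 * d\<close>, and \<open>main_const\<close> depends on \<open>d\<close>, \<open>M\<close>, \<open>q\<close> and \<open>C0\<close> only.\<close>
lemma op_norm_uniform_bound:
  fixes q :: real and C0 :: ennreal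
  assumes q: "1 \<le> q" "q < 3" and C0: "C0 < \<infinity>"
  shows "\<exists>C::ennreal. C < \<infinity> \<and> (\<forall>m :: (real^'d) \<times> (real^'d) \<times> (real^'d) \<Rightarrow> complex.
                let M = nat \<lfloor>3 * real CARD('d) / (3 - q)\<rfloor> + 1 in
                in_Lp q m \<and> Ck M m \<and>
                (\<forall>bs. set bs \<subseteq> Basis \<and> length bs \<le> M \<longrightarrow> Linf_norm (iter_deriv bs m) \<le> C0) \<longrightarrow>
                op_norm m \<le> C * ennpowr (Lp_norm q m) (q / 3))"
proof -
  let ?M = "nat \<lfloor>3 * real CARD('d) / (3 - q)\<rfloor> + 1"
  let ?c = "enn2real C0"
  have cC: "ennreal ?c = C0" using C0 by simp
  have Mq: "real ?M * (3 - q) > real (3 * DIM(real^'d))"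
  proof -
    have "3 * real CARD('d) / (3 - q) \<ge> 0" using q by simp
    then have "real ?M > 3 * real CARD('d) / (3 - q)" by linarith
    then show ?thesis using q by (simp add: pos_divide_less_eq)
  qed
  show ?thesis
    unfolding Let_def
  proof (intro exI[of _ "ennreal (main_const DIM(real^'d) ?M q ?c powr (3/2))"] conjI allI impI)
    fix m :: "(real^'d) \<times> (real^'d) \<times> (real^'d) \<Rightarrow> complex"
    assume m: "in_Lp q m \<and> Ck ?M m \<and> (\<forall>bs. set bs \<subseteq> Basis \<and> length bs \<le> ?M \<longrightarrow> Linf_norm (iter_deriv bs m) \<le> C0)"
    show "op_norm m \<le> ennreal (main_const DIM(real^'d) ?M q ?c powr (3/2)) * ennpowr (Lp_norm q m) (q / 3)"
      by (rule op_norm_le_Lp_norm[OF _ _ q(2) Mq]) (use m q cC in auto)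
  qed simp
qed

section \<open>Families of Gaussian type and smooth series\<close>

text \<open>Polynomials in \<open>z/L\<close> whose coefficients depend on \<open>L\<close> but stay bounded for \<open>L \<ge> 1\<close>. Differentiation in \<open>z\<close> produces
factors \<open>1/L \<le> 1\<close>, so the class is closed under it, and this is what makes all derivatives of the functions
below bounded uniformly in \<open>L\<close>.\<close>
inductive scaled_poly :: "(real \<Rightarrow> 'a::euclidean_space \<Rightarrow> complex) \<Rightarrow> bool" where
  const: "(\<And>L. L \<ge> 1 \<Longrightarrow> norm (c L) \<le> B) \<Longrightarrow> scaled_poly (\<lambda>L z. c L)"
| lin: "scaled_poly (\<lambda>L z. complex_of_real ((z \<bullet> v) / L))"
| add: "scaled_poly p \<Longrightarrow> scaled_poly q \<Longrightarrow> scaled_poly (\<lambda>L z. p L z + q L z)"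
| mult: "scaled_poly p \<Longrightarrow> scaled_poly q \<Longrightarrow> scaled_poly (\<lambda>L z. p L z * q L z)"

lemma scaled_poly_derivative:
  assumes "scaled_poly p"
  shows "\<exists>p'. scaled_poly p' \<and> (\<forall>L z. ((\<lambda>t. p L (z + t *\<^sub>R b)) has_vector_derivative p' L z) (at 0))"
  using assms
proof induction
  case (const c B)
  have "scaled_poly (\<lambda>L z::'a. 0)" by (rule scaled_poly.const[of _ 0]) simp
  then show ?case by (intro exI[of _ "\<lambda>L z. 0"]) simp
next
  case (lin v)
  have "scaled_poly (\<lambda>L z::'a. complex_of_real ((b \<bullet> v) / L))"
  proof (rule scaled_poly.const[of _ "\<bar>b \<bullet> v\<bar>"])
    fix L :: real assume "L \<ge> 1"
    then show "norm (complex_of_real ((b \<bullet> v) / L)) \<le> \<bar>b \<bullet> v\<bar>"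
      unfolding norm_of_real abs_divide by (intro divide_le_eq[THEN iffD2]) (auto simp: mult_le_cancel_left1)
  qed
  moreover have "((\<lambda>t. complex_of_real (((z + t *\<^sub>R b) \<bullet> v) / L)) has_vector_derivative complex_of_real ((b \<bullet> v) / L)) (at 0)" for L :: real and z :: 'a
  proof -
    have "((\<lambda>t. x + t * k) has_real_derivative k) (at 0)" for x k :: real
      by (auto intro!: derivative_eq_intros)
    then have "((\<lambda>t. ((z + t *\<^sub>R b) \<bullet> v) / L) has_real_derivative (b \<bullet> v) / L) (at 0)"
      unfolding inner_add_left inner_scaleR_left add_divide_distrib times_divide_eq_right[symmetric] .
    then show ?thesis by (intro has_vector_derivative_of_real) (simp add: has_real_derivative_iff_has_vector_derivative)
  qed
  ultimately show ?case by (intro exI[of _ "\<lambda>L z. complex_of_real ((b \<bullet> v) / L)"]) simp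
next
  case (add p q)
  then obtain p' q' where "scaled_poly p'" "scaled_poly q'"
    and "\<And>L z. ((\<lambda>t. p L (z + t *\<^sub>R b)) has_vector_derivative p' L z) (at 0)" "\<And>L z. ((\<lambda>t. q L (z + t *\<^sub>R b)) has_vector_derivative q' L z) (at 0)" by blast
  then show ?case
    by (intro exI[of _ "\<lambda>L z. p' L z + q' L z"] conjI allI scaled_poly.add has_vector_derivative_add)
next
  case (mult p q)
  then obtain p' q' where p': "scaled_poly p'" "scaled_poly q'"
    and d: "\<And>L z. ((\<lambda>t. p L (z + t *\<^sub>R b)) has_vector_derivative p' L z) (at 0)" "\<And>L z. ((\<lambda>t. q L (z + t *\<^sub>R b)) has_vector_derivative q' L z) (at 0)" by blast
  have "((\<lambda>t. p L (z + t *\<^sub>R b) * q L (z + t *\<^sub>R b)) has_vector_derivative p L z * q' L z + p' L z * q L z) (at 0)" for L z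
    using has_vector_derivative_mult[OF d(1)[of L z] d(2)[of L z]] by simp
  then show ?case using mult p'
    by (intro exI[of _ "\<lambda>L z. p L z * q' L z + p' L z * q L z"] conjI allI scaled_poly.add scaled_poly.mult)
qed

lemma scaled_poly_continuous: "scaled_poly p \<Longrightarrow> continuous_on UNIV (p L)"
proof (induction rule: scaled_poly.induct)
  case (lin v)
  then show ?case unfolding divide_inverse by (intro continuous_intros)
qed (auto intro!: continuous_intros)

lemma scaled_poly_bound:
  assumes "scaled_poly p"
  shows "\<exists>K k. K \<ge> 0 \<and> (\<forall>L z. L \<ge> 1 \<longrightarrow> norm (p L z) \<le> K * (1 + norm z / L) ^ k)"
  using assms
proof induction
  case (const c B)
  have "B \<ge> 0" using const[of 1] order_trans[OF norm_ge_zero] by simp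
  then show ?case using const by (intro exI[of _ B] exI[of _ 0]) auto
next
  case (lin v)
  have "norm (complex_of_real ((z \<bullet> v) / L)) \<le> norm v * (1 + norm z / L) ^ 1" if L: "L \<ge> 1" for L :: real and z :: 'a
  proof -
    have "\<bar>z \<bullet> v\<bar> / L \<le> (norm z * norm v) / L" using L Cauchy_Schwarz_ineq2[of z v] by (intro divide_right_mono) auto
    also have "\<dots> = norm v * (norm z / L)" by simp
    also have "\<dots> \<le> norm v * (1 + norm z / L) ^ 1" by (intro mult_left_mono) auto
    finally show ?thesis unfolding norm_of_real abs_divide using L by simp
  qed
  then show ?case by (intro exI[of _ "norm v"] exI[of _ 1]) auto
next
  case (add p q)
  then obtain K k K' k' where K: "K \<ge> 0" "\<And>L z. L \<ge> 1 \<Longrightarrow> norm (p L z) \<le> K * (1 + norm z / L) ^ k"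
    and K': "K' \<ge> 0" "\<And>L z. L \<ge> 1 \<Longrightarrow> norm (q L z) \<le> K' * (1 + norm z / L) ^ k'" by blast
  have "norm (p L z + q L z) \<le> (K + K') * (1 + norm z / L) ^ (k + k')" if L: "L \<ge> 1" for L and z :: 'a
  proof -
    have 1: "1 \<le> 1 + norm z / L" using L by simp
    have "norm (p L z + q L z) \<le> K * (1 + norm z / L) ^ k + K' * (1 + norm z / L) ^ k'"
      by (intro order_trans[OF norm_triangle_ineq] add_mono K K' L)
    also have "\<dots> \<le> K * (1 + norm z / L) ^ (k + k') + K' * (1 + norm z / L) ^ (k + k')"
      using 1 K K' by (intro add_mono mult_left_mono power_increasing) auto
    finally show ?thesis by (simp add: algebra_simps)
  qed
  then show ?case using K K' by (intro exI[of _ "K + K'"] exI[of _ "k + k'"]) auto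
next
  case (mult p q)
  then obtain K k K' k' where K: "K \<ge> 0" "\<And>L z. L \<ge> 1 \<Longrightarrow> norm (p L z) \<le> K * (1 + norm z / L) ^ k"
    and K': "K' \<ge> 0" "\<And>L z. L \<ge> 1 \<Longrightarrow> norm (q L z) \<le> K' * (1 + norm z / L) ^ k'" by blast
  have "norm (p L z * q L z) \<le> (K * K') * (1 + norm z / L) ^ (k + k')" if L: "L \<ge> 1" for L and z :: 'a
  proof -
    have "norm (p L z * q L z) \<le> (K * (1 + norm z / L) ^ k) * (K' * (1 + norm z / L) ^ k')"
      unfolding norm_mult using K K' L by (intro mult_mono) auto
    then show ?thesis by (simp add: power_add mult_ac)
  qed
  then show ?case using K K' by (intro exI[of _ "K * K'"] exI[of _ "k + k'"]) auto
qed

lemma power_times_gaussian_bounded: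
  fixes c :: real assumes c: "c > 0"
  shows "\<exists>B. \<forall>u\<ge>0. (1 + u) ^ k * exp (- c * u\<^sup>2) \<le> B"
proof -
  define n where "n = Suc k"
  define D where "D = 2 * max 1 (real n / c)"
  have "(1 + u) ^ k * exp (- c * u\<^sup>2) \<le> D ^ n" if u: "u \<ge> 0" for u :: real
  proof -
    have n: "n > 0" by (simp add: n_def)
    have "(1 + u)\<^sup>2 \<le> 2 * (1 + u\<^sup>2)" using sum_squares_bound[of 1 u] by (simp add: power2_sum)
    also have "\<dots> \<le> D * (1 + c * u\<^sup>2 / real n)"
    proof -
      have "u\<^sup>2 = (real n / c) * (c * u\<^sup>2 / real n)" using c n by simp
      also have "\<dots> \<le> max 1 (real n / c) * (c * u\<^sup>2 / real n)" using c by (intro mult_right_mono) auto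
      finally have "1 + u\<^sup>2 \<le> max 1 (real n / c) * (1 + c * u\<^sup>2 / real n)" by (simp add: distrib_left)
      then show ?thesis by (simp add: D_def)
    qed
    finally have sq: "(1 + u)\<^sup>2 \<le> D * (1 + c * u\<^sup>2 / real n)" .
    have "(1 + u) ^ k \<le> (1 + u) ^ (2 * n)" using u by (intro power_increasing) (auto simp: n_def)
    also have "\<dots> = ((1 + u)\<^sup>2) ^ n" by (simp add: power_mult)
    also have "\<dots> \<le> (D * (1 + c * u\<^sup>2 / real n)) ^ n" by (intro power_mono sq) auto
    also have "\<dots> = D ^ n * (1 + c * u\<^sup>2 / real n) ^ n" by (simp add: power_mult_distrib)
    also have "\<dots> \<le> D ^ n * exp (c * u\<^sup>2)"
    proof (intro mult_left_mono exp_ge_one_plus_x_over_n_power_n)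
      have "0 \<le> c * u\<^sup>2" using c by simp
      then show "- real n \<le> c * u\<^sup>2" by linarith
    qed (use n in \<open>auto simp: D_def\<close>)
    finally have "(1 + u) ^ k * exp (- c * u\<^sup>2) \<le> D ^ n * exp (c * u\<^sup>2) * exp (- c * u\<^sup>2)" by (rule mult_right_mono) simp
    also have "\<dots> = D ^ n" by (simp add: mult.assoc flip: exp_add)
    finally show ?thesis .
  qed
  then show ?thesis by blast
qed

text \<open>Functions whose logarithmic derivatives are scaled polynomials and which are dominated by a Gaussian of width
\<open>L\<close>, such as a Gaussian window of width \<open>L\<close> multiplied by a chirp.\<close>
definition gaussian_family :: "(real \<Rightarrow> 'a::euclidean_space \<Rightarrow> complex) \<Rightarrow> bool"
  where "gaussian_family E \<longleftrightarrow>
    (\<forall>b\<in>Basis. \<exists>p. scaled_poly p \<and> (\<forall>L\<ge>1. \<forall>z. ((\<lambda>t. E L (z + t *\<^sub>R b)) has_vector_derivative p L z * E L z) (at 0))) \<and>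
    (\<forall>L\<ge>1. continuous_on UNIV (E L)) \<and> (\<exists>c>0. \<forall>L\<ge>1. \<forall>z. norm (E L z) \<le> exp (- c * (norm z / L)\<^sup>2))"

text \<open>Differentiating \<open>p * E\<close> gives \<open>(p' + p * p\<^sub>b) * E\<close>, where \<open>p\<^sub>b\<close> is the logarithmic derivative of \<open>E\<close>.\<close>
lemma gaussian_family_iter_deriv:
  assumes E: "gaussian_family E" and "set bs \<subseteq> Basis"
  shows "\<exists>p. scaled_poly p \<and> (\<forall>L\<ge>1. \<forall>z. iter_deriv bs (E L) z = p L z * E L z)"
  using assms(2)
proof (induction bs)
  case Nil
  have "scaled_poly (\<lambda>L z::'a. 1)" by (rule scaled_poly.const[of _ 1]) simp
  then show ?case by (intro exI[of _ "\<lambda>L z. 1"]) simp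
next
  case (Cons b bs)
  then obtain p where p: "scaled_poly p" "\<And>L z. L \<ge> 1 \<Longrightarrow> iter_deriv bs (E L) z = p L z * E L z" by auto
  obtain e where e: "scaled_poly e" "\<And>L z. L \<ge> 1 \<Longrightarrow> ((\<lambda>t. E L (z + t *\<^sub>R b)) has_vector_derivative e L z * E L z) (at 0)"
    using E Cons.prems unfolding gaussian_family_def by auto
  obtain p' where p': "scaled_poly p'" "\<And>L z. ((\<lambda>t. p L (z + t *\<^sub>R b)) has_vector_derivative p' L z) (at 0)"
    using scaled_poly_derivative[OF p(1)] by blast
  have "iter_deriv (b # bs) (E L) z = (p L z * e L z + p' L z) * E L z" if L: "L \<ge> 1" for L z
  proof -
    have "((\<lambda>t. p L (z + t *\<^sub>R b) * E L (z + t *\<^sub>R b)) has_vector_derivative p L z * (e L z * E L z) + p' L z * E L z) (at 0)"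
      using has_vector_derivative_mult[OF p'(2)[of L z] e(2)[OF L, of z]] by simp
    then have "((\<lambda>t. iter_deriv bs (E L) (z + t *\<^sub>R b)) has_vector_derivative (p L z * e L z + p' L z) * E L z) (at 0)"
      using p(2)[OF L] by (simp add: algebra_simps)
    then show ?thesis unfolding iter_deriv_Cons partial_deriv_def by (rule vector_derivative_at)
  qed
  then show ?case using p p' e
    by (intro exI[of _ "\<lambda>L z. p L z * e L z + p' L z"] conjI allI impI scaled_poly.add scaled_poly.mult)
qed

lemma gaussian_family_line_derivative:
  assumes E: "gaussian_family E" and bs: "set bs \<subseteq> Basis" and b: "b \<in> Basis" and L: "L \<ge> 1"
  shows "((\<lambda>t. iter_deriv bs (E L) (z + t *\<^sub>R b)) has_vector_derivative iter_deriv (b # bs) (E L) z) (at 0)"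
proof -
  obtain p where p: "scaled_poly p" "\<And>L z. L \<ge> 1 \<Longrightarrow> iter_deriv bs (E L) z = p L z * E L z"
    using gaussian_family_iter_deriv[OF E bs] by blast
  obtain e where e: "\<And>L z. L \<ge> 1 \<Longrightarrow> ((\<lambda>t. E L (z + t *\<^sub>R b)) has_vector_derivative e L z * E L z) (at 0)"
    using E b unfolding gaussian_family_def by blast
  obtain p' where p': "\<And>L z. ((\<lambda>t. p L (z + t *\<^sub>R b)) has_vector_derivative p' L z) (at 0)"
    using scaled_poly_derivative[OF p(1)] by blast
  have "((\<lambda>t. iter_deriv bs (E L) (z + t *\<^sub>R b)) has_vector_derivative p L z * (e L z * E L z) + p' L z * E L z) (at 0)"
    using has_vector_derivative_mult[OF p'[of L z] e[OF L, of z]] p(2)[OF L] by simp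
  then show ?thesis unfolding iter_deriv_Cons partial_deriv_def by (metis vector_derivative_at)
qed

lemma gaussian_family_continuous:
  assumes E: "gaussian_family E" and bs: "set bs \<subseteq> Basis" and L: "L \<ge> 1"
  shows "continuous_on UNIV (iter_deriv bs (E L))"
proof -
  obtain p where p: "scaled_poly p" "\<And>L z. L \<ge> 1 \<Longrightarrow> iter_deriv bs (E L) z = p L z * E L z"
    using gaussian_family_iter_deriv[OF E bs] by blast
  have "continuous_on UNIV (\<lambda>z. p L z * E L z)"
    using E L scaled_poly_continuous[OF p(1)] by (intro continuous_on_mult) (auto simp: gaussian_family_def)
  moreover have "iter_deriv bs (E L) = (\<lambda>z. p L z * E L z)" using p(2)[OF L] by auto
  ultimately show ?thesis by simp
qed

lemma gaussian_family_uniform_bound: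
  assumes E: "gaussian_family E" and bs: "set bs \<subseteq> Basis"
  shows "\<exists>B. \<forall>L\<ge>1. \<forall>z. (norm z / L) ^ k * norm (iter_deriv bs (E L) z) \<le> B"
proof -
  obtain p where p: "scaled_poly p" "\<And>L z. L \<ge> 1 \<Longrightarrow> iter_deriv bs (E L) z = p L z * E L z"
    using gaussian_family_iter_deriv[OF E bs] by blast
  obtain K j where K: "K \<ge> 0" "\<And>L z. L \<ge> 1 \<Longrightarrow> norm (p L z) \<le> K * (1 + norm z / L) ^ j"
    using scaled_poly_bound[OF p(1)] by blast
  obtain c where c: "c > 0" "\<And>L z. L \<ge> 1 \<Longrightarrow> norm (E L z) \<le> exp (- c * (norm z / L)\<^sup>2)"
    using E unfolding gaussian_family_def by blast
  obtain B where B: "\<And>u. u \<ge> 0 \<Longrightarrow> (1 + u) ^ (k + j) * exp (- c * u\<^sup>2) \<le> B"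
    using power_times_gaussian_bounded[OF c(1)] by blast
  have "(norm z / L) ^ k * norm (iter_deriv bs (E L) z) \<le> K * B" if L: "L \<ge> 1" for L and z :: 'a
  proof -
    let ?u = "norm z / L"
    have u: "?u \<ge> 0" using L by simp
    have "?u ^ k * norm (iter_deriv bs (E L) z) \<le> (1 + ?u) ^ k * ((K * (1 + ?u) ^ j) * exp (- c * ?u\<^sup>2))"
      unfolding p(2)[OF L] norm_mult using u K L c by (intro mult_mono power_mono) auto
    also have "\<dots> = K * ((1 + ?u) ^ (k + j) * exp (- c * ?u\<^sup>2))" by (simp add: power_add mult_ac)
    also have "\<dots> \<le> K * B" using K u by (intro mult_left_mono B) auto
    finally show ?thesis .
  qed
  then show ?thesis by blast
qed

lemma gaussian_family_schwartz:
  assumes E: "gaussian_family E"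
  shows "schwartz (E 1)"
  unfolding schwartz_def smooth_def Ck_def
proof (intro conjI allI impI)
  fix bs :: "'a list" and k assume "set bs \<subseteq> Basis"
  from gaussian_family_uniform_bound[OF E this, of k]
  obtain B where "\<And>z. (norm z / 1) ^ k * norm (iter_deriv bs (E 1) z) \<le> B" by (meson order_refl)
  then show "bounded (range (\<lambda>x. norm x ^ k *\<^sub>R iter_deriv bs (E 1) x))"
    by (auto simp: bounded_iff)
next
  fix n and bs :: "'a list" and b x :: 'a assume "set bs \<subseteq> Basis \<and> length bs < n \<and> b \<in> Basis"
  then have "set bs \<subseteq> Basis" "b \<in> Basis" by auto
  from gaussian_family_line_derivative[OF E this order_refl, of x]
  show "(\<lambda>t. iter_deriv bs (E 1) (x + t *\<^sub>R b)) differentiable at 0"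
    by (rule differentiableI_vector)
next
  fix n and bs :: "'a list" assume "set bs \<subseteq> Basis \<and> length bs \<le> n"
  then show "continuous_on UNIV (iter_deriv bs (E 1))" by (intro gaussian_family_continuous[OF E]) auto
qed

lemma line_derivative_shift:
  fixes F :: "'a::real_vector \<Rightarrow> complex"
  assumes "\<And>z. ((\<lambda>t. F (z + t *\<^sub>R b)) has_vector_derivative G z) (at 0)"
  shows "((\<lambda>t. F (z + t *\<^sub>R b)) has_vector_derivative G (z + t0 *\<^sub>R b)) (at t0)"
proof -
  have "((\<lambda>t. t - t0) has_vector_derivative 1) (at t0)" by (auto intro!: derivative_eq_intros)
  moreover have "((\<lambda>s. F (z + t0 *\<^sub>R b + s *\<^sub>R b)) has_vector_derivative G (z + t0 *\<^sub>R b)) (at (t0 - t0))"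
    using assms[of "z + t0 *\<^sub>R b"] by simp
  ultimately have "(((\<lambda>s. F (z + t0 *\<^sub>R b + s *\<^sub>R b)) \<circ> (\<lambda>t. t - t0)) has_vector_derivative 1 *\<^sub>R G (z + t0 *\<^sub>R b)) (at t0)"
    by (rule vector_diff_chain_at)
  moreover have "(\<lambda>s. F (z + t0 *\<^sub>R b + s *\<^sub>R b)) \<circ> (\<lambda>t. t - t0) = (\<lambda>t. F (z + t *\<^sub>R b))"
    by (auto simp: algebra_simps fun_eq_iff)
  ultimately show ?thesis by simp
qed

text \<open>Termwise differentiation: the derivatives converge uniformly by the M-test.\<close>
lemma series_line_derivative:
  fixes F G :: "nat \<Rightarrow> 'a::real_normed_vector \<Rightarrow> complex"
  assumes der: "\<And>i z. ((\<lambda>t. F i (z + t *\<^sub>R b)) has_vector_derivative G i z) (at 0)"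
    and sF: "\<And>z. summable (\<lambda>i. F i z)" and G: "\<And>i z. norm (G i z) \<le> K i" "summable K"
  shows "((\<lambda>t. \<Sum>i. F i (z + t *\<^sub>R b)) has_vector_derivative (\<Sum>i. G i z)) (at 0)"
proof -
  have der': "((\<lambda>t. F i (z + t *\<^sub>R b)) has_vector_derivative G i (z + t0 *\<^sub>R b)) (at t0)" for i t0
    by (rule line_derivative_shift[OF der])
  have sG: "summable (\<lambda>i. G i z)" for z by (rule summable_comparison_test'[OF G(2)]) (use G(1) in auto)
  have ul: "uniform_limit UNIV (\<lambda>n t. \<Sum>i<n. G i (z + t *\<^sub>R b)) (\<lambda>t. \<Sum>i. G i (z + t *\<^sub>R b)) sequentially"
    using G by (intro Weierstrass_m_test) auto
  have "\<exists>g. \<forall>t\<in>UNIV. (\<lambda>n. F n (z + t *\<^sub>R b)) sums g t \<and> (g has_derivative (\<lambda>h. h *\<^sub>R (\<Sum>i. G i (z + t *\<^sub>R b)))) (at t within UNIV)"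
  proof (rule has_derivative_series[where f'="\<lambda>i t h. h *\<^sub>R G i (z + t *\<^sub>R b)" and x=0])
    show "((\<lambda>t. F i (z + t *\<^sub>R b)) has_derivative (\<lambda>h. h *\<^sub>R G i (z + t *\<^sub>R b))) (at t within UNIV)" for i t
      using der' by (simp add: has_vector_derivative_def)
    show "(\<lambda>n. F n (z + 0 *\<^sub>R b)) sums (\<Sum>i. F i z)" using sF[of z] by (simp add: summable_sums)
    fix e :: real assume e: "e > 0"
    have "\<forall>\<^sub>F n in sequentially. \<forall>t\<in>UNIV. dist (\<Sum>i<n. G i (z + t *\<^sub>R b)) (\<Sum>i. G i (z + t *\<^sub>R b)) < e"
      using uniform_limitD[OF ul e] .
    then show "\<forall>\<^sub>F n in sequentially. \<forall>t\<in>UNIV. \<forall>h. norm ((\<Sum>i<n. h *\<^sub>R G i (z + t *\<^sub>R b)) - h *\<^sub>R (\<Sum>i. G i (z + t *\<^sub>R b))) \<le> e * norm h"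
    proof (rule eventually_mono, intro ballI allI)
      fix n t h assume "\<forall>t\<in>UNIV. dist (\<Sum>i<n. G i (z + t *\<^sub>R b)) (\<Sum>i. G i (z + t *\<^sub>R b)) < e"
      then have "norm ((\<Sum>i<n. G i (z + t *\<^sub>R b)) - (\<Sum>i. G i (z + t *\<^sub>R b))) \<le> e" by (auto simp: dist_norm less_imp_le)
      then have "\<bar>h\<bar> * norm ((\<Sum>i<n. G i (z + t *\<^sub>R b)) - (\<Sum>i. G i (z + t *\<^sub>R b))) \<le> \<bar>h\<bar> * e" by (rule mult_left_mono) simp
      then show "norm ((\<Sum>i<n. h *\<^sub>R G i (z + t *\<^sub>R b)) - h *\<^sub>R (\<Sum>i. G i (z + t *\<^sub>R b))) \<le> e * norm h"
        by (simp add: scaleR_sum_right[symmetric] scaleR_diff_right[symmetric] mult.commute)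
    qed
  qed auto
  then obtain g where g: "\<And>t. (\<lambda>n. F n (z + t *\<^sub>R b)) sums g t" "(g has_derivative (\<lambda>h. h *\<^sub>R (\<Sum>i. G i (z + 0 *\<^sub>R b)))) (at 0)"
    by (metis UNIV_I)
  have "g = (\<lambda>t. \<Sum>i. F i (z + t *\<^sub>R b))" using g(1) by (auto simp: sums_iff)
  with g(2) show ?thesis by (simp add: has_vector_derivative_def)
qed

text \<open>All the derivatives of the terms have bounds that do not depend on \<open>L i\<close>, so the convergence of \<open>\<Sum> c i\<close> is enough to
differentiate term by term arbitrarily often.\<close>
lemma gaussian_series_smooth_bounded:
  fixes E :: "real \<Rightarrow> 'a::euclidean_space \<Rightarrow> complex" and c :: "nat \<Rightarrow> real"
  assumes E: "gaussian_family E" and c: "summable c" "\<And>i. c i \<ge> 0" and L: "\<And>i. L i \<ge> 1"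
  shows "smooth_bounded (\<lambda>z. \<Sum>i. complex_of_real (c i) * E (L i) z)"
proof -
  let ?m = "\<lambda>z. \<Sum>i. complex_of_real (c i) * E (L i) z"
  let ?D = "\<lambda>bs i z. complex_of_real (c i) * iter_deriv bs (E (L i)) z"
  have bd: "\<exists>B\<ge>0. \<forall>i z. norm (?D bs i z) \<le> c i * B" if bs: "set bs \<subseteq> Basis" for bs
  proof -
    obtain B where B: "\<And>L z. L \<ge> 1 \<Longrightarrow> (norm z / L) ^ 0 * norm (iter_deriv bs (E L) z) \<le> B"
      using gaussian_family_uniform_bound[OF E bs] by blast
    have "B \<ge> 0" using B[of 1 0] order_trans[OF norm_ge_zero] by simp
    moreover have "norm (?D bs i z) \<le> c i * B" for i z
      unfolding norm_mult norm_of_real using B[OF L, of z i] c(2)[of i] by (simp add: mult_left_mono)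
    ultimately show ?thesis by blast
  qed
  have sm: "summable (\<lambda>i. ?D bs i z)" if bs: "set bs \<subseteq> Basis" for bs z
  proof -
    obtain B where "\<And>i z. norm (?D bs i z) \<le> c i * B" using bd[OF bs] by blast
    then show ?thesis by (intro summable_comparison_test'[OF summable_mult2[OF c(1), of B]]) auto
  qed
  have line: "((\<lambda>t. \<Sum>i. ?D bs i (z + t *\<^sub>R b)) has_vector_derivative (\<Sum>i. ?D (b # bs) i z)) (at 0)"
    if bs: "set bs \<subseteq> Basis" and b: "b \<in> Basis" for bs b z
  proof -
    have bbs: "set (b # bs) \<subseteq> Basis" using bs b by simp
    obtain B where B: "\<And>i z. norm (?D (b # bs) i z) \<le> c i * B" using bd[OF bbs] by blast
    show ?thesis
    proof (rule series_line_derivative[where K="\<lambda>i. c i * B"])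
      show "((\<lambda>t. ?D bs i (z + t *\<^sub>R b)) has_vector_derivative ?D (b # bs) i z) (at 0)" for i z
        by (intro has_vector_derivative_mult_right gaussian_family_line_derivative[OF E bs b L])
    qed (use B sm[OF bs] summable_mult2[OF c(1), of B] in auto)
  qed
  have id: "iter_deriv bs ?m = (\<lambda>z. \<Sum>i. ?D bs i z)" if "set bs \<subseteq> Basis" for bs
    using that
  proof (induction bs)
    case (Cons b bs)
    then have bs: "set bs \<subseteq> Basis" and b: "b \<in> Basis" by auto
    show ?case
      unfolding iter_deriv_Cons[of b bs ?m] Cons.IH[OF bs] partial_deriv_def
      by (rule ext) (rule vector_derivative_at[OF line[OF bs b]])
  qed simp
  have cont: "continuous_on UNIV (iter_deriv bs ?m)" if bs: "set bs \<subseteq> Basis" for bs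
    unfolding id[OF bs]
  proof (rule uniform_limit_theorem)
    obtain B where B: "\<And>i z. norm (?D bs i z) \<le> c i * B" using bd[OF bs] by blast
    show "uniform_limit UNIV (\<lambda>n z. \<Sum>i<n. ?D bs i z) (\<lambda>z. \<Sum>i. ?D bs i z) sequentially"
      by (rule Weierstrass_m_test[where M="\<lambda>i. c i * B"]) (rule B, rule summable_mult2[OF c(1)])
    show "\<forall>\<^sub>F n in sequentially. continuous_on UNIV (\<lambda>z. \<Sum>i<n. ?D bs i z)"
      by (intro always_eventually allI continuous_on_sum continuous_on_mult continuous_on_const gaussian_family_continuous[OF E bs L])
  qed simp
  show ?thesis
    unfolding smooth_bounded_def smooth_def Ck_def
  proof (intro conjI allI impI)
    fix bs :: "'a list" assume bs: "set bs \<subseteq> Basis"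
    obtain B where B: "\<And>i z. norm (?D bs i z) \<le> c i * B" using bd[OF bs] by blast
    have "norm (iter_deriv bs ?m z) \<le> (\<Sum>i. c i * B)" for z
      unfolding id[OF bs] by (rule norm_suminf_le) (use B summable_mult2[OF c(1), of B] in auto)
    then show "bounded (range (iter_deriv bs ?m))" by (auto simp: bounded_iff)
  next
    fix n and bs :: "'a list" and b x :: 'a assume "set bs \<subseteq> Basis \<and> length bs < n \<and> b \<in> Basis"
    then have bs: "set bs \<subseteq> Basis" and b: "b \<in> Basis" by auto
    show "(\<lambda>t. iter_deriv bs ?m (x + t *\<^sub>R b)) differentiable at 0"
      unfolding id[OF bs] by (rule differentiableI_vector[OF line[OF bs b]])
  qed (use cont in auto)
qed

section \<open>Chirp multipliers and Gaussian test functions\<close>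

lemma exp_quadratic_derivative:
  fixes a q1 q2 :: complex
  shows "((\<lambda>t. exp (a + complex_of_real t * q1 + (complex_of_real t)\<^sup>2 * q2)) has_vector_derivative q1 * exp a) (at 0)"
proof (rule has_vector_derivative_real_field)
  show "((\<lambda>t. exp (a + t * q1 + t\<^sup>2 * q2)) has_field_derivative q1 * exp a) (at (complex_of_real 0))"
    by (auto intro!: derivative_eq_intros)
qed

definition freq_sum :: "'a::euclidean_space \<times> 'a \<times> 'a \<Rightarrow> 'a"
  where "freq_sum z = fst z + fst (snd z) + snd (snd z)"

text \<open>The window is chosen with the test functions in mind. Their three Fourier transforms contribute
\<open>\<bar>z\<bar>\<^sup>2 / 8\<close>, which cancels the negative term; what remains is a sum of squares of \<open>\<xi>\<close>, \<open>\<eta>\<close> and \<open>\<xi> + \<eta> + \<delta>\<close>, and in these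
variables the integral defining the operator factors.\<close>
definition chirp_form :: "'a::euclidean_space \<times> 'a \<times> 'a \<Rightarrow> real"
  where "chirp_form z = (norm (fst z))\<^sup>2 + (norm (fst (snd z)))\<^sup>2 + (norm (freq_sum z))\<^sup>2 - (norm z)\<^sup>2 / 8"

definition chirp :: "real \<Rightarrow> 'a::euclidean_space \<times> 'a \<times> 'a \<Rightarrow> complex"
  where "chirp L z = exp (complex_of_real (- pi * chirp_form z / L\<^sup>2) + \<i> * complex_of_real (pi * (norm (freq_sum z))\<^sup>2 / L))"

lemma norm_triple_square: "(norm z)\<^sup>2 = (norm (fst z))\<^sup>2 + (norm (fst (snd z)))\<^sup>2 + (norm (snd (snd z)))\<^sup>2"
  by (simp add: norm_prod_def)

text \<open>Since \<open>\<delta> = (\<xi> + \<eta> + \<delta>) - \<xi> - \<eta>\<close>, the positive part of the form is at least \<open>\<bar>z\<bar>\<^sup>2 / 4\<close>; half of it remains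
after the subtraction.\<close>
lemma chirp_form_ge: "chirp_form z \<ge> (norm z)\<^sup>2 / 8"
proof -
  obtain x y w where z: "z = (x, y, w)" by (cases z) auto
  have "w = freq_sum z - x - y" by (simp add: freq_sum_def z)
  then have "norm w \<le> norm (freq_sum z) + norm x + norm y"
    by (metis (no_types, opaque_lifting) add_mono_thms_linordered_semiring(3) norm_triangle_ineq4 order_trans)
  then have "(norm w)\<^sup>2 \<le> (norm (freq_sum z) + norm x + norm y)\<^sup>2" by (rule power_mono) simp
  also have "\<dots> \<le> 3 * ((norm (freq_sum z))\<^sup>2 + (norm x)\<^sup>2 + (norm y)\<^sup>2)"
  proof -
    have "(a + b + c)\<^sup>2 \<le> 3 * (a\<^sup>2 + b\<^sup>2 + c\<^sup>2)" for a b c :: real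
    proof -
      have "3 * (a\<^sup>2 + b\<^sup>2 + c\<^sup>2) - (a + b + c)\<^sup>2 = (a - b)\<^sup>2 + (b - c)\<^sup>2 + (c - a)\<^sup>2"
        by (simp add: power2_eq_square algebra_simps)
      also have "\<dots> \<ge> 0" by simp
      finally show ?thesis by simp
    qed
    then show ?thesis .
  qed
  finally have "(norm w)\<^sup>2 \<le> 3 * ((norm (freq_sum z))\<^sup>2 + (norm x)\<^sup>2 + (norm y)\<^sup>2)" .
  moreover have "fst z = x" "fst (snd z) = y" "snd (snd z) = w" by (simp_all add: z)
  moreover have "0 \<le> (norm (freq_sum z))\<^sup>2" by simp
  moreover have "a + b + s - (a + b + c) / 8 \<ge> (a + b + c) / 8" if "c \<le> 3 * (s + a + b)" "0 \<le> s" for a b c s :: real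
    using that by (simp add: field_simps)
  ultimately show ?thesis unfolding chirp_form_def norm_triple_square by (simp only:)
qed

lemma norm_chirp: "norm (chirp L z) = exp (- pi * chirp_form z / L\<^sup>2)"
  by (simp add: chirp_def)

lemma norm_chirp_le: "norm (chirp L z) \<le> exp (- pi * (1 / (8 * L\<^sup>2)) * (norm z)\<^sup>2)"
proof -
  have "pi * (norm z)\<^sup>2 / 8 / L\<^sup>2 \<le> pi * chirp_form z / L\<^sup>2"
    using chirp_form_ge[of z] by (intro divide_right_mono) auto
  then show ?thesis by (simp add: norm_chirp)
qed

lemma norm_chirp_le_1: "norm (chirp L z) \<le> 1"
proof -
  have "chirp_form z \<ge> 0" by (rule order_trans[OF _ chirp_form_ge]) simp
  then show ?thesis by (simp add: norm_chirp)
qed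

lemma chirp_continuous: "L \<noteq> 0 \<Longrightarrow> continuous_on UNIV (chirp L)"
  unfolding chirp_def chirp_form_def freq_sum_def by (intro continuous_intros) auto

lemma norm_line_square:
  fixes u v :: "'a::real_inner"
  shows "(norm (u + t *\<^sub>R v))\<^sup>2 = (norm u)\<^sup>2 + t * (2 * (u \<bullet> v)) + t\<^sup>2 * (norm v)\<^sup>2"
  by (simp add: power2_norm_eq_inner inner_add_left inner_add_right inner_commute) (simp add: power2_eq_square algebra_simps)

lemma gaussian_family_chirp: "gaussian_family (chirp :: real \<Rightarrow> 'a::euclidean_space \<times> 'a \<times> 'a \<Rightarrow> complex)"
  unfolding gaussian_family_def
proof (intro conjI ballI allI impI)
  fix b :: "'a \<times> 'a \<times> 'a"
  obtain b1 b2 b3 where b: "b = (b1, b2, b3)" by (cases b) auto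
  let ?\<beta> = "b1 + b2 + b3"
  let ?v2 = "(?\<beta>, ?\<beta>, ?\<beta>)"
  let ?v1 = "(b1, 0, 0) + (0, b2, 0) + ?v2 - (1/8) *\<^sub>R b"
  let ?p = "\<lambda>L z. complex_of_real (- 2 * pi / L) * complex_of_real ((z \<bullet> ?v1) / L) + (2 * pi * \<i>) * complex_of_real ((z \<bullet> ?v2) / L)"
  have "scaled_poly (\<lambda>L z::'a \<times> 'a \<times> 'a. complex_of_real (- 2 * pi / L))"
    by (rule scaled_poly.const[of _ "2 * pi"]) (simp only: norm_of_real abs_divide, simp add: divide_le_eq)
  moreover have "scaled_poly (\<lambda>L z::'a \<times> 'a \<times> 'a. 2 * pi * \<i>)"
    by (rule scaled_poly.const[of _ "2 * pi"]) (simp add: norm_mult)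
  ultimately have "scaled_poly ?p"
    by (intro scaled_poly.add[OF scaled_poly.mult scaled_poly.mult] scaled_poly.lin)
  moreover have "((\<lambda>t. chirp L (z + t *\<^sub>R b)) has_vector_derivative ?p L z * chirp L z) (at 0)" if L: "L \<ge> 1" for L z
  proof -
    obtain x y w where z: "z = (x, y, w)" by (cases z) auto
    define \<sigma> where "\<sigma> = x + y + w"
    define \<beta> where "\<beta> = b1 + b2 + b3"
    define e1 where "e1 = 2 * (x \<bullet> b1) + 2 * (y \<bullet> b2) + 2 * (\<sigma> \<bullet> \<beta>) - (x \<bullet> b1 + y \<bullet> b2 + w \<bullet> b3) / 4"
    define e2 where "e2 = (norm b1)\<^sup>2 + (norm b2)\<^sup>2 + (norm \<beta>)\<^sup>2 - ((norm b1)\<^sup>2 + (norm b2)\<^sup>2 + (norm b3)\<^sup>2) / 8"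
    note sq = norm_line_square
    have fs: "freq_sum (z + t *\<^sub>R b) = \<sigma> + t *\<^sub>R \<beta>" for t
      by (simp add: freq_sum_def z b \<sigma>_def \<beta>_def algebra_simps)
    have fs0: "freq_sum z = \<sigma>" by (simp add: freq_sum_def z \<sigma>_def)
    have comps: "fst (z + t *\<^sub>R b) = x + t *\<^sub>R b1" "fst (snd (z + t *\<^sub>R b)) = y + t *\<^sub>R b2" "snd (snd (z + t *\<^sub>R b)) = w + t *\<^sub>R b3"
      "fst z = x" "fst (snd z) = y" "snd (snd z) = w" for t by (simp_all add: z b)
    have cf: "chirp_form (z + t *\<^sub>R b) = chirp_form z + t * e1 + t\<^sup>2 * e2" for t
      unfolding chirp_form_def norm_triple_square comps fs fs0 sq e1_def e2_def by (simp add: field_simps)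
    let ?q1 = "complex_of_real (- pi * e1 / L\<^sup>2) + \<i> * complex_of_real (pi * (2 * (\<sigma> \<bullet> \<beta>)) / L)"
    let ?q2 = "complex_of_real (- pi * e2 / L\<^sup>2) + \<i> * complex_of_real (pi * (norm \<beta>)\<^sup>2 / L)"
    let ?a = "complex_of_real (- pi * chirp_form z / L\<^sup>2) + \<i> * complex_of_real (pi * (norm \<sigma>)\<^sup>2 / L)"
    have "chirp L (z + t *\<^sub>R b) = exp (?a + complex_of_real t * ?q1 + (complex_of_real t)\<^sup>2 * ?q2)" for t
    proof -
      have "complex_of_real (- pi * chirp_form (z + t *\<^sub>R b) / L\<^sup>2) + \<i> * complex_of_real (pi * (norm (freq_sum (z + t *\<^sub>R b)))\<^sup>2 / L)
        = ?a + complex_of_real t * ?q1 + (complex_of_real t)\<^sup>2 * ?q2"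
        unfolding cf fs fs0 sq by (simp add: add_divide_distrib diff_divide_distrib algebra_simps)
      then show ?thesis unfolding chirp_def by (simp only:)
    qed
    moreover have "?q1 = ?p L z"
    proof -
      have v: "z \<bullet> ?v1 = e1 / 2" "z \<bullet> ?v2 = \<sigma> \<bullet> \<beta>"
        by (simp_all add: z b e1_def \<sigma>_def \<beta>_def inner_add_left inner_add_right inner_diff_right add_divide_distrib algebra_simps)
      show ?thesis unfolding v using L by (simp add: power2_eq_square)
    qed
    ultimately show ?thesis using exp_quadratic_derivative[of ?a ?q1 ?q2] by (simp only: chirp_def[of L z] fs0)
  qed
  ultimately show "\<exists>p. scaled_poly p \<and> (\<forall>L\<ge>1. \<forall>z. ((\<lambda>t. chirp L (z + t *\<^sub>R b)) has_vector_derivative p L z * chirp L z) (at 0))"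
    by (intro exI[of _ ?p]) auto
next
  show "\<exists>c>0. \<forall>L\<ge>1. \<forall>z::'a \<times> 'a \<times> 'a. norm (chirp L z) \<le> exp (- c * (norm z / L)\<^sup>2)"
    using norm_chirp_le by (intro exI[of _ "pi / 8"]) (auto simp: power_divide)
next
  fix L :: real assume "L \<ge> 1"
  then show "continuous_on UNIV (chirp L :: 'a \<times> 'a \<times> 'a \<Rightarrow> complex)" by (intro chirp_continuous) simp
qed

text \<open>Scaled such that its Fourier transform is a multiple of \<open>exp (- pi * \<bar>\<xi>\<bar>\<^sup>2 / (8 * L\<^sup>2))\<close>.\<close>
definition test_function :: "real \<Rightarrow> 'a::euclidean_space \<Rightarrow> complex"
  where "test_function L x = complex_of_real (exp (- pi * (8 * L\<^sup>2) * (norm x)\<^sup>2))"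

text \<open>The dilates of a fixed Gaussian form a family of Gaussian type, and the test function is its member with parameter 1.\<close>
lemma schwartz_test_function:
  assumes L: "L > 0" shows "schwartz (test_function L :: 'a::euclidean_space \<Rightarrow> complex)"
proof -
  define a where "a = 8 * pi * L\<^sup>2"
  have a: "a > 0" using L by (simp add: a_def)
  define E where "E = (\<lambda>M x::'a. exp (complex_of_real (- a * (norm x)\<^sup>2 / M\<^sup>2)))"
  have "gaussian_family E"
    unfolding gaussian_family_def
  proof (intro conjI ballI allI impI)
    fix b :: 'a
    let ?p = "\<lambda>M x. complex_of_real (- 2 * a / M) * complex_of_real ((x \<bullet> b) / M)"
    have "scaled_poly ?p"
      by (intro scaled_poly.mult scaled_poly.lin scaled_poly.const[of _ "2 * a"], unfold norm_of_real)
        (use a in \<open>simp add: divide_le_eq\<close>)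
    moreover have "((\<lambda>t. E M (z + t *\<^sub>R b)) has_vector_derivative ?p M z * E M z) (at 0)" for M z
    proof -
      let ?a = "complex_of_real (- a * (norm z)\<^sup>2 / M\<^sup>2)" and ?q2 = "complex_of_real (- a * (norm b)\<^sup>2 / M\<^sup>2)"
      have "complex_of_real (- a * (norm (z + t *\<^sub>R b))\<^sup>2 / M\<^sup>2) = ?a + complex_of_real t * ?p M z + (complex_of_real t)\<^sup>2 * ?q2" for t
      proof -
        have "- a * (norm (z + t *\<^sub>R b))\<^sup>2 / M\<^sup>2 = - a * (norm z)\<^sup>2 / M\<^sup>2 + t * ((- 2 * a / M) * ((z \<bullet> b) / M)) + t\<^sup>2 * (- a * (norm b)\<^sup>2 / M\<^sup>2)"
          unfolding norm_line_square by (simp add: add_divide_distrib diff_divide_distrib algebra_simps power2_eq_square)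
        then show ?thesis by (simp only: of_real_add of_real_mult of_real_power)
      qed
      then show ?thesis unfolding E_def using exp_quadratic_derivative[of ?a "?p M z" ?q2] by (simp only:)
    qed
    ultimately show "\<exists>p. scaled_poly p \<and> (\<forall>M\<ge>1. \<forall>z. ((\<lambda>t. E M (z + t *\<^sub>R b)) has_vector_derivative p M z * E M z) (at 0))"
      by (intro exI[of _ ?p]) auto
  next
    show "\<exists>c>0. \<forall>L\<ge>1. \<forall>z. norm (E L z) \<le> exp (- c * (norm z / L)\<^sup>2)"
      using a by (intro exI[of _ a]) (auto simp: E_def power_divide)
  next
    fix M :: real assume "M \<ge> 1"
    then show "continuous_on UNIV (E M)" unfolding E_def by (intro continuous_intros) auto
  qed
  from gaussian_family_schwartz[OF this] have "schwartz (E 1)" .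
  moreover have "E 1 = test_function L"
    by (simp add: E_def test_function_def a_def fun_eq_iff exp_of_real mult_ac flip: of_real_minus of_real_mult of_real_power)
  ultimately show ?thesis by simp
qed

lemma fourier_test_function:
  assumes L: "L > 0"
  shows "fourier (test_function L) (\<xi>::'a::euclidean_space) = complex_of_real (exp (- pi * (norm \<xi>)\<^sup>2 / (8 * L\<^sup>2)) / sqrt (8 * L\<^sup>2) ^ DIM('a))"
  using gaussian_fourier(2)[of "8 * L\<^sup>2" "- \<xi>"] L by (simp add: fourier_def test_function_def)

lemma gaussian_integral:
  assumes a: "a > 0"
  shows "(\<integral>\<^sup>+x. ennreal (exp (- pi * a * (norm (x::'a::euclidean_space))\<^sup>2)) \<partial>lborel) = ennreal (1 / sqrt a ^ DIM('a))"
    and "(LINT x|lborel. complex_of_real (exp (- pi * a * (norm (x::'a))\<^sup>2))) = complex_of_real (1 / sqrt a ^ DIM('a))"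
    and "integrable lborel (\<lambda>x::'a. complex_of_real (exp (- pi * a * (norm x)\<^sup>2)))"
proof -
  show i: "integrable lborel (\<lambda>x::'a. complex_of_real (exp (- pi * a * (norm x)\<^sup>2)))"
    using gaussian_fourier(1)[OF a, of 0] by simp
  show v: "(LINT x|lborel. complex_of_real (exp (- pi * a * (norm (x::'a))\<^sup>2))) = complex_of_real (1 / sqrt a ^ DIM('a))"
    using gaussian_fourier(2)[OF a, of 0] by simp
  have "integrable lborel (\<lambda>x::'a. exp (- pi * a * (norm x)\<^sup>2))"
    using i unfolding complex_of_real_integrable_eq .
  then have "(\<integral>\<^sup>+x. ennreal (exp (- pi * a * (norm (x::'a))\<^sup>2)) \<partial>lborel) = ennreal (LINT x|lborel. exp (- pi * a * (norm (x::'a))\<^sup>2))"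
    by (rule nn_integral_eq_integral) simp
  moreover have "(LINT x|lborel. exp (- pi * a * (norm (x::'a))\<^sup>2)) = 1 / sqrt a ^ DIM('a)"
    using v unfolding integral_complex_of_real of_real_eq_iff .
  ultimately show "(\<integral>\<^sup>+x. ennreal (exp (- pi * a * (norm (x::'a))\<^sup>2)) \<partial>lborel) = ennreal (1 / sqrt a ^ DIM('a))" by simp
qed

lemma test_function_square:
  assumes L: "L > 0"
  shows "(\<integral>\<^sup>+x. ennreal ((norm (test_function L (x::'a::euclidean_space)))\<^sup>2) \<partial>lborel) = ennreal (1 / (4 * L) ^ DIM('a))"
proof -
  have "(norm (test_function L x))\<^sup>2 = exp (- pi * (16 * L\<^sup>2) * (norm x)\<^sup>2)" for x :: 'a
  proof -
    have "(exp a)\<^sup>2 = exp (a + a)" for a :: real by (simp only: power2_eq_square exp_add)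
    then show ?thesis unfolding test_function_def norm_of_real abs_exp_cancel by simp
  qed
  moreover have "sqrt (16 * L\<^sup>2) = 4 * L" using L by (simp add: real_sqrt_mult)
  ultimately show ?thesis using gaussian_integral(1)[of "16 * L\<^sup>2", where 'a='a] L by simp
qed

text \<open>The squared modulus is a double integral of \<open>P s * cnj (P (s + u))\<close>. In the variables \<open>u\<close> and \<open>w = s + u/2\<close> the quadratic
phase becomes the bilinear phase \<open>- 2 * pi * \<beta> * (w \<bullet> u)\<close>, so both integrations are Fourier transforms of real
Gaussians, and square roots of complex numbers are avoided.\<close>
lemma chirp_integral:
  fixes x :: "'a::euclidean_space" and \<alpha> \<beta> :: real
  assumes \<alpha>: "\<alpha> > 0"
  defines "\<gamma> \<equiv> (\<alpha> + \<beta>\<^sup>2 / \<alpha>) / 2"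
  shows "(norm (LINT s|lborel. complex_of_real (exp (- pi * \<alpha> * (norm s)\<^sup>2)) * cis (pi * \<beta> * (norm s)\<^sup>2) * cis (2 * pi * (x \<bullet> s))))\<^sup>2
    = exp (- pi * (norm x)\<^sup>2 / \<gamma>) / (sqrt \<gamma> ^ DIM('a) * sqrt (2 * \<alpha>) ^ DIM('a))"
proof -
  define P where "P = (\<lambda>s::'a. complex_of_real (exp (- pi * \<alpha> * (norm s)\<^sup>2)) * cis (pi * \<beta> * (norm s)\<^sup>2) * cis (2 * pi * (x \<bullet> s)))"
  have \<gamma>: "\<gamma> > 0" unfolding \<gamma>_def using \<alpha> by (simp add: add_pos_nonneg)
  have Pm [measurable]: "P \<in> borel_measurable borel" unfolding P_def cis_conv_exp by measurable
  have Pi: "integrable lborel P"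
  proof -
    have "integrable lborel (\<lambda>s::'a. complex_of_real (exp (- pi * \<alpha> * (norm s)\<^sup>2)) * (cis (pi * \<beta> * (norm s)\<^sup>2) * cis (2 * pi * (x \<bullet> s))))"
      by (rule integrable_mult_bounded[OF gaussian_integral(3)[OF \<alpha>], where B=1]) (auto simp: norm_mult cis_conv_exp)
    then show ?thesis unfolding P_def by (simp only: mult.assoc)
  qed
  have int: "integrable (lborel \<Otimes>\<^sub>M lborel) (\<lambda>(s, u). P s * cnj (P (s + u)))"
  proof (rule lborel_pair.Fubini_integrable)
    show "(\<lambda>(s, u). P s * cnj (P (s + u))) \<in> borel_measurable (lborel \<Otimes>\<^sub>M lborel)" by measurable
    have tr: "integrable lborel (\<lambda>u. P (s + u))" for s by (rule integrable_lborel_translate[OF Pi])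
    have "(LINT u|lborel. norm (P s * cnj (P (s + u)))) = norm (P s) * (LINT u|lborel. norm (P u))" for s
    proof -
      have "(LINT u|lborel. complex_of_real (norm (P (s + u)))) = (LINT u|lborel. complex_of_real (norm (P u)))"
        by (rule integral_lborel_translate) simp
      then have "(LINT u|lborel. norm (P (s + u))) = (LINT u|lborel. norm (P u))" unfolding integral_complex_of_real of_real_eq_iff .
      then show ?thesis by (simp add: norm_mult)
    qed
    then show "integrable lborel (\<lambda>s. LINT u|lborel. norm (case (s, u) of (s, u) \<Rightarrow> P s * cnj (P (s + u))))"
      using Pi by simp
    show "AE s in lborel. integrable lborel (\<lambda>u. case (s, u) of (s, u) \<Rightarrow> P s * cnj (P (s + u)))"
      using tr by simp
  qed
  have polar: "(complex_of_real A * cis p * cis q) * cnj (complex_of_real B * cis p' * cis q') = complex_of_real (A * B) * cis (p + q - p' - q')" for A B p q p' q'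
  proof -
    have "cis (p + q - p' - q') = cis p * cis q * cis (- p') * cis (- q')" by (simp add: cis_mult)
    then show ?thesis by (simp add: cis_cnj mult_ac)
  qed
  have inner: "(LINT s|lborel. P s * cnj (P (s + u))) = complex_of_real (exp (- pi * \<gamma> * (norm u)\<^sup>2)) * cis (2 * pi * (u \<bullet> - x)) * complex_of_real (1 / sqrt (2 * \<alpha>) ^ DIM('a))" for u
  proof -
    have "(LINT s|lborel. P s * cnj (P (s + u))) = (LINT w|lborel. P (- (1/2) *\<^sub>R u + w) * cnj (P (- (1/2) *\<^sub>R u + w + u)))"
      by (rule integral_lborel_translate[symmetric]) simp
    also have "\<dots> = (LINT w|lborel. (complex_of_real (exp (- pi * (\<alpha> / 2) * (norm u)\<^sup>2)) * cis (2 * pi * (u \<bullet> - x))) * (complex_of_real (exp (- pi * (2 * \<alpha>) * (norm w)\<^sup>2)) * cis (2 * pi * (w \<bullet> (- \<beta> *\<^sub>R u)))))"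
    proof (intro Bochner_Integration.integral_cong refl)
      fix w :: 'a
      let ?s = "- (1/2) *\<^sub>R u + w" and ?t = "- (1/2) *\<^sub>R u + w + u"
      have t: "?t = (1/2) *\<^sub>R u + w" by (simp add: algebra_simps flip: scaleR_add_left)
      have ns: "(norm ?s)\<^sup>2 = (norm w)\<^sup>2 - w \<bullet> u + (norm u)\<^sup>2 / 4" and nt: "(norm ?t)\<^sup>2 = (norm w)\<^sup>2 + w \<bullet> u + (norm u)\<^sup>2 / 4"
        unfolding t by (simp_all add: power2_norm_eq_inner inner_add_left inner_add_right inner_diff_left inner_diff_right inner_commute algebra_simps)
      have "P ?s * cnj (P ?t) = complex_of_real (exp (- pi * \<alpha> * (norm ?s)\<^sup>2) * exp (- pi * \<alpha> * (norm ?t)\<^sup>2)) * cis (pi * \<beta> * (norm ?s)\<^sup>2 + 2 * pi * (x \<bullet> ?s) - pi * \<beta> * (norm ?t)\<^sup>2 - 2 * pi * (x \<bullet> ?t))"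
        unfolding P_def by (rule polar)
      also have "exp (- pi * \<alpha> * (norm ?s)\<^sup>2) * exp (- pi * \<alpha> * (norm ?t)\<^sup>2) = exp (- pi * (\<alpha> / 2) * (norm u)\<^sup>2) * exp (- pi * (2 * \<alpha>) * (norm w)\<^sup>2)"
        unfolding exp_add[symmetric] ns nt by (simp add: algebra_simps)
      also have "pi * \<beta> * (norm ?s)\<^sup>2 + 2 * pi * (x \<bullet> ?s) - pi * \<beta> * (norm ?t)\<^sup>2 - 2 * pi * (x \<bullet> ?t) = 2 * pi * (u \<bullet> - x) + 2 * pi * (w \<bullet> (- \<beta> *\<^sub>R u))"
        unfolding ns nt by (simp add: inner_add_right inner_commute algebra_simps)
      finally show "P ?s * cnj (P ?t) = (complex_of_real (exp (- pi * (\<alpha> / 2) * (norm u)\<^sup>2)) * cis (2 * pi * (u \<bullet> - x))) * (complex_of_real (exp (- pi * (2 * \<alpha>) * (norm w)\<^sup>2)) * cis (2 * pi * (w \<bullet> (- \<beta> *\<^sub>R u))))"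
        by (simp only: of_real_mult cis_mult[symmetric] mult_ac)
    qed
    also have "\<dots> = (complex_of_real (exp (- pi * (\<alpha> / 2) * (norm u)\<^sup>2)) * cis (2 * pi * (u \<bullet> - x))) * complex_of_real (exp (- pi * (norm (- \<beta> *\<^sub>R u))\<^sup>2 / (2 * \<alpha>)) / sqrt (2 * \<alpha>) ^ DIM('a))"
      using gaussian_fourier[of "2 * \<alpha>" "- \<beta> *\<^sub>R u"] \<alpha> by (simp only: integral_mult_right_zero)
    also have "\<dots> = complex_of_real (exp (- pi * (\<alpha> / 2) * (norm u)\<^sup>2) * exp (- pi * (norm (- \<beta> *\<^sub>R u))\<^sup>2 / (2 * \<alpha>))) * cis (2 * pi * (u \<bullet> - x)) * complex_of_real (1 / sqrt (2 * \<alpha>) ^ DIM('a))"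
      by (simp add: mult_ac)
    also have "exp (- pi * (\<alpha> / 2) * (norm u)\<^sup>2) * exp (- pi * (norm (- \<beta> *\<^sub>R u))\<^sup>2 / (2 * \<alpha>)) = exp (- pi * \<gamma> * (norm u)\<^sup>2)"
      unfolding exp_add[symmetric] \<gamma>_def using \<alpha> by (simp add: power_mult_distrib field_simps)
    finally show ?thesis .
  qed
  have "complex_of_real ((norm (integral\<^sup>L lborel P))\<^sup>2) = integral\<^sup>L lborel P * cnj (integral\<^sup>L lborel P)"
    by (rule complex_norm_square)
  also have "\<dots> = (LINT s|lborel. P s * cnj (integral\<^sup>L lborel P))" by simp
  also have "\<dots> = (LINT s|lborel. LINT u|lborel. P s * cnj (P (s + u)))"
  proof (intro Bochner_Integration.integral_cong refl)
    fix s
    have "cnj (integral\<^sup>L lborel P) = (LINT u|lborel. cnj (P (s + u)))"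
      using integral_lborel_translate[OF Pm, of s] by simp
    then show "P s * cnj (integral\<^sup>L lborel P) = (LINT u|lborel. P s * cnj (P (s + u)))" by simp
  qed
  also have "\<dots> = (LINT u|lborel. LINT s|lborel. P s * cnj (P (s + u)))"
    using lborel_pair.Fubini_integral[OF int] by simp
  also have "\<dots> = (LINT u|lborel. complex_of_real (exp (- pi * \<gamma> * (norm u)\<^sup>2)) * cis (2 * pi * (u \<bullet> - x)) * complex_of_real (1 / sqrt (2 * \<alpha>) ^ DIM('a)))"
    by (simp only: inner)
  also have "\<dots> = complex_of_real (exp (- pi * (norm (- x))\<^sup>2 / \<gamma>) / sqrt \<gamma> ^ DIM('a)) * complex_of_real (1 / sqrt (2 * \<alpha>) ^ DIM('a))"
    using gaussian_fourier(2)[OF \<gamma>, of "- x"] by (simp only: integral_mult_left_zero)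
  finally have "(norm (integral\<^sup>L lborel P))\<^sup>2 = exp (- pi * (norm (- x))\<^sup>2 / \<gamma>) / sqrt \<gamma> ^ DIM('a) * (1 / sqrt (2 * \<alpha>) ^ DIM('a))"
    unfolding of_real_mult[symmetric] of_real_eq_iff .
  then show ?thesis by (simp add: P_def)
qed

text \<open>Here \<open>\<alpha> = 1/L\<^sup>2\<close> and \<open>\<beta> = 1/L\<close> with \<open>L = H\<^sup>2\<close>, so that \<open>\<beta>\<^sup>2 / \<alpha> = 1\<close> and \<open>\<gamma>\<close> lies between \<open>1/2\<close> and 1: the integral, as a
function of \<open>x\<close>, is spread over the unit ball at height of order \<open>L powr (d/2)\<close>.\<close>
lemma chirp_integral_lower_bound:
  fixes x :: "'a::euclidean_space"
  assumes H: "H \<ge> 1" and x: "norm x \<le> 1"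
  shows "norm (LINT s|lborel. complex_of_real (exp (- pi * (1 / (H\<^sup>2)\<^sup>2) * (norm s)\<^sup>2)) * cis (pi * (1 / H\<^sup>2) * (norm s)\<^sup>2) * cis (2 * pi * (x \<bullet> s)))
    \<ge> exp (- pi) * (H / 2) ^ DIM('a)" (is "norm ?I \<ge> _")
proof -
  let ?\<alpha> = "1 / (H\<^sup>2)\<^sup>2" and ?\<beta> = "1 / H\<^sup>2"
  let ?\<gamma> = "(?\<alpha> + ?\<beta>\<^sup>2 / ?\<alpha>) / 2"
  have \<alpha>: "?\<alpha> > 0" "?\<alpha> \<le> 1" using H by (simp_all add: one_le_power)
  have \<gamma>eq: "?\<gamma> = (?\<alpha> + 1) / 2" using H by (simp add: power_divide)
  have mid: "(a + 1) / 2 \<ge> 1/2 \<and> (a + 1) / 2 \<le> 1" if "0 < a" "a \<le> 1" for a :: real using that by simp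
  have \<gamma>1: "?\<gamma> \<ge> 1/2" and \<gamma>2: "?\<gamma> \<le> 1" unfolding \<gamma>eq using mid[OF \<alpha>] by blast+
  have \<gamma>3: "?\<gamma> > 0" by (rule less_le_trans[OF _ \<gamma>1]) simp
  note \<gamma> = \<gamma>1 \<gamma>2 \<gamma>3
  have sq: "(norm ?I)\<^sup>2 = exp (- pi * (norm x)\<^sup>2 / ?\<gamma>) / (sqrt ?\<gamma> ^ DIM('a) * sqrt (2 * ?\<alpha>) ^ DIM('a))"
    by (rule chirp_integral[OF \<alpha>(1)])
  have e: "exp (- 2 * pi) \<le> exp (- pi * (norm x)\<^sup>2 / ?\<gamma>)"
  proof -
    have "(norm x)\<^sup>2 / ?\<gamma> \<le> 1 / (1/2)" using x \<gamma> by (intro frac_le) (auto simp: power_le_one)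
    from mult_left_mono[OF this, of pi] show ?thesis by simp
  qed
  have d: "sqrt ?\<gamma> ^ DIM('a) * sqrt (2 * ?\<alpha>) ^ DIM('a) \<le> (4 / H\<^sup>2) ^ DIM('a)"
  proof -
    have "sqrt ?\<gamma> * sqrt (2 * ?\<alpha>) \<le> 1 * (4 / H\<^sup>2)"
    proof (intro mult_mono)
      show "sqrt ?\<gamma> \<le> 1" using \<gamma> by simp
      have "sqrt (2 * ?\<alpha>) \<le> sqrt ((4 / H\<^sup>2)\<^sup>2)" by (intro real_sqrt_le_mono) (simp add: power_divide divide_right_mono)
      then show "sqrt (2 * ?\<alpha>) \<le> 4 / H\<^sup>2" by simp
    qed (use \<gamma> in auto)
    then have "(sqrt ?\<gamma> * sqrt (2 * ?\<alpha>)) ^ DIM('a) \<le> (1 * (4 / H\<^sup>2)) ^ DIM('a)"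
      using \<gamma> by (intro power_mono mult_nonneg_nonneg) auto
    then show ?thesis by (simp add: power_mult_distrib)
  qed
  have pos: "sqrt ?\<gamma> ^ DIM('a) * sqrt (2 * ?\<alpha>) ^ DIM('a) > 0" using \<gamma> \<alpha> H by (intro mult_pos_pos zero_less_power) auto
  have "(exp (- pi) * (H / 2) ^ DIM('a))\<^sup>2 = exp (- 2 * pi) / (4 / H\<^sup>2) ^ DIM('a)"
  proof -
    have "(exp (- pi))\<^sup>2 = exp (- 2 * pi)" by (simp add: power2_eq_square flip: exp_add)
    moreover have "((H / 2) ^ DIM('a))\<^sup>2 = 1 / (4 / H\<^sup>2) ^ DIM('a)"
    proof -
      have "((H / 2) ^ DIM('a))\<^sup>2 = ((H / 2)\<^sup>2) ^ DIM('a)" by (simp only: power_mult[symmetric] mult.commute)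
      also have "(H / 2)\<^sup>2 = 1 / (4 / H\<^sup>2)" by (simp add: power_divide)
      finally show ?thesis by (simp only: power_divide power_one)
    qed
    ultimately show ?thesis by (simp add: power_mult_distrib)
  qed
  also have "\<dots> \<le> (norm ?I)\<^sup>2" unfolding sq using e d pos by (intro frac_le) auto
  finally show ?thesis by (rule power2_le_imp_le) simp
qed

section \<open>A single chirp\<close>

lemma integrable_tensor:
  fixes u :: "'a::euclidean_space \<Rightarrow> complex" and v :: "'b::euclidean_space \<Rightarrow> complex"
  assumes u: "integrable lborel u" and v: "integrable lborel v"
  shows "integrable lborel (\<lambda>z. u (fst z) * v (snd z))"
proof -
  have [measurable]: "u \<in> borel_measurable borel" "v \<in> borel_measurable borel"
    using u v by (auto dest: borel_measurable_integrable)
  have "integrable (lborel \<Otimes>\<^sub>M lborel) (\<lambda>(x, y). u x * v y)"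
  proof (rule lborel_pair.Fubini_integrable)
    show "(\<lambda>(x, y). u x * v y) \<in> borel_measurable (lborel \<Otimes>\<^sub>M lborel)" by measurable
    show "integrable lborel (\<lambda>x. LINT y|lborel. norm (case (x, y) of (x, y) \<Rightarrow> u x * v y))"
      using u by (simp add: norm_mult)
    show "AE x in lborel. integrable lborel (\<lambda>y. case (x, y) of (x, y) \<Rightarrow> u x * v y)"
      using v by simp
  qed
  then show ?thesis unfolding lborel_prod split_beta' .
qed

text \<open>Fubini; for a series of multipliers one integral over the product is more convenient than three nested ones.\<close>
lemma trilinear_op_eq_integral:
  fixes m :: "'a::euclidean_space \<times> 'a \<times> 'a \<Rightarrow> complex"
  assumes m: "m \<in> borel_measurable borel" "\<And>z. norm (m z) \<le> B"
    and f: "integrable lborel (fourier f)" and g: "integrable lborel (fourier g)" and h: "integrable lborel (fourier h)"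
  defines "F \<equiv> \<lambda>z. fourier f (fst z) * (fourier g (fst (snd z)) * fourier h (snd (snd z)))"
  shows "integrable lborel (\<lambda>z. F z * (m z * cis (2 * pi * (x \<bullet> freq_sum z))))"
    and "trilinear_op m f g h x = (LINT z|lborel. F z * (m z * cis (2 * pi * (x \<bullet> freq_sum z))))"
proof -
  let ?c = "\<lambda>z. m z * cis (2 * pi * (x \<bullet> freq_sum z))"
  have cont: "continuous_on UNIV (freq_sum :: 'a \<times> 'a \<times> 'a \<Rightarrow> 'a)"
    unfolding freq_sum_def by (intro continuous_intros)
  have fsm [measurable]: "(freq_sum :: 'a \<times> 'a \<times> 'a \<Rightarrow> 'a) \<in> borel_measurable borel"
    by (rule borel_measurable_continuous_onI[OF cont])
  have cm: "?c \<in> borel_measurable borel" using m(1) unfolding cis_conv_exp by measurable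
  have gh: "integrable lborel (\<lambda>y. fourier g (fst y) * fourier h (snd y))" by (rule integrable_tensor[OF g h])
  have F: "integrable lborel F" unfolding F_def using integrable_tensor[OF f gh] by simp
  have cb: "norm (?c z) \<le> B" for z using m(2) by (simp add: norm_mult)
  show int: "integrable lborel (\<lambda>z. F z * ?c z)"
    by (rule integrable_mult_bounded[OF F cm cb])
  have slice: "integrable lborel (\<lambda>y. (fourier g (fst y) * fourier h (snd y)) * ?c (\<xi>, y))" for \<xi>
  proof (rule integrable_mult_bounded[OF gh _ cb])
    have "(\<lambda>y. Pair \<xi> y) \<in> borel_measurable (borel :: ('a \<times> 'a) measure)"
      by (intro borel_measurable_continuous_onI continuous_intros)
    from measurable_compose[OF this cm] show "(\<lambda>y. ?c (\<xi>, y)) \<in> borel_measurable borel" .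
  qed
  have "(LINT z|lborel. F z * ?c z) = (LINT \<xi>|lborel. LINT y|lborel. F (\<xi>, y) * ?c (\<xi>, y))"
    using lborel_pair.integral_fst'[of "\<lambda>z. F z * ?c z"] int by (simp add: lborel_prod)
  also have "\<dots> = (LINT \<xi>|lborel. fourier f \<xi> * (LINT y|lborel. (fourier g (fst y) * fourier h (snd y)) * ?c (\<xi>, y)))"
    unfolding F_def by (simp add: mult.assoc)
  also have "\<dots> = (LINT \<xi>|lborel. fourier f \<xi> * (LINT \<eta>|lborel. LINT \<delta>|lborel. (fourier g \<eta> * fourier h \<delta>) * ?c (\<xi>, \<eta>, \<delta>)))"
  proof (intro Bochner_Integration.integral_cong refl)
    fix \<xi> :: 'a
    show "fourier f \<xi> * (LINT y|lborel. (fourier g (fst y) * fourier h (snd y)) * ?c (\<xi>, y)) = fourier f \<xi> * (LINT \<eta>|lborel. LINT \<delta>|lborel. (fourier g \<eta> * fourier h \<delta>) * ?c (\<xi>, \<eta>, \<delta>))"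
      using lborel_pair.integral_fst'[of "\<lambda>y. (fourier g (fst y) * fourier h (snd y)) * ?c (\<xi>, y)"] slice[of \<xi>] by (simp add: lborel_prod)
  qed
  also have "\<dots> = trilinear_op m f g h x"
    unfolding trilinear_op_def by (simp add: freq_sum_def mult_ac add.assoc flip: integral_mult_right_zero)
  finally show "trilinear_op m f g h x = (LINT z|lborel. F z * ?c z)" ..
qed

text \<open>After the cancellation described at \<open>chirp_form\<close>, the innermost integral over \<open>\<delta>\<close> is a translate of the chirp integral
and hence independent of \<open>\<xi>\<close> and \<open>\<eta>\<close>. The constants are \<open>(1/L ^ d) ^ 3\<close> from the test functions,
\<open>L ^ d * L ^ d\<close> from the integrals over \<open>\<xi>\<close> and \<open>\<eta>\<close>, and \<open>H ^ d\<close> from the chirp, where \<open>L = H\<^sup>2\<close>.\<close>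
lemma trilinear_op_chirp:
  fixes x :: "'a::euclidean_space"
  assumes H: "H \<ge> 1" and x: "norm x \<le> 1"
  shows "norm (trilinear_op (chirp (H\<^sup>2)) (test_function (H\<^sup>2)) (test_function (H\<^sup>2)) (test_function (H\<^sup>2)) x)
    \<ge> exp (- pi) / (2 ^ DIM('a) * (sqrt 8 ^ DIM('a)) ^ 3) / H ^ DIM('a)"
proof -
  let ?L = "H\<^sup>2" and ?d = "DIM('a)"
  have L: "?L > 0" using H by simp
  define c where "c = complex_of_real (1 / sqrt (8 * ?L\<^sup>2) ^ ?d)"
  define E where "E = (\<lambda>\<xi>::'a. complex_of_real (exp (- pi * (1 / ?L\<^sup>2) * (norm \<xi>)\<^sup>2)))"
  define P where "P = (\<lambda>s::'a. E s * cis (pi * (1 / ?L) * (norm s)\<^sup>2) * cis (2 * pi * (x \<bullet> s)))"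
  have Pm [measurable]: "P \<in> borel_measurable borel" unfolding P_def E_def cis_conv_exp by measurable
  have f: "fourier (test_function ?L) \<xi> = c * complex_of_real (exp (- pi * (norm \<xi>)\<^sup>2 / (8 * ?L\<^sup>2)))" for \<xi> :: 'a
    unfolding fourier_test_function[OF L] c_def by simp
  have k: "chirp ?L (\<xi>, \<eta>, \<delta>) * fourier (test_function ?L) \<xi> * fourier (test_function ?L) \<eta> * fourier (test_function ?L) \<delta> * cis (2 * pi * (x \<bullet> (\<xi> + \<eta> + \<delta>)))
     = (c ^ 3 * E \<xi> * E \<eta>) * P (\<xi> + \<eta> + \<delta>)" for \<xi> \<eta> \<delta>
  proof -
    let ?s = "\<xi> + \<eta> + \<delta>"
    have ch: "chirp ?L (\<xi>, \<eta>, \<delta>) = complex_of_real (exp (- pi * chirp_form (\<xi>, \<eta>, \<delta>) / ?L\<^sup>2)) * cis (pi * (1 / ?L) * (norm ?s)\<^sup>2)"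
      unfolding chirp_def exp_add exp_of_real cis_conv_exp by (simp add: freq_sum_def)
    have "exp (- pi * chirp_form (\<xi>, \<eta>, \<delta>) / ?L\<^sup>2) * exp (- pi * (norm \<xi>)\<^sup>2 / (8 * ?L\<^sup>2)) * exp (- pi * (norm \<eta>)\<^sup>2 / (8 * ?L\<^sup>2)) * exp (- pi * (norm \<delta>)\<^sup>2 / (8 * ?L\<^sup>2))
      = exp (- pi * (1 / ?L\<^sup>2) * (norm \<xi>)\<^sup>2) * exp (- pi * (1 / ?L\<^sup>2) * (norm \<eta>)\<^sup>2) * exp (- pi * (1 / ?L\<^sup>2) * (norm ?s)\<^sup>2)"
      unfolding exp_add[symmetric] chirp_form_def norm_triple_square freq_sum_def using H
      by (intro arg_cong[where f=exp]) (simp add: field_simps)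
    then have "complex_of_real (exp (- pi * chirp_form (\<xi>, \<eta>, \<delta>) / ?L\<^sup>2)) * complex_of_real (exp (- pi * (norm \<xi>)\<^sup>2 / (8 * ?L\<^sup>2))) * complex_of_real (exp (- pi * (norm \<eta>)\<^sup>2 / (8 * ?L\<^sup>2))) * complex_of_real (exp (- pi * (norm \<delta>)\<^sup>2 / (8 * ?L\<^sup>2)))
      = E \<xi> * E \<eta> * E ?s"
      unfolding E_def of_real_mult[symmetric] of_real_eq_iff .
    moreover have "(a * w) * (c * p) * (c * q) * (c * r) * t = (c ^ 3) * (a * p * q * r) * (w * t)" for a w p q r t :: complex
      by (simp add: power3_eq_cube mult_ac)
    ultimately show ?thesis unfolding f ch P_def by (simp only:) (simp only: mult_ac)
  qed
  have "trilinear_op (chirp ?L) (test_function ?L) (test_function ?L) (test_function ?L) x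
    = (LINT \<xi>|lborel. LINT \<eta>|lborel. (c ^ 3 * E \<xi> * E \<eta>) * (LINT \<delta>|lborel. P ((\<xi> + \<eta>) + \<delta>)))"
    unfolding trilinear_op_def k by simp
  also have "\<dots> = (LINT \<xi>|lborel. LINT \<eta>|lborel. (c ^ 3 * E \<xi> * E \<eta>) * integral\<^sup>L lborel P)"
    by (simp only: integral_lborel_translate[OF Pm])
  also have "\<dots> = c ^ 3 * integral\<^sup>L lborel E * integral\<^sup>L lborel E * integral\<^sup>L lborel P"
    by (simp add: mult.assoc)
  finally have "norm (trilinear_op (chirp ?L) (test_function ?L) (test_function ?L) (test_function ?L) x)
    = norm c ^ 3 * norm (integral\<^sup>L lborel E) * norm (integral\<^sup>L lborel E) * norm (integral\<^sup>L lborel P)"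
    by (simp add: norm_mult norm_power)
  also have "norm (integral\<^sup>L lborel E) = ?L ^ ?d"
  proof -
    have "integral\<^sup>L lborel E = complex_of_real (1 / sqrt (1 / ?L\<^sup>2) ^ ?d)"
      unfolding E_def by (rule gaussian_integral(2)) (use L in simp)
    also have "1 / sqrt (1 / ?L\<^sup>2) ^ ?d = ?L ^ ?d"
      unfolding real_sqrt_divide real_sqrt_abs real_sqrt_one using L by (simp add: power_one_over)
    finally show ?thesis using L by (simp only: norm_of_real) simp
  qed
  also have "norm c = 1 / (sqrt 8 ^ ?d * ?L ^ ?d)"
    unfolding c_def norm_of_real real_sqrt_mult real_sqrt_abs power_mult_distrib using L by simp
  also have "(1 / (sqrt 8 ^ ?d * ?L ^ ?d)) ^ 3 * ?L ^ ?d * ?L ^ ?d * norm (integral\<^sup>L lborel P)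
    = (1 / ((sqrt 8 ^ ?d) ^ 3 * ?L ^ ?d)) * norm (integral\<^sup>L lborel P)"
  proof -
    have "?L ^ ?d > 0" using L by simp
    then show ?thesis by (simp add: power_divide power_mult_distrib power3_eq_cube)
  qed
  finally have eq: "norm (trilinear_op (chirp ?L) (test_function ?L) (test_function ?L) (test_function ?L) x) = (1 / ((sqrt 8 ^ ?d) ^ 3 * ?L ^ ?d)) * norm (integral\<^sup>L lborel P)" .
  have "exp (- pi) * (H / 2) ^ ?d \<le> norm (integral\<^sup>L lborel P)"
    unfolding P_def E_def by (rule chirp_integral_lower_bound[OF H x])
  then have "(1 / ((sqrt 8 ^ ?d) ^ 3 * ?L ^ ?d)) * (exp (- pi) * (H / 2) ^ ?d) \<le> norm (trilinear_op (chirp ?L) (test_function ?L) (test_function ?L) (test_function ?L) x)"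
    unfolding eq using H by (intro mult_left_mono) auto
  moreover have "(1 / ((sqrt 8 ^ ?d) ^ 3 * ?L ^ ?d)) * (exp (- pi) * (H / 2) ^ ?d) = exp (- pi) / (2 ^ ?d * (sqrt 8 ^ ?d) ^ 3) / H ^ ?d"
  proof -
    have "?L ^ ?d = H ^ ?d * H ^ ?d" by (simp add: power2_eq_square power_mult_distrib)
    moreover have "H ^ ?d > 0" using H by simp
    ultimately show ?thesis by (simp add: power_divide)
  qed
  ultimately show ?thesis by simp
qed

section \<open>The counterexample\<close>

text \<open>The square roots of the frequency scales \<open>L i\<close>. The growth is chosen such that each one is at least the fourth
power of all the earlier ones.\<close>
definition freq_root :: "nat \<Rightarrow> real" where "freq_root i = 2 ^ (4 ^ i)"

text \<open>Since \<open>(freq_root i)\<^sup>2 = L i\<close>, the coefficients are \<open>i / L i ^ d\<close>. The \<open>i\<close>-th chirp has operator norm of order at least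
\<open>L i ^ d\<close>, so the \<open>i\<close>-th term has norm of order at least \<open>i\<close>.\<close>
definition counterexample :: "'a::euclidean_space \<times> 'a \<times> 'a \<Rightarrow> complex"
  where "counterexample z = (\<Sum>i. complex_of_real (real i / (freq_root i ^ DIM('a))\<^sup>2) * chirp ((freq_root i)\<^sup>2) z)"

lemma freq_root_ge: "freq_root i \<ge> 1" "freq_root i > 0"
  by (simp_all add: freq_root_def)

lemma freq_root_power_ge:
  assumes d: "d > 0" shows "freq_root i ^ d \<ge> 2 ^ (4 ^ i)"
proof -
  have "freq_root i ^ 1 \<le> freq_root i ^ d" using d by (intro power_increasing freq_root_ge) auto
  then show ?thesis by (simp add: freq_root_def)
qed

lemma index_le_freq_root:
  assumes d: "d > 0" shows "real i * 2 ^ i \<le> freq_root i ^ d"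
proof -
  have "real i \<le> 2 ^ i" using of_nat_less_two_power[of i, where 'a=real] by simp
  then have "real i * 2 ^ i \<le> 2 ^ i * 2 ^ i" by (rule mult_right_mono) simp
  also have "\<dots> = 2 ^ (2 * i)" by (simp add: mult_2 power_add)
  also have "\<dots> \<le> (2::real) ^ (4 ^ i)"
  proof (rule power_increasing)
    show "2 * i \<le> 4 ^ i"
    proof (induction i)
      case (Suc i)
      have "(1::nat) \<le> 4 ^ i" by (rule one_le_power) simp
      with Suc show ?case unfolding power_Suc mult_Suc_right by linarith
    qed simp
  qed simp
  also have "\<dots> \<le> freq_root i ^ d" by (rule freq_root_power_ge[OF d])
  finally show ?thesis .
qed

lemma freq_root_power_le:
  assumes "i < j" shows "(freq_root i ^ d) ^ 4 \<le> freq_root j ^ d"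
proof -
  have "(freq_root i ^ d) ^ 4 = (2 ^ (4 ^ Suc i)) ^ d"
    by (simp add: freq_root_def power_mult[symmetric] mult_ac)
  also have "\<dots> \<le> (2 ^ (4 ^ j)) ^ d"
    using assms by (intro power_mono power_increasing) auto
  finally show ?thesis by (simp add: freq_root_def)
qed

lemma coefficient_le:
  assumes d: "d > 0"
  shows "real i / (freq_root i ^ d)\<^sup>2 \<le> (1/2) ^ i / freq_root i ^ d"
proof -
  let ?h = "freq_root i ^ d"
  have h: "?h > 0" using freq_root_ge by simp
  have "real i / ?h\<^sup>2 = (1/2) ^ i * (real i * 2 ^ i) / ?h\<^sup>2" by (simp add: power_one_over)
  also have "\<dots> \<le> (1/2) ^ i * ?h / ?h\<^sup>2" using index_le_freq_root[OF d] by (intro divide_right_mono mult_left_mono) auto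
  also have "\<dots> = (1/2) ^ i / ?h" using h by (simp add: power2_eq_square)
  finally show ?thesis .
qed

text \<open>Terms with \<open>i < j\<close> are small because they see only a small part of the test function, those with \<open>i > j\<close> because of their
small coefficients.\<close>
lemma interaction_le:
  assumes d: "d > 0" and ij: "i \<noteq> j"
  shows "real i / (freq_root i ^ d)\<^sup>2 * min 1 ((freq_root i ^ d / freq_root j ^ d) ^ 6) \<le> (1/2) ^ i / (freq_root j ^ d) ^ 3"
proof -
  let ?a = "freq_root i ^ d" and ?b = "freq_root j ^ d"
  have a: "?a \<ge> 1" and b: "?b \<ge> 1" using freq_root_ge by (auto intro: one_le_power)
  have pos: "?a > 0" "?b > 0" using freq_root_ge(2) by simp_all
  show ?thesis
  proof (cases "i < j")
    case True
    have ab: "?a ^ 4 \<le> ?b" by (rule freq_root_power_le[OF True])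
    have "?a ^ 1 \<le> ?a ^ 4" using a by (intro power_increasing) auto
    then have ab1: "?a \<le> ?b" using ab by simp
    have "real i / ?a\<^sup>2 * min 1 ((?a / ?b) ^ 6) \<le> real i / ?a\<^sup>2 * (?a / ?b) ^ 6" by (intro mult_left_mono) auto
    also have "\<dots> = real i * ?a ^ 4 / ?b ^ 6"
      using a by (simp add: power_divide field_simps eval_nat_numeral)
    also have "\<dots> = (1/2) ^ i * ((real i * 2 ^ i) * ?a ^ 4) / ?b ^ 6" by (simp add: power_one_over)
    also have "\<dots> \<le> (1/2) ^ i * (?b * ?b) / ?b ^ 6"
      using a b ab ab1 index_le_freq_root[OF d, of i]
      by (intro divide_right_mono mult_left_mono mult_mono) auto
    also have "\<dots> \<le> (1/2) ^ i * ?b ^ 3 / ?b ^ 6"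
    proof -
      have "?b ^ 2 \<le> ?b ^ 3" using b by (intro power_increasing) auto
      then show ?thesis using b by (intro divide_right_mono mult_left_mono) (auto simp: power2_eq_square)
    qed
    also have "\<dots> = (1/2) ^ i / ?b ^ 3"
    proof -
      have 6: "?b ^ 6 = ?b ^ 3 * ?b ^ 3" by (simp flip: power_add)
      have cancel: "u * v / (v * v) = u / v" for u v :: real by simp
      show ?thesis unfolding 6 by (rule cancel)
    qed
    finally show ?thesis .
  next
    case False
    with ij have "j < i" by simp
    then have ba: "?b ^ 4 \<le> ?a" by (rule freq_root_power_le)
    have "real i / ?a\<^sup>2 * min 1 ((?a / ?b) ^ 6) \<le> real i / ?a\<^sup>2 * 1" by (intro mult_left_mono) auto
    also have "\<dots> \<le> (1/2) ^ i / ?a" using coefficient_le[OF d, of i] by simp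
    also have "\<dots> \<le> (1/2) ^ i / ?b ^ 4" 
      by (rule divide_left_mono[OF ba _ mult_pos_pos[OF pos(1) zero_less_power[OF pos(2)]]]) simp
    also have "\<dots> \<le> (1/2) ^ i / ?b ^ 3"
    proof (rule divide_left_mono)
      show "?b ^ 3 \<le> ?b ^ 4" using b by (intro power_increasing) simp_all
      show "0 < ?b ^ 4 * ?b ^ 3" by (intro mult_pos_pos zero_less_power pos)
    qed simp
    finally show ?thesis .
  qed
qed

lemma summable_half_power: "summable (\<lambda>i. (1/2::real) ^ i)" and suminf_half_power: "(\<Sum>i. (1/2::real) ^ i) = 2"
  by (simp_all add: summable_geometric suminf_geometric)

lemma summable_coefficient:
  assumes d: "d > 0" shows "summable (\<lambda>i. real i / (freq_root i ^ d)\<^sup>2)"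
proof (rule summable_comparison_test'[OF summable_half_power])
  fix i :: nat
  have "real i / (freq_root i ^ d)\<^sup>2 \<le> (1/2) ^ i / freq_root i ^ d" by (rule coefficient_le[OF d])
  also have "\<dots> \<le> (1/2) ^ i / 1" using freq_root_ge[of i] by (intro divide_left_mono one_le_power) auto
  finally show "norm (real i / (freq_root i ^ d)\<^sup>2) \<le> (1/2) ^ i" by simp
qed

lemma smooth_bounded_counterexample: "smooth_bounded (counterexample :: 'a::euclidean_space \<times> 'a \<times> 'a \<Rightarrow> complex)"
proof -
  have eq: "counterexample = (\<lambda>z::'a \<times> 'a \<times> 'a. \<Sum>i. complex_of_real (real i / (freq_root i ^ DIM('a))\<^sup>2) * chirp ((freq_root i)\<^sup>2) z)"
    by (simp add: counterexample_def fun_eq_iff)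
  show ?thesis
    by (subst eq) (rule gaussian_series_smooth_bounded[OF gaussian_family_chirp summable_coefficient], auto simp: freq_root_ge one_le_power)
qed

lemma counterexample_measurable: "(counterexample :: 'a::euclidean_space \<times> 'a \<times> 'a \<Rightarrow> complex) \<in> borel_measurable borel"
proof -
  have "smooth (counterexample :: 'a \<times> 'a \<times> 'a \<Rightarrow> complex)" using smooth_bounded_counterexample[where 'a='a] by (simp add: smooth_bounded_def)
  then have "Ck 0 (counterexample :: 'a \<times> 'a \<times> 'a \<Rightarrow> complex)" by (simp add: smooth_def)
  then have "continuous_on UNIV (iter_deriv [] (counterexample :: 'a \<times> 'a \<times> 'a \<Rightarrow> complex))" unfolding Ck_def by force
  then show ?thesis by (intro borel_measurable_continuous_onI) simp
qed

lemma counterexample_summable: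
  "summable (\<lambda>i. real i / (freq_root i ^ DIM('a))\<^sup>2 * norm (chirp ((freq_root i)\<^sup>2) (z::'a::euclidean_space \<times> 'a \<times> 'a)))"
proof (rule summable_comparison_test'[OF summable_coefficient[of "DIM('a)"]])
  show "norm (real i / (freq_root i ^ DIM('a))\<^sup>2 * norm (chirp ((freq_root i)\<^sup>2) z)) \<le> real i / (freq_root i ^ DIM('a))\<^sup>2" for i
    using mult_left_mono[OF norm_chirp_le_1[of "(freq_root i)\<^sup>2" z], of "real i / (freq_root i ^ DIM('a))\<^sup>2"] by (simp add: abs_mult)
qed simp

lemma inverse_power_inverse: "1 / (1 / k) ^ n = (k::real) ^ n"
  by (simp add: power_one_over)

lemma chirp_L1_bound:
  assumes L: "L > 0"
  shows "(\<integral>\<^sup>+z. ennreal (norm (chirp L (z::'a::euclidean_space \<times> 'a \<times> 'a))) \<partial>lborel) \<le> ennreal ((sqrt 8 * L) ^ (3 * DIM('a)))"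
proof -
  have a: "1 / (8 * L\<^sup>2) > 0" using L by simp
  have "(\<integral>\<^sup>+z. ennreal (norm (chirp L (z::'a \<times> 'a \<times> 'a))) \<partial>lborel) \<le> (\<integral>\<^sup>+z. ennreal (exp (- pi * (1 / (8 * L\<^sup>2)) * (norm (z::'a \<times> 'a \<times> 'a))\<^sup>2)) \<partial>lborel)"
    by (intro nn_integral_mono ennreal_leI norm_chirp_le)
  also have "\<dots> = ennreal (1 / sqrt (1 / (8 * L\<^sup>2)) ^ DIM('a \<times> 'a \<times> 'a))" by (rule gaussian_integral(1)[OF a])
  also have "1 / sqrt (1 / (8 * L\<^sup>2)) ^ DIM('a \<times> 'a \<times> 'a) = (sqrt 8 * L) ^ (3 * DIM('a))"
  proof -
    have "sqrt (1 / (8 * L\<^sup>2)) = 1 / (sqrt 8 * L)" unfolding real_sqrt_divide real_sqrt_mult real_sqrt_abs using L by simp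
    moreover have "DIM('a \<times> 'a \<times> 'a) = 3 * DIM('a)" by simp
    ultimately show ?thesis by (simp only: inverse_power_inverse)
  qed
  finally show ?thesis .
qed

text \<open>The chirp has modulus at most 1 and \<open>F\<close> has integral 1, which gives the bound 1. In the other direction, \<open>F\<close> is at most
\<open>1 / (sqrt 8 * R) ^ (3 * d)\<close> and the modulus of the chirp has integral at most \<open>(sqrt 8 * L) ^ (3 * d)\<close>.\<close>
lemma interaction_integral:
  fixes L R :: real
  assumes L: "L > 0" and R: "R > 0"
  defines "F \<equiv> \<lambda>z::'a::euclidean_space \<times> 'a \<times> 'a. norm (fourier (test_function R) (fst z) * (fourier (test_function R) (fst (snd z)) * fourier (test_function R) (snd (snd z))))"
  shows "(\<integral>\<^sup>+z. ennreal (norm (chirp L z) * F z) \<partial>lborel) \<le> ennreal (min 1 ((L / R) ^ (3 * DIM('a))))"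
proof -
  let ?D = "3 * DIM('a)" and ?c = "1 / (sqrt 8 * R) ^ (3 * DIM('a))"
  have Rd: "sqrt (8 * R\<^sup>2) = sqrt 8 * R" using R by (simp add: real_sqrt_mult)
  have F: "F z = ?c * exp (- pi * (1 / (8 * R\<^sup>2)) * (norm z)\<^sup>2)" for z
  proof -
    have "?c = (1 / (sqrt 8 * R) ^ DIM('a)) * ((1 / (sqrt 8 * R) ^ DIM('a)) * (1 / (sqrt 8 * R) ^ DIM('a)))"
    proof -
      have e: "3 * DIM('a) = DIM('a) + (DIM('a) + DIM('a))" by simp
      show ?thesis unfolding e power_add by simp
    qed
    moreover have "exp (- pi * (1 / (8 * R\<^sup>2)) * (norm z)\<^sup>2) = exp (- pi * (norm (fst z))\<^sup>2 / (8 * R\<^sup>2)) * (exp (- pi * (norm (fst (snd z)))\<^sup>2 / (8 * R\<^sup>2)) * exp (- pi * (norm (snd (snd z)))\<^sup>2 / (8 * R\<^sup>2)))"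
      unfolding norm_triple_square exp_add[symmetric] by (simp add: add_divide_distrib diff_divide_distrib algebra_simps)
    moreover have nf: "norm (fourier (test_function R) \<xi>) = (1 / (sqrt 8 * R) ^ DIM('a)) * exp (- pi * (norm \<xi>)\<^sup>2 / (8 * R\<^sup>2))" for \<xi> :: 'a
      unfolding fourier_test_function[OF R] Rd norm_of_real using R by simp
    moreover have "(c * x) * ((c * y) * (c * w)) = (c * (c * c)) * (x * (y * w))" for c x y w :: real by simp
    ultimately show ?thesis unfolding F_def norm_mult by (simp only:)
  qed
  have c0: "?c \<ge> 0" using R by simp
  have "(\<integral>\<^sup>+z. ennreal (norm (chirp L z) * F z) \<partial>lborel) \<le> (\<integral>\<^sup>+z. ennreal ?c * ennreal (exp (- pi * (1 / (8 * R\<^sup>2)) * (norm (z::'a \<times> 'a \<times> 'a))\<^sup>2)) \<partial>lborel)"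
  proof (intro nn_integral_mono)
    fix z :: "'a \<times> 'a \<times> 'a"
    have "norm (chirp L z) * F z \<le> 1 * F z" using norm_chirp_le_1 by (rule mult_right_mono) (simp add: F_def)
    then show "ennreal (norm (chirp L z) * F z) \<le> ennreal ?c * ennreal (exp (- pi * (1 / (8 * R\<^sup>2)) * (norm z)\<^sup>2))"
      unfolding F using c0 by (simp add: ennreal_mult'[symmetric] ennreal_leI)
  qed
  also have "\<dots> = ennreal ?c * ennreal (1 / sqrt (1 / (8 * R\<^sup>2)) ^ DIM('a \<times> 'a \<times> 'a))"
    using R by (subst nn_integral_cmult) (simp, subst gaussian_integral(1), simp_all)
  also have "\<dots> = 1"
  proof -
    have "sqrt (1 / (8 * R\<^sup>2)) = 1 / (sqrt 8 * R)" unfolding real_sqrt_divide Rd by simp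
    moreover have "DIM('a \<times> 'a \<times> 'a) = ?D" by simp
    ultimately have "1 / sqrt (1 / (8 * R\<^sup>2)) ^ DIM('a \<times> 'a \<times> 'a) = (sqrt 8 * R) ^ ?D"
      by (simp only: inverse_power_inverse)
    moreover have "?c * (sqrt 8 * R) ^ ?D = 1" using R by simp
    ultimately show ?thesis using c0 by (simp only: ennreal_mult'[symmetric]) simp
  qed
  finally have 1: "(\<integral>\<^sup>+z. ennreal (norm (chirp L z) * F z) \<partial>lborel) \<le> 1" .
  have "(\<integral>\<^sup>+z. ennreal (norm (chirp L z) * F z) \<partial>lborel) \<le> (\<integral>\<^sup>+z. ennreal ?c * ennreal (norm (chirp L (z::'a \<times> 'a \<times> 'a))) \<partial>lborel)"
  proof (intro nn_integral_mono)
    fix z :: "'a \<times> 'a \<times> 'a"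
    have "F z \<le> ?c * 1" unfolding F using c0 by (intro mult_left_mono) auto
    then have "norm (chirp L z) * F z \<le> norm (chirp L z) * ?c" by (intro mult_left_mono) auto
    then show "ennreal (norm (chirp L z) * F z) \<le> ennreal ?c * ennreal (norm (chirp L z))"
      using c0 by (simp add: ennreal_mult'[symmetric] ennreal_leI mult.commute)
  qed
  also have "\<dots> = ennreal ?c * (\<integral>\<^sup>+z. ennreal (norm (chirp L (z::'a \<times> 'a \<times> 'a))) \<partial>lborel)"
  proof (rule nn_integral_cmult)
    have "chirp L \<in> borel_measurable (borel :: ('a \<times> 'a \<times> 'a) measure)"
      using L by (intro borel_measurable_continuous_onI chirp_continuous) simp
    then show "(\<lambda>z. ennreal (norm (chirp L (z::'a \<times> 'a \<times> 'a)))) \<in> borel_measurable lborel" by simp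
  qed
  also have "\<dots> \<le> ennreal ?c * ennreal ((sqrt 8 * L) ^ ?D)" by (intro mult_left_mono chirp_L1_bound L) simp
  also have "\<dots> = ennreal ((L / R) ^ ?D)"
    using c0 R by (simp add: ennreal_mult'[symmetric] power_mult_distrib power_divide)
  finally have 2: "(\<integral>\<^sup>+z. ennreal (norm (chirp L z) * F z) \<partial>lborel) \<le> ennreal ((L / R) ^ ?D)" .
  show ?thesis using 1 2 by (simp add: min_def)
qed

text \<open>The \<open>j\<close>-th term is bounded below by \<open>trilinear_op_chirp\<close>; by \<open>interaction_le\<close> the others contribute at most
\<open>\<Sum> (1/2) ^ i = 2\<close> times \<open>1 / (freq_root j ^ d) ^ 3\<close>.\<close>
lemma counterexample_lower_bound:
  fixes x :: "'a::euclidean_space" and j :: nat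
  assumes x: "norm x \<le> 1"
  defines "\<psi> \<equiv> (test_function ((freq_root j)\<^sup>2) :: 'a \<Rightarrow> complex)" and "c1 \<equiv> exp (- pi) / (2 ^ DIM('a) * (sqrt 8 ^ DIM('a)) ^ 3)"
  shows "norm (trilinear_op counterexample \<psi> \<psi> \<psi> x) \<ge> (c1 * real j - 2) / (freq_root j ^ DIM('a)) ^ 3"
proof -
  let ?d = "DIM('a)" and ?R = "(freq_root j)\<^sup>2" and ?h = "\<lambda>i. freq_root i ^ DIM('a)"
  let ?c = "\<lambda>i. real i / (?h i)\<^sup>2"
  let ?g = "\<lambda>i. chirp ((freq_root i)\<^sup>2) :: 'a \<times> 'a \<times> 'a \<Rightarrow> complex"
  have R: "?R > 0" and Li: "(freq_root i)\<^sup>2 > 0" for i by (simp_all add: freq_root_def)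
  have hp: "?h i > 0" for i by (simp add: freq_root_def)
  have \<psi>i: "integrable lborel (fourier \<psi>)" unfolding \<psi>_def by (rule fourier_schwartz_integrable[OF schwartz_test_function[OF R]])
  define F where "F = (\<lambda>z. fourier \<psi> (fst z) * (fourier \<psi> (fst (snd z)) * fourier \<psi> (snd (snd z))))"
  define e where "e = (\<lambda>z::'a \<times> 'a \<times> 'a. cis (2 * pi * (x \<bullet> freq_sum z)))"
  obtain B where B: "\<And>z. norm (counterexample (z::'a \<times> 'a \<times> 'a)) \<le> B"
  proof -
    have "bounded (range (iter_deriv [] (counterexample :: 'a \<times> 'a \<times> 'a \<Rightarrow> complex)))"
      using smooth_bounded_counterexample[where 'a='a] unfolding smooth_bounded_def by (metis empty_subsetI set_empty)
    then show ?thesis using that by (auto simp: bounded_iff)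
  qed
  have gm: "?g i \<in> borel_measurable borel" for i
    using Li[of i] by (intro borel_measurable_continuous_onI chirp_continuous) simp
  have T: "integrable lborel (\<lambda>z. F z * (counterexample z * e z))"
      "trilinear_op counterexample \<psi> \<psi> \<psi> x = (LINT z|lborel. F z * (counterexample z * e z))"
    unfolding F_def e_def by (rule trilinear_op_eq_integral[OF counterexample_measurable B \<psi>i \<psi>i \<psi>i])+
  have Tj: "integrable lborel (\<lambda>z. F z * (?g j z * e z))"
      "trilinear_op (?g j) \<psi> \<psi> \<psi> x = (LINT z|lborel. F z * (?g j z * e z))"
    unfolding F_def e_def by (rule trilinear_op_eq_integral[OF gm[of j] norm_chirp_le_1 \<psi>i \<psi>i \<psi>i])+
  let ?D = "\<lambda>z. F z * (counterexample z * e z) - complex_of_real (?c j) * (F z * (?g j z * e z))"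
  have Di: "integrable lborel ?D" using T(1) Tj(1) by (intro Bochner_Integration.integrable_diff integrable_mult_right)
  have diff: "trilinear_op counterexample \<psi> \<psi> \<psi> x - complex_of_real (?c j) * trilinear_op (?g j) \<psi> \<psi> \<psi> x = (LINT z|lborel. ?D z)"
    unfolding T(2) Tj(2) using T(1) Tj(1) by (subst Bochner_Integration.integral_diff) auto
  have Dle: "norm (?D z) \<le> (\<Sum>i. (if i = j then 0 else ?c i) * (norm (?g i z) * norm (F z)))"
    and Ds: "summable (\<lambda>i. (if i = j then 0 else ?c i) * (norm (?g i z) * norm (F z)))" for z
  proof -
    (* ?D z is the series of the counterexample with its j-th term removed *)
    let ?t = "\<lambda>i. complex_of_real (?c i) * ?g i z" and ?n = "\<lambda>i. if i = j then 0 else ?c i * norm (?g i z)"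
    have nt_eq: "norm (?t i) = ?c i * norm (?g i z)" for i unfolding norm_mult norm_of_real by simp
    have nt: "summable (\<lambda>i. norm (?t i))" unfolding nt_eq by (rule counterexample_summable)
    have st: "summable ?t" by (rule summable_norm_cancel[OF nt])
    have sn: "summable ?n" by (rule summable_comparison_test'[OF counterexample_summable[of z]]) simp
    have sj: "(\<lambda>i. if i = j then ?t i else 0) sums ?t j" by (rule sums_single)
    have "(\<lambda>i. ?t i - (if i = j then ?t i else 0)) sums (counterexample z - ?t j)"
      unfolding counterexample_def by (intro sums_diff sj summable_sums st)
    then have tail: "counterexample z - ?t j = (\<Sum>i. ?t i - (if i = j then ?t i else 0))" by (simp add: sums_iff)
    have le: "norm (counterexample z - ?t j) \<le> (\<Sum>i. ?n i)"
      unfolding tail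
    proof (rule norm_suminf_le[OF _ sn])
      show "norm (?t i - (if i = j then ?t i else 0)) \<le> ?n i" for i
        using nt_eq[of i] by (cases "i = j") simp_all
    qed
    have mult: "(\<lambda>i. (if i = j then 0 else ?c i) * (norm (?g i z) * norm (F z))) = (\<lambda>i. ?n i * norm (F z))" by auto
    show "summable (\<lambda>i. (if i = j then 0 else ?c i) * (norm (?g i z) * norm (F z)))"
      unfolding mult by (rule summable_mult2[OF sn])
    have "?D z = F z * e z * (counterexample z - ?t j)" by (simp add: algebra_simps)
    then have "norm (?D z) = norm (counterexample z - ?t j) * norm (F z)" by (simp add: norm_mult e_def)
    also have "\<dots> \<le> (\<Sum>i. ?n i) * norm (F z)" by (rule mult_right_mono[OF le]) simp
    also have "\<dots> = (\<Sum>i. ?n i * norm (F z))" by (rule suminf_mult2[OF sn])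
    finally show "norm (?D z) \<le> (\<Sum>i. (if i = j then 0 else ?c i) * (norm (?g i z) * norm (F z)))" unfolding mult .
  qed
  have Fm [measurable]: "F \<in> borel_measurable borel"
  proof -
    have "fourier \<psi> \<in> borel_measurable borel" using \<psi>i by (auto dest: borel_measurable_integrable)
    then show ?thesis unfolding F_def borel_prod[symmetric] by measurable
  qed
  note gm[measurable]
  have "ennreal (norm (LINT z|lborel. ?D z)) \<le> (\<integral>\<^sup>+z. ennreal (norm (?D z)) \<partial>lborel)" by (rule integral_norm_bound_ennreal[OF Di])
  also have "\<dots> \<le> (\<integral>\<^sup>+z. (\<Sum>i. ennreal (if i = j then 0 else ?c i) * ennreal (norm (?g i z) * norm (F z))) \<partial>lborel)"
  proof (rule nn_integral_mono)
    fix z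
    have "ennreal (norm (?D z)) \<le> ennreal (\<Sum>i. (if i = j then 0 else ?c i) * (norm (?g i z) * norm (F z)))" by (rule ennreal_leI[OF Dle])
    also have "\<dots> = (\<Sum>i. ennreal ((if i = j then 0 else ?c i) * (norm (?g i z) * norm (F z))))"
      by (rule suminf_ennreal2[OF _ Ds, symmetric]) simp
    also have "\<dots> = (\<Sum>i. ennreal (if i = j then 0 else ?c i) * ennreal (norm (?g i z) * norm (F z)))"
      by (intro suminf_cong ennreal_mult) auto
    finally show "ennreal (norm (?D z)) \<le> (\<Sum>i. ennreal (if i = j then 0 else ?c i) * ennreal (norm (?g i z) * norm (F z)))" .
  qed
  also have "\<dots> = (\<Sum>i. \<integral>\<^sup>+z. ennreal (if i = j then 0 else ?c i) * ennreal (norm (?g i z) * norm (F z)) \<partial>lborel)"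
    by (rule nn_integral_suminf) measurable
  also have "\<dots> \<le> (\<Sum>i. ennreal ((1/2) ^ i / ?h j ^ 3))"
  proof (rule suminf_le)
    fix i
    show "(\<integral>\<^sup>+z. ennreal (if i = j then 0 else ?c i) * ennreal (norm (?g i z) * norm (F z)) \<partial>lborel) \<le> ennreal ((1/2) ^ i / ?h j ^ 3)"
    proof (cases "i = j")
      case False
      have "(\<integral>\<^sup>+z. ennreal (?c i) * ennreal (norm (?g i z) * norm (F z)) \<partial>lborel) = ennreal (?c i) * (\<integral>\<^sup>+z. ennreal (norm (?g i z) * norm (F z)) \<partial>lborel)"
        by (rule nn_integral_cmult) measurable
      also have "\<dots> \<le> ennreal (?c i) * ennreal (min 1 (((freq_root i)\<^sup>2 / ?R) ^ (3 * ?d)))"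
        unfolding F_def \<psi>_def by (intro mult_left_mono interaction_integral Li R) simp
      also have "((freq_root i)\<^sup>2 / ?R) ^ (3 * ?d) = (?h i / ?h j) ^ 6"
        unfolding power_divide power_mult[symmetric] by (simp add: mult_ac)
      also have "ennreal (?c i) * ennreal (min 1 ((?h i / ?h j) ^ 6)) = ennreal (?c i * min 1 ((?h i / ?h j) ^ 6))"
        by (rule ennreal_mult'[symmetric]) simp
      also have "\<dots> \<le> ennreal ((1/2) ^ i / ?h j ^ 3)" by (intro ennreal_leI interaction_le False) simp
      finally show ?thesis using False by simp
    qed simp
  qed auto
  also have "\<dots> = ennreal (\<Sum>i. (1/2) ^ i / ?h j ^ 3)"
    by (rule suminf_ennreal2) (use hp[of j] summable_divide[OF summable_half_power] in auto)
  also have "(\<Sum>i. (1/2) ^ i / ?h j ^ 3) = 2 / ?h j ^ 3"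
    by (simp only: suminf_divide[OF summable_half_power] suminf_half_power)
  finally have rest: "norm (trilinear_op counterexample \<psi> \<psi> \<psi> x - complex_of_real (?c j) * trilinear_op (?g j) \<psi> \<psi> \<psi> x) \<le> 2 / ?h j ^ 3"
    unfolding diff using hp[of j] by (subst (asm) ennreal_le_iff) auto
  have "c1 / ?h j \<le> norm (trilinear_op (?g j) \<psi> \<psi> \<psi> x)"
    unfolding c1_def \<psi>_def by (rule trilinear_op_chirp[OF freq_root_ge(1) x])
  then have "?c j * (c1 / ?h j) \<le> ?c j * norm (trilinear_op (?g j) \<psi> \<psi> \<psi> x)" by (rule mult_left_mono) simp
  moreover have "?c j * (c1 / ?h j) = c1 * real j / ?h j ^ 3" by (simp add: power2_eq_square power3_eq_cube)
  moreover have "norm (complex_of_real (?c j) * trilinear_op (?g j) \<psi> \<psi> \<psi> x) = ?c j * norm (trilinear_op (?g j) \<psi> \<psi> \<psi> x)"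
    unfolding norm_mult norm_of_real by simp
  ultimately have "c1 * real j / ?h j ^ 3 \<le> norm (complex_of_real (?c j) * trilinear_op (?g j) \<psi> \<psi> \<psi> x)" by simp
  also have "\<dots> \<le> norm (trilinear_op counterexample \<psi> \<psi> \<psi> x) + 2 / ?h j ^ 3"
  proof -
    have "norm b \<le> norm a + norm (a - b)" for a b :: complex
      using norm_triangle_ineq4[of a "a - b"] by simp
    from order_trans[OF this add_left_mono[OF rest]] show ?thesis .
  qed
  finally show ?thesis by (simp add: diff_divide_distrib)
qed

section \<open>Integrability and unboundedness of the counterexample\<close>

text \<open>Some \<open>b i\<close> satisfies \<open>4 * 2 ^ i * b i \<ge> \<Sum> b\<close>, as otherwise the sum would be at most half of itself.\<close>
lemma suminf_powr_le:
  fixes b :: "nat \<Rightarrow> real"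
  assumes b: "\<And>i. b i \<ge> 0" "summable b" and q: "q > 0"
  shows "ennreal ((\<Sum>i. b i) powr q) \<le> (\<Sum>i. ennreal ((4 * 2 ^ i * b i) powr q))"
proof (cases "(\<Sum>i. b i) = 0")
  case False
  define S where "S = (\<Sum>i. b i)"
  have S: "S > 0" using False suminf_nonneg[OF b(2)] b(1) by (simp add: S_def order.strict_iff_order)
  have "\<exists>i. S \<le> 4 * 2 ^ i * b i"
  proof (rule ccontr)
    assume "\<not> ?thesis"
    then have lt: "4 * 2 ^ i * b i < S" for i by (simp add: not_le)
    have "b i \<le> S / 4 * (1/2) ^ i" for i
      using lt[of i] by (simp add: power_one_over field_simps)
    then have "S \<le> (\<Sum>i. S / 4 * (1/2) ^ i)"
      unfolding S_def[symmetric] by (subst (1) S_def) (intro suminf_le b summable_mult summable_half_power)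
    also have "\<dots> = S / 4 * 2" by (simp only: suminf_mult[OF summable_half_power] suminf_half_power)
    finally show False using S by simp
  qed
  then obtain i where i: "S \<le> 4 * 2 ^ i * b i" by blast
  have "ennreal (S powr q) \<le> ennreal ((4 * 2 ^ i * b i) powr q)" using i S q by (intro ennreal_leI powr_mono2) auto
  also have "\<dots> \<le> (\<Sum>i. ennreal ((4 * 2 ^ i * b i) powr q))"
  proof -
    have single: "u i \<le> (\<Sum>i. u i)" for u :: "nat \<Rightarrow> ennreal"
      using sum_le_suminf[of u "{i}"] by (simp add: summableI)
    show ?thesis by (rule single)
  qed
  finally show ?thesis by (simp add: S_def)
qed (use q in simp)

lemma powr_times_exponential_bounded:
  assumes e: "e > (0::real)"
  shows "\<exists>B. \<forall>n::nat. (4 * real n) powr q * 2 powr (- (2 * e) * real n) * real n \<le> B"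
proof -
  have "(\<lambda>n::nat. (4 * real n) powr q * 2 powr (- (2 * e) * real n) * real n) \<longlonglongrightarrow> 0"
    using e by real_asymp
  then have "Bseq (\<lambda>n::nat. (4 * real n) powr q * 2 powr (- (2 * e) * real n) * real n)"
    by (rule convergent_imp_Bseq[OF convergentI])
  then obtain K where "\<And>n. norm ((4 * real n) powr q * 2 powr (- (2 * e) * real n) * real n) \<le> K"
    by (auto simp: Bseq_def)
  then show ?thesis by (intro exI[of _ K]) (auto intro: order_trans[OF abs_ge_self])
qed

text \<open>The modulus of a chirp is at most 1, so its \<open>q\<close>-th power is bounded by the modulus itself, which has integral of order
at most \<open>h i ^ 6\<close> with \<open>h i = freq_root i ^ d\<close>. The \<open>i\<close>-th term contributes \<open>(i / h i ^ 2) powr q * h i ^ 6\<close> apart from a factor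
exponential in \<open>i\<close>, and \<open>h i powr (6 - 2 * q)\<close> decays doubly exponentially for \<open>q > 3\<close>.\<close>
lemma in_Lp_counterexample:
  assumes q: "q > 3" shows "in_Lp q (counterexample :: 'a::euclidean_space \<times> 'a \<times> 'a \<Rightarrow> complex)"
proof -
  let ?h = "\<lambda>i. freq_root i ^ DIM('a)" and ?c = "\<lambda>i. real i / (freq_root i ^ DIM('a))\<^sup>2"
  let ?g = "\<lambda>i. chirp ((freq_root i)\<^sup>2) :: 'a \<times> 'a \<times> 'a \<Rightarrow> complex"
  let ?V = "sqrt 8 ^ (3 * DIM('a))"
  have Li: "(freq_root i)\<^sup>2 > 0" for i by (rule zero_less_power[OF freq_root_ge(2)])
  have gm [measurable]: "?g i \<in> borel_measurable borel" for i
    using Li[of i] by (intro borel_measurable_continuous_onI chirp_continuous) simp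
  obtain B where B: "\<And>n::nat. (4 * real n) powr q * 2 powr (- (2 * (q - 3)) * real n) * real n \<le> B"
    using powr_times_exponential_bounded[of "q - 3" q] q by auto
  have term_le: "(4 * 2 ^ i * ?c i) powr q * ((sqrt 8 * (freq_root i)\<^sup>2) ^ (3 * DIM('a))) \<le> ?V * B * (1/2) ^ i" for i
  proof -
    (* h i is at least 2 to the power n, and n also dominates i * 2 ^ i *)
    let ?n = "real (4 ^ i)"
    have h1: "?h i \<ge> 2 ^ (4 ^ i)" by (rule freq_root_power_ge) simp
    have h0: "?h i > 0" using freq_root_ge(2) by simp
    have "real i \<le> 2 ^ i" using of_nat_less_two_power[of i, where 'a=real] by simp
    then have "real i * 2 ^ i \<le> 2 ^ i * 2 ^ i" by (rule mult_right_mono) simp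
    also have "\<dots> = ?n" by (simp flip: power_mult_distrib)
    finally have n: "real i * 2 ^ i \<le> ?n" .
    have "4 * 2 ^ i * ?c i = 4 * (real i * 2 ^ i) / (?h i)\<^sup>2" by simp
    also have "\<dots> \<le> 4 * ?n / (?h i)\<^sup>2" using n by (intro divide_right_mono mult_left_mono) auto
    finally have "(4 * 2 ^ i * ?c i) powr q \<le> (4 * ?n / (?h i)\<^sup>2) powr q" using q by (intro powr_mono2) auto
    also have "\<dots> = (4 * ?n) powr q * ?h i powr (- 2 * q)"
    proof -
      have "((?h i)\<^sup>2) powr q = ?h i powr (2 * q)"
      proof -
        have "(?h i)\<^sup>2 = ?h i powr 2" using h0 by simp
        then show ?thesis by (simp only: powr_powr)
      qed
      moreover have "(4 * ?n / (?h i)\<^sup>2) powr q = (4 * ?n) powr q / ((?h i)\<^sup>2) powr q"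
        by (rule powr_divide)
      moreover have "?h i powr (- 2 * q) = inverse (?h i powr (2 * q))"
        unfolding powr_minus[symmetric] by simp
      ultimately show ?thesis by (simp only: divide_inverse)
    qed
    finally have 1: "(4 * 2 ^ i * ?c i) powr q \<le> (4 * ?n) powr q * ?h i powr (- 2 * q)" .
    have 2: "(sqrt 8 * (freq_root i)\<^sup>2) ^ (3 * DIM('a)) = ?V * ?h i powr 6"
    proof -
      have "((freq_root i)\<^sup>2) ^ (3 * DIM('a)) = ?h i ^ 6" unfolding power_mult[symmetric] by (simp add: mult_ac)
      then show ?thesis using h0 by (simp add: power_mult_distrib)
    qed
    have "(4 * 2 ^ i * ?c i) powr q * ((sqrt 8 * (freq_root i)\<^sup>2) ^ (3 * DIM('a))) \<le> ((4 * ?n) powr q * ?h i powr (- 2 * q)) * (?V * ?h i powr 6)"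
      unfolding 2 by (rule mult_right_mono[OF 1]) simp
    also have "\<dots> = ?V * ((4 * ?n) powr q * ?h i powr (- (2 * (q - 3))))"
    proof -
      have "?h i powr (- 2 * q) * ?h i powr 6 = ?h i powr (- (2 * (q - 3)))" unfolding powr_add[symmetric] by simp
      moreover have "(a * b) * (v * d) = v * (a * (b * d))" for a b v d :: real by (simp only: mult_ac)
      ultimately show ?thesis by (simp only:)
    qed
    also have "\<dots> \<le> ?V * ((4 * ?n) powr q * (2 powr ?n) powr (- (2 * (q - 3))))"
    proof (intro mult_left_mono)
      have "2 powr ?n \<le> ?h i" using h1 by (simp only: powr_realpow zero_less_numeral)
      then show "?h i powr (- (2 * (q - 3))) \<le> (2 powr ?n) powr (- (2 * (q - 3)))" using q by (intro powr_mono2') auto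
    qed auto
    also have "(2 powr ?n) powr (- (2 * (q - 3))) = 2 powr (- (2 * (q - 3)) * ?n)" by (simp only: powr_powr mult.commute)
    also have "?V * ((4 * ?n) powr q * 2 powr (- (2 * (q - 3)) * ?n)) \<le> ?V * (B / ?n)"
      using B[of "4 ^ i"] by (intro mult_left_mono) (simp_all add: field_simps)
    also have "\<dots> \<le> ?V * (B / 2 ^ i)"
    proof (intro mult_left_mono divide_left_mono)
      have "0 \<le> (4 * real 0) powr q * 2 powr (- (2 * (q - 3)) * real 0) * real 0" by simp
      then show "0 \<le> B" using B[of 0] by linarith
      have "(2::real) ^ i \<le> 4 ^ i" by (rule power_mono) auto
      then show "2 ^ i \<le> ?n" by simp
    qed auto
    finally show ?thesis by (simp add: power_one_over)
  qed
  have "(\<integral>\<^sup>+z. ennreal (norm (counterexample (z::'a \<times> 'a \<times> 'a)) powr q) \<partial>lborel)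
    \<le> (\<integral>\<^sup>+z. (\<Sum>i. ennreal ((4 * 2 ^ i * ?c i) powr q) * ennreal (norm (?g i z))) \<partial>lborel)"
  proof (rule nn_integral_mono)
    fix z :: "'a \<times> 'a \<times> 'a"
    let ?b = "\<lambda>i. ?c i * norm (?g i z)"
    have sb: "summable ?b" by (rule counterexample_summable)
    have "norm (counterexample z) \<le> (\<Sum>i. ?b i)"
      unfolding counterexample_def by (rule norm_suminf_le[OF _ sb]) (unfold norm_mult norm_of_real, simp)
    then have "ennreal (norm (counterexample z) powr q) \<le> ennreal ((\<Sum>i. ?b i) powr q)" using q by (intro ennreal_leI powr_mono2) auto
    also have "\<dots> \<le> (\<Sum>i. ennreal ((4 * 2 ^ i * ?b i) powr q))" by (rule suminf_powr_le[OF _ sb]) (use q in auto)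
    also have "\<dots> \<le> (\<Sum>i. ennreal ((4 * 2 ^ i * ?c i) powr q) * ennreal (norm (?g i z)))"
    proof (intro suminf_le)
      fix i
      have le: "norm (?g i z) powr q \<le> norm (?g i z)"
      proof (cases "norm (?g i z) = 0")
        case False
        then show ?thesis using powr_mono'[of 1 q "norm (?g i z)"] q norm_chirp_le_1[of "(freq_root i)\<^sup>2" z] by simp
      qed (use q in simp)
      have "(4 * 2 ^ i * ?b i) powr q = (4 * 2 ^ i * ?c i) powr q * norm (?g i z) powr q"
        by (simp only: powr_mult[symmetric] mult.assoc)
      also have "\<dots> \<le> (4 * 2 ^ i * ?c i) powr q * norm (?g i z)" by (rule mult_left_mono[OF le]) simp
      finally show "ennreal ((4 * 2 ^ i * ?b i) powr q) \<le> ennreal ((4 * 2 ^ i * ?c i) powr q) * ennreal (norm (?g i z))"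
        by (simp only: ennreal_mult'[symmetric] powr_ge_zero ennreal_leI)
    qed auto
    finally show "ennreal (norm (counterexample z) powr q) \<le> (\<Sum>i. ennreal ((4 * 2 ^ i * ?c i) powr q) * ennreal (norm (?g i z)))" .
  qed
  also have "\<dots> = (\<Sum>i. \<integral>\<^sup>+z. ennreal ((4 * 2 ^ i * ?c i) powr q) * ennreal (norm (?g i z)) \<partial>lborel)"
    by (rule nn_integral_suminf) measurable
  also have "\<dots> \<le> (\<Sum>i. ennreal (?V * B * (1/2) ^ i))"
  proof (intro suminf_le)
    fix i
    have "(\<integral>\<^sup>+z. ennreal ((4 * 2 ^ i * ?c i) powr q) * ennreal (norm (?g i z)) \<partial>lborel) = ennreal ((4 * 2 ^ i * ?c i) powr q) * (\<integral>\<^sup>+z. ennreal (norm (?g i z)) \<partial>lborel)"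
      by (rule nn_integral_cmult) measurable
    also have "\<dots> \<le> ennreal ((4 * 2 ^ i * ?c i) powr q) * ennreal ((sqrt 8 * (freq_root i)\<^sup>2) ^ (3 * DIM('a)))"
      by (intro mult_left_mono chirp_L1_bound Li) simp
    also have "\<dots> = ennreal ((4 * 2 ^ i * ?c i) powr q * ((sqrt 8 * (freq_root i)\<^sup>2) ^ (3 * DIM('a))))"
      by (rule ennreal_mult'[symmetric]) simp
    also have "\<dots> \<le> ennreal (?V * B * (1/2) ^ i)" by (rule ennreal_leI[OF term_le])
    finally show "(\<integral>\<^sup>+z. ennreal ((4 * 2 ^ i * ?c i) powr q) * ennreal (norm (?g i z)) \<partial>lborel) \<le> ennreal (?V * B * (1/2) ^ i)" .
  qed auto
  also have "\<dots> = ennreal (\<Sum>i. ?V * B * (1/2) ^ i)"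
  proof (rule suminf_ennreal2)
    have "0 \<le> B" using B[of 0] by simp
    then show "0 \<le> ?V * B * (1/2) ^ i" for i by simp
  qed (rule summable_mult[OF summable_half_power])
  finally have "(\<integral>\<^sup>+z. ennreal (norm (counterexample (z::'a \<times> 'a \<times> 'a)) powr q) \<partial>lborel) < \<infinity>"
    using order.strict_trans1 by fastforce
  then show ?thesis
    using counterexample_measurable[where 'a='a] by (auto simp: in_Lp_def Lp_norm_def ennpowr_def)
qed

text \<open>On the unit ball the output is at least \<open>(c1 * j - 2) / h j ^ 3\<close>, and the product of the three \<open>L\<^sup>2\<close> norms is
\<open>1 / (8 ^ d * h j ^ 3)\<close>, where \<open>h j = freq_root j ^ d\<close>. Their ratio is unbounded in \<open>j\<close>.\<close>
lemma not_bounded_counterexample: "\<not> bounded_op (counterexample :: 'a::euclidean_space \<times> 'a \<times> 'a \<Rightarrow> complex)"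
proof
  let ?m = "counterexample :: 'a \<times> 'a \<times> 'a \<Rightarrow> complex" and ?d = "DIM('a)"
  assume "bounded_op ?m"
  then obtain A where A: "A < \<infinity>"
    and bd: "\<And>f g h. schwartz f \<Longrightarrow> schwartz g \<Longrightarrow> schwartz h \<Longrightarrow> Lp_norm (2/3) (trilinear_op ?m f g h) \<le> A * Lp_norm 2 f * Lp_norm 2 g * Lp_norm 2 h"
    unfolding bounded_op_def op_norm_def Inf_less_iff by auto
  define a where "a = enn2real A"
  have a: "A = ennreal a" "a \<ge> 0" using A by (auto simp: a_def)
  define c1 where "c1 = exp (- pi) / (2 ^ ?d * (sqrt 8 ^ ?d) ^ 3)"
  have c1: "c1 > 0" by (simp add: c1_def)
  define V where "V = unit_ball_vol (real ?d)"
  have V: "V > 0" by (simp add: V_def)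
  have ball: "emeasure lborel (cball (0::'a) 1) = ennreal V" by (simp add: emeasure_cball V_def)
  have key: "(c1 * real j - 2) * V powr (3/2) \<le> a / 8 ^ ?d" if j: "c1 * real j \<ge> 2" for j
  proof -
    let ?h = "freq_root j ^ ?d" and ?R = "(freq_root j)\<^sup>2"
    let ?\<psi> = "test_function ?R :: 'a \<Rightarrow> complex"
    let ?y = "(c1 * real j - 2) / ?h ^ 3"
    have h: "?h > 0" using freq_root_ge(2) by simp
    have R: "?R > 0" by (rule zero_less_power[OF freq_root_ge(2)])
    have y: "?y \<ge> 0" using j h by simp
    have S: "schwartz ?\<psi>" by (rule schwartz_test_function[OF R])
    have N: "Lp_norm 2 ?\<psi> = ennreal (1 / (2 ^ ?d * ?h))"
    proof -
      have "Lp_norm 2 ?\<psi> = ennreal ((1 / (4 * ?R) ^ ?d) powr (1/2))"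
        by (rule Lp_norm_2_eq[OF test_function_square[OF R]]) (use R in simp)
      also have "1 / (4 * ?R) ^ ?d = (1 / (2 ^ ?d * ?h))\<^sup>2"
      proof -
        have "4 * ?R = (2 * freq_root j)\<^sup>2" by (simp add: power_mult_distrib)
        then have "(4 * ?R) ^ ?d = ((2 * freq_root j) ^ ?d)\<^sup>2" by (simp only: power_mult[symmetric] mult.commute)
        then show ?thesis by (simp add: power_divide power_mult_distrib)
      qed
      also have "((1 / (2 ^ ?d * ?h))\<^sup>2) powr (1/2) = 1 / (2 ^ ?d * ?h)"
        using h by (simp add: powr_half_sqrt real_sqrt_abs)
      finally show ?thesis .
    qed
    have "ennreal (?y powr (2/3) * V) = ennreal (?y powr (2/3)) * emeasure lborel (cball (0::'a) 1)"
      unfolding ball by (rule ennreal_mult') simp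
    also have "\<dots> = (\<integral>\<^sup>+x. ennreal (?y powr (2/3)) * indicator (cball (0::'a) 1) x \<partial>lborel)"
      by (rule nn_integral_cmult_indicator[symmetric]) simp
    also have "\<dots> \<le> (\<integral>\<^sup>+x. ennreal (norm (trilinear_op ?m ?\<psi> ?\<psi> ?\<psi> x) powr (2/3)) \<partial>lborel)"
    proof (rule nn_integral_mono)
      fix x :: 'a
      show "ennreal (?y powr (2/3)) * indicator (cball (0::'a) 1) x \<le> ennreal (norm (trilinear_op ?m ?\<psi> ?\<psi> ?\<psi> x) powr (2/3))"
      proof (cases "norm x \<le> 1")
        case True
        have "?y \<le> norm (trilinear_op ?m ?\<psi> ?\<psi> ?\<psi> x)" unfolding c1_def by (rule counterexample_lower_bound[OF True])
        then have "ennreal (?y powr (2/3)) \<le> ennreal (norm (trilinear_op ?m ?\<psi> ?\<psi> ?\<psi> x) powr (2/3))"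
          using y by (intro ennreal_leI powr_mono2) auto
        then show ?thesis using True by simp
      qed simp
    qed
    finally have lower: "ennpowr (ennreal (?y powr (2/3) * V)) (3/2) \<le> Lp_norm (2/3) (trilinear_op ?m ?\<psi> ?\<psi> ?\<psi>)"
      unfolding Lp_norm_def by simp (rule ennpowr_mono, simp_all)
    have "ennpowr (ennreal (u powr (2/3) * V)) (3/2) = ennreal (u * V powr (3/2))" if "u \<ge> 0" for u
      using V that by (subst ennpowr_ennreal) (simp_all add: powr_mult powr_powr)
    from this[OF y] have "ennreal (?y * V powr (3/2)) = ennpowr (ennreal (?y powr (2/3) * V)) (3/2)" ..
    also note lower
    also have "Lp_norm (2/3) (trilinear_op ?m ?\<psi> ?\<psi> ?\<psi>) \<le> A * Lp_norm 2 ?\<psi> * Lp_norm 2 ?\<psi> * Lp_norm 2 ?\<psi>"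
      by (rule bd[OF S S S])
    also have "\<dots> = ennreal (a * (1 / (2 ^ ?d * ?h)) * (1 / (2 ^ ?d * ?h)) * (1 / (2 ^ ?d * ?h)))"
    proof -
      have "ennreal a * ennreal u * ennreal u * ennreal u = ennreal (a * u * u * u)" if "u \<ge> 0" for u
        using that a(2) by (simp add: ennreal_mult)
      then show ?thesis unfolding N a(1) using h by simp
    qed
    finally have "?y * V powr (3/2) \<le> a * (1 / (2 ^ ?d * ?h)) * (1 / (2 ^ ?d * ?h)) * (1 / (2 ^ ?d * ?h))"
      using a(2) h by (subst (asm) ennreal_le_iff) auto
    also have "\<dots> = a / 8 ^ ?d / ?h ^ 3"
    proof -
      have "(8::real) ^ ?d = 2 ^ ?d * 2 ^ ?d * 2 ^ ?d" by (simp flip: power_mult_distrib)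
      then show ?thesis by (simp add: power3_eq_cube)
    qed
    finally have "(c1 * real j - 2) * V powr (3/2) / ?h ^ 3 \<le> a / 8 ^ ?d / ?h ^ 3" by simp
    moreover have "u \<le> v" if "u / k \<le> v / k" "k > 0" for u v k :: real
      using that by (simp add: divide_le_cancel)
    ultimately show ?thesis using zero_less_power[OF h] by blast
  qed
  obtain j :: nat where j: "real j > (a / 8 ^ ?d / V powr (3/2) + 2) / c1" using reals_Archimedean2 by blast
  then have 1: "c1 * real j - 2 > a / 8 ^ ?d / V powr (3/2)" using c1 by (simp add: field_simps)
  moreover have "a / 8 ^ ?d / V powr (3/2) \<ge> 0" using a(2) V by simp
  ultimately have "(c1 * real j - 2) * V powr (3/2) \<le> a / 8 ^ ?d" by (intro key) linarith
  moreover have "V powr (3/2) > 0" using V by simp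
  ultimately have "c1 * real j - 2 \<le> a / 8 ^ ?d / V powr (3/2)" by (simp only: pos_le_divide_eq)
  with 1 show False by simp
qed

theorem theorem4:
  shows "(\<forall>(q::real) (C0::ennreal). 1 \<le> q \<and> q < 3 \<and> C0 < \<infinity> \<longrightarrow>
           (\<exists>C::ennreal. C < \<infinity> \<and>
             (\<forall>m :: (real^'d) \<times> (real^'d) \<times> (real^'d) \<Rightarrow> complex.
                let M = nat \<lfloor>3 * real CARD('d) / (3 - q)\<rfloor> + 1 in
                in_Lp q m \<and> Ck M m \<and>
                (\<forall>bs. set bs \<subseteq> Basis \<and> length bs \<le> M \<longrightarrow> Linf_norm (iter_deriv bs m) \<le> C0) \<longrightarrow>
                op_norm m \<le> C * ennpowr (Lp_norm q m) (q / 3))))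
       \<and> (\<exists>m :: (real^'d) \<times> (real^'d) \<times> (real^'d) \<Rightarrow> complex.
            (\<forall>q::real. q > 3 \<longrightarrow> in_Lp q m) \<and> smooth_bounded m \<and> \<not> bounded_op m)"
proof (intro conjI allI impI)
  fix q :: real and C0 :: ennreal
  assume "1 \<le> q \<and> q < 3 \<and> C0 < \<infinity>"
  then show "\<exists>C::ennreal. C < \<infinity> \<and>
      (\<forall>m :: (real^'d) \<times> (real^'d) \<times> (real^'d) \<Rightarrow> complex.
        let M = nat \<lfloor>3 * real CARD('d) / (3 - q)\<rfloor> + 1 in
        in_Lp q m \<and> Ck M m \<and>
        (\<forall>bs. set bs \<subseteq> Basis \<and> length bs \<le> M \<longrightarrow> Linf_norm (iter_deriv bs m) \<le> C0) \<longrightarrow>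
        op_norm m \<le> C * ennpowr (Lp_norm q m) (q / 3))"
    by (elim conjE) (rule op_norm_uniform_bound)
next
  show "\<exists>m :: (real^'d) \<times> (real^'d) \<times> (real^'d) \<Rightarrow> complex.
      (\<forall>q::real. q > 3 \<longrightarrow> in_Lp q m) \<and> smooth_bounded m \<and> \<not> bounded_op m"
    by (intro exI[of _ counterexample] conjI allI impI in_Lp_counterexample
        smooth_bounded_counterexample not_bounded_counterexample)
qed

end
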